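(* Let $k\ge 2$ and $m\ge 2$ be integers, let $a_1,a_2\in\mathbb{R}$ with $a_1<1$, and let $b\ge 0$. In the hierarchical normal model described in the context, take the two-stage prior $\boldsymbol\beta\mid\lambda\sim N_k(\boldsymbol\beta^0,\lambda\mathbf{A})$, $\lambda\sim\pi(\lambda)$ on $\lambda>0$, with $\boldsymbol\beta^0\in\mathbb{R}^k$ and a positive-definite $k\times k$ matrix $\mathbf{A}$ specified, where the (possibly improper) density $\pi(\lambda)$ satisfies $\int_0^c\pi(\lambda)\,d\lambda<\infty$ for $c>0$, and $\pi(\lambda)\sim C\lambda^{-b}$ as $\lambda\to\infty$ for some constant $C>0$. Suppose also that there are constants $C_1,C_2>0$ such that for all $k\times k$ orthonormal $\mathbf{H}$ and all $\mathbf{D}=\mathrm{diag}(d_1,\dots,d_k)$ with $d_1>\cdots>d_k>0$, $$\frac{C_1}{|\mathbf{I}+\mathbf{D}|^{a_2-a_1}|\mathbf{D}|^{a_1}}\le \pi(\mathbf{H},\mathbf{D})\le \frac{C_2}{|\mathbf{I}+\mathbf{D}|^{a_2-a_1}|\mathbf{D}|^{a_1}}.$$ If any one of the following holds: (i) $k\ge 2$, $a_2\ge 1-\frac1k$ and $b>1$; or (ii) $k\ge 3$, $a_2>1-\frac bk$ and $0\le b<1$; or (iii) $k=2$, $a_2>1-\frac b2$ and $0<b<1$; then the posterior mean of $\boldsymbol\theta$ is admissible under quadratic loss.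
   Context: Model: $p=mk$, and $\mathbf{X}=(\mathbf{X}_1,\dots,\mathbf{X}_m)\in\mathbb{R}^p$ with $\mathbf{X}_i\in\mathbb{R}^k$. Independently for $i=1,\dots,m$, $\mathbf{X}_i\mid\boldsymbol\theta_i\sim N_k(\boldsymbol\theta_i,\mathbf{I})$ and $\boldsymbol\theta_i\mid\boldsymbol\beta,\mathbf{V}\sim N_k(\boldsymbol\beta,\mathbf{V})$, where $\boldsymbol\beta\in\mathbb{R}^k$ and $\mathbf{V}$ is a $k\times k$ positive-definite matrix; $\boldsymbol\theta=(\boldsymbol\theta_1,\dots,\boldsymbol\theta_m)\in\mathbb{R}^p$. The hyperprior is a (possibly improper) density $\pi(\boldsymbol\beta)\pi(\mathbf{V})$; for the two-stage prior, $\pi(\boldsymbol\beta)=\int_0^\infty\pi(\boldsymbol\beta|\lambda)\pi(\lambda)\,d\lambda$. Change of variables: write $\mathbf{V}=\mathbf{H}^t\mathbf{D}\mathbf{H}$ with $\mathbf{H}$ orthonormal and $\mathbf{D}=\mathrm{diag}(d_1,\dots,d_k)$, $d_1>\cdots>d_k>0$ the eigenvalues of $\mathbf{V}$. The prior on $\mathbf{V}$ is rewritten as $\pi(\mathbf{V})\,d\mathbf{V}=\pi(\mathbf{H},\mathbf{D})I_{[d_1>\cdots>d_k]}\,d\mathbf{D}\,d\mathbf{H}$, where $d\mathbf{V}=\prod_{i\le j}dV_{ij}$, $d\mathbf{D}=\prod_i dd_i$, $d\mathbf{H}$ is the invariant Haar measure on orthonormal matrices, and $\pi(\mathbf{H},\mathbf{D})=\pi(\mathbf{H}^t\mathbf{D}\mathbf{H})\prod_{i<j}(d_i-d_j)$.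 $|\cdot|$ of a matrix is its determinant. The posterior mean is $\boldsymbol\delta^\pi(\mathbf{x})=E[\boldsymbol\theta\mid\mathbf{X}=\mathbf{x}]$ under the posterior distribution. Quadratic loss: $L(\boldsymbol\theta,\boldsymbol\delta)=(\boldsymbol\theta-\boldsymbol\delta)^t\mathbf{Q}(\boldsymbol\theta-\boldsymbol\delta)$ with $\mathbf{Q}$ a known positive-definite $p\times p$ matrix. Frequentist risk of an estimator $\boldsymbol\delta$ of $\boldsymbol\theta$: $R(\boldsymbol\theta,\boldsymbol\delta)=E[L(\boldsymbol\theta,\boldsymbol\delta(\mathbf{X}))]$ with $\mathbf{X}\sim N_p(\boldsymbol\theta,\mathbf{I})$. An estimator $\boldsymbol\delta$ is inadmissible if there is another estimator whose risk is nowhere larger and somewhere smaller (as a function of $\boldsymbol\theta\in\mathbb{R}^p$); otherwise it is admissible. *)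

theory Defs
  imports "HOL-Probability.Probability" "HOL-Library.Landau_Symbols"
begin

text \<open>
  The observation and parameter space \<open>\<real>\<^sup>p\<close>, \<open>p = m k\<close>, is \<open>real^'k^'m\<close> with \<open>k = CARD('k)\<close> and
  \<open>m = CARD('m)\<close>; the block \<open>X\<^sub>i\<close> is \<open>x $ i\<close>.  The order on \<open>'k\<close> is only used to enumerate the
  coordinates (in \<open>d\<^sub>1 > \<dots> > d\<^sub>k\<close> and in the products over \<open>i \<le> j\<close> and \<open>i < j\<close>).
\<close>

definition pos_def :: "real^'n^'n \<Rightarrow> bool" where
  "pos_def M \<longleftrightarrow> transpose M = M \<and> (\<forall>x. x \<noteq> 0 \<longrightarrow> 0 < x \<bullet> (M *v x))"

definition diag :: "real^'n \<Rightarrow> real^'n^'n" where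
  "diag d = (\<chi> i j. if i = j then d $ i else 0)"

definition mvn_density :: "real^'n \<Rightarrow> real^'n^'n \<Rightarrow> real^'n \<Rightarrow> real" where
  "mvn_density \<mu> S x =
     exp (- ((x - \<mu>) \<bullet> (matrix_inv S *v (x - \<mu>))) / 2) / sqrt ((2 * pi) ^ CARD('n) * det S)"

text \<open>The measure \<open>dV = \<Prod>\<^bsub>i \<le> j\<^esub> dV\<^sub>i\<^sub>j\<close>, carried by the symmetric matrices.\<close>

definition sym_lborel :: "(real^'k::{finite,linorder}^'k::_) measure" where
  "sym_lborel =
     distr (\<Pi>\<^sub>M p\<in>{(i, j). i \<le> j}. lborel) borel (\<lambda>v. \<chi> i j. v (min i j, max i j))"

definition likelihood :: "real^'k^'m \<Rightarrow> real^'k^'m \<Rightarrow> real" where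
  "likelihood x \<theta> = (\<Prod>i\<in>UNIV. mvn_density (\<theta> $ i) (mat 1) (x $ i))"

definition theta_density :: "real^'k \<Rightarrow> real^'k^'k \<Rightarrow> real^'k^'m \<Rightarrow> real" where
  "theta_density \<beta> V \<theta> = (\<Prod>i\<in>UNIV. mvn_density \<beta> V (\<theta> $ i))"

text \<open>
  The two-stage prior density of \<open>\<beta>\<close>.  It is extended-valued because the integral may diverge
  at \<open>\<beta> = \<beta>\<^sub>0\<close>.
\<close>

definition two_stage_prior ::
    "real^'k \<Rightarrow> real^'k^'k \<Rightarrow> (real \<Rightarrow> real) \<Rightarrow> real^'k \<Rightarrow> ennreal" where
  "two_stage_prior \<beta>0 A \<pi>L \<beta> =
     (\<integral>\<^sup>+ l\<in>{0<..}. ennreal (mvn_density \<beta>0 (l *\<^sub>R A) \<beta> * \<pi>L l) \<partial>lborel)"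

text \<open>
  A prior density on \<open>V\<close> in the coordinates \<open>V = H\<^sup>t D H\<close>, \<open>D = diag d\<close>: the product of differences is
  the Jacobian, up to a constant that depends on the normalisation of Haar measure.
\<close>

definition prior_HD ::
    "(real^'k::{finite,linorder}^'k::_ \<Rightarrow> real) \<Rightarrow> real^'k::_^'k::_ \<Rightarrow> real^'k::_ \<Rightarrow> real" where
  "prior_HD \<pi>V H d =
     \<pi>V (transpose H ** diag d ** H) * (\<Prod>(i, j)\<in>{(i, j). i < j}. d $ i - d $ j)"

text \<open>
  The joint density of \<open>(x, \<theta>, \<beta>, V)\<close>, for possibly improper prior densities \<open>\<pi>B\<close> of \<open>\<beta>\<close> and
  \<open>\<pi>V\<close> of \<open>V\<close>.  Values of \<open>\<pi>V\<close> off the positive-definite matrices play no role.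
\<close>

definition joint_density ::
    "(real^'k \<Rightarrow> ennreal) \<Rightarrow> (real^'k^'k \<Rightarrow> real) \<Rightarrow> real^'k^'m
      \<Rightarrow> (real^'k^'m) \<times> (real^'k) \<times> (real^'k^'k) \<Rightarrow> ennreal" where
  "joint_density \<pi>B \<pi>V x = (\<lambda>(\<theta>, \<beta>, V).
     ennreal (likelihood x \<theta>) * ennreal (theta_density \<beta> V \<theta>)
       * \<pi>B \<beta> * (ennreal (\<pi>V V) * indicator {V. pos_def V} V))"

definition param_measure ::
    "((real^'k::{finite,linorder}^'m) \<times> (real^'k::_) \<times> (real^'k::_^'k::_)) measure" where
  "param_measure = lborel \<Otimes>\<^sub>M lborel \<Otimes>\<^sub>M sym_lborel"

definition marginal ::
    "(real^'k::{finite,linorder} \<Rightarrow> ennreal) \<Rightarrow> (real^'k::_^'k::_ \<Rightarrow> real) \<Rightarrow> real^'k::_^'m \<Rightarrow> ennreal" where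
  "marginal \<pi>B \<pi>V x = (\<integral>\<^sup>+ w. joint_density \<pi>B \<pi>V x w \<partial>param_measure)"

definition posterior ::
    "(real^'k::{finite,linorder} \<Rightarrow> ennreal) \<Rightarrow> (real^'k::_^'k::_ \<Rightarrow> real) \<Rightarrow> real^'k::_^'m
      \<Rightarrow> ((real^'k::_^'m) \<times> (real^'k::_) \<times> (real^'k::_^'k::_)) measure" where
  "posterior \<pi>B \<pi>V x =
     density param_measure (\<lambda>w. joint_density \<pi>B \<pi>V x w / marginal \<pi>B \<pi>V x)"

text \<open>
  The integral below is meaningful only if the posterior is proper and has a first moment; as the
  Bochner integral defaults to \<open>0\<close>, this has to be stated separately.
\<close>

definition posterior_mean_exists ::
    "(real^'k::{finite,linorder} \<Rightarrow> ennreal) \<Rightarrow> (real^'k::_^'k::_ \<Rightarrow> real) \<Rightarrow> real^'k::_^'m \<Rightarrow> bool" where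
  "posterior_mean_exists \<pi>B \<pi>V x \<longleftrightarrow>
     0 < marginal \<pi>B \<pi>V x \<and> marginal \<pi>B \<pi>V x < \<infinity> \<and> integrable (posterior \<pi>B \<pi>V x) fst"

definition posterior_mean ::
    "(real^'k::{finite,linorder} \<Rightarrow> ennreal) \<Rightarrow> (real^'k::_^'k::_ \<Rightarrow> real) \<Rightarrow> real^'k::_^'m \<Rightarrow> real^'k::_^'m" where
  "posterior_mean \<pi>B \<pi>V x = (\<integral>w. fst w \<partial>posterior \<pi>B \<pi>V x)"

text \<open>The identification of \<open>real^'k^'m\<close> with \<open>\<real>\<^sup>p\<close>, on which the \<open>p \<times> p\<close> matrix of the loss acts.\<close>

definition stack :: "real^'k^'m \<Rightarrow> real^('m \<times> 'k)" where
  "stack \<theta> = (\<chi> p. \<theta> $ fst p $ snd p)"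

definition quad_loss ::
    "real^('m \<times> 'k)^('m \<times> 'k) \<Rightarrow> real^'k^'m \<Rightarrow> real^'k^'m \<Rightarrow> real" where
  "quad_loss Q \<theta> a = stack (\<theta> - a) \<bullet> (Q *v stack (\<theta> - a))"

definition risk ::
    "real^('m \<times> 'k)^('m \<times> 'k) \<Rightarrow> real^'k^'m \<Rightarrow> (real^'k^'m \<Rightarrow> real^'k^'m) \<Rightarrow> ennreal" where
  "risk Q \<theta> \<delta> =
     (\<integral>\<^sup>+ x. ennreal (quad_loss Q \<theta> (\<delta> x)) \<partial>density lborel (\<lambda>x. ennreal (likelihood x \<theta>)))"

definition inadmissible ::
    "real^('m \<times> 'k)^('m \<times> 'k) \<Rightarrow> (real^'k^'m \<Rightarrow> real^'k^'m) \<Rightarrow> bool" where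
  "inadmissible Q \<delta> \<longleftrightarrow>
     (\<exists>\<delta>'\<in>borel_measurable borel.
        (\<forall>\<theta>. risk Q \<theta> \<delta>' \<le> risk Q \<theta> \<delta>) \<and> (\<exists>\<theta>. risk Q \<theta> \<delta>' < risk Q \<theta> \<delta>))"

definition admissible ::
    "real^('m \<times> 'k)^('m \<times> 'k) \<Rightarrow> (real^'k^'m \<Rightarrow> real^'k^'m) \<Rightarrow> bool" where
  "admissible Q \<delta> \<longleftrightarrow> \<delta> \<in> borel_measurable borel \<and> \<not> inadmissible Q \<delta>"

end

theory Submission imports Defs "HOL-Real_Asymp.Real_Asymp" begin

text \<open>
  Blyth's method for a prior \<open>\<nu>\<close> on the parameter of a translation family.  Put \<open>q \<theta> = 1 + \<bar>\<theta>\<bar>\<^sup>2\<close>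
  and compare the Bayes rule with the Bayes rules of the finite priors \<open>u \<nu>\<close>, where
  \<open>u = q powr (-t) / (1 + q / N)\<close>.  Because \<open>\<bar>u \<theta> - u x\<bar>\<^sup>2\<close> is of order
  \<open>t\<^sup>2 u(\<theta>)\<^sup>2 / q(\<theta>)\<close> up to powers of \<open>q (\<theta> - x)\<close> and a term that vanishes as \<open>N \<rightarrow> \<infinity>\<close>, the excess
  Bayes risk is at most a constant times \<open>t\<^sup>2 \<integral> q powr (-1 - t) d\<nu>\<close>, and it suffices that this
  becomes small for suitable \<open>t\<close>.

  For the hierarchical prior the integral is \<open>O(1 / t)\<close>.  A Gaussian vector with covariance
  \<open>H\<^sup>t D H\<close> and arbitrary mean satisfies
  \<open>E (\<Prod> (1 + (H Y)\<^sub>i\<^sup>2) powr (-\<alpha>\<^sub>i)) \<le> c \<Prod> (1 + d\<^sub>i) powr (-\<alpha>\<^sub>i)\<close> for \<open>\<alpha>\<^sub>i \<le> a < 1/2\<close>.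
  Applied to two independent blocks of \<open>\<theta>\<close>, this bounds the integral by integrals over \<open>\<lambda>\<close> and over
  the eigenvalues of \<open>V\<close>.  The density of \<open>V\<close> in spectral coordinates is only needed as an upper
  bound, for which finitely many Cayley charts of the orthogonal group replace Haar measure.
\<close>

section \<open>Admissibility of Bayes rules in translation families\<close>

text \<open>A moment of size \<open>K / t\<close> leaves an excess risk of order \<open>t\<close>; a
  blow-up like \<open>t powr (-k)\<close> would be too much already for \<open>k = 2\<close>. This
  shapes the case \<open>b > 1\<close>, \<open>a2 = 1 - 1/k\<close>. Spreading the exponent
  \<open>1 + t\<close> evenly over the \<open>k\<close> eigenvalues makes every one-dimensional
  integral of order \<open>1 / t\<close> and their product of order \<open>t powr (-k)\<close>.
  Putting all of it on the largest eigenvalue is impossible too: a normal variable of variance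
  \<open>d\<close> can meet the unit interval with probability of order
  \<open>d powr (-1/2)\<close>, so one block of \<theta> yields exponents below 1/2 in each
  direction, and two blocks yield exponents below 1. Hence the split into \<open>1/2 + t\<close> for
  the largest eigenvalue and \<open>1 / (2 k)\<close> for every eigenvalue, with sum
  \<open>1 + t\<close>. For \<open>b < 1\<close> the critical direction is \<lambda> instead: it
  takes \<open>1 - b + t\<close>, and \<open>V\<close> takes \<open>b\<close>. The exponent of
  \<lambda> is drawn from a single block, so \<open>(1 - b + t) / k < 1/2\<close> must hold; this is
  where \<open>b > 0\<close> enters for \<open>k = 2\<close>.\<close>

definition qq :: "'a::real_inner \<Rightarrow> real" where
  "qq z = 1 + (norm z)\<^sup>2"

lemma qq_ge_1: "1 \<le> qq z" and qq_pos: "0 < qq z" and qq_nonneg: "0 \<le> qq z"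
  by (auto simp: qq_def add_pos_nonneg)

lemma qq_measurable [measurable]: "(qq :: 'a::euclidean_space \<Rightarrow> real) \<in> borel_measurable borel"
  unfolding qq_def[abs_def] by measurable

lemma qq_minus_commute: "qq (x - y) = qq (y - x)"
  by (simp add: qq_def norm_minus_commute)

lemma norm_sq_le_qq: "(norm z)\<^sup>2 \<le> qq z"
  by (simp add: qq_def)

text \<open>Peetre's inequality: moving the base point costs one factor \<open>qq\<close> of the
  displacement. All comparisons between weights at the parameter and at the observation rest on it,
  and the kernel absorbs the resulting powers of \<open>qq (\<theta> - x)\<close>.\<close>

lemma qq_peetre: "qq x \<le> 2 * qq y * qq (x - y)"
proof -
  have "norm x \<le> norm y + norm (x - y)"
    using norm_triangle_ineq[of y "x - y"] by simp
  then have "(norm x)\<^sup>2 \<le> (norm y + norm (x - y))\<^sup>2"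
    by (intro power_mono) auto
  also have "\<dots> \<le> 2 * (norm y)\<^sup>2 + 2 * (norm (x - y))\<^sup>2"
    using sum_squares_bound[of "norm y" "norm (x - y)"] by (simp add: power2_sum)
  finally have "qq x \<le> 2 * (1 + (norm y)\<^sup>2 + (norm (x - y))\<^sup>2)"
    by (simp add: qq_def)
  also have "\<dots> \<le> 2 * (qq y * qq (x - y))"
    by (simp add: qq_def algebra_simps)
  finally show ?thesis by simp
qed

lemma integrable_Cauchy_Schwarz:
  fixes f g :: "'a \<Rightarrow> real"
  assumes [measurable]: "f \<in> borel_measurable M" "g \<in> borel_measurable M"
    and nn: "\<And>x. 0 \<le> f x" "\<And>x. 0 \<le> g x"
    and int: "integrable M (\<lambda>x. (f x)\<^sup>2)" "integrable M (\<lambda>x. (g x)\<^sup>2)"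
  shows "integrable M (\<lambda>x. f x * g x)"
    and "(\<integral>x. f x * g x \<partial>M)\<^sup>2 \<le> (\<integral>x. (f x)\<^sup>2 \<partial>M) * (\<integral>x. (g x)\<^sup>2 \<partial>M)"
proof -
  show i: "integrable M (\<lambda>x. f x * g x)"
  proof (rule Bochner_Integration.integrable_bound)
    show "integrable M (\<lambda>x. (f x)\<^sup>2 + (g x)\<^sup>2)" using int by simp
    have "f x * g x \<le> (f x)\<^sup>2 + (g x)\<^sup>2" for x
      using sum_squares_bound[of "f x" "g x"] nn[of x] mult_nonneg_nonneg[of "f x" "g x"] by linarith
    then show "AE x in M. norm (f x * g x) \<le> norm ((f x)\<^sup>2 + (g x)\<^sup>2)"
      using nn by (intro AE_I2) (simp add: abs_mult)
  qed measurable
  have "(\<integral>\<^sup>+x. ennreal (f x) * ennreal (g x) \<partial>M)\<^sup>2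
      \<le> (\<integral>\<^sup>+x. (ennreal (f x))\<^sup>2 \<partial>M) * (\<integral>\<^sup>+x. (ennreal (g x))\<^sup>2 \<partial>M)"
    by (rule Cauchy_Schwarz_nn_integral) auto
  also have "(\<integral>\<^sup>+x. ennreal (f x) * ennreal (g x) \<partial>M) = ennreal (\<integral>x. f x * g x \<partial>M)"
    using nn i by (subst nn_integral_eq_integral[symmetric]) (auto simp: ennreal_mult)
  also have "(\<integral>\<^sup>+x. (ennreal (f x))\<^sup>2 \<partial>M) = ennreal (\<integral>x. (f x)\<^sup>2 \<partial>M)"
    using nn int by (subst nn_integral_eq_integral[symmetric]) (auto simp: ennreal_power)
  also have "(\<integral>\<^sup>+x. (ennreal (g x))\<^sup>2 \<partial>M) = ennreal (\<integral>x. (g x)\<^sup>2 \<partial>M)"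
    using nn int by (subst nn_integral_eq_integral[symmetric]) (auto simp: ennreal_power)
  finally show "(\<integral>x. f x * g x \<partial>M)\<^sup>2 \<le> (\<integral>x. (f x)\<^sup>2 \<partial>M) * (\<integral>x. (g x)\<^sup>2 \<partial>M)"
    using nn by (simp add: ennreal_power ennreal_mult[symmetric] integral_nonneg_AE)
qed

lemma ennreal_add_le_plus: "0 \<le> b \<Longrightarrow> ennreal (a + b) \<le> ennreal a + ennreal b"
  by (cases "0 \<le> a") (auto simp: ennreal_neg intro: ennreal_leI)

text \<open>Only the marginal prior of the location parameter appears here; hyperparameters are
  already integrated out, and the prior may be infinite. The exponent -1 in
  \<open>prior_growth\<close> is that of the gradient term: the squared logarithmic gradient of a
  power of \<open>qq\<close> decays like \<open>1 / qq\<close>.\<close>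

locale translation_bayes =
  fixes K :: "'a::euclidean_space \<Rightarrow> real" and \<nu> :: "'a measure"
  assumes K_measurable [measurable]: "K \<in> borel_measurable borel"
    and K_pos: "\<And>z. 0 < K z"
    and K_bounded: "\<And>j. \<exists>C. \<forall>z. qq z ^ j * K z \<le> C"
    and K_moment: "\<And>j. (\<integral>\<^sup>+z. ennreal (qq z ^ j * K z) \<partial>lborel) < \<infinity>"
    and sets_prior [measurable_cong]: "sets \<nu> = sets borel"
    and prior_growth: "\<And>s. s > 0 \<Longrightarrow> (\<integral>\<^sup>+\<theta>. ennreal (qq \<theta> powr (-1 - s)) \<partial>\<nu>) < \<infinity>"
    and prior_nonzero: "emeasure \<nu> UNIV \<noteq> 0"
begin

lemma space_prior [simp]: "space \<nu> = UNIV"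
  using sets_eq_imp_space_eq[OF sets_prior] by simp

lemma K_nonneg: "0 \<le> K z"
  using K_pos[of z] by simp

lemma integrable_inverse_square: "integrable \<nu> (\<lambda>\<theta>. inverse ((qq \<theta>)\<^sup>2))"
proof -
  have "qq \<theta> powr (-1 - 1) = inverse ((qq \<theta>)\<^sup>2)" for \<theta> :: 'a
  proof -
    have "qq \<theta> powr (-1 - 1) = inverse (qq \<theta> powr 2)"
      by (simp add: powr_minus[symmetric])
    then show ?thesis
      using qq_pos[of \<theta>] powr_realpow[of "qq \<theta>" 2] by simp
  qed
  then show ?thesis
    using prior_growth[of 1] by (intro integrableI_nonneg) auto
qed

text \<open>Markov's inequality bounds the mass of the sublevel sets of \<open>qq\<close>.
  Sigma-finiteness is what the exchange of integrals needs.\<close>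

lemma sigma_finite_prior: "sigma_finite_measure \<nu>"
proof
  let ?A = "\<lambda>n::nat. {\<theta>::'a. qq \<theta> \<le> real n}"
  have "emeasure \<nu> (?A n) \<noteq> \<infinity>" for n
  proof -
    have "emeasure \<nu> (?A n) = (\<integral>\<^sup>+\<theta>. indicator (?A n) \<theta> \<partial>\<nu>)"
      by (subst nn_integral_indicator) auto
    also have "\<dots> \<le> (\<integral>\<^sup>+\<theta>. ennreal ((real n)\<^sup>2) * ennreal (inverse ((qq \<theta>)\<^sup>2)) \<partial>\<nu>)"
    proof (rule nn_integral_mono)
      fix \<theta> :: 'a
      show "indicator (?A n) \<theta> \<le> ennreal ((real n)\<^sup>2) * ennreal (inverse ((qq \<theta>)\<^sup>2))"
      proof (cases "qq \<theta> \<le> real n")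
        case True
        then have "(qq \<theta>)\<^sup>2 \<le> (real n)\<^sup>2"
          using qq_nonneg by (intro power_mono)
        then have "1 \<le> (real n)\<^sup>2 * inverse ((qq \<theta>)\<^sup>2)"
          using qq_pos[of \<theta>] by (simp add: field_simps)
        then show ?thesis
          using True by (simp flip: ennreal_mult ennreal_1 add: ennreal_leI)
      qed simp
    qed
    also have "\<dots> = ennreal ((real n)\<^sup>2) * ennreal (\<integral>\<theta>. inverse ((qq \<theta>)\<^sup>2) \<partial>\<nu>)"
      by (subst nn_integral_cmult) (auto simp: nn_integral_eq_integral integrable_inverse_square)
    also have "\<dots> < \<infinity>" by (simp add: ennreal_mult_less_top)
    finally show ?thesis by simp
  qed
  moreover have "(\<Union>n. ?A n) = UNIV"
    using real_arch_simple by fastforce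
  ultimately show "\<exists>A. countable A \<and> A \<subseteq> sets \<nu> \<and> \<Union> A = space \<nu> \<and> (\<forall>a\<in>A. emeasure \<nu> a \<noteq> \<infinity>)"
    by (intro exI[of _ "range ?A"]) (auto simp: sets_prior)
qed

sublocale \<nu>: sigma_finite_measure \<nu>
  by (rule sigma_finite_prior)

sublocale lborel_prior: pair_sigma_finite "lborel :: 'a measure" \<nu>
  by (simp add: pair_sigma_finite.intro sigma_finite_prior lborel.sigma_finite_measure_axioms)

text \<open>The kernel beats any power: two extra factors \<open>qq (\<theta> - x)\<close> are
  traded by Peetre's inequality for \<open>inverse ((qq \<theta>)\<^sup>2)\<close>, which the prior
  integrates.\<close>

lemma integrable_moment: "integrable \<nu> (\<lambda>\<theta>. qq (\<theta> - x) ^ j * K (x - \<theta>))"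
proof -
  obtain C where C: "\<And>z. qq z ^ (j + 2) * K z \<le> C"
    using K_bounded[of "j + 2"] by blast
  have "qq (\<theta> - x) ^ j * K (x - \<theta>) \<le> C * (2 * qq x)\<^sup>2 * inverse ((qq \<theta>)\<^sup>2)" for \<theta>
  proof -
    have "(qq \<theta>)\<^sup>2 \<le> (2 * qq x * qq (\<theta> - x))\<^sup>2"
      using qq_peetre[of \<theta> x] qq_nonneg by (intro power_mono)
    then have 1: "inverse ((qq (\<theta> - x))\<^sup>2) \<le> (2 * qq x)\<^sup>2 * inverse ((qq \<theta>)\<^sup>2)"
      using qq_pos[of \<theta>] qq_pos[of "\<theta> - x"] by (simp add: field_simps power_mult_distrib)
    have "qq (\<theta> - x) ^ j * K (x - \<theta>) = qq (x - \<theta>) ^ (j + 2) * K (x - \<theta>) * inverse ((qq (\<theta> - x))\<^sup>2)"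
      using qq_pos[of "x - \<theta>"] by (simp add: qq_minus_commute[of \<theta> x] field_simps power_add power2_eq_square)
    also have "\<dots> \<le> C * inverse ((qq (\<theta> - x))\<^sup>2)"
      using C[of "x - \<theta>"] by (intro mult_right_mono) auto
    also have "\<dots> \<le> C * ((2 * qq x)\<^sup>2 * inverse ((qq \<theta>)\<^sup>2))"
      using C[of 0] K_pos[of 0] qq_pos[of "0::'a"] 1
      by (intro mult_left_mono) (auto intro: order_trans[of 0 "qq 0 ^ (j+2) * K 0"] simp: K_nonneg qq_nonneg)
    finally show ?thesis by (simp add: mult_ac)
  qed
  then show ?thesis
    by (intro Bochner_Integration.integrable_bound[OF integrable_mult_right[OF integrable_inverse_square, of "C * (2 * qq x)\<^sup>2"]])
      (auto simp: K_nonneg qq_nonneg intro!: AE_I2 order_trans[OF _ abs_ge_self])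
qed

lemma integrable_dominated:
  fixes f :: "'a \<Rightarrow> 'b::{banach,second_countable_topology}"
  assumes [measurable]: "f \<in> borel_measurable borel"
    and "\<And>\<theta>. norm (f \<theta>) \<le> c * (qq (\<theta> - x) ^ j * K (x - \<theta>))"
  shows "integrable \<nu> f"
  using assms(2) by (intro Bochner_Integration.integrable_bound[OF integrable_mult_right[OF integrable_moment, of c x j]])
    (auto intro!: AE_I2 order_trans[OF _ abs_ge_self])

text \<open>Unnormalised posterior moments: dividing by \<open>dens x\<close>, the marginal density
  of the observation, gives the posterior expectation of \<open>qq (\<theta> - x) ^ j\<close>.
  Without the quotient they are linear in the kernel and can be integrated over
  \<open>x\<close>.\<close>

definition mom :: "nat \<Rightarrow> 'a \<Rightarrow> real" where
  "mom j x = (\<integral>\<theta>. qq (\<theta> - x) ^ j * K (x - \<theta>) \<partial>\<nu>)"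

definition dens :: "'a \<Rightarrow> real" where
  "dens x = (\<integral>\<theta>. K (x - \<theta>) \<partial>\<nu>)"

definition bayes :: "'a \<Rightarrow> 'a" where
  "bayes x = (\<integral>\<theta>. K (x - \<theta>) *\<^sub>R \<theta> \<partial>\<nu>) /\<^sub>R dens x"

lemma integrable_K: "integrable \<nu> (\<lambda>\<theta>. K (x - \<theta>))"
  using integrable_moment[of x 0] by simp

lemma weighted_integral_pos:
  fixes f :: "'a \<Rightarrow> real"
  assumes "integrable \<nu> f" "\<And>\<theta>. 0 < f \<theta>"
  shows "0 < (\<integral>\<theta>. f \<theta> \<partial>\<nu>)"
proof -
  have "(\<integral>\<theta>. f \<theta> \<partial>\<nu>) \<noteq> 0"
  proof
    assume "(\<integral>\<theta>. f \<theta> \<partial>\<nu>) = 0"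
    then have "AE \<theta> in \<nu>. f \<theta> = 0"
      using integral_nonneg_eq_0_iff_AE[OF assms(1)] assms(2) by (auto intro: less_imp_le)
    then have "AE \<theta> in \<nu>. False"
      by eventually_elim (metis assms(2) less_irrefl)
    then show False
      using prior_nonzero AE_iff_null[of \<nu> "\<lambda>_. False"] by (auto simp: null_sets_def sets_prior)
  qed
  then show ?thesis
    using integral_nonneg_AE[where M=\<nu> and f=f] assms(2) by (simp add: less_le)
qed

lemma dens_pos: "0 < dens x"
  unfolding dens_def using integrable_K K_pos by (intro weighted_integral_pos) auto

lemma norm_mult_le_qq: "norm z * c \<le> qq z * c" if "0 \<le> c"
proof -
  have "norm z \<le> qq z"
    using sum_squares_bound[of 1 "norm z"] norm_ge_zero[of z] unfolding qq_def power_one by linarith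
  then show ?thesis using that by (intro mult_right_mono)
qed

lemma integrable_K_scaleR_diff: "integrable \<nu> (\<lambda>\<theta>. K (x - \<theta>) *\<^sub>R (\<theta> - x))"
  by (rule integrable_dominated[of _ 1 x 1])
    (use norm_mult_le_qq[OF K_nonneg] in \<open>auto simp: K_nonneg mult_ac\<close>)

lemma integrable_K_scaleR: "integrable \<nu> (\<lambda>\<theta>. K (x - \<theta>) *\<^sub>R \<theta>)"
proof -
  have "integrable \<nu> (\<lambda>\<theta>. K (x - \<theta>) *\<^sub>R (\<theta> - x) + K (x - \<theta>) *\<^sub>R x)"
    by (intro Bochner_Integration.integrable_add integrable_K_scaleR_diff) (simp add: integrable_K)
  then show ?thesis by (simp add: scaleR_diff_right)
qed

lemma dens_scaleR_bayes: "dens x *\<^sub>R (bayes x - x) = (\<integral>\<theta>. K (x - \<theta>) *\<^sub>R (\<theta> - x) \<partial>\<nu>)"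
  using dens_pos[of x] by (simp add: bayes_def dens_def scaleR_diff_right integrable_K integrable_K_scaleR)

lemma bayes_centred: "(\<integral>\<theta>. K (x - \<theta>) *\<^sub>R (\<theta> - bayes x) \<partial>\<nu>) = 0"
  using dens_pos[of x] by (simp add: bayes_def dens_def scaleR_diff_right integrable_K integrable_K_scaleR)

lemma mom_nonneg: "0 \<le> mom j x"
  by (simp add: mom_def K_nonneg qq_nonneg)

lemma mom_mono: "i \<le> j \<Longrightarrow> mom i x \<le> mom j x"
  unfolding mom_def
  by (intro integral_mono integrable_moment mult_right_mono power_increasing)
    (auto simp: K_nonneg qq_ge_1)

text \<open>Cauchy-Schwarz after splitting the kernel into two square roots. The factor
  \<open>dens x\<close> later cancels the denominator of the Bayes rule.\<close>

lemma mom_sq_le: "(mom j x)\<^sup>2 \<le> dens x * mom (2 * j) x"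
proof -
  have e: "sqrt (K (x - \<theta>)) * (qq (\<theta> - x) ^ j * sqrt (K (x - \<theta>))) = qq (\<theta> - x) ^ j * K (x - \<theta>)" for \<theta>
    using K_nonneg[of "x - \<theta>"] by (simp add: mult_ac)
  show ?thesis
    using integrable_Cauchy_Schwarz(2)[of "\<lambda>\<theta>. sqrt (K (x - \<theta>))" \<nu> "\<lambda>\<theta>. qq (\<theta> - x) ^ j * sqrt (K (x - \<theta>))"]
      integrable_K[of x] integrable_moment[of x "2 * j"]
    by (simp add: mom_def dens_def power_mult_distrib K_nonneg qq_nonneg e flip: power_mult mult.commute[of 2 j])
qed

text \<open>Jensen's inequality for the posterior with the normalisation cleared:
  \<open>bayes x - x\<close> is the posterior mean of \<open>\<theta> - x\<close>.\<close>

lemma bayes_dist_le: "dens x * (norm (bayes x - x))\<^sup>2 \<le> mom 1 x"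
proof -
  have K2: "sqrt (K z) * (sqrt (K z) * norm w) = norm (K z *\<^sub>R w)" for z and w :: 'a
    using K_nonneg[of z] by (simp flip: mult.assoc)
  have i2: "integrable \<nu> (\<lambda>\<theta>. K (x - \<theta>) * (norm (\<theta> - x))\<^sup>2)"
    by (rule integrable_dominated[of _ 1 x 1]) (auto simp: K_nonneg qq_def abs_mult mult.commute mult_left_mono)
  have "dens x * norm (bayes x - x) = norm (dens x *\<^sub>R (bayes x - x))"
    using dens_pos[of x] by simp
  also have "\<dots> \<le> (\<integral>\<theta>. norm (K (x - \<theta>) *\<^sub>R (\<theta> - x)) \<partial>\<nu>)"
    unfolding dens_scaleR_bayes by (rule integral_norm_bound)
  finally have "(dens x * norm (bayes x - x))\<^sup>2 \<le> (\<integral>\<theta>. norm (K (x - \<theta>) *\<^sub>R (\<theta> - x)) \<partial>\<nu>)\<^sup>2"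
    using dens_pos[of x] by (intro power_mono) auto
  also have "\<dots> \<le> (\<integral>\<theta>. K (x - \<theta>) \<partial>\<nu>) * (\<integral>\<theta>. K (x - \<theta>) * (norm (\<theta> - x))\<^sup>2 \<partial>\<nu>)"
    using integrable_Cauchy_Schwarz(2)[of "\<lambda>\<theta>. sqrt (K (x - \<theta>))" \<nu> "\<lambda>\<theta>. sqrt (K (x - \<theta>)) * norm (\<theta> - x)"]
      integrable_K[of x] i2
    by (simp only: K2) (simp add: power_mult_distrib K_nonneg)
  also have "(\<integral>\<theta>. K (x - \<theta>) * (norm (\<theta> - x))\<^sup>2 \<partial>\<nu>) \<le> mom 1 x"
    unfolding mom_def using i2 integrable_moment[of x 1]
    by (intro integral_mono) (auto simp: K_nonneg qq_def mult.commute mult_left_mono)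
  finally have "dens x * (dens x * (norm (bayes x - x))\<^sup>2) \<le> dens x * mom 1 x"
    using dens_pos[of x] by (simp add: dens_def power_mult_distrib power2_eq_square mult_ac mult_left_mono)
  then show ?thesis
    using dens_pos[of x] by simp
qed

text \<open>\<open>\<theta> - bayes x\<close> is split at the observation. The displacement of
  \<open>bayes x\<close> contributes at most \<open>mom 1 x * mom j x / dens x\<close>, and passing
  to \<open>mom (2 * j)\<close> is the price of removing this quotient by
  \<open>mom_sq_le\<close>.\<close>

lemma integrable_posterior_spread: "integrable \<nu> (\<lambda>\<theta>. (norm (\<theta> - bayes x))\<^sup>2 * (qq (\<theta> - x) ^ j * K (x - \<theta>)))"
    (is "integrable \<nu> ?f")
  and posterior_spread_le:
    "1 \<le> j \<Longrightarrow> (\<integral>\<theta>. (norm (\<theta> - bayes x))\<^sup>2 * (qq (\<theta> - x) ^ j * K (x - \<theta>)) \<partial>\<nu>) \<le> 4 * mom (2 * j) x"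
proof -
  let ?w = "\<lambda>\<theta>. qq (\<theta> - x) ^ j * K (x - \<theta>)"
  let ?c = "(norm (bayes x - x))\<^sup>2"
  have le: "?f \<theta> \<le> 2 * (qq (\<theta> - x) ^ (j + 1) * K (x - \<theta>)) + 2 * ?c * ?w \<theta>" for \<theta>
  proof -
    have "(norm (\<theta> - bayes x))\<^sup>2 \<le> (norm (\<theta> - x) + norm (bayes x - x))\<^sup>2"
      using norm_triangle_ineq4[of "\<theta> - x" "bayes x - x"] by (intro power_mono) auto
    also have "\<dots> \<le> 2 * (norm (\<theta> - x))\<^sup>2 + 2 * ?c"
      using sum_squares_bound[of "norm (\<theta> - x)" "norm (bayes x - x)"] by (simp add: power2_sum)
    also have "\<dots> \<le> 2 * qq (\<theta> - x) + 2 * ?c"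
      by (simp add: norm_sq_le_qq)
    finally have "?f \<theta> \<le> (2 * qq (\<theta> - x) + 2 * ?c) * ?w \<theta>"
      by (rule mult_right_mono) (simp add: K_nonneg qq_nonneg)
    then show ?thesis by (simp add: algebra_simps)
  qed
  have i: "integrable \<nu> (\<lambda>\<theta>. 2 * (qq (\<theta> - x) ^ (j + 1) * K (x - \<theta>)) + 2 * ?c * ?w \<theta>)"
    by (intro Bochner_Integration.integrable_add integrable_mult_right integrable_moment)
  show i': "integrable \<nu> ?f"
    using le by (intro Bochner_Integration.integrable_bound[OF i])
      (auto intro!: AE_I2 order_trans[OF _ abs_ge_self] simp: K_nonneg qq_nonneg)
  assume j: "1 \<le> j"
  have "(\<integral>\<theta>. ?f \<theta> \<partial>\<nu>) \<le> (\<integral>\<theta>. 2 * (qq (\<theta> - x) ^ (j + 1) * K (x - \<theta>)) + 2 * ?c * ?w \<theta> \<partial>\<nu>)"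
    using i i' le by (intro integral_mono) auto
  also have "\<dots> = 2 * mom (j + 1) x + 2 * (?c * mom j x)"
    unfolding mom_def
    by (subst Bochner_Integration.integral_add)
      (intro Bochner_Integration.integrable_add integrable_mult_right integrable_moment | simp)+
  also have "mom (j + 1) x \<le> mom (2 * j) x"
    using j by (intro mom_mono) auto
  also have "?c * mom j x \<le> mom (2 * j) x"
  proof -
    have "dens x * (?c * mom j x) \<le> mom 1 x * mom j x"
      using mult_right_mono[OF bayes_dist_le mom_nonneg] by (simp add: mult_ac)
    also have "\<dots> \<le> mom j x * mom j x"
      using j mom_mono[of 1 j x] mom_nonneg by (intro mult_right_mono) auto
    also have "\<dots> \<le> dens x * mom (2 * j) x"
      using mom_sq_le[of j x] by (simp add: power2_eq_square)
    finally show ?thesis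
      using dens_pos[of x] by simp
  qed
  finally show "(\<integral>\<theta>. ?f \<theta> \<partial>\<nu>) \<le> 4 * mom (2 * j) x"
    by linarith
qed

lemma mom_eq_nn: "ennreal (mom j x) = (\<integral>\<^sup>+\<theta>. ennreal (qq (\<theta> - x) ^ j * K (x - \<theta>)) \<partial>\<nu>)"
  unfolding mom_def using integrable_moment by (subst nn_integral_eq_integral) (auto simp: K_nonneg qq_nonneg)

definition kmom :: "nat \<Rightarrow> real" where
  "kmom j = (\<integral>z. qq z ^ j * K z \<partial>lborel)"

lemma kmom_nonneg: "0 \<le> kmom j"
  by (simp add: kmom_def K_nonneg qq_nonneg)

lemma nn_kmom: "(\<integral>\<^sup>+x. ennreal (qq (\<theta> - x) ^ j * K (x - \<theta>)) \<partial>lborel) = ennreal (kmom j)"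
proof -
  have "(\<integral>\<^sup>+x. ennreal (qq (\<theta> - x) ^ j * K (x - \<theta>)) \<partial>lborel)
      = (\<integral>\<^sup>+x. ennreal (qq (x - \<theta>) ^ j * K (x - \<theta>)) \<partial>distr lborel borel ((+) \<theta>))"
    by (simp add: lborel_distr_plus qq_minus_commute[of \<theta>])
  also have "\<dots> = (\<integral>\<^sup>+z. ennreal (qq z ^ j * K z) \<partial>lborel)"
    by (subst nn_integral_distr) auto
  also have "\<dots> = ennreal (kmom j)"
    unfolding kmom_def using K_moment[of j]
    by (intro nn_integral_eq_integral) (auto intro!: integrableI_nonneg simp: K_nonneg qq_nonneg)
  finally show ?thesis .
qed

text \<open>Exchanges the weight at the observation for the weight at the parameter, after which the
  integral over the observation is a moment of the kernel.\<close>

lemma integral_weighted_mom_le: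
  assumes [measurable]: "f \<in> borel_measurable borel"
    and f: "\<And>x \<theta>. f x \<le> D * qq (\<theta> - x) ^ i * f \<theta>" "\<And>x. 0 \<le> f x" and D: "0 \<le> D"
  shows "(\<integral>\<^sup>+x. ennreal (f x * mom j x) \<partial>lborel) \<le> ennreal (D * kmom (i + j)) * (\<integral>\<^sup>+\<theta>. ennreal (f \<theta>) \<partial>\<nu>)"
proof -
  have "(\<integral>\<^sup>+x. ennreal (f x * mom j x) \<partial>lborel)
      = (\<integral>\<^sup>+x. (\<integral>\<^sup>+\<theta>. ennreal (f x * (qq (\<theta> - x) ^ j * K (x - \<theta>))) \<partial>\<nu>) \<partial>lborel)"
    using f(2) by (intro nn_integral_cong)
      (simp add: ennreal_mult mom_nonneg mom_eq_nn nn_integral_cmult K_nonneg qq_nonneg)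
  also have "\<dots> \<le> (\<integral>\<^sup>+x. (\<integral>\<^sup>+\<theta>. ennreal (D * f \<theta>) * ennreal (qq (\<theta> - x) ^ (i + j) * K (x - \<theta>)) \<partial>\<nu>) \<partial>lborel)"
  proof (intro nn_integral_mono)
    fix x \<theta>
    have "f x * (qq (\<theta> - x) ^ j * K (x - \<theta>)) \<le> D * qq (\<theta> - x) ^ i * f \<theta> * (qq (\<theta> - x) ^ j * K (x - \<theta>))"
      using f(1) by (intro mult_right_mono) (auto simp: K_nonneg qq_nonneg)
    then show "ennreal (f x * (qq (\<theta> - x) ^ j * K (x - \<theta>)))
        \<le> ennreal (D * f \<theta>) * ennreal (qq (\<theta> - x) ^ (i + j) * K (x - \<theta>))"
      using f(2) D by (simp flip: ennreal_mult add: K_nonneg qq_nonneg power_add mult_ac ennreal_leI)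
  qed
  also have "\<dots> = (\<integral>\<^sup>+\<theta>. (\<integral>\<^sup>+x. ennreal (D * f \<theta>) * ennreal (qq (\<theta> - x) ^ (i + j) * K (x - \<theta>)) \<partial>lborel) \<partial>\<nu>)"
    by (rule lborel_prior.Fubini'[symmetric]) simp
  also have "\<dots> = (\<integral>\<^sup>+\<theta>. ennreal (D * kmom (i + j)) * ennreal (f \<theta>) \<partial>\<nu>)"
    using D f(2) kmom_nonneg
    by (intro nn_integral_cong) (subst nn_integral_cmult, simp, subst nn_kmom, simp add: ennreal_mult mult_ac)
  also have "\<dots> = ennreal (D * kmom (i + j)) * (\<integral>\<^sup>+\<theta>. ennreal (f \<theta>) \<partial>\<nu>)"
    by (rule nn_integral_cmult) simp
  finally show ?thesis .
qed

lemma bayes_measurable [measurable]: "bayes \<in> borel_measurable borel"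
proof -
  have [measurable]: "dens \<in> borel_measurable borel"
    unfolding dens_def[abs_def] by measurable
  show ?thesis
    unfolding bayes_def[abs_def] by measurable
qed

lemma mom_measurable [measurable]: "mom j \<in> borel_measurable borel"
  unfolding mom_def[abs_def] by measurable

text \<open>
  Blyth's comparison with the proper prior \<open>u \<nu>\<close>.  Only the vectors
  \<open>v x = \<integral> K (x - \<theta>) (u \<theta> - u x) (\<theta> - bayes x) d\<nu>\<close> enter, because \<open>\<theta> - bayes x\<close> is centred
  under the posterior; the factor \<open>sqrt (u \<theta>)\<close> in the oscillation bound lets Cauchy-Schwarz
  cancel the marginal density of the modified prior.
\<close>

lemma blyth_estimate:
  fixes B :: "'a \<Rightarrow> 'a \<Rightarrow> real" and u \<rho> :: "'a \<Rightarrow> real" and \<delta> :: "'a \<Rightarrow> 'a"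
  assumes B: "bounded_bilinear B" "\<And>v w. B v w = B w v" "\<And>v. c * (norm v)\<^sup>2 \<le> B v v" "0 < c"
      "\<And>v w. \<bar>B v w\<bar> \<le> C * norm v * norm w" "0 \<le> C"
    and [measurable]: "\<delta> \<in> borel_measurable borel" "u \<in> borel_measurable borel" "\<rho> \<in> borel_measurable borel"
    and risk: "\<And>\<theta>. (\<integral>\<^sup>+x. ennreal (B (\<theta> - \<delta> x) (\<theta> - \<delta> x) * K (x - \<theta>)) \<partial>lborel)
        \<le> (\<integral>\<^sup>+x. ennreal (B (\<theta> - bayes x) (\<theta> - bayes x) * K (x - \<theta>)) \<partial>lborel)"
    and D: "0 \<le> D"
    and u: "\<And>\<theta>. 0 < u \<theta>" "\<And>x \<theta>. u x \<le> D * qq (\<theta> - x) ^ 8 * u \<theta>"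
      "(\<integral>\<^sup>+\<theta>. ennreal (u \<theta>) \<partial>\<nu>) < \<infinity>"
    and osc: "\<And>x \<theta>. \<bar>u \<theta> - u x\<bar> \<le> D * qq (\<theta> - x) ^ 8 * sqrt (u \<theta>) * \<rho> x"
    and \<rho>: "\<And>x. 0 \<le> \<rho> x" "\<And>x \<theta>. (\<rho> x)\<^sup>2 \<le> D * qq (\<theta> - x) ^ 8 * (\<rho> \<theta>)\<^sup>2"
  shows "(\<integral>\<^sup>+x. ennreal ((\<integral>\<theta>. u \<theta> * K (x - \<theta>) \<partial>\<nu>) * (norm (\<delta> x - bayes x))\<^sup>2) \<partial>lborel)
    \<le> ennreal (16 * C\<^sup>2 / c\<^sup>2 * D ^ 3 * kmom 40) * (\<integral>\<^sup>+\<theta>. ennreal ((\<rho> \<theta>)\<^sup>2) \<partial>\<nu>)"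
proof -
  interpret B: bounded_bilinear B by fact
  have [measurable]: "(\<lambda>p. B (f p) (g p)) \<in> borel_measurable M"
    if "f \<in> borel_measurable M" "g \<in> borel_measurable M" for f g and M :: "'c measure"
    using that by (intro borel_measurable_continuous_Pair[where H=B]) (auto intro!: B.continuous_on continuous_intros)
  have Bnn: "0 \<le> B v v" for v
    using B(3)[of v] B(4) by (meson mult_nonneg_nonneg less_imp_le order_trans zero_le_power2)
  have Bub: "B v v \<le> C * (norm v)\<^sup>2" for v
    using B(5)[of v v] by (simp add: power2_eq_square mult.assoc)
  define w where "w x \<theta> = u \<theta> * K (x - \<theta>)" for x \<theta>
  have w_pos: "0 < w x \<theta>" for x \<theta> using u(1) K_pos by (simp add: w_def)
  have [measurable]: "(\<lambda>(x, \<theta>). w x \<theta>) \<in> borel_measurable (borel \<Otimes>\<^sub>M borel)" "w x \<in> borel_measurable borel" for x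
    unfolding w_def by measurable
  have w_le: "w x \<theta> \<le> D * u x * (qq (\<theta> - x) ^ 8 * K (x - \<theta>))" for x \<theta>
    using mult_right_mono[OF u(2)[of \<theta> x] K_nonneg[of "x - \<theta>"]]
    by (simp add: w_def qq_minus_commute[of x] mult_ac)
  have int_w: "integrable \<nu> (w x)" for x
    by (rule integrable_dominated[of _ "D * u x" x 8]) (use w_le w_pos in \<open>auto simp: less_imp_le\<close>)
  have int_wn2: "integrable \<nu> (\<lambda>\<theta>. w x \<theta> * (norm (\<theta> - bayes x))\<^sup>2)" for x
  proof (rule Bochner_Integration.integrable_bound[OF integrable_mult_right[OF integrable_posterior_spread[of x 8], of "D * u x"]])
    show "AE \<theta> in \<nu>. norm (w x \<theta> * (norm (\<theta> - bayes x))\<^sup>2)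
      \<le> norm (D * u x * ((norm (\<theta> - bayes x))\<^sup>2 * (qq (\<theta> - x) ^ 8 * K (x - \<theta>))))"
      using mult_right_mono[OF w_le, of "(norm (_ - bayes x))\<^sup>2" x] w_pos
      by (intro AE_I2 order_trans[OF _ abs_ge_self[THEN order_trans[OF _ eq_refl[OF real_norm_def[symmetric]]]]])
        (auto simp: mult_ac less_imp_le)
  qed measurable
  \<comment> \<open>\<open>mu x\<close> is the marginal density under the modified prior, and
    \<open>v x / mu x\<close> below is the displacement of its Bayes rule from
    \<open>bayes x\<close>.\<close>
  define mu where "mu x = (\<integral>\<theta>. w x \<theta> \<partial>\<nu>)" for x
  have [measurable]: "mu \<in> borel_measurable borel"
    unfolding mu_def[abs_def] by measurable
  have mu_pos: "0 < mu x" for x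
    unfolding mu_def using int_w w_pos by (intro weighted_integral_pos)
  have int_wn: "integrable \<nu> (\<lambda>\<theta>. w x \<theta> *\<^sub>R (\<theta> - bayes x))" for x
  proof (rule Bochner_Integration.integrable_bound[OF Bochner_Integration.integrable_add[OF int_w[of x] int_wn2[of x]]])
    have "norm z \<le> 1 + (norm z)\<^sup>2" for z :: 'a
      using sum_squares_bound[of 1 "norm z"] norm_ge_zero[of z] unfolding power_one by linarith
    then have "w x \<theta> * norm (\<theta> - bayes x) \<le> w x \<theta> * (1 + (norm (\<theta> - bayes x))\<^sup>2)" for \<theta>
      using w_pos by (intro mult_left_mono) (auto simp: less_imp_le)
    then show "AE \<theta> in \<nu>. norm (w x \<theta> *\<^sub>R (\<theta> - bayes x)) \<le> norm (w x \<theta> + w x \<theta> * (norm (\<theta> - bayes x))\<^sup>2)"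
      using w_pos by (intro AE_I2) (auto simp: less_imp_le distrib_left intro: order_trans[OF _ abs_ge_self])
  qed measurable
  define v where "v x = (\<integral>\<theta>. w x \<theta> *\<^sub>R (\<theta> - bayes x) \<partial>\<nu>)" for x
  have [measurable]: "v \<in> borel_measurable borel"
    unfolding v_def[abs_def] by measurable
  \<comment> \<open>The exponents: 8 from the oscillation bound is squared to 16,
    \<open>posterior_spread_le\<close> doubles it to 32, and the final exchange of weights adds
    another 8, whence \<open>kmom 40\<close>.\<close>
  have v_le: "(norm (v x))\<^sup>2 \<le> mu x * (4 * D\<^sup>2 * ((\<rho> x)\<^sup>2 * mom 32 x))" for x
  proof -
    let ?g = "\<lambda>\<theta>. norm (\<theta> - bayes x) * (qq (\<theta> - x) ^ 8 * sqrt (K (x - \<theta>)))"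
    let ?f = "\<lambda>\<theta>. sqrt (w x \<theta>)"
    have i0: "integrable \<nu> (\<lambda>\<theta>. (u x * K (x - \<theta>)) *\<^sub>R (\<theta> - bayes x))"
      using integrable_K[of x] integrable_K_scaleR[of x]
      by (simp add: scaleR_diff_right flip: scaleR_scaleR)
    have "(\<integral>\<theta>. (u x * K (x - \<theta>)) *\<^sub>R (\<theta> - bayes x) \<partial>\<nu>) = 0"
      using bayes_centred[of x] by (simp flip: scaleR_scaleR)
    then have "v x = (\<integral>\<theta>. w x \<theta> *\<^sub>R (\<theta> - bayes x) - (u x * K (x - \<theta>)) *\<^sub>R (\<theta> - bayes x) \<partial>\<nu>)"
      using int_wn[of x] i0 by (simp add: v_def)
    also have "\<dots> = (\<integral>\<theta>. ((u \<theta> - u x) * K (x - \<theta>)) *\<^sub>R (\<theta> - bayes x) \<partial>\<nu>)"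
      by (simp add: w_def left_diff_distrib scaleR_diff_left)
    finally have veq: "v x = (\<integral>\<theta>. ((u \<theta> - u x) * K (x - \<theta>)) *\<^sub>R (\<theta> - bayes x) \<partial>\<nu>)" .
    have g2: "(?g \<theta>)\<^sup>2 = (norm (\<theta> - bayes x))\<^sup>2 * (qq (\<theta> - x) ^ 16 * K (x - \<theta>))" for \<theta>
      by (simp add: power_mult_distrib K_nonneg flip: power_mult)
    have f2: "(?f \<theta>)\<^sup>2 = w x \<theta>" for \<theta> using w_pos by (simp add: less_imp_le)
    have CS: "integrable \<nu> (\<lambda>\<theta>. ?f \<theta> * ?g \<theta>)"
      "(\<integral>\<theta>. ?f \<theta> * ?g \<theta> \<partial>\<nu>)\<^sup>2 \<le> mu x * (\<integral>\<theta>. (norm (\<theta> - bayes x))\<^sup>2 * (qq (\<theta> - x) ^ 16 * K (x - \<theta>)) \<partial>\<nu>)"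
      using integrable_Cauchy_Schwarz[of ?f \<nu> ?g] int_w[of x] integrable_posterior_spread[of x 16] w_pos
      unfolding g2 f2 mu_def by (auto simp: K_nonneg qq_nonneg less_imp_le)
    have bnd: "norm (((u \<theta> - u x) * K (x - \<theta>)) *\<^sub>R (\<theta> - bayes x)) \<le> D * \<rho> x * (?f \<theta> * ?g \<theta>)" for \<theta>
    proof -
      have "\<bar>u \<theta> - u x\<bar> * (K (x - \<theta>) * norm (\<theta> - bayes x))
          \<le> D * qq (\<theta> - x) ^ 8 * sqrt (u \<theta>) * \<rho> x * (K (x - \<theta>) * norm (\<theta> - bayes x))"
        using osc by (intro mult_right_mono) (auto simp: K_nonneg)
      moreover have "?f \<theta> * ?g \<theta> = sqrt (u \<theta>) * (norm (\<theta> - bayes x) * qq (\<theta> - x) ^ 8)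
          * (sqrt (K (x - \<theta>)) * sqrt (K (x - \<theta>)))"
        unfolding w_def real_sqrt_mult by (simp only: mult_ac)
      then have "?f \<theta> * ?g \<theta> = sqrt (u \<theta>) * (norm (\<theta> - bayes x) * qq (\<theta> - x) ^ 8) * K (x - \<theta>)"
        by (simp add: K_nonneg)
      ultimately show ?thesis
        by (simp only: norm_scaleR abs_mult abs_of_nonneg[OF K_nonneg]) (simp only: mult_ac)
    qed
    have "norm (v x) \<le> (\<integral>\<theta>. D * \<rho> x * (?f \<theta> * ?g \<theta>) \<partial>\<nu>)"
      unfolding veq
    proof (rule Bochner_Integration.integral_norm_bound_integral)
      show i: "integrable \<nu> (\<lambda>\<theta>. D * \<rho> x * (?f \<theta> * ?g \<theta>))"
        using CS(1) by (rule integrable_mult_right)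
      show "integrable \<nu> (\<lambda>\<theta>. ((u \<theta> - u x) * K (x - \<theta>)) *\<^sub>R (\<theta> - bayes x))"
        by (rule Bochner_Integration.integrable_bound[OF i])
          (auto intro!: AE_I2 order_trans[OF bnd] simp del: norm_scaleR)
    qed (rule bnd)
    then have "(norm (v x))\<^sup>2 \<le> (D * \<rho> x * (\<integral>\<theta>. ?f \<theta> * ?g \<theta> \<partial>\<nu>))\<^sup>2"
      by (intro power_mono) auto
    also have "\<dots> = D\<^sup>2 * (\<rho> x)\<^sup>2 * (\<integral>\<theta>. ?f \<theta> * ?g \<theta> \<partial>\<nu>)\<^sup>2"
      by (simp add: power_mult_distrib)
    also have "\<dots> \<le> D\<^sup>2 * (\<rho> x)\<^sup>2 * (mu x * (4 * mom 32 x))"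
      using CS(2) posterior_spread_le[of 16 x] mu_pos[of x]
      by (intro mult_left_mono order_trans[OF CS(2)]) (auto intro: mult_left_mono)
    finally show ?thesis by (simp add: mult_ac)
  qed
  define L where "L \<delta> x = (\<integral>\<^sup>+\<theta>. ennreal (B (\<theta> - \<delta> x) (\<theta> - \<delta> x) * w x \<theta>) \<partial>\<nu>)" for \<delta> :: "'a \<Rightarrow> 'a" and x
  have Lm [measurable]: "L \<delta>' \<in> borel_measurable borel" if [measurable]: "\<delta>' \<in> borel_measurable borel" for \<delta>'
    unfolding L_def[abs_def] by measurable
  have int_L: "(\<integral>\<^sup>+x. L \<delta>' x \<partial>lborel)
      = (\<integral>\<^sup>+\<theta>. ennreal (u \<theta>) * (\<integral>\<^sup>+x. ennreal (B (\<theta> - \<delta>' x) (\<theta> - \<delta>' x) * K (x - \<theta>)) \<partial>lborel) \<partial>\<nu>)"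
    if [measurable]: "\<delta>' \<in> borel_measurable borel" for \<delta>'
  proof -
    have "(\<integral>\<^sup>+x. L \<delta>' x \<partial>lborel) = (\<integral>\<^sup>+\<theta>. (\<integral>\<^sup>+x. ennreal (B (\<theta> - \<delta>' x) (\<theta> - \<delta>' x) * w x \<theta>) \<partial>lborel) \<partial>\<nu>)"
      unfolding L_def by (rule lborel_prior.Fubini'[symmetric]) measurable
    also have "\<dots> = (\<integral>\<^sup>+\<theta>. ennreal (u \<theta>) * (\<integral>\<^sup>+x. ennreal (B (\<theta> - \<delta>' x) (\<theta> - \<delta>' x) * K (x - \<theta>)) \<partial>lborel) \<partial>\<nu>)"
    proof (rule nn_integral_cong)
      fix \<theta>
      have eq: "B (\<theta> - \<delta>' x) (\<theta> - \<delta>' x) * w x \<theta> = u \<theta> * (B (\<theta> - \<delta>' x) (\<theta> - \<delta>' x) * K (x - \<theta>))" for x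
        by (simp add: w_def)
      show "(\<integral>\<^sup>+x. ennreal (B (\<theta> - \<delta>' x) (\<theta> - \<delta>' x) * w x \<theta>) \<partial>lborel)
          = ennreal (u \<theta>) * (\<integral>\<^sup>+x. ennreal (B (\<theta> - \<delta>' x) (\<theta> - \<delta>' x) * K (x - \<theta>)) \<partial>lborel)"
        unfolding eq using u(1)[of \<theta>] Bnn K_nonneg
        by (subst nn_integral_cmult[symmetric]) (auto simp: less_imp_le simp flip: ennreal_mult)
    qed
    finally show ?thesis .
  qed
  \<comment> \<open>The assumed risk inequality averaged over the modified prior, that is, a
    comparison of two Bayes risks.\<close>
  have L_le: "(\<integral>\<^sup>+x. L \<delta> x \<partial>lborel) \<le> (\<integral>\<^sup>+x. L bayes x \<partial>lborel)"
    by (simp add: int_L, rule nn_integral_mono, rule mult_left_mono, rule risk, simp)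
  have int_BL: "integrable \<nu> (\<lambda>\<theta>. B (\<theta> - bayes x) (\<theta> - bayes x) * w x \<theta>)" for x
    using Bub Bnn w_pos
    by (intro Bochner_Integration.integrable_bound[OF integrable_mult_right[OF int_wn2[of x], of C]] AE_I2
        order_trans[OF _ abs_ge_self[THEN order_trans[OF _ eq_refl[OF real_norm_def[symmetric]]]]])
      (auto simp: less_imp_le mult.assoc[symmetric] mult.commute[of "w _ _"] intro!: mult_right_mono)
  define k where "k x = (\<integral>\<theta>. B (\<theta> - bayes x) (\<theta> - bayes x) * w x \<theta> \<partial>\<nu>)" for x
  have k_nn: "0 \<le> k x" for x
    unfolding k_def using Bnn w_pos by (intro integral_nonneg_AE) (auto simp: less_imp_le)
  have L_bayes: "L bayes x = ennreal (k x)" for x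
    unfolding L_def k_def using int_BL Bnn w_pos by (intro nn_integral_eq_integral) (auto simp: less_imp_le)
  have k_le: "k x \<le> 4 * C * D * (u x * mom 16 x)" for x
  proof -
    have "B (\<theta> - bayes x) (\<theta> - bayes x) * w x \<theta>
      \<le> C * D * u x * ((norm (\<theta> - bayes x))\<^sup>2 * (qq (\<theta> - x) ^ 8 * K (x - \<theta>)))" for \<theta>
    proof -
      have "B (\<theta> - bayes x) (\<theta> - bayes x) * w x \<theta>
        \<le> (C * (norm (\<theta> - bayes x))\<^sup>2) * (D * u x * (qq (\<theta> - x) ^ 8 * K (x - \<theta>)))"
        using w_pos Bub w_le B(6) by (intro mult_mono) (auto simp: less_imp_le)
      then show ?thesis by (simp add: mult_ac)
    qed
    then have "k x \<le> (\<integral>\<theta>. C * D * u x * ((norm (\<theta> - bayes x))\<^sup>2 * (qq (\<theta> - x) ^ 8 * K (x - \<theta>))) \<partial>\<nu>)"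
      unfolding k_def by (intro integral_mono int_BL integrable_mult_right integrable_posterior_spread)
    also have "\<dots> = C * D * u x * (\<integral>\<theta>. ((norm (\<theta> - bayes x))\<^sup>2 * (qq (\<theta> - x) ^ 8 * K (x - \<theta>))) \<partial>\<nu>)"
      by simp
    also have "\<dots> \<le> C * D * u x * (4 * mom 16 x)"
      using posterior_spread_le[of 8 x] B(6) D u(1)[of x] by (intro mult_left_mono) (auto simp: less_imp_le)
    finally show ?thesis by (simp add: mult_ac)
  qed
  \<comment> \<open>Finiteness of this Bayes risk is what permits cancelling it from both sides in
    \<open>ennreal\<close> at the end.\<close>
  have fin: "(\<integral>\<^sup>+x. L bayes x \<partial>lborel) < \<infinity>"
  proof -
    have "(\<integral>\<^sup>+x. L bayes x \<partial>lborel) \<le> (\<integral>\<^sup>+x. ennreal (4 * C * D) * ennreal (u x * mom 16 x) \<partial>lborel)"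
      unfolding L_bayes using k_le B(6) D u(1) mom_nonneg
      by (intro nn_integral_mono) (simp flip: ennreal_mult add: ennreal_leI less_imp_le)
    also have "\<dots> = ennreal (4 * C * D) * (\<integral>\<^sup>+x. ennreal (u x * mom 16 x) \<partial>lborel)"
      by (rule nn_integral_cmult) measurable
    also have "\<dots> \<le> ennreal (4 * C * D) * (ennreal (D * kmom (8 + 16)) * (\<integral>\<^sup>+\<theta>. ennreal (u \<theta>) \<partial>\<nu>))"
      using u D by (intro mult_left_mono integral_weighted_mom_le) (auto simp: less_imp_le)
    also have "\<dots> < \<infinity>"
      using u(3) by (simp add: ennreal_mult_less_top)
    finally show ?thesis .
  qed
  \<comment> \<open>The posterior loss is expanded around \<open>bayes x\<close>. Half of the
    coercive term \<open>c * mu x\<close> times the squared displacement absorbs the cross term with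
    \<open>v x\<close>; the other half is the gain kept on the left.\<close>
  have key: "ennreal (k x) + ennreal (c / 2 * (mu x * (norm (\<delta> x - bayes x))\<^sup>2))
      \<le> L \<delta> x + ennreal (8 * C\<^sup>2 / c * D\<^sup>2 * ((\<rho> x)\<^sup>2 * mom 32 x))" for x
  proof -
    let ?d = "\<delta> x - bayes x"
    have exp: "B (\<theta> - \<delta> x) (\<theta> - \<delta> x) * w x \<theta> = B (\<theta> - bayes x) (\<theta> - bayes x) * w x \<theta>
        - 2 * B (w x \<theta> *\<^sub>R (\<theta> - bayes x)) ?d + w x \<theta> * B ?d ?d" for \<theta>
    proof -
      have e: "\<theta> - \<delta> x = (\<theta> - bayes x) - ?d" by simp
      have sq: "B (a - d) (a - d) = B a a - 2 * B a d + B d d" for a d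
        using B(2)[of d a] by (simp add: B.diff_left B.diff_right)
      have eq: "B (\<theta> - \<delta> x) (\<theta> - \<delta> x) = B (\<theta> - bayes x) (\<theta> - bayes x) - 2 * B (\<theta> - bayes x) ?d + B ?d ?d"
        unfolding e by (rule sq)
      show ?thesis
        unfolding eq B.scaleR_left real_scaleR_def by (simp add: algebra_simps)
    qed
    have iB: "integrable \<nu> (\<lambda>\<theta>. B (w x \<theta> *\<^sub>R (\<theta> - bayes x)) ?d)"
      by (rule integrable_bounded_linear[OF B.bounded_linear_left int_wn])
    have eB: "(\<integral>\<theta>. B (w x \<theta> *\<^sub>R (\<theta> - bayes x)) ?d \<partial>\<nu>) = B (v x) ?d"
      unfolding v_def by (rule integral_bounded_linear[OF B.bounded_linear_left int_wn])
    have "integrable \<nu> (\<lambda>\<theta>. B (\<theta> - \<delta> x) (\<theta> - \<delta> x) * w x \<theta>)"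
      unfolding exp using int_BL[of x] iB int_w[of x] by simp
    then have "L \<delta> x = ennreal (\<integral>\<theta>. B (\<theta> - \<delta> x) (\<theta> - \<delta> x) * w x \<theta> \<partial>\<nu>)"
      unfolding L_def using Bnn w_pos
      by (intro nn_integral_eq_integral) (auto simp: less_imp_le)
    also have "(\<integral>\<theta>. B (\<theta> - \<delta> x) (\<theta> - \<delta> x) * w x \<theta> \<partial>\<nu>) = k x - 2 * B (v x) ?d + mu x * B ?d ?d"
      unfolding exp k_def mu_def eB[symmetric] using int_BL[of x] iB int_w[of x] by simp
    finally have Leq: "L \<delta> x = ennreal (k x - 2 * B (v x) ?d + mu x * B ?d ?d)" .
    have "2 * B (v x) ?d \<le> 2 * (C * norm (v x) * norm ?d)"
      using B(5)[of "v x" ?d] by simp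
    also have "\<dots> \<le> c / 2 * (mu x * (norm ?d)\<^sup>2) + 2 * C\<^sup>2 / c * ((norm (v x))\<^sup>2 / mu x)"
    proof -
      have "0 \<le> (sqrt (c / 2 * mu x) * norm ?d - sqrt (2 / (c * mu x)) * (C * norm (v x)))\<^sup>2" by simp
      also have "\<dots> = c / 2 * mu x * (norm ?d)\<^sup>2 + 2 / (c * mu x) * (C * norm (v x))\<^sup>2
          - 2 * (sqrt (c / 2 * mu x) * sqrt (2 / (c * mu x))) * (C * norm (v x) * norm ?d)"
        using mu_pos[of x] B(4) by (simp add: power2_diff power_mult_distrib mult_ac)
      also have "sqrt (c / 2 * mu x) * sqrt (2 / (c * mu x)) = 1"
        using mu_pos[of x] B(4) by (simp flip: real_sqrt_mult)
      finally show ?thesis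
        using mu_pos[of x] B(4) by (simp add: power_mult_distrib field_simps)
    qed
    also have "(norm (v x))\<^sup>2 / mu x \<le> 4 * D\<^sup>2 * ((\<rho> x)\<^sup>2 * mom 32 x)"
      using v_le[of x] mu_pos[of x] by (simp add: divide_le_eq mult_ac)
    finally have "2 * B (v x) ?d \<le> c / 2 * (mu x * (norm ?d)\<^sup>2) + 2 * C\<^sup>2 / c * (4 * D\<^sup>2 * ((\<rho> x)\<^sup>2 * mom 32 x))"
      using B(4) by (simp add: mult_left_mono divide_right_mono)
    moreover have "c * (mu x * (norm ?d)\<^sup>2) \<le> mu x * B ?d ?d"
      using mult_left_mono[OF B(3)[of ?d] less_imp_le[OF mu_pos[of x]]] by (simp add: mult_ac)
    moreover have "2 * C\<^sup>2 / c * (4 * D\<^sup>2 * ((\<rho> x)\<^sup>2 * mom 32 x)) = 8 * C\<^sup>2 / c * D\<^sup>2 * ((\<rho> x)\<^sup>2 * mom 32 x)"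
      "c / 2 * (mu x * (norm ?d)\<^sup>2) = c * (mu x * (norm ?d)\<^sup>2) / 2"
      by simp_all
    ultimately have fin: "k x + c / 2 * (mu x * (norm ?d)\<^sup>2)
        \<le> k x - 2 * B (v x) ?d + mu x * B ?d ?d + 8 * C\<^sup>2 / c * D\<^sup>2 * ((\<rho> x)\<^sup>2 * mom 32 x)"
      by linarith
    have "ennreal (k x) + ennreal (c / 2 * (mu x * (norm ?d)\<^sup>2)) = ennreal (k x + c / 2 * (mu x * (norm ?d)\<^sup>2))"
      using k_nn[of x] mu_pos[of x] B(4) by (intro ennreal_plus[symmetric]) auto
    also have "\<dots> \<le> ennreal (k x - 2 * B (v x) ?d + mu x * B ?d ?d + 8 * C\<^sup>2 / c * D\<^sup>2 * ((\<rho> x)\<^sup>2 * mom 32 x))"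
      using fin by (rule ennreal_leI)
    also have "\<dots> \<le> L \<delta> x + ennreal (8 * C\<^sup>2 / c * D\<^sup>2 * ((\<rho> x)\<^sup>2 * mom 32 x))"
      unfolding Leq
      using mom_nonneg[of 32 x] B(4) by (intro ennreal_add_le_plus) auto
    finally show ?thesis .
  qed
  have "(\<integral>\<^sup>+x. L bayes x \<partial>lborel) + (\<integral>\<^sup>+x. ennreal (c / 2 * (mu x * (norm (\<delta> x - bayes x))\<^sup>2)) \<partial>lborel)
      \<le> (\<integral>\<^sup>+x. L \<delta> x \<partial>lborel) + (\<integral>\<^sup>+x. ennreal (8 * C\<^sup>2 / c * D\<^sup>2 * ((\<rho> x)\<^sup>2 * mom 32 x)) \<partial>lborel)"
    using key by (subst (1 2) nn_integral_add[symmetric]) (auto intro!: nn_integral_mono simp: L_bayes)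
  also have "\<dots> \<le> (\<integral>\<^sup>+x. L bayes x \<partial>lborel) + (\<integral>\<^sup>+x. ennreal (8 * C\<^sup>2 / c * D\<^sup>2 * ((\<rho> x)\<^sup>2 * mom 32 x)) \<partial>lborel)"
    using L_le by (intro add_right_mono)
  finally have 1: "(\<integral>\<^sup>+x. ennreal (c / 2 * (mu x * (norm (\<delta> x - bayes x))\<^sup>2)) \<partial>lborel)
      \<le> (\<integral>\<^sup>+x. ennreal (8 * C\<^sup>2 / c * D\<^sup>2 * ((\<rho> x)\<^sup>2 * mom 32 x)) \<partial>lborel)"
    using fin by (auto simp: ennreal_add_left_cancel_le)
  have "(\<integral>\<^sup>+x. ennreal (mu x * (norm (\<delta> x - bayes x))\<^sup>2) \<partial>lborel)
      = (\<integral>\<^sup>+x. ennreal (2 / c) * ennreal (c / 2 * (mu x * (norm (\<delta> x - bayes x))\<^sup>2)) \<partial>lborel)"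
    using B(4) mu_pos by (simp flip: ennreal_mult add: less_imp_le)
  also have "\<dots> = ennreal (2 / c) * (\<integral>\<^sup>+x. ennreal (c / 2 * (mu x * (norm (\<delta> x - bayes x))\<^sup>2)) \<partial>lborel)"
    by (rule nn_integral_cmult) measurable
  also have "\<dots> \<le> ennreal (2 / c) * (\<integral>\<^sup>+x. ennreal (8 * C\<^sup>2 / c * D\<^sup>2 * ((\<rho> x)\<^sup>2 * mom 32 x)) \<partial>lborel)"
    using 1 by (rule mult_left_mono) simp
  also have "(\<integral>\<^sup>+x. ennreal (8 * C\<^sup>2 / c * D\<^sup>2 * ((\<rho> x)\<^sup>2 * mom 32 x)) \<partial>lborel)
      = ennreal (8 * C\<^sup>2 / c * D\<^sup>2) * (\<integral>\<^sup>+x. ennreal ((\<rho> x)\<^sup>2 * mom 32 x) \<partial>lborel)"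
    using B(4) mom_nonneg by (subst nn_integral_cmult[symmetric]) (auto simp flip: ennreal_mult)
  also have "(\<integral>\<^sup>+x. ennreal ((\<rho> x)\<^sup>2 * mom 32 x) \<partial>lborel)
      \<le> ennreal (D * kmom (8 + 32)) * (\<integral>\<^sup>+\<theta>. ennreal ((\<rho> \<theta>)\<^sup>2) \<partial>\<nu>)"
    using \<rho>(2) D by (intro integral_weighted_mom_le) auto
  also have "ennreal (2 / c) * (ennreal (8 * C\<^sup>2 / c * D\<^sup>2) * (ennreal (D * kmom (8 + 32)) * (\<integral>\<^sup>+\<theta>. ennreal ((\<rho> \<theta>)\<^sup>2) \<partial>\<nu>)))
      = ennreal (16 * C\<^sup>2 / c\<^sup>2 * D ^ 3 * kmom 40) * (\<integral>\<^sup>+\<theta>. ennreal ((\<rho> \<theta>)\<^sup>2) \<partial>\<nu>)"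
  proof -
    have "16 * C\<^sup>2 / c\<^sup>2 * D ^ 3 * kmom 40 = 2 / c * (8 * C\<^sup>2 / c * D\<^sup>2 * (D * kmom (8 + 32)))"
      by (simp add: power2_eq_square power3_eq_cube)
    moreover have "ennreal a * (ennreal b * (ennreal d * I)) = ennreal (a * (b * d)) * I"
      if "0 \<le> a" "0 \<le> b" "0 \<le> d" for a b d I
      using that by (simp add: ennreal_mult mult.assoc)
    ultimately show ?thesis
      using B(4) D kmom_nonneg by simp
  qed
  finally show ?thesis
    by (simp add: mu_def w_def mult_left_mono)
qed

end

section \<open>The weights that make the prior finite\<close>

text \<open>The truncating factor supplies the missing power of decay, so that the weight is at most
  \<open>N * y powr (-1 - t)\<close> and integrable against the prior; it tends to 1 as
  \<open>N\<close> grows.\<close>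

definition taper :: "real \<Rightarrow> real \<Rightarrow> real \<Rightarrow> real" where
  "taper t N y = y powr (- t) * (N / (N + y))"

text \<open>Minus the derivative of \<open>ln (taper t N y)\<close> with respect to
  \<open>ln y\<close>. The summand \<open>y / (N + y)\<close> stays below 1 and vanishes pointwise
  as \<open>N\<close> grows, leaving the small constant \<open>t\<close>.\<close>

definition taper_slope :: "real \<Rightarrow> real \<Rightarrow> real \<Rightarrow> real" where
  "taper_slope t N y = t + y / (N + y)"

lemma taper_pos: "0 < y \<Longrightarrow> 0 < N \<Longrightarrow> 0 < taper t N y"
  by (simp add: taper_def)

lemma taper_slope_pos: "0 < t \<Longrightarrow> 0 < y \<Longrightarrow> 0 < N \<Longrightarrow> 0 < taper_slope t N y"
  by (simp add: taper_slope_def add_pos_pos)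

text \<open>The taper is decreasing, so a one-sided comparison of the arguments suffices. Each of
  its two factors costs at most \<open>c\<close>; for the power this uses
  \<open>t \<le> 1\<close>.\<close>

lemma taper_ratio:
  assumes "0 < y" "0 < z" "0 < N" "0 < t" "t \<le> 1" "1 \<le> c" "y \<le> c * z"
  shows "taper t N z \<le> c\<^sup>2 * taper t N y"
proof -
  have "z powr (- t) \<le> c * y powr (- t)"
  proof -
    have "y powr t \<le> (c * z) powr t" using assms by (intro powr_mono2) auto
    also have "\<dots> = c powr t * z powr t" using assms by (simp add: powr_mult)
    also have "c powr t \<le> c powr 1" using assms by (intro powr_mono) auto
    finally have "y powr t \<le> c * z powr t" using assms by (simp add: mult_right_mono)
    then show ?thesis using assms by (simp add: powr_minus field_simps)
  qed
  moreover have "N / (N + z) \<le> c * (N / (N + y))"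
  proof -
    have "N \<le> c * N" using mult_right_mono[of 1 c N] assms by simp
    then have "N + y \<le> c * (N + z)" using assms(7) unfolding distrib_left by linarith
    then have "N * (N + y) \<le> N * (c * (N + z))" using assms by (intro mult_left_mono) auto
    then show ?thesis using assms by (simp add: field_simps)
  qed
  ultimately have "z powr (- t) * (N / (N + z)) \<le> (c * y powr (- t)) * (c * (N / (N + y)))"
    using assms by (intro mult_mono) auto
  then show ?thesis by (simp add: taper_def power2_eq_square mult_ac)
qed

lemma taper_slope_ratio:
  assumes "0 < y" "0 < z" "0 < N" "0 < t" "1 \<le> c" "y \<le> c * z"
  shows "taper_slope t N y \<le> c * taper_slope t N z"
proof -
  have "t \<le> c * t" using assms by simp
  moreover have "y / (N + y) \<le> c * (z / (N + z))"
  proof -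
    have "y * N \<le> c * z * N" using assms by (intro mult_right_mono) auto
    moreover have "y * z \<le> c * z * y" using assms by simp
    ultimately have "y * (N + z) \<le> c * z * (N + y)" by (simp add: algebra_simps)
    then show ?thesis using assms by (simp add: divide_simps mult_ac add_pos_pos)
  qed
  ultimately show ?thesis by (simp add: taper_slope_def distrib_left)
qed

lemma taper_deriv:
  assumes "0 < y" "0 < N"
  shows "(taper t N has_real_derivative - (taper t N y / y * taper_slope t N y)) (at y)"
proof -
  have "((\<lambda>y. y powr (- t) * (N / (N + y))) has_real_derivative
      (- t) * y powr (- t - 1) * (N / (N + y)) + y powr (- t) * (- N / (N + y)\<^sup>2)) (at y)"
  proof -
    have 1: "((\<lambda>y. N / (N + y)) has_real_derivative - N / (N + y)\<^sup>2) (at y)"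
      using assms by (auto intro!: derivative_eq_intros simp: power2_eq_square)
    have 2: "((\<lambda>y. y powr (- t)) has_real_derivative (- t) * y powr (- t - 1)) (at y)"
      using assms by (rule_tac has_real_derivative_powr)
    show ?thesis
      using DERIV_mult'[OF 2 1] by (simp add: add.commute)
  qed
  moreover have "(- t) * y powr (- t - 1) * (N / (N + y)) + y powr (- t) * (- N / (N + y)\<^sup>2)
      = - (taper t N y / y * taper_slope t N y)"
  proof -
    have pd: "y powr (- t - 1) = y powr (- t) / y"
      using assms by (simp add: powr_diff)
    have ne: "N + y \<noteq> 0" using assms by simp
    have "(- t) * (p / y) * (N / (N + y)) + p * (- N / (N + y)\<^sup>2) = - (p * (N / (N + y)) / y * (t + y / (N + y)))" for p
      using ne assms by (simp add: divide_simps power2_eq_square) (simp add: algebra_simps)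
    then show ?thesis
      unfolding pd taper_def taper_slope_def .
  qed
  ultimately show ?thesis
    by (simp add: taper_def[abs_def])
qed

text \<open>Mean value theorem. The intermediate point \<open>w\<close> stays within a factor
  \<open>c\<close> of \<open>y\<close>, so the derivative there is comparable to the one at
  \<open>y\<close>: two factors \<open>c\<close> come from the taper, one from \<open>1 / w\<close>
  and one from the slope.\<close>

lemma taper_diff_le:
  assumes "0 < y" "0 < z" "0 < N" "0 < t" "t \<le> 1" "1 \<le> c" "y \<le> c * z" "z \<le> c * y"
  shows "\<bar>taper t N z - taper t N y\<bar> \<le> \<bar>z - y\<bar> * (c ^ 4 * (taper t N y / y * taper_slope t N y))"
proof -
  have bound: "taper t N w / w * taper_slope t N w \<le> c ^ 4 * (taper t N y / y * taper_slope t N y)"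
    if w: "0 < w" "y \<le> c * w" "w \<le> c * y" for w
  proof -
    have "taper t N w \<le> c\<^sup>2 * taper t N y"
      using assms w by (intro taper_ratio) auto
    moreover have "1 / w \<le> c / y"
      using assms w by (simp add: field_simps)
    moreover have "taper_slope t N w \<le> c * taper_slope t N y"
      using assms w by (intro taper_slope_ratio) auto
    ultimately have "taper t N w * (1 / w) * taper_slope t N w
        \<le> (c\<^sup>2 * taper t N y) * (c / y) * (c * taper_slope t N y)"
      using assms w by (intro mult_mono mult_nonneg_nonneg less_imp_le[OF taper_pos] less_imp_le[OF taper_slope_pos]) auto
    then show ?thesis by (simp add: power2_eq_square power4_eq_xxxx mult_ac)
  qed
  have "\<exists>w. 0 < w \<and> y \<le> c * w \<and> w \<le> c * y \<and>
      \<bar>taper t N z - taper t N y\<bar> = \<bar>z - y\<bar> * (taper t N w / w * taper_slope t N w)" if ne: "y \<noteq> z"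
  proof -
    have c1: "x \<le> c * x'" if "x \<le> x'" "0 < x'" for x x'
    proof -
      have "x' \<le> c * x'" using that assms mult_right_mono[of 1 c x'] by simp
      then show ?thesis using that by linarith
    qed
    have abs: "\<bar>d * - (taper t N w / w * taper_slope t N w)\<bar> = \<bar>d\<bar> * (taper t N w / w * taper_slope t N w)"
      if "0 < w" for d w
      using that assms taper_pos[of w N t] taper_slope_pos[of t w N] by (simp add: abs_mult)
    consider "y < z" | "z < y" using ne by linarith
    then show ?thesis
    proof cases
      case 1
      then obtain w where w: "y < w" "w < z" "taper t N z - taper t N y = (z - y) * - (taper t N w / w * taper_slope t N w)"
        using MVT2[of y z "taper t N" "\<lambda>w. - (taper t N w / w * taper_slope t N w)"] taper_deriv assms by fastforce
      have "0 < w" using w assms by linarith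
      then have "\<bar>taper t N z - taper t N y\<bar> = \<bar>z - y\<bar> * (taper t N w / w * taper_slope t N w)"
        unfolding w(3) by (rule abs)
      then show ?thesis
        using w(1,2) assms c1[of y w] \<open>0 < w\<close> by (intro exI[of _ w]) linarith
    next
      case 2
      then obtain w where w: "z < w" "w < y" "taper t N y - taper t N z = (y - z) * - (taper t N w / w * taper_slope t N w)"
        using MVT2[of z y "taper t N" "\<lambda>w. - (taper t N w / w * taper_slope t N w)"] taper_deriv assms by fastforce
      have "0 < w" using w assms by linarith
      then have "\<bar>taper t N z - taper t N y\<bar> = \<bar>z - y\<bar> * (taper t N w / w * taper_slope t N w)"
        unfolding abs_minus_commute[of _ "taper t N y"] abs_minus_commute[of z] w(3) by (rule abs)
      moreover have "c * z \<le> c * w" using w assms by (intro mult_left_mono) auto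
      ultimately show ?thesis
        using w(1,2) assms c1[of w y] \<open>0 < w\<close> by (intro exI[of _ w]) linarith
    qed
  qed
  then obtain w where "y \<noteq> z \<Longrightarrow> 0 < w \<and> y \<le> c * w \<and> w \<le> c * y \<and>
      \<bar>taper t N z - taper t N y\<bar> = \<bar>z - y\<bar> * (taper t N w / w * taper_slope t N w)"
    by blast
  then show ?thesis
    using mult_left_mono[OF bound[of w], of "\<bar>z - y\<bar>"] by (cases "y = z") auto
qed

text \<open>The increment grows only like \<open>sqrt (qq x)\<close>. Together with the factor
  \<open>1 / qq x\<close> in the derivative of the taper this makes the squared relative oscillation
  of order \<open>1 / qq x\<close>.\<close>

lemma qq_diff_le: "\<bar>qq \<theta> - qq x\<bar> \<le> 2 * qq (\<theta> - x) * sqrt (qq x)"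
proof -
  let ?r = "norm (\<theta> - x)"
  have n: "norm x \<le> sqrt (qq x)" by (rule real_le_rsqrt) (simp add: qq_def)
  have o: "1 \<le> sqrt (qq x)" using qq_ge_1[of x] by simp
  have "\<bar>qq \<theta> - qq x\<bar> = \<bar>norm \<theta> - norm x\<bar> * (norm \<theta> + norm x)"
    by (simp add: qq_def power2_eq_square square_diff_square_factored abs_mult)
  also have "\<dots> \<le> ?r * (2 * norm x + ?r)"
    using norm_triangle_ineq3[of \<theta> x] norm_triangle_ineq[of x "\<theta> - x"] by (intro mult_mono) auto
  also have "\<dots> \<le> ?r * (2 * sqrt (qq x) + ?r * sqrt (qq x))"
    using n mult_left_mono[OF o, of ?r] by (intro mult_left_mono add_mono) auto
  also have "\<dots> = (2 * ?r + ?r\<^sup>2) * sqrt (qq x)"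
    by (simp add: algebra_simps power2_eq_square)
  also have "\<dots> \<le> (2 * qq (\<theta> - x)) * sqrt (qq x)"
    using sum_squares_bound[of 1 ?r] by (intro mult_right_mono) (auto simp: qq_def qq_nonneg)
  finally show ?thesis .
qed

section \<open>Uniqueness of the Bayes rule among rules of no larger risk\<close>

context translation_bayes
begin

text \<open>A lower bound of the Blyth integral that does not depend on \<open>t\<close> and
  \<open>N\<close> is squeezed to 0. The order of the limits matters: \<open>growth\<close> fixes
  \<open>t\<close> first, and only then does dominated convergence in \<open>N\<close> remove the
  truncation term.\<close>

theorem bayes_unique:
  fixes B :: "'a \<Rightarrow> 'a \<Rightarrow> real" and \<delta> :: "'a \<Rightarrow> 'a"
  assumes B: "bounded_bilinear B" "\<And>v w. B v w = B w v" "\<And>v. c * (norm v)\<^sup>2 \<le> B v v" "0 < c"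
    and \<delta> [measurable]: "\<delta> \<in> borel_measurable borel"
    and risk: "\<And>\<theta>. (\<integral>\<^sup>+x. ennreal (B (\<theta> - \<delta> x) (\<theta> - \<delta> x) * K (x - \<theta>)) \<partial>lborel)
        \<le> (\<integral>\<^sup>+x. ennreal (B (\<theta> - bayes x) (\<theta> - bayes x) * K (x - \<theta>)) \<partial>lborel)"
    and growth: "\<And>e. 0 < e \<Longrightarrow> \<exists>t. 0 < t \<and> t \<le> 1 \<and>
        ennreal (t\<^sup>2) * (\<integral>\<^sup>+\<theta>. ennreal (qq \<theta> powr (-1 - t)) \<partial>\<nu>) \<le> ennreal e"
  shows "AE x in lborel. \<delta> x = bayes x"
proof -
  obtain C where C: "0 \<le> C" "\<And>v w. \<bar>B v w\<bar> \<le> C * norm v * norm w"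
    using bounded_bilinear.nonneg_bounded[OF B(1)] by (auto simp: mult_ac)
  \<comment> \<open>The weight is the taper for \<open>t = 1\<close> and \<open>N = 1\<close>. It
    lies below every taper with \<open>t \<le> 1 \<le> N\<close>, so that \<open>I\<close> is the
    same for all of them.\<close>
  define m0 where "m0 x = (\<integral>\<theta>. inverse (qq \<theta>) * inverse (1 + qq \<theta>) * K (x - \<theta>) \<partial>\<nu>)" for x
  have inv1: "inverse (qq \<theta>) * inverse (1 + qq \<theta>) \<le> 1" for \<theta> :: 'a
    using qq_ge_1[of \<theta>] by (simp add: mult_le_one inverse_le_1_iff)
  have nn: "0 \<le> inverse (qq \<theta>) * inverse (1 + qq \<theta>) * K z" for \<theta> z :: 'a
    by (intro mult_nonneg_nonneg) (auto simp: K_nonneg qq_nonneg add_nonneg_nonneg)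
  have int0: "integrable \<nu> (\<lambda>\<theta>. inverse (qq \<theta>) * inverse (1 + qq \<theta>) * K (x - \<theta>))" for x
    by (rule integrable_dominated[of _ 1 x 0])
      (use mult_right_mono[OF inv1 K_nonneg] in \<open>auto simp: abs_of_nonneg[OF nn]\<close>)
  have m0_pos: "0 < m0 x" for x
    unfolding m0_def using int0 K_pos qq_pos
    by (intro weighted_integral_pos) (auto intro!: mult_pos_pos add_pos_pos)
  have [measurable]: "m0 \<in> borel_measurable borel"
    unfolding m0_def[abs_def] by measurable
  define I where "I = (\<integral>\<^sup>+x. ennreal (m0 x * (norm (\<delta> x - bayes x))\<^sup>2) \<partial>lborel)"
  \<comment> \<open>64 and the exponent 8 are common bounds for the three comparisons below, which
    produce \<open>4 * ?P ^ 2\<close> for the weight, \<open>64 * ?P ^ 6\<close> for its oscillation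
    and \<open>32 * ?P ^ 5\<close> for \<open>?\<rho>\<close> squared.\<close>
  define A where "A = 16 * C\<^sup>2 / c\<^sup>2 * 64 ^ 3 * kmom 40"
  have A: "0 \<le> A" using kmom_nonneg by (simp add: A_def)
  have est: "I \<le> ennreal A * (\<integral>\<^sup>+\<theta>. ennreal (taper t N (qq \<theta>) / qq \<theta> * (taper_slope t N (qq \<theta>))\<^sup>2) \<partial>\<nu>)"
    if t: "0 < t" "t \<le> 1" and N: "1 \<le> N" for t N
  proof -
    let ?u = "\<lambda>\<theta>::'a. taper t N (qq \<theta>)"
    let ?\<rho> = "\<lambda>\<theta>::'a. sqrt (taper t N (qq \<theta>) / qq \<theta>) * taper_slope t N (qq \<theta>)"
    have [measurable]: "?u \<in> borel_measurable borel" "?\<rho> \<in> borel_measurable borel"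
      unfolding taper_def taper_slope_def by measurable
    have up: "0 < ?u \<theta>" and sp: "0 < taper_slope t N (qq \<theta>)" for \<theta>
      using t N qq_pos by (auto intro!: taper_pos taper_slope_pos)
    have P1: "1 \<le> 2 * qq z" for z :: 'a using qq_ge_1[of z] by simp
    have pe: "qq \<theta> \<le> 2 * qq (\<theta> - x) * qq x" "qq x \<le> 2 * qq (\<theta> - x) * qq \<theta>" for x \<theta> :: 'a
      using qq_peetre[of \<theta> x] qq_peetre[of x \<theta>] by (auto simp: mult_ac qq_minus_commute[of x])
    have ur: "?u x \<le> (2 * qq (\<theta> - x))\<^sup>2 * ?u \<theta>" for x \<theta>
      using t N qq_pos pe P1 by (intro taper_ratio) auto
    have pw: "a * qq z ^ i \<le> 64 * qq z ^ 8" if "0 \<le> a" "a \<le> 64" "i \<le> 8" for a i and z :: 'a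
      using that qq_ge_1[of z] by (intro mult_mono power_increasing) (auto simp: qq_nonneg)
    have \<rho>sq: "(?\<rho> \<theta>)\<^sup>2 = ?u \<theta> / qq \<theta> * (taper_slope t N (qq \<theta>))\<^sup>2" for \<theta>
      using up[of \<theta>] qq_pos[of \<theta>] by (simp add: power_mult_distrib)
    have "(\<integral>\<^sup>+x. ennreal ((\<integral>\<theta>. ?u \<theta> * K (x - \<theta>) \<partial>\<nu>) * (norm (\<delta> x - bayes x))\<^sup>2) \<partial>lborel)
      \<le> ennreal (16 * C\<^sup>2 / c\<^sup>2 * 64 ^ 3 * kmom 40) * (\<integral>\<^sup>+\<theta>. ennreal ((?\<rho> \<theta>)\<^sup>2) \<partial>\<nu>)"
    proof (rule blyth_estimate[where B=B])
      show "bounded_bilinear B" "\<And>v w. B v w = B w v" "\<And>v. c * (norm v)\<^sup>2 \<le> B v v" "0 < c"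
        "\<And>v w. \<bar>B v w\<bar> \<le> C * norm v * norm w" "0 \<le> C" by fact+
      show "0 < ?u \<theta>" for \<theta> by (rule up)
      show "?u x \<le> 64 * qq (\<theta> - x) ^ 8 * ?u \<theta>" for x \<theta>
        using pw[of 4 2 "\<theta> - x"] up[of \<theta>]
        by (intro order_trans[OF ur[of x \<theta>]] mult_right_mono) (auto simp: power_mult_distrib)
      show "(\<integral>\<^sup>+\<theta>. ennreal (?u \<theta>) \<partial>\<nu>) < \<infinity>"
      proof -
        have "?u \<theta> \<le> N * qq \<theta> powr (-1 - t)" for \<theta> :: 'a
        proof -
          have "N / (N + qq \<theta>) \<le> N * qq \<theta> powr (- 1)"
            using N qq_pos[of \<theta>] by (simp add: powr_minus field_simps)
          then have "?u \<theta> \<le> qq \<theta> powr (- t) * (N * qq \<theta> powr (- 1))"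
            unfolding taper_def by (intro mult_left_mono) auto
          also have "\<dots> = N * qq \<theta> powr (-1 - t)"
          proof -
            have "-1 - t = - t + - 1" by simp
            then show ?thesis by (simp only: powr_add mult_ac)
          qed
          finally show ?thesis .
        qed
        then have "(\<integral>\<^sup>+\<theta>. ennreal (?u \<theta>) \<partial>\<nu>) \<le> (\<integral>\<^sup>+\<theta>. ennreal N * ennreal (qq \<theta> powr (-1 - t)) \<partial>\<nu>)"
          using N by (intro nn_integral_mono) (simp flip: ennreal_mult add: ennreal_leI)
        also have "\<dots> = ennreal N * (\<integral>\<^sup>+\<theta>. ennreal (qq \<theta> powr (-1 - t)) \<partial>\<nu>)"
          by (rule nn_integral_cmult) measurable
        also have "\<dots> < \<infinity>"
          using prior_growth[OF t(1)] by (simp add: ennreal_mult_less_top)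
        finally show ?thesis .
      qed
      show "\<bar>?u \<theta> - ?u x\<bar> \<le> 64 * qq (\<theta> - x) ^ 8 * sqrt (?u \<theta>) * ?\<rho> x" for x \<theta>
      proof -
        let ?P = "qq (\<theta> - x)"
        have "\<bar>?u \<theta> - ?u x\<bar> \<le> \<bar>qq \<theta> - qq x\<bar> * ((2 * ?P) ^ 4 * (?u x / qq x * taper_slope t N (qq x)))"
          using t N qq_pos pe P1 by (intro taper_diff_le) auto
        also have "\<dots> \<le> (2 * ?P * sqrt (qq x)) * ((2 * ?P) ^ 4 * (?u x / qq x * taper_slope t N (qq x)))"
          using up[of x] sp[of x] qq_pos[of x] qq_pos[of "\<theta> - x"]
          by (intro mult_right_mono qq_diff_le) auto
        also have "\<dots> = 32 * ?P ^ 5 * (sqrt (qq x) * (?u x / qq x)) * taper_slope t N (qq x)"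
          by (simp add: power_mult_distrib mult_ac power_numeral_reduce)
        also have "sqrt (qq x) * (?u x / qq x) = sqrt (?u x) * sqrt (?u x / qq x)"
        proof -
          have "sqrt (?u x) * sqrt (?u x / qq x) = ?u x / sqrt (qq x)"
            using up[of x] by (simp add: real_sqrt_divide)
          moreover have "sqrt (qq x) * (?u x / qq x) = ?u x / sqrt (qq x)"
            using qq_pos[of x] by (simp add: field_simps)
          ultimately show ?thesis by simp
        qed
        also have "32 * ?P ^ 5 * (sqrt (?u x) * sqrt (?u x / qq x)) * taper_slope t N (qq x)
            = 32 * ?P ^ 5 * sqrt (?u x) * ?\<rho> x"
          by simp
        also have "\<dots> \<le> 32 * ?P ^ 5 * (2 * ?P * sqrt (?u \<theta>)) * ?\<rho> x"
        proof -
          have "sqrt (?u x) \<le> sqrt ((2 * ?P)\<^sup>2 * ?u \<theta>)"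
            using ur by (rule real_sqrt_le_mono)
          also have "\<dots> = 2 * ?P * sqrt (?u \<theta>)"
            using qq_pos[of "\<theta> - x"] by (simp add: real_sqrt_mult)
          finally show ?thesis
            using sp[of x] up[of x] qq_pos[of x] qq_nonneg[of "\<theta> - x"]
            by (intro mult_right_mono mult_left_mono) auto
        qed
        also have "\<dots> = 64 * ?P ^ 6 * (sqrt (?u \<theta>) * ?\<rho> x)"
          by (simp add: mult_ac power_numeral_reduce)
        also have "\<dots> \<le> 64 * ?P ^ 8 * (sqrt (?u \<theta>) * ?\<rho> x)"
          using pw[of 64 6 "\<theta> - x"] sp[of x] up[of x] up[of \<theta>] qq_pos[of x]
          by (intro mult_right_mono) auto
        finally show ?thesis by (simp add: mult_ac)
      qed
      show "0 \<le> ?\<rho> x" for x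
        using sp[of x] up[of x] qq_pos[of x] by simp
      show "(?\<rho> x)\<^sup>2 \<le> 64 * qq (\<theta> - x) ^ 8 * (?\<rho> \<theta>)\<^sup>2" for x \<theta>
      proof -
        let ?P = "qq (\<theta> - x)"
        have "taper_slope t N (qq x) \<le> 2 * ?P * taper_slope t N (qq \<theta>)"
          using t N qq_pos pe P1 by (intro taper_slope_ratio) auto
        then have "(taper_slope t N (qq x))\<^sup>2 \<le> (2 * ?P * taper_slope t N (qq \<theta>))\<^sup>2"
          using sp[of x] by (intro power_mono) auto
        moreover have "1 / qq x \<le> 2 * ?P / qq \<theta>"
          using pe(1)[of \<theta> x] qq_pos[of x] qq_pos[of \<theta>] by (simp add: field_simps)
        ultimately have "?u x * (1 / qq x) * (taper_slope t N (qq x))\<^sup>2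
            \<le> ((2 * ?P)\<^sup>2 * ?u \<theta>) * (2 * ?P / qq \<theta>) * (2 * ?P * taper_slope t N (qq \<theta>))\<^sup>2"
          using ur[of x \<theta>] up[of x] up[of \<theta>] qq_pos[of x] qq_pos[of \<theta>] qq_nonneg[of "\<theta> - x"]
          by (intro mult_mono) auto
        also have "\<dots> = 32 * ?P ^ 5 * (?\<rho> \<theta>)\<^sup>2"
          unfolding \<rho>sq by (simp add: power_mult_distrib mult_ac power_numeral_reduce)
        also have "\<dots> \<le> 64 * ?P ^ 8 * (?\<rho> \<theta>)\<^sup>2"
          using pw[of 32 5 "\<theta> - x"] by (intro mult_right_mono) auto
        finally show ?thesis unfolding \<rho>sq by simp
      qed
    qed (use risk in auto)
    moreover have "I \<le> (\<integral>\<^sup>+x. ennreal ((\<integral>\<theta>. ?u \<theta> * K (x - \<theta>) \<partial>\<nu>) * (norm (\<delta> x - bayes x))\<^sup>2) \<partial>lborel)"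
      unfolding I_def
    proof (intro nn_integral_mono ennreal_leI mult_right_mono)
      fix x
      have "?u \<theta> \<le> 1" for \<theta>
      proof -
        have "qq \<theta> powr (- t) \<le> 1" using t qq_ge_1[of \<theta>] by (simp add: powr_le_one_le powr_le1 powr_minus ge_one_powr_ge_zero inverse_le_1_iff)
        moreover have "N / (N + qq \<theta>) \<le> 1" using N qq_pos[of \<theta>] by simp
        ultimately show ?thesis
          unfolding taper_def using N qq_pos[of \<theta>] by (intro mult_le_one) auto
      qed
      then have "integrable \<nu> (\<lambda>\<theta>. ?u \<theta> * K (x - \<theta>))"
        using up by (intro integrable_dominated[of _ 1 x 0])
          (auto simp: K_nonneg abs_mult less_imp_le intro!: mult_left_le_one_le)
      moreover have "inverse (qq \<theta>) * inverse (1 + qq \<theta>) \<le> ?u \<theta>" for \<theta> :: 'a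
      proof -
        have "qq \<theta> powr (- 1) \<le> qq \<theta> powr (- t)" using t qq_ge_1[of \<theta>] by (intro powr_mono) auto
        then have "inverse (qq \<theta>) \<le> qq \<theta> powr (- t)" using qq_pos[of \<theta>] by (simp add: powr_minus)
        moreover have "inverse (1 + qq \<theta>) \<le> N / (N + qq \<theta>)"
          using N qq_pos[of \<theta>] by (simp add: field_simps add_pos_pos)
        ultimately show ?thesis
          unfolding taper_def using qq_pos[of \<theta>] by (intro mult_mono) auto
      qed
      ultimately show "m0 x \<le> (\<integral>\<theta>. ?u \<theta> * K (x - \<theta>) \<partial>\<nu>)"
        unfolding m0_def using int0 by (intro integral_mono mult_right_mono) (auto simp: K_nonneg)
    qed simp
    ultimately show ?thesis
      unfolding \<rho>sq A_def by (rule order_trans[rotated])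
  qed
  have "I \<le> ennreal A * (4 * ennreal e)" if e: "0 < e" for e
  proof -
    obtain t where t: "0 < t" "t \<le> 1" and te: "ennreal (t\<^sup>2) * (\<integral>\<^sup>+\<theta>. ennreal (qq \<theta> powr (-1 - t)) \<partial>\<nu>) \<le> ennreal e"
      using growth[OF e] by blast
    have "(\<lambda>n. \<integral>\<^sup>+\<theta>. ennreal (qq \<theta> powr (-1 - t) * (qq \<theta> / (real (Suc n) + qq \<theta>))\<^sup>2) \<partial>\<nu>) \<longlonglongrightarrow> (\<integral>\<^sup>+(\<theta>::'a). 0 \<partial>\<nu>)"
    proof (rule nn_integral_dominated_convergence[where w="\<lambda>\<theta>. ennreal (qq \<theta> powr (-1 - t))"])
      show "AE \<theta> in \<nu>. (\<lambda>n. ennreal (qq \<theta> powr (-1 - t) * (qq \<theta> / (real (Suc n) + qq \<theta>))\<^sup>2)) \<longlonglongrightarrow> 0"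
      proof (rule AE_I2)
        fix \<theta> :: 'a
        have "(\<lambda>n. qq \<theta> / (real (Suc n) + qq \<theta>)) \<longlonglongrightarrow> 0"
          by real_asymp
        then have "(\<lambda>n. qq \<theta> powr (-1 - t) * (qq \<theta> / (real (Suc n) + qq \<theta>))\<^sup>2) \<longlonglongrightarrow> qq \<theta> powr (-1 - t) * 0\<^sup>2"
          by (intro tendsto_intros)
        then show "(\<lambda>n. ennreal (qq \<theta> powr (-1 - t) * (qq \<theta> / (real (Suc n) + qq \<theta>))\<^sup>2)) \<longlonglongrightarrow> 0"
          using tendsto_ennrealI by fastforce
      qed
      show "AE \<theta> in \<nu>. ennreal (qq \<theta> powr (-1 - t) * (qq \<theta> / (real (Suc n) + qq \<theta>))\<^sup>2) \<le> ennreal (qq \<theta> powr (-1 - t))" for n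
      proof (intro AE_I2 ennreal_leI mult_left_le)
        fix \<theta> :: 'a
        show "(qq \<theta> / (real (Suc n) + qq \<theta>))\<^sup>2 \<le> 1"
          using qq_pos[of \<theta>] by (intro power_le_one) (auto simp: divide_simps)
      qed simp
      show "(\<integral>\<^sup>+\<theta>. ennreal (qq \<theta> powr (-1 - t)) \<partial>\<nu>) < \<infinity>"
        using prior_growth[OF t(1)] .
    qed measurable
    then have "\<forall>\<^sub>F n in sequentially. (\<integral>\<^sup>+\<theta>. ennreal (qq \<theta> powr (-1 - t) * (qq \<theta> / (real (Suc n) + qq \<theta>))\<^sup>2) \<partial>\<nu>) < ennreal e"
      using e by (intro order_tendstoD(2)) auto
    then obtain n where n: "(\<integral>\<^sup>+\<theta>. ennreal (qq \<theta> powr (-1 - t) * (qq \<theta> / (real (Suc n) + qq \<theta>))\<^sup>2) \<partial>\<nu>) \<le> ennreal e"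
      by (auto simp: eventually_sequentially intro: less_imp_le)
    let ?N = "real (Suc n)"
    have le: "taper t ?N (qq \<theta>) / qq \<theta> * (taper_slope t ?N (qq \<theta>))\<^sup>2
        \<le> 2 * t\<^sup>2 * qq \<theta> powr (-1 - t) + 2 * (qq \<theta> powr (-1 - t) * (qq \<theta> / (?N + qq \<theta>))\<^sup>2)" for \<theta> :: 'a
    proof -
      have "?N / (?N + qq \<theta>) \<le> 1" using qq_pos[of \<theta>] by simp
      then have "taper t ?N (qq \<theta>) \<le> qq \<theta> powr (- t)"
        unfolding taper_def by (intro mult_left_le) auto
      then have "taper t ?N (qq \<theta>) / qq \<theta> \<le> qq \<theta> powr (- t) / qq \<theta>"
        using qq_pos[of \<theta>] by (simp add: divide_right_mono)
      also have "\<dots> = qq \<theta> powr (-1 - t)"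
        using qq_pos[of \<theta>] by (simp add: powr_diff powr_minus divide_simps)
      finally have 1: "taper t ?N (qq \<theta>) / qq \<theta> \<le> qq \<theta> powr (-1 - t)" .
      have "(taper_slope t ?N (qq \<theta>))\<^sup>2 \<le> 2 * t\<^sup>2 + 2 * (qq \<theta> / (?N + qq \<theta>))\<^sup>2"
      proof -
        have "(a + b)\<^sup>2 \<le> 2 * a\<^sup>2 + 2 * b\<^sup>2" for a b :: real
          using sum_squares_bound[of a b] by (simp add: power2_sum)
        then show ?thesis unfolding taper_slope_def .
      qed
      with 1 have "taper t ?N (qq \<theta>) / qq \<theta> * (taper_slope t ?N (qq \<theta>))\<^sup>2
          \<le> qq \<theta> powr (-1 - t) * (2 * t\<^sup>2 + 2 * (qq \<theta> / (?N + qq \<theta>))\<^sup>2)"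
        by (intro mult_mono) auto
      then show ?thesis by (simp only: distrib_left mult_ac)
    qed
    have "(\<integral>\<^sup>+\<theta>. ennreal (taper t ?N (qq \<theta>) / qq \<theta> * (taper_slope t ?N (qq \<theta>))\<^sup>2) \<partial>\<nu>)
        \<le> (\<integral>\<^sup>+\<theta>. 2 * (ennreal (t\<^sup>2) * ennreal (qq \<theta> powr (-1 - t))) + 2 * ennreal (qq \<theta> powr (-1 - t) * (qq \<theta> / (?N + qq \<theta>))\<^sup>2) \<partial>\<nu>)"
    proof (intro nn_integral_mono)
      fix \<theta> :: 'a
      have "ennreal (2 * t\<^sup>2 * qq \<theta> powr (-1 - t) + 2 * (qq \<theta> powr (-1 - t) * (qq \<theta> / (?N + qq \<theta>))\<^sup>2))
          = 2 * (ennreal (t\<^sup>2) * ennreal (qq \<theta> powr (-1 - t))) + 2 * ennreal (qq \<theta> powr (-1 - t) * (qq \<theta> / (?N + qq \<theta>))\<^sup>2)"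
        by (subst ennreal_plus) (auto simp: ennreal_mult mult.assoc)
      then show "ennreal (taper t ?N (qq \<theta>) / qq \<theta> * (taper_slope t ?N (qq \<theta>))\<^sup>2)
         \<le> 2 * (ennreal (t\<^sup>2) * ennreal (qq \<theta> powr (-1 - t))) + 2 * ennreal (qq \<theta> powr (-1 - t) * (qq \<theta> / (?N + qq \<theta>))\<^sup>2)"
        using ennreal_leI[OF le[of \<theta>]] by simp
    qed
    also have "\<dots> = 2 * (ennreal (t\<^sup>2) * (\<integral>\<^sup>+\<theta>. ennreal (qq \<theta> powr (-1 - t)) \<partial>\<nu>))
        + 2 * (\<integral>\<^sup>+\<theta>. ennreal (qq \<theta> powr (-1 - t) * (qq \<theta> / (?N + qq \<theta>))\<^sup>2) \<partial>\<nu>)"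
      by (subst nn_integral_add) (auto simp: nn_integral_cmult)
    also have "\<dots> \<le> 2 * ennreal e + 2 * ennreal e"
      using te n by (intro add_mono mult_left_mono) auto
    also have "\<dots> = 4 * ennreal e"
      by (simp flip: distrib_right)
    finally have "ennreal A * (\<integral>\<^sup>+\<theta>. ennreal (taper t ?N (qq \<theta>) / qq \<theta> * (taper_slope t ?N (qq \<theta>))\<^sup>2) \<partial>\<nu>)
        \<le> ennreal A * (4 * ennreal e)"
      by (intro mult_left_mono) auto
    then show ?thesis
      using est[OF t, of ?N] by (auto intro: order_trans)
  qed
  moreover have "ennreal A * (4 * ennreal e) = ennreal (4 * A * e)" if "0 < e" for e
    using that A by (simp add: ennreal_mult mult_ac)
  ultimately have I0: "I \<le> ennreal (4 * A * e)" if "0 < e" for e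
    using that by metis
  have "I \<le> 0"
  proof (rule ennreal_le_epsilon)
    fix e :: real assume "0 < e"
    then have "I \<le> ennreal (4 * A * (e / (4 * A + 1)))"
      using A by (intro I0) auto
    also have "\<dots> \<le> ennreal e"
      using \<open>0 < e\<close> A by (intro ennreal_leI) (simp add: field_simps)
    finally show "I \<le> 0 + ennreal e" by simp
  qed
  then have "AE x in lborel. ennreal (m0 x * (norm (\<delta> x - bayes x))\<^sup>2) = 0"
    unfolding I_def by (subst nn_integral_0_iff_AE[symmetric]) auto
  then show ?thesis
  proof eventually_elim
    case (elim x)
    then show ?case
      using m0_pos[of x] by (auto simp: ennreal_eq_0_iff mult_le_0_iff)
  qed
qed

end

section \<open>The spectral theorem and the Cayley transform\<close>

lemma matrix_mult_add_left: "(A + B) ** (C :: real^'p^'n) = A ** C + B ** C"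
  by (simp add: matrix_matrix_mult_def vec_eq_iff sum.distrib distrib_right)

lemma matrix_mult_diff_left: "(A - B) ** (C :: real^'p^'n) = A ** C - B ** C"
  by (simp add: matrix_matrix_mult_def vec_eq_iff sum_subtractf left_diff_distrib)

lemma matrix_mult_diff_right: "(C :: real^'n^'m) ** (A - B) = C ** A - C ** B"
  by (simp add: matrix_matrix_mult_def vec_eq_iff sum_subtractf right_diff_distrib)

lemma matrix_mult_minus_left: "(- A) ** (C :: real^'p^'n) = - (A ** C)"
  by (simp add: matrix_matrix_mult_def vec_eq_iff sum_negf)

lemma matrix_mult_minus_right: "(C :: real^'n^'m) ** (- A) = - (C ** A)"
  by (simp add: matrix_matrix_mult_def vec_eq_iff sum_negf)

lemma matrix_mult_scaleR_left: "(c *\<^sub>R A) ** (B :: real^'p^'n) = c *\<^sub>R (A ** B)"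
  by (simp add: scalar_matrix_assoc)

lemma matrix_mult_scaleR_right: "(A :: real^'n^'m) ** (c *\<^sub>R B) = c *\<^sub>R (A ** B)"
  by (simp add: matrix_scalar_ac scalar_matrix_assoc)

lemmas matrix_mult_algebra = matrix_mult_add_left matrix_add_ldistrib matrix_mult_diff_left
  matrix_mult_diff_right matrix_mult_minus_left matrix_mult_minus_right
  matrix_mult_scaleR_left matrix_mult_scaleR_right

lemma transpose_add: "transpose (A + B) = transpose A + transpose (B :: real^'n^'m)"
  by (simp add: transpose_def vec_eq_iff)

lemma transpose_diff: "transpose (A - B) = transpose A - transpose (B :: real^'n^'m)"
  by (simp add: transpose_def vec_eq_iff)

lemma transpose_minus: "transpose (- A) = - transpose (A :: real^'n^'m)"
  by (simp add: transpose_def vec_eq_iff)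

lemma transpose_scaleR: "transpose (c *\<^sub>R A) = c *\<^sub>R transpose (A :: real^'n^'m)"
  by (simp add: transpose_def vec_eq_iff)

lemma transpose_diag [simp]: "transpose (diag d) = diag d"
  by (simp add: transpose_def diag_def vec_eq_iff)

lemma bounded_bilinear_matrix_mult: "bounded_bilinear (\<lambda>(A::real^'n^'m) (B::real^'p^'n). A ** B)"
proof -
  have "bilinear (\<lambda>(A::real^'n^'m) (B::real^'p^'n). A ** B)"
    by (auto simp: bilinear_def linear_iff matrix_mult_algebra)
  then show ?thesis by (simp add: bilinear_conv_bounded_bilinear)
qed

lemma bounded_linear_transpose: "bounded_linear (transpose :: real^'n^'m \<Rightarrow> real^'m^'n)"
  by (intro linear_conv_bounded_linear[THEN iffD1] linearI) (simp_all add: transpose_add transpose_scaleR)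

lemma norm_matrix_vector_mult_le: "norm (A *v x) \<le> norm A * norm (x :: real^'n)" for A :: "real^'n^'m"
proof -
  have "(norm (A *v x))\<^sup>2 = (\<Sum>i\<in>UNIV. ((A $ i) \<bullet> x)\<^sup>2)"
    by (simp add: norm_vec_def L2_set_def sum_nonneg matrix_vector_mul_component)
  also have "\<dots> \<le> (\<Sum>i\<in>UNIV. (norm (A $ i) * norm x)\<^sup>2)"
  proof (rule sum_mono)
    fix i
    show "(A $ i \<bullet> x)\<^sup>2 \<le> (norm (A $ i) * norm x)\<^sup>2"
      using power_mono[OF Cauchy_Schwarz_ineq2[of "A $ i" x], of 2] by simp
  qed
  also have "\<dots> = (norm A * norm x)\<^sup>2"
    by (simp add: power_mult_distrib norm_vec_def[of A] L2_set_def sum_nonneg sum_distrib_right)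
  finally show ?thesis by (rule power2_le_imp_le) simp
qed

lemma norm_orthogonal_mult:
  assumes "orthogonal_matrix (H :: real^'n^'n)"
  shows "norm (H *v x) = norm x"
  using assms orthogonal_transformation_matrix[of "(*v) H"] orthogonal_transformation_norm by auto

lemma orthogonal_matrix_entry_le:
  assumes "orthogonal_matrix (H :: real^'n^'n)"
  shows "\<bar>H $ i $ j\<bar> \<le> 1"
proof -
  have "norm (row i H) = 1"
    using assms by (simp add: orthogonal_matrix_orthonormal_rows)
  then show ?thesis
    using component_le_norm_cart[of "row i H" j] by (simp add: row_def)
qed

lemma orthogonal_matrix_inverse:
  assumes "orthogonal_matrix (H :: real^'n^'n)"
  shows "transpose H ** H = mat 1" "H ** transpose H = mat 1"
  using assms by (auto simp: orthogonal_matrix_def)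

text \<open>Serves twice: it provides the maximiser behind the spectral theorem and the finite cover
  by Cayley charts.\<close>

lemma compact_orthogonal_matrices: "compact {H :: real^'n^'n. orthogonal_matrix H}"
proof -
  have "closed {H :: real^'n^'n. transpose H ** H = mat 1}"
    by (intro closed_Collect_eq bounded_bilinear.continuous_on[OF bounded_bilinear_matrix_mult]
        bounded_linear.continuous_on[OF bounded_linear_transpose] continuous_intros)
  moreover have "bounded {H :: real^'n^'n. transpose H ** H = mat 1}"
  proof (rule boundedI)
    fix H :: "real^'n^'n" assume "H \<in> {H. transpose H ** H = mat 1}"
    then have H: "orthogonal_matrix H" by (simp add: orthogonal_matrix)
    have "norm H \<le> (\<Sum>i\<in>UNIV. norm (H $ i))"
      by (simp add: norm_vec_def[of H] L2_set_le_sum)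
    also have "\<dots> = (\<Sum>i\<in>(UNIV::'n set). 1)"
      using H by (intro sum.cong) (auto simp: orthogonal_matrix_orthonormal_rows row_def)
    finally show "norm H \<le> real CARD('n)" by simp
  qed
  ultimately show ?thesis
    by (simp add: compact_eq_bounded_closed orthogonal_matrix)
qed

text \<open>A Givens rotation acting from the left, written on rows so that the quadratic forms of
  the other rows are visibly unchanged.\<close>

definition rotate_rows :: "'n \<Rightarrow> 'n \<Rightarrow> real \<Rightarrow> real \<Rightarrow> real^'n^'n \<Rightarrow> real^'n^'n" where
  "rotate_rows i j c s H = (\<chi> l. if l = i then c *\<^sub>R H $ i + s *\<^sub>R H $ j
     else if l = j then c *\<^sub>R H $ j - s *\<^sub>R H $ i else H $ l)"

lemma orthogonal_matrix_iff_rows: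
  "orthogonal_matrix (H :: real^'n^'n) \<longleftrightarrow> (\<forall>i j. H $ i \<bullet> H $ j = (if i = j then 1 else 0))"
  by (auto simp: orthogonal_matrix_orthonormal_rows row_def norm_eq_1 orthogonal_def)

lemma orthogonal_rotate_rows:
  assumes "orthogonal_matrix (H :: real^'n^'n)" "i \<noteq> j" "c\<^sup>2 + s\<^sup>2 = 1"
  shows "orthogonal_matrix (rotate_rows i j c s H)"
proof -
  have r: "H $ a \<bullet> H $ b = (if a = b then 1 else 0)" for a b
    using assms(1) by (simp add: orthogonal_matrix_iff_rows)
  have cs: "c * c + s * s = 1" "s * s + c * c = 1" using assms(3) by (auto simp: power2_eq_square)
  show ?thesis
    using assms(2) by (auto simp: orthogonal_matrix_iff_rows rotate_rows_def inner_add_left inner_add_right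
        inner_diff_left inner_diff_right r cs)
qed

text \<open>
  The diagonalising matrix maximises \<open>\<Sum> w\<^sub>i (H V H\<^sup>t)\<^sub>i\<^sub>i\<close> for strictly decreasing weights \<open>w\<close>: small
  rotations of two rows show that \<open>H V H\<^sup>t\<close> is diagonal, and a quarter turn that it is sorted.
\<close>

lemma spectral_theorem:
  fixes V :: "real^'k::{finite,linorder}^'k::_"
  assumes sym: "transpose V = V"
  obtains H d where "orthogonal_matrix H" "V = transpose H ** diag d ** H" "\<And>i j. i < j \<Longrightarrow> d $ j \<le> d $ i"
proof -
  \<comment> \<open>The number of larger indices: strictly decreasing in \<open>i\<close>, and
    available from the order alone.\<close>
  define wt where "wt i = real (card {j. i < j})" for i :: 'k
  have wt: "wt j < wt i" if "i < j" for i j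
    unfolding wt_def using that by (auto intro!: psubset_card_mono)
  define f where "f H = (\<Sum>i\<in>UNIV. wt i * (H $ i \<bullet> (V *v H $ i)))" for H :: "real^'k::_^'k::_"
  have Vc: "continuous_on S (\<lambda>H. V *v (H $ i))" for S :: "(real^'k::_^'k::_) set" and i
    by (intro bounded_linear.continuous_on[OF matrix_vector_mul_bounded_linear] continuous_intros)
  have "continuous_on S f" for S
    unfolding f_def by (intro continuous_intros Vc)
  moreover have "{H :: real^'k::_^'k::_. orthogonal_matrix H} \<noteq> {}"
    using orthogonal_matrix_id by blast
  ultimately obtain H where H: "orthogonal_matrix H" and max: "\<And>G. orthogonal_matrix G \<Longrightarrow> f G \<le> f H"
    using continuous_attains_sup[OF compact_orthogonal_matrices] by (metis mem_Collect_eq)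
  define W where "W i j = H $ i \<bullet> (V *v H $ j)" for i j
  have Wsym: "W i j = W j i" for i j
  proof -
    have "W i j = (transpose V *v H $ i) \<bullet> H $ j"
      unfolding W_def by (metis dot_lmul_matrix transpose_matrix_vector vector_transpose_matrix)
    then show ?thesis by (simp add: sym W_def inner_commute)
  qed
  \<comment> \<open>Optimality against the rotation by \<open>(c, s)\<close>. The contributions of
    the other rows cancel, and the positive factor \<open>wt i - wt j\<close> is divided
    out.\<close>
  have key: "2 * W i j * (c * s) \<le> (W i i - W j j) * s\<^sup>2" if ij: "i < j" and cs: "c\<^sup>2 + s\<^sup>2 = 1" for i j c s
  proof -
    let ?G = "rotate_rows i j c s H"
    have ne: "i \<noteq> j" using ij by simp
    have Gi: "?G $ i = c *\<^sub>R H $ i + s *\<^sub>R H $ j" and Gj: "?G $ j = c *\<^sub>R H $ j - s *\<^sub>R H $ i"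
      and Gl: "l \<noteq> i \<Longrightarrow> l \<noteq> j \<Longrightarrow> ?G $ l = H $ l" for l
      using ne by (auto simp: rotate_rows_def)
    have qi: "?G $ i \<bullet> (V *v ?G $ i) = c\<^sup>2 * W i i + 2 * (c * s) * W i j + s\<^sup>2 * W j j"
      unfolding Gi using Wsym[of j i]
      by (simp add: matrix_vector_right_distrib matrix_vector_mult_scaleR inner_add_left inner_add_right
          W_def algebra_simps power2_eq_square)
    have qj: "?G $ j \<bullet> (V *v ?G $ j) = c\<^sup>2 * W j j - 2 * (c * s) * W i j + s\<^sup>2 * W i i"
      unfolding Gj using Wsym[of j i]
      by (simp add: matrix_vector_mult_diff_distrib matrix_vector_mult_scaleR inner_diff_left inner_diff_right
          W_def algebra_simps power2_eq_square)
    have split: "f G = wt i * (G $ i \<bullet> (V *v G $ i)) + wt j * (G $ j \<bullet> (V *v G $ j))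
        + (\<Sum>l\<in>UNIV - {i, j}. wt l * (G $ l \<bullet> (V *v G $ l)))" for G
      unfolding f_def using ne by (subst sum.subset_diff[of "{i, j}"]) auto
    have "f ?G \<le> f H"
      using H ne cs by (intro max orthogonal_rotate_rows)
    moreover have "(\<Sum>l\<in>UNIV - {i, j}. wt l * (?G $ l \<bullet> (V *v ?G $ l))) = (\<Sum>l\<in>UNIV - {i, j}. wt l * (H $ l \<bullet> (V *v H $ l)))"
      by (intro sum.cong) (auto simp: Gl)
    ultimately have "wt i * (c\<^sup>2 * W i i + 2 * (c * s) * W i j + s\<^sup>2 * W j j)
        + wt j * (c\<^sup>2 * W j j - 2 * (c * s) * W i j + s\<^sup>2 * W i i) \<le> wt i * W i i + wt j * W j j"
      unfolding split[of ?G] split[of H] qi qj by (simp add: W_def)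
    moreover have "c\<^sup>2 = 1 - s\<^sup>2" using cs by simp
    ultimately have "wt i * ((1 - s\<^sup>2) * W i i + 2 * (c * s) * W i j + s\<^sup>2 * W j j)
        + wt j * ((1 - s\<^sup>2) * W j j - 2 * (c * s) * W i j + s\<^sup>2 * W i i) \<le> wt i * W i i + wt j * W j j"
      by simp
    then have "(wt i - wt j) * (2 * (c * s) * W i j - s\<^sup>2 * (W i i - W j j)) \<le> 0"
      by (simp add: algebra_simps)
    then show ?thesis
      using wt[OF ij] by (simp add: mult_le_0_iff mult_ac)
  qed
  have sorted: "W j j \<le> W i i" if "i < j" for i j
    using key[OF that, of 0 1] by simp
  have off: "W i j = 0" if "i < j" for i j
  proof (rule ccontr)
    assume a: "W i j \<noteq> 0"
    define b where "b = W i i - W j j"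
    \<comment> \<open>The rotation whose tangent is \<open>x\<close>. The left side is linear in
      \<open>x\<close> and the right side quadratic, so a small multiple
      \<open>x = e * W i j\<close> refutes \<open>W i j \<noteq> 0\<close>.\<close>
    have tan: "2 * W i j * x \<le> b * x\<^sup>2" for x
    proof -
      have p: "0 < 1 + x\<^sup>2" by (simp add: add_pos_nonneg)
      have "(1 / sqrt (1 + x\<^sup>2))\<^sup>2 + (x / sqrt (1 + x\<^sup>2))\<^sup>2 = 1"
        using p by (simp add: power_divide field_simps)
      from key[OF that this]
      have "2 * W i j * (x / (1 + x\<^sup>2)) \<le> b * (x\<^sup>2 / (1 + x\<^sup>2))"
        using p by (simp add: power_divide b_def)
      then show ?thesis using p by (simp add: divide_le_cancel)
    qed
    define e where "e = 1 / (\<bar>b\<bar> + 1)"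
    have e: "0 < e" by (simp add: e_def)
    have "2 * W i j * (e * W i j) \<le> b * (e * W i j)\<^sup>2"
      by (rule tan)
    then have "(2 * e) * (W i j)\<^sup>2 \<le> (b * e\<^sup>2) * (W i j)\<^sup>2"
      by (simp add: power2_eq_square mult_ac)
    then have "2 * e \<le> b * e\<^sup>2" using a by (simp add: mult_le_cancel_right)
    then have "2 \<le> b * e" using e by (simp add: power2_eq_square)
    moreover have "b * e < 1" by (simp add: e_def field_simps)
    ultimately show False by simp
  qed
  define d where "d = (\<chi> i. W i i)"
  have "(H ** V ** transpose H) $ i $ j = W i j" for i j
  proof -
    have "(H ** V ** transpose H) $ i $ j = H $ i \<bullet> column j (V ** transpose H)"
      unfolding matrix_mul_assoc[symmetric] by (simp add: matrix_matrix_mult_def inner_vec_def column_def)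
    also have "column j (V ** transpose H) = V *v H $ j"
      by (simp add: column_def matrix_matrix_mult_def matrix_vector_mult_def transpose_def vec_eq_iff)
    finally show ?thesis by (simp add: W_def)
  qed
  moreover have "W i j = diag d $ i $ j" for i j
    using off[of i j] off[of j i] Wsym[of i j] by (cases "i < j"; cases "j < i") (auto simp: diag_def d_def)
  ultimately have "H ** V ** transpose H = diag d"
    by (simp add: vec_eq_iff)
  then have "transpose H ** diag d ** H = (transpose H ** H) ** V ** (transpose H ** H)"
    by (metis matrix_mul_assoc)
  then have "V = transpose H ** diag d ** H"
    by (simp add: orthogonal_matrix_inverse[OF H])
  moreover have "d $ j \<le> d $ i" if "i < j" for i j
    using sorted[OF that] by (simp add: d_def)
  ultimately show ?thesis using that H by blast
qed

lemma inner_conjugate_diag: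
  fixes H :: "real^'k^'k"
  shows "x \<bullet> ((transpose H ** diag d ** H) *v x) = (\<Sum>i\<in>UNIV. d $ i * ((H *v x) $ i)\<^sup>2)"
proof -
  have "x \<bullet> ((transpose H ** diag d ** H) *v x) = (H *v x) \<bullet> (diag d *v (H *v x))"
    by (simp add: dot_lmul_matrix transpose_matrix_vector flip: matrix_vector_mul_assoc inner_commute[of "H *v x"])
      (metis dot_lmul_matrix inner_commute transpose_matrix_vector)
  also have "\<dots> = (\<Sum>i\<in>UNIV. d $ i * ((H *v x) $ i)\<^sup>2)"
    by (simp add: inner_vec_def diag_def matrix_vector_mult_def if_distrib[of "\<lambda>x. x * _"] power2_eq_square
        mult_ac cong: if_cong)
  finally show ?thesis .
qed

lemma transpose_conjugate_diag: "transpose (transpose H ** diag d ** H) = transpose H ** diag d ** (H :: real^'k^'k)"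
  by (simp add: matrix_transpose_mul matrix_mul_assoc)

lemma pos_def_conjugate_diag_iff:
  fixes H :: "real^'k^'k"
  assumes H: "orthogonal_matrix H"
  shows "pos_def (transpose H ** diag d ** H) \<longleftrightarrow> (\<forall>i. 0 < d $ i)"
proof
  assume pd: "pos_def (transpose H ** diag d ** H)"
  show "\<forall>i. 0 < d $ i"
  proof
    fix i
    let ?x = "transpose H *v axis i 1"
    have Hx: "H *v ?x = axis i 1"
      unfolding matrix_vector_mul_assoc orthogonal_matrix_inverse[OF H] by simp
    then have "?x \<noteq> 0"
      by (metis axis_eq_0_iff matrix_vector_mult_0_right zero_neq_one)
    then have "0 < (\<Sum>l\<in>UNIV. d $ l * ((H *v ?x) $ l)\<^sup>2)"
      using pd by (simp add: pos_def_def inner_conjugate_diag)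
    also have "\<dots> = d $ i"
      unfolding Hx by (simp add: axis_def if_distrib[of "\<lambda>x. x\<^sup>2"] if_distrib[of "\<lambda>x. _ * x"] cong: if_cong)
    finally show "0 < d $ i" .
  qed
next
  assume d: "\<forall>i. 0 < d $ i"
  have "0 < (\<Sum>i\<in>UNIV. d $ i * ((H *v x) $ i)\<^sup>2)" if "x \<noteq> 0" for x
  proof -
    have "H *v x \<noteq> 0"
      using norm_orthogonal_mult[OF H, of x] that by auto
    then obtain i where "(H *v x) $ i \<noteq> 0" by (auto simp: vec_eq_iff)
    then show ?thesis
      using d by (intro sum_pos2[of _ i]) (auto simp: less_imp_le)
  qed
  then show "pos_def (transpose H ** diag d ** H)"
    by (simp add: pos_def_def transpose_conjugate_diag inner_conjugate_diag)
qed

lemma pos_def_spectral: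
  fixes V :: "real^'k::{finite,linorder}^'k::_"
  assumes "pos_def V"
  obtains H d where "orthogonal_matrix H" "V = transpose H ** diag d ** H"
    "\<And>i j. i < j \<Longrightarrow> d $ j \<le> d $ i" "\<And>i. 0 < d $ i"
  using assms spectral_theorem[of V] pos_def_conjugate_diag_iff by (metis pos_def_def)

text \<open>Leibniz expansion. It is applied to Jacobians, where any bound in terms of the dimension
  and the size of the entries will do.\<close>

lemma abs_det_le:
  fixes M :: "real^'n^'n"
  assumes "\<And>i j. \<bar>M $ i $ j\<bar> \<le> B"
  shows "\<bar>det M\<bar> \<le> fact CARD('n) * B ^ CARD('n)"
proof -
  have "\<bar>det M\<bar> \<le> (\<Sum>p\<in>{p. p permutes UNIV}. \<bar>of_int (sign p) * (\<Prod>i\<in>UNIV. M $ i $ p i)\<bar>)"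
    unfolding det_def by (rule sum_abs)
  also have "\<dots> \<le> (\<Sum>p\<in>{p. p permutes (UNIV :: 'n set)}. B ^ CARD('n))"
  proof (rule sum_mono)
    fix p :: "'n \<Rightarrow> 'n"
    have "\<bar>of_int (sign p) * (\<Prod>i\<in>UNIV. M $ i $ p i)\<bar> = (\<Prod>i\<in>UNIV. \<bar>M $ i $ p i\<bar>)"
      by (simp add: abs_mult abs_prod sign_def)
    also have "\<dots> \<le> (\<Prod>i\<in>(UNIV :: 'n set). B)"
      using assms by (intro prod_mono) auto
    finally show "\<bar>of_int (sign p) * (\<Prod>i\<in>UNIV. M $ i $ p i)\<bar> \<le> B ^ CARD('n)" by simp
  qed
  also have "\<dots> = fact CARD('n) * B ^ CARD('n)"
    by (simp add: card_permutations)
  finally show ?thesis .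
qed

section \<open>The Cayley transform\<close>

definition resolvent :: "real^'n^'n \<Rightarrow> real^'n^'n" where
  "resolvent S = matrix_inv (mat 1 + S)"

text \<open>For skew \<open>S\<close> this is \<open>(1 - S) (1 + S)^(-1)\<close>. Written as twice
  the resolvent minus the identity, its derivative is read off from that of the resolvent.\<close>

definition cayley :: "real^'n^'n \<Rightarrow> real^'n^'n" where
  "cayley S = resolvent S + resolvent S - mat 1"

context
  fixes S :: "real^'n^'n"
  assumes skew: "transpose S = - S"
begin

lemma skew_inner: "x \<bullet> (S *v x) = 0"
proof -
  have "x \<bullet> (S *v x) = (transpose S *v x) \<bullet> x"
    by (metis dot_lmul_matrix transpose_matrix_vector vector_transpose_matrix)
  also have "\<dots> = - (x \<bullet> (S *v x))"
    by (simp add: skew inner_commute matrix_vector_mult_def sum_negf inner_vec_def)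
  finally show ?thesis by simp
qed

text \<open>The quadratic form of a skew matrix vanishes, so \<open>1 + S\<close> does not shrink
  norms. Hence it is invertible for every skew \<open>S\<close>, and its inverse is a contraction
  with entries at most 1.\<close>

lemma norm_le_one_plus_skew: "norm x \<le> norm ((mat 1 + S) *v x)"
proof -
  have "norm x * norm x = x \<bullet> ((mat 1 + S) *v x)"
    by (simp add: matrix_vector_mult_add_rdistrib inner_add_right skew_inner dot_square_norm power2_eq_square)
  also have "\<dots> \<le> norm x * norm ((mat 1 + S) *v x)"
    by (rule norm_cauchy_schwarz)
  finally show ?thesis
    by (cases "x = 0") auto
qed

lemma resolvent_inverse: "(mat 1 + S) ** resolvent S = mat 1" "resolvent S ** (mat 1 + S) = mat 1"
proof -
  have "inj ((*v) (mat 1 + S))"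
  proof (rule injI)
    fix x y assume "(mat 1 + S) *v x = (mat 1 + S) *v y"
    then have "(mat 1 + S) *v (x - y) = 0" by (simp add: matrix_vector_mult_diff_distrib)
    then show "x = y" using norm_le_one_plus_skew[of "x - y"] by simp
  qed
  then obtain B where B: "B ** (mat 1 + S) = mat 1"
    using matrix_left_invertible_injective by blast
  then have ex: "\<exists>A'. (mat 1 + S) ** A' = mat 1 \<and> A' ** (mat 1 + S) = mat 1"
    using matrix_left_right_inverse by blast
  show "(mat 1 + S) ** resolvent S = mat 1" "resolvent S ** (mat 1 + S) = mat 1"
    using someI_ex[OF ex] by (auto simp: resolvent_def matrix_inv_def)
qed

lemma resolvent_entry_le: "\<bar>resolvent S $ i $ j\<bar> \<le> 1"
proof -
  have "norm (resolvent S *v x) \<le> norm x" for x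
    using norm_le_one_plus_skew[of "resolvent S *v x"] by (simp add: matrix_vector_mul_assoc resolvent_inverse)
  from this[of "axis j 1"] have "norm (column j (resolvent S)) \<le> 1"
    by (simp add: matrix_vector_mul_component column_def vec_eq_iff matrix_vector_mult_basis)
  then show ?thesis
    using component_le_norm_cart[of "column j (resolvent S)" i] by (simp add: column_def)
qed

lemma transpose_resolvent: "transpose (resolvent S) ** (mat 1 - S) = mat 1" "(mat 1 - S) ** transpose (resolvent S) = mat 1"
  using arg_cong[OF resolvent_inverse(1), of transpose] arg_cong[OF resolvent_inverse(2), of transpose]
  by (simp_all add: matrix_transpose_mul transpose_add skew)

lemma cayley_mult: "cayley S ** (mat 1 + S) = mat 1 - S" "transpose (cayley S) = (mat 1 + S) ** transpose (resolvent S)"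
  "transpose (cayley S) ** (mat 1 - S) = mat 1 + S"
proof -
  have 2: "mat 1 + S = mat 1 + mat 1 - (mat 1 - S)"
    by simp
  show "cayley S ** (mat 1 + S) = mat 1 - S"
    unfolding cayley_def matrix_mult_diff_left matrix_mult_add_left resolvent_inverse by simp
  show "transpose (cayley S) = (mat 1 + S) ** transpose (resolvent S)"
    unfolding 2 matrix_mult_diff_left[of "mat 1 + mat 1"] transpose_resolvent matrix_mult_add_left
    by (simp only: cayley_def transpose_diff transpose_add transpose_mat matrix_mul_lid)
  show "transpose (cayley S) ** (mat 1 - S) = mat 1 + S"
    unfolding cayley_def transpose_diff transpose_add matrix_mult_diff_left[of _ "transpose (mat 1)"]
      matrix_mult_add_left transpose_resolvent by simp
qed

lemma orthogonal_cayley: "orthogonal_matrix (cayley S)"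
proof -
  have "cayley S ** transpose (cayley S) = cayley S ** (mat 1 + S) ** transpose (resolvent S)"
    by (simp add: cayley_mult(2) matrix_mul_assoc)
  then have "cayley S ** transpose (cayley S) = mat 1"
    by (simp add: cayley_mult(1) transpose_resolvent)
  then have "orthogonal_matrix (transpose (cayley S))"
    by (simp add: orthogonal_matrix)
  then show ?thesis by simp
qed

text \<open>The derivative of the transform has a resolvent on either side; multiplying it by the
  transposed transform turns the right one into its transpose, and the result is the skew matrix
  \<open>log_deriv\<close>.\<close>

lemma resolvent_transpose_cayley: "resolvent S ** transpose (cayley S) = transpose (resolvent S)"
  by (simp add: cayley_mult(2) matrix_mul_assoc resolvent_inverse)

end

text \<open>The inverse transform is \<open>S = 2 (1 + G)^(-1) - 1\<close>. Closeness of
  \<open>G\<close> to the identity keeps -1 away from the spectrum quantitatively: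
  \<open>1 + G\<close> does not shrink norms, so the entries of its inverse are at most 1 and those
  of \<open>S\<close> at most \<open>2 + 1 = 3\<close>.\<close>

lemma cayley_onto:
  fixes G :: "real^'n^'n"
  assumes G: "orthogonal_matrix G" and near: "\<And>x. norm ((G - mat 1) *v x) \<le> norm x / 2"
  obtains S where "transpose S = - S" "cayley S = G" "\<And>i j. \<bar>S $ i $ j\<bar> \<le> 3"
proof -
  have lower: "norm x \<le> norm ((mat 1 + G) *v x)" for x
  proof -
    have "2 *\<^sub>R x = (mat 1 + G) *v x - (G - mat 1) *v x"
      by (simp add: matrix_vector_mult_add_rdistrib matrix_vector_mult_diff_rdistrib scaleR_2)
    then have "2 * norm x \<le> norm ((mat 1 + G) *v x) + norm ((G - mat 1) *v x)"
      by (metis norm_scaleR norm_triangle_ineq4 abs_numeral)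
    then show ?thesis using near[of x] norm_ge_zero[of x] by linarith
  qed
  have "inj ((*v) (mat 1 + G))"
  proof (rule injI)
    fix x y assume "(mat 1 + G) *v x = (mat 1 + G) *v y"
    then have "(mat 1 + G) *v (x - y) = 0" by (simp add: matrix_vector_mult_diff_distrib)
    then show "x = y" using lower[of "x - y"] by simp
  qed
  then obtain B where B: "B ** (mat 1 + G) = mat 1"
    using matrix_left_invertible_injective by blast
  then have B': "(mat 1 + G) ** B = mat 1"
    using matrix_left_right_inverse by blast
  define S where "S = B + B - mat 1"
  \<comment> \<open>From \<open>1 + G^t = G^t (1 + G)\<close> the inverse of the left side is
    \<open>B G\<close>. This is where orthogonality of \<open>G\<close> makes \<open>S\<close>
    skew.\<close>
  have tB: "transpose B = B ** G"
  proof -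
    have "transpose B ** transpose (mat 1 + G) = mat 1"
      using arg_cong[OF B', of transpose] by (simp add: matrix_transpose_mul)
    moreover have "transpose (mat 1 + G) ** (B ** G) = mat 1"
    proof -
      have "transpose (mat 1 + G) = transpose G ** (mat 1 + G)"
        by (simp add: transpose_add matrix_add_ldistrib orthogonal_matrix_inverse[OF G] add.commute)
      then have "transpose (mat 1 + G) ** (B ** G) = transpose G ** ((mat 1 + G) ** B) ** G"
        by (simp add: matrix_mul_assoc)
      then show ?thesis by (simp add: B' orthogonal_matrix_inverse[OF G])
    qed
    ultimately show ?thesis
      by (metis matrix_mul_assoc matrix_mul_lid matrix_mul_rid)
  qed
  have "transpose S + S = B ** (mat 1 + G) + B ** (mat 1 + G) - mat 1 - mat 1"
    unfolding S_def transpose_diff transpose_add tB matrix_add_ldistrib by simp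
  then have skew: "transpose S = - S"
    by (simp add: B eq_neg_iff_add_eq_0)
  have "cayley S = G"
  proof -
    have e: "mat 1 + S = B + B" by (simp add: S_def)
    have "resolvent S + resolvent S = ((mat 1 + G) ** (B + B)) ** resolvent S"
      unfolding matrix_add_ldistrib B' matrix_mult_add_left[of "mat 1" "mat 1"] by (simp only: matrix_mul_lid)
    also have "\<dots> = mat 1 + G"
      using resolvent_inverse(1)[OF skew] by (simp add: e flip: matrix_mul_assoc)
    finally show ?thesis by (simp add: cayley_def)
  qed
  moreover have "\<bar>S $ i $ j\<bar> \<le> 3" for i j
  proof -
    have "norm (B *v axis j 1) \<le> 1"
      using lower[of "B *v axis j 1"] by (simp add: matrix_vector_mul_assoc B')
    then have "norm (column j B) \<le> 1"
      by (simp add: matrix_vector_mult_basis)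
    then have "\<bar>B $ i $ j\<bar> \<le> 1"
      using component_le_norm_cart[of "column j B" i] by (simp add: column_def)
    then show ?thesis by (auto simp: S_def mat_def abs_le_iff)
  qed
  ultimately show ?thesis using that skew by blast
qed

section \<open>Coordinates on symmetric and skew-symmetric matrices\<close>

lemma prod_Basis_vec: "(\<Prod>b\<in>(Basis :: ('a::euclidean_space^'n) set). f b) = (\<Prod>i\<in>UNIV. \<Prod>b\<in>Basis. f (axis i b))"
proof -
  have 1: "(Basis :: ('a^'n) set) = (\<lambda>(i, b). axis i b) ` (UNIV \<times> Basis)"
    by (auto simp: Basis_vec_def)
  have 2: "inj_on (\<lambda>(i, b). axis i b) ((UNIV :: 'n set) \<times> (Basis :: 'a set))"
    by (auto simp: inj_on_def axis_eq_axis nonzero_Basis)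
  show ?thesis
    unfolding 1 prod.reindex[OF 2] by (simp add: prod.cartesian_product case_prod_beta o_def)
qed

lemma measurable_vec_lambda_component:
  "(\<lambda>v. \<chi> i. v (\<sigma> i)) \<in> (\<Pi>\<^sub>M p\<in>I. (borel :: 'a::euclidean_space measure)) \<rightarrow>\<^sub>M (borel :: ('a^'n) measure)"
  if "\<And>i. \<sigma> i \<in> I"
proof -
  have "(\<lambda>v. \<Sum>i\<in>UNIV. axis i (v (\<sigma> i))) \<in> (\<Pi>\<^sub>M p\<in>I. (borel :: 'a measure)) \<rightarrow>\<^sub>M (borel :: ('a^'n) measure)"
  proof (rule borel_measurable_sum)
    fix i :: 'n
    have "continuous_on UNIV (\<lambda>x::'a. if l = i then x else 0)" for l
      by (cases "l = i") auto
    then have "(axis i :: 'a \<Rightarrow> 'a^'n) \<in> borel_measurable borel"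
      unfolding axis_def by (intro borel_measurable_continuous_onI continuous_on_vec_lambda)
    moreover have "(\<lambda>v. v (\<sigma> i)) \<in> (\<Pi>\<^sub>M p\<in>I. (borel :: 'a measure)) \<rightarrow>\<^sub>M borel"
      using that by (rule measurable_component_singleton)
    ultimately show "(\<lambda>v. axis i (v (\<sigma> i)) :: 'a^'n) \<in> borel_measurable (\<Pi>\<^sub>M p\<in>I. borel)"
      by (rule measurable_compose[rotated])
  qed
  moreover have "(\<Sum>i\<in>UNIV. axis i (v (\<sigma> i))) = ((\<chi> i. v (\<sigma> i)) :: 'a^'n)" for v
    by (simp add: vec_eq_iff axis_def)
  ultimately show ?thesis by simp
qed

text \<open>The bijection \<open>\<sigma>\<close> admits any index set for the coordinates, in
  particular the pairs \<open>i \<le> j\<close> over which \<open>sym_lborel\<close> is a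
  product.\<close>

lemma lborel_vec:
  fixes \<sigma> :: "'n::finite \<Rightarrow> 'i"
  assumes \<sigma>: "bij_betw \<sigma> UNIV I"
  shows "distr (\<Pi>\<^sub>M p\<in>I. lborel) borel (\<lambda>v. \<chi> i. v (\<sigma> i)) = (lborel :: ('a::euclidean_space^'n) measure)"
proof (rule lborel_eqI[symmetric])
  interpret product_sigma_finite "\<lambda>_::'i. lborel :: 'a measure"
    by (simp add: product_sigma_finite_def lborel.sigma_finite_measure_axioms)
  have fin: "finite I" using bij_betw_finite[OF \<sigma>] by simp
  have \<sigma>I: "\<sigma> i \<in> I" for i using \<sigma> by (auto simp: bij_betw_def)
  define \<tau> where "\<tau> = inv_into UNIV \<sigma>"
  have \<tau>: "\<tau> (\<sigma> i) = i" "p \<in> I \<Longrightarrow> \<sigma> (\<tau> p) = p" for i p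
    using \<sigma> by (auto simp: \<tau>_def bij_betw_def f_inv_into_f)
  have [measurable]: "(\<lambda>v. \<chi> i. v (\<sigma> i)) \<in> (\<Pi>\<^sub>M p\<in>I. (lborel :: 'a measure)) \<rightarrow>\<^sub>M (borel :: ('a^'n) measure)"
    using measurable_vec_lambda_component[of \<sigma> I] \<sigma>I by (simp cong: measurable_cong_sets sets_PiM_cong)
  fix l u :: "'a^'n" assume le: "\<And>b. b \<in> Basis \<Longrightarrow> l \<bullet> b \<le> u \<bullet> b"
  have lei: "l $ i \<bullet> b \<le> u $ i \<bullet> b" if "b \<in> Basis" for i b
    using le[of "axis i b"] that by (simp add: inner_axis)
  have mem: "x \<in> box l u \<longleftrightarrow> (\<forall>i. x $ i \<in> box (l $ i) (u $ i))" for x :: "'a^'n"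
    by (auto simp: mem_box Basis_vec_def inner_axis)
  have "(\<lambda>v. \<chi> i. v (\<sigma> i)) -` box l u \<inter> space (\<Pi>\<^sub>M p\<in>I. (lborel :: 'a measure)) = (\<Pi>\<^sub>E p\<in>I. box (l $ \<tau> p) (u $ \<tau> p))"
    using \<tau> \<sigma>I by (auto simp: mem space_PiM PiE_def Pi_def) metis+
  then have "emeasure (distr (\<Pi>\<^sub>M p\<in>I. lborel) borel (\<lambda>v. \<chi> i. v (\<sigma> i))) (box l u)
      = (\<Prod>p\<in>I. emeasure lborel (box (l $ \<tau> p) (u $ \<tau> p)))"
    using fin by (simp add: emeasure_distr emeasure_PiM)
  also have "\<dots> = (\<Prod>i\<in>UNIV. emeasure lborel (box (l $ i) (u $ i)))"
    using prod.reindex_bij_betw[OF \<sigma>, of "\<lambda>p. emeasure lborel (box (l $ \<tau> p) (u $ \<tau> p))"] by (simp add: \<tau>)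
  also have "\<dots> = (\<Prod>i\<in>UNIV. ennreal (\<Prod>b\<in>Basis. (u $ i - l $ i) \<bullet> b))"
    using lei by (simp add: emeasure_lborel_box)
  also have "\<dots> = ennreal (\<Prod>b\<in>Basis. (u - l) \<bullet> b)"
    using lei by (subst prod_ennreal) (auto simp: prod_Basis_vec inner_axis inner_diff_left intro!: prod_nonneg)
  finally show "emeasure (distr (\<Pi>\<^sub>M p\<in>I. lborel) borel (\<lambda>v. \<chi> i. v (\<sigma> i))) (box l u) = ennreal (\<Prod>b\<in>Basis. (u - l) \<bullet> b)" .
qed simp

lemma nn_integral_lborel_vec_prod:
  fixes f :: "'n::finite \<Rightarrow> 'a::euclidean_space \<Rightarrow> ennreal"
  assumes [measurable]: "\<And>i. f i \<in> borel_measurable borel"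
  shows "(\<integral>\<^sup>+x. (\<Prod>i\<in>UNIV. f i (x $ i)) \<partial>(lborel :: ('a^'n) measure)) = (\<Prod>i\<in>UNIV. \<integral>\<^sup>+y. f i y \<partial>lborel)"
proof -
  interpret product_sigma_finite "\<lambda>_::'n. lborel :: 'a measure"
    by (simp add: product_sigma_finite_def lborel.sigma_finite_measure_axioms)
  have b: "bij_betw (\<lambda>i::'n. i) UNIV UNIV" by (simp add: bij_betw_def)
  have [measurable]: "(\<lambda>v. \<chi> i. v i) \<in> (\<Pi>\<^sub>M p\<in>UNIV. (lborel :: 'a measure)) \<rightarrow>\<^sub>M (borel :: ('a^'n) measure)"
    using measurable_vec_lambda_component[of "\<lambda>i. i" UNIV] by (simp cong: measurable_cong_sets sets_PiM_cong)
  have [measurable]: "(\<lambda>x. f i (x $ i)) \<in> borel_measurable (borel :: ('a^'n) measure)" for i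
    by (rule measurable_compose[of _ borel borel]) (auto intro!: borel_measurable_continuous_onI continuous_intros)
  show ?thesis
    unfolding lborel_vec[OF b, symmetric]
    by (subst nn_integral_distr) (auto simp: product_nn_integral_prod)
qed

text \<open>The positions of the upper triangle as a type, so that symmetric matrices become vectors
  \<open>real^('k sidx)\<close> and Jacobian estimates for maps between such vectors apply. Their
  class constraint \<open>{finite,wellorder}\<close> explains the order instances.\<close>

typedef (overloaded) 'a sidx = "{p :: 'a::linorder \<times> 'a. fst p \<le> snd p}"
  by (intro exI[of _ "(undefined, undefined)"]) simp

definition lo :: "'a::linorder sidx \<Rightarrow> 'a" where "lo p = fst (Rep_sidx p)"
definition hi :: "'a::linorder sidx \<Rightarrow> 'a" where "hi p = snd (Rep_sidx p)"
definition idx :: "'a::linorder \<Rightarrow> 'a \<Rightarrow> 'a sidx" where "idx i j = Abs_sidx (min i j, max i j)"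

lemma lo_le_hi: "lo p \<le> hi p"
  using Rep_sidx[of p] by (simp add: lo_def hi_def)

lemma Rep_sidx_idx: "Rep_sidx (idx i j) = (min i j, max i j)"
  unfolding idx_def by (rule Abs_sidx_inverse) (auto simp: min_def max_def)

lemma lo_idx [simp]: "lo (idx i j) = min i j" and hi_idx [simp]: "hi (idx i j) = max i j"
  by (simp_all add: lo_def hi_def Rep_sidx_idx)

lemma idx_lo_hi [simp]: "idx (lo p) (hi p) = p"
  using lo_le_hi[of p] by (simp add: idx_def min_absorb1 max_absorb2) (simp add: lo_def hi_def Rep_sidx_inverse)

lemma idx_commute: "idx i j = idx j i"
  by (simp add: idx_def min.commute max.commute)

lemma sidx_eq_iff: "p = q \<longleftrightarrow> lo p = lo q \<and> hi p = hi q"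
  by (metis idx_lo_hi)

instance sidx :: ("{finite,linorder}") finite
proof
  have "inj (Rep_sidx :: 'a sidx \<Rightarrow> _)" by (simp add: inj_def Rep_sidx_inject)
  then show "finite (UNIV :: 'a sidx set)" by (rule finite_imageD[rotated]) simp
qed

instantiation sidx :: (linorder) linorder
begin
definition less_eq_sidx :: "'a sidx \<Rightarrow> 'a sidx \<Rightarrow> bool" where
  "less_eq_sidx p q \<longleftrightarrow> lo p < lo q \<or> lo p = lo q \<and> hi p \<le> hi q"
definition less_sidx :: "'a sidx \<Rightarrow> 'a sidx \<Rightarrow> bool" where
  "less_sidx p q \<longleftrightarrow> lo p < lo q \<or> lo p = lo q \<and> hi p < hi q"
instance
  by standard (auto simp: less_eq_sidx_def less_sidx_def sidx_eq_iff)
end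

instance sidx :: ("{finite,linorder}") wellorder
proof
  fix P :: "'a sidx \<Rightarrow> bool" and a
  assume step: "\<And>x. (\<And>y. y < x \<Longrightarrow> P y) \<Longrightarrow> P x"
  have "card {z. z < y} < card {z. z < x}" if "y < x" for x y :: "'a sidx"
    using that by (intro psubset_card_mono) auto
  then show "P a"
    by (induction a rule: measure_induct_rule[of "\<lambda>x. card {z. z < x}"]) (use step in blast)
qed

definition symm :: "real^('k::{finite,linorder} sidx) \<Rightarrow> real^'k::_^'k::_" where
  "symm z = (\<chi> i j. z $ idx i j)"

text \<open>One vector carries all spectral coordinates: its off-diagonal entries determine the skew
  matrix of a Cayley chart, its diagonal entries \<open>dg z\<close> the eigenvalues. Their total
  number is the dimension of the space of symmetric matrices.\<close>

definition skew :: "real^('k::{finite,linorder} sidx) \<Rightarrow> real^'k::_^'k::_" where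
  "skew z = (\<chi> i j. if i < j then z $ idx i j else if j < i then - z $ idx i j else 0)"

definition dg :: "real^('k::{finite,linorder} sidx) \<Rightarrow> real^'k::_" where
  "dg z = (\<chi> i. z $ idx i i)"

definition upper :: "real^'k::{finite,linorder}^'k::_ \<Rightarrow> real^('k sidx)" where
  "upper V = (\<chi> p. V $ lo p $ hi p)"

lemma symm_upper: "transpose V = V \<Longrightarrow> symm (upper V) = V"
  by (auto simp: symm_def upper_def vec_eq_iff transpose_def min_def max_def)

lemma upper_symm [simp]: "upper (symm z) = z"
  by (simp add: symm_def upper_def vec_eq_iff)

lemma transpose_symm [simp]: "transpose (symm z) = symm z"
  by (simp add: transpose_def symm_def idx_commute)

lemma transpose_skew [simp]: "transpose (skew z) = - skew z"
  by (auto simp: transpose_def skew_def idx_commute vec_eq_iff)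

lemma linear_symm: "linear symm" and linear_skew: "linear skew" and linear_dg: "linear dg"
  and linear_upper: "linear upper" and linear_diag: "linear diag"
  by (auto intro!: linearI simp: symm_def skew_def dg_def upper_def diag_def vec_eq_iff)

lemmas bounded_linear_symm = linear_symm[unfolded linear_conv_bounded_linear]
  and bounded_linear_skew = linear_skew[unfolded linear_conv_bounded_linear]
  and bounded_linear_dg = linear_dg[unfolded linear_conv_bounded_linear]
  and bounded_linear_upper = linear_upper[unfolded linear_conv_bounded_linear]
  and bounded_linear_diag = linear_diag[unfolded linear_conv_bounded_linear]

lemma measurable_symm [measurable]: "symm \<in> borel_measurable borel"
  and measurable_dg [measurable]: "dg \<in> borel_measurable borel"
  by (auto intro!: borel_measurable_continuous_onI linear_continuous_on bounded_linear_symm bounded_linear_dg)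

lemma sym_lborel_eq: "sym_lborel = distr lborel borel (symm :: real^('k::{finite,linorder} sidx) \<Rightarrow> _)"
proof -
  have Rep: "Rep_sidx p = (lo p, hi p)" for p :: "'k sidx" by (simp add: lo_def hi_def)
  have b: "bij_betw Rep_sidx (UNIV :: 'k sidx set) {(i, j). i \<le> j}"
  proof -
    have "range (Rep_sidx :: 'k sidx \<Rightarrow> _) = {(i, j). i \<le> j}"
      unfolding type_definition.Rep_range[OF type_definition_sidx] by auto
    then show ?thesis by (simp add: bij_betw_def inj_def Rep_sidx_inject)
  qed
  have "lborel = distr (\<Pi>\<^sub>M p\<in>{(i, j). i \<le> j}. lborel) borel (\<lambda>v. \<chi> p. v (Rep_sidx p) :: real^('k sidx))"
    by (rule lborel_vec[OF b, symmetric])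
  moreover have "(\<lambda>v. \<chi> p. v (Rep_sidx p)) \<in> (\<Pi>\<^sub>M p\<in>{(i, j). i \<le> j}. (lborel :: real measure)) \<rightarrow>\<^sub>M (borel :: (real^('k sidx)) measure)"
    using measurable_vec_lambda_component[of "Rep_sidx :: 'k sidx \<Rightarrow> _" "{(i, j). i \<le> j}"] Rep_sidx
    by (auto simp: case_prod_beta cong: measurable_cong_sets sets_PiM_cong)
  ultimately have "distr lborel borel symm = distr (\<Pi>\<^sub>M p\<in>{(i, j). i \<le> j}. lborel) borel (symm \<circ> (\<lambda>v. \<chi> p. v (Rep_sidx p) :: real^('k sidx)))"
    by (metis distr_distr measurable_symm)
  also have "symm \<circ> (\<lambda>v. \<chi> p. v (Rep_sidx p) :: real^('k sidx)) = (\<lambda>v. \<chi> i j. v (min i j, max i j))"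
    by (auto simp: symm_def Rep fun_eq_iff vec_eq_iff)
  finally show ?thesis by (simp add: sym_lborel_def)
qed

lemma sets_sym_lborel [simp, measurable_cong]: "sets sym_lborel = sets borel"
  by (simp add: sym_lborel_eq)

lemma space_sym_lborel [simp]: "space sym_lborel = UNIV"
  by (simp add: sym_lborel_eq)

text \<open>Makes preimages of balls under \<open>symm\<close> bounded, which gives sigma-finiteness
  of \<open>sym_lborel\<close>.\<close>

lemma norm_le_norm_symm: "norm z \<le> real CARD('k sidx) * norm (symm (z :: real^('k::{finite,linorder} sidx)))"
proof -
  have "\<bar>z $ p\<bar> \<le> norm (symm z)" for p
    using component_le_norm_cart[of "symm z $ lo p" "hi p"] Finite_Cartesian_Product.norm_nth_le[of "symm z" "lo p"]
    by (simp add: symm_def)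
  then have "(\<Sum>p\<in>UNIV. \<bar>z $ p\<bar>) \<le> of_nat CARD('k sidx) * norm (symm z)"
    by (intro sum_bounded_above) simp
  then show ?thesis using norm_le_l1_cart[of z] by linarith
qed

lemma sigma_finite_sym_lborel: "sigma_finite_measure (sym_lborel :: (real^'k::{finite,linorder}^'k::_) measure)"
proof
  let ?A = "\<lambda>n::nat. cball 0 (real n) :: (real^'k::_^'k::_) set"
  have "emeasure sym_lborel (?A n) \<noteq> \<infinity>" for n
  proof -
    have "emeasure sym_lborel (?A n) = emeasure lborel (symm -` ?A n)"
      by (simp add: sym_lborel_eq emeasure_distr)
    also have "\<dots> \<le> emeasure lborel (cball 0 (real CARD('k sidx) * real n) :: (real^('k sidx)) set)"
    proof (rule emeasure_mono)
      show "symm -` ?A n \<subseteq> cball 0 (real CARD('k sidx) * real n)"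
        using order_trans[OF norm_le_norm_symm mult_left_mono] by auto
    qed simp
    also have "\<dots> < \<infinity>" by (rule emeasure_bounded_finite) simp
    finally show ?thesis by simp
  qed
  moreover have "(\<Union>n. ?A n) = UNIV"
    using real_arch_simple by fastforce
  ultimately show "\<exists>A::(real^'k::_^'k::_) set set. countable A \<and> A \<subseteq> sets sym_lborel \<and> \<Union> A = space sym_lborel \<and> (\<forall>a\<in>A. emeasure sym_lborel a \<noteq> \<infinity>)"
    by (intro exI[of _ "range ?A"]) auto
qed

section \<open>An upper bound by change of variables\<close>

text \<open>As a mere upper bound it tolerates overlapping and non-injective charts. For indicators
  it is the estimate of the measure of a differentiable image; the rest is the standard induction
  over measurable functions.\<close>

lemma nn_integral_image_le:
  fixes g :: "'i \<Rightarrow> real^'n::{finite,wellorder} \<Rightarrow> real^'n::_" and f :: "real^'n::_ \<Rightarrow> ennreal"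
  assumes fin: "finite F" and S [measurable]: "\<And>a. a \<in> F \<Longrightarrow> S a \<in> sets borel"
    and deriv: "\<And>a x. a \<in> F \<Longrightarrow> x \<in> S a \<Longrightarrow> (g a has_derivative g' a x) (at x)"
    and g [measurable]: "\<And>a. a \<in> F \<Longrightarrow> g a \<in> borel_measurable borel"
    and D [measurable]: "\<And>a. a \<in> F \<Longrightarrow> D a \<in> borel_measurable borel"
    and det: "\<And>a x. a \<in> F \<Longrightarrow> x \<in> S a \<Longrightarrow> \<bar>det (matrix (g' a x))\<bar> \<le> D a x"
    and P [measurable]: "P \<in> sets borel" and cover: "P \<subseteq> (\<Union>a\<in>F. g a ` S a)"
    and f: "f \<in> borel_measurable borel"
  shows "(\<integral>\<^sup>+y. f y * indicator P y \<partial>lborel) \<le> (\<Sum>a\<in>F. \<integral>\<^sup>+x. f (g a x) * ennreal (D a x) * indicator (S a) x \<partial>lborel)"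
  using f
proof (induction rule: borel_measurable_induct)
  case (cong f g)
  then have "f = g" by auto
  then show ?case using cong by simp
next
  case (set A)
  then have [measurable]: "A \<in> sets borel" by simp
  let ?I = "\<lambda>a. \<integral>\<^sup>+x. indicator A (g a x) * ennreal (D a x) * indicator (S a) x \<partial>lborel"
  let ?S = "\<lambda>a. S a \<inter> g a -` A"
  have meas [measurable]: "?S a \<in> sets borel" if "a \<in> F" for a
    using measurable_sets[OF g[OF that], of A] S[OF that] by simp
  have one: "g a ` ?S a \<in> sets lebesgue \<and> emeasure lebesgue (g a ` ?S a) \<le> ?I a" if a: "a \<in> F" and "?I a < \<infinity>" for a
  proof -
    have [measurable]: "?S a \<in> sets lborel" "?S a \<in> sets lebesgue" "g a \<in> borel_measurable borel" "D a \<in> borel_measurable borel" "S a \<in> sets borel"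
      using meas[OF a] a by auto
    have der: "(g a has_derivative g' a x) (at x within ?S a)" if "x \<in> ?S a" for x
      using deriv[OF a, of x] that by (auto intro: has_derivative_at_withinI)
    have D0: "0 \<le> D a x" if "x \<in> S a" for x
      using det[OF a that] by linarith
    have Ieq: "?I a = (\<integral>\<^sup>+x. ennreal (indicator (?S a) x * D a x) \<partial>lborel)"
      using D0 by (intro nn_integral_cong) (auto simp: indicator_def)
    have "integrable lborel (\<lambda>x. indicator (?S a) x * D a x)"
      using that(2) D0 unfolding Ieq by (intro integrableI_nonneg) (auto simp: indicator_def)
    then have "integrable lebesgue (\<lambda>x. indicator (?S a) x *\<^sub>R D a x)"
      using integrable_completion[of "\<lambda>x. indicator (?S a) x *\<^sub>R D a x" lborel] by simp
    then have iD: "integrable (lebesgue_on (?S a)) (D a)"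
      by (subst integrable_restrict_space) auto
    have idet: "integrable (lebesgue_on (?S a)) (\<lambda>x. \<bar>det (matrix (g' a x))\<bar>)"
    proof (rule Bochner_Integration.integrable_bound[OF iD])
      show "(\<lambda>x. \<bar>det (matrix (g' a x))\<bar>) \<in> borel_measurable (lebesgue_on (?S a))"
        using borel_measurable_det_Jacobian[of "?S a" "g a" "g' a"] der by (intro borel_measurable_abs) auto
      show "AE x in lebesgue_on (?S a). norm \<bar>det (matrix (g' a x))\<bar> \<le> norm (D a x)"
        using det[OF a] by (intro AE_I2) (auto simp: space_restrict_space intro: order_trans[OF _ abs_ge_self])
    qed
    have int: "(\<lambda>x. \<bar>det (matrix (g' a x))\<bar>) integrable_on ?S a"
      using idet by (rule integrable_on_lebesgue_on) simp
    have lm: "g a ` ?S a \<in> lmeasurable"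
      using der int by (intro measurable_differentiable_image) auto
    have "measure lebesgue (g a ` ?S a) \<le> integral (?S a) (\<lambda>x. \<bar>det (matrix (g' a x))\<bar>)"
      using der int by (intro measure_differentiable_image) auto
    also have "\<dots> = (\<integral>x. \<bar>det (matrix (g' a x))\<bar> \<partial>lebesgue_on (?S a))"
      using idet by (intro lebesgue_integral_eq_integral[symmetric]) auto
    also have "\<dots> \<le> (\<integral>x. D a x \<partial>lebesgue_on (?S a))"
      using idet iD det[OF a] by (intro integral_mono) (auto simp: space_restrict_space)
    also have "\<dots> = (\<integral>x. indicator (?S a) x *\<^sub>R D a x \<partial>lebesgue)"
      by (subst integral_restrict_space) auto
    also have "\<dots> = (\<integral>x. indicator (?S a) x *\<^sub>R D a x \<partial>lborel)"
      by (rule integral_completion) simp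
    finally have "ennreal (measure lebesgue (g a ` ?S a)) \<le> ennreal (\<integral>x. indicator (?S a) x *\<^sub>R D a x \<partial>lborel)"
      by (rule ennreal_leI)
    also have "\<dots> = ?I a"
      unfolding Ieq using \<open>integrable lborel _\<close> D0 by (subst nn_integral_eq_integral) (auto simp: indicator_def)
    finally show ?thesis
      using lm by (simp add: emeasure_eq_measure2 fmeasurableD)
  qed
  show ?case
  \<comment> \<open>An infinite integral on the right leaves nothing to show. In the other case
    finiteness makes the Jacobian integrable, which yields measurability of the images.\<close>
  proof (cases "\<forall>a\<in>F. ?I a < \<infinity>")
    case True
    have "(\<integral>\<^sup>+y. indicator A y * indicator P y \<partial>lborel) = emeasure lborel (A \<inter> P)"
      by (simp add: indicator_inter_arith[symmetric])
    also have "\<dots> = emeasure lebesgue (A \<inter> P)" by simp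
    also have "\<dots> \<le> emeasure lebesgue (\<Union>a\<in>F. g a ` ?S a)"
    proof (rule emeasure_mono)
      show "A \<inter> P \<subseteq> (\<Union>a\<in>F. g a ` ?S a)"
        using cover by blast
      show "(\<Union>a\<in>F. g a ` ?S a) \<in> sets lebesgue"
        using one True fin by (intro sets.finite_UN) auto
    qed
    also have "\<dots> \<le> (\<Sum>a\<in>F. emeasure lebesgue (g a ` ?S a))"
      using one True fin by (intro emeasure_subadditive_finite) auto
    also have "\<dots> \<le> (\<Sum>a\<in>F. ?I a)"
      by (intro sum_mono one[THEN conjunct2] True[rule_format])
    finally show ?thesis .
  next
    case False
    then obtain a where "a \<in> F" "?I a = \<infinity>"
      by (auto simp: less_top[symmetric])
    then have "(\<Sum>a\<in>F. ?I a) = \<infinity>"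
      using fin by auto
    then show ?thesis by simp
  qed
next
  case (mult u c)
  have [measurable]: "u \<in> borel_measurable borel" using mult by simp
  have "(\<integral>\<^sup>+y. c * u y * indicator P y \<partial>lborel) = c * (\<integral>\<^sup>+y. u y * indicator P y \<partial>lborel)"
    by (simp add: mult.assoc nn_integral_cmult)
  also have "\<dots> \<le> c * (\<Sum>a\<in>F. \<integral>\<^sup>+x. u (g a x) * ennreal (D a x) * indicator (S a) x \<partial>lborel)"
    using mult by (intro mult_left_mono) auto
  also have "\<dots> = (\<Sum>a\<in>F. \<integral>\<^sup>+x. c * u (g a x) * ennreal (D a x) * indicator (S a) x \<partial>lborel)"
    unfolding sum_distrib_left by (intro sum.cong refl) (simp add: mult.assoc nn_integral_cmult)
  finally show ?case .
next
  case (add u v)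
  have [measurable]: "u \<in> borel_measurable borel" "v \<in> borel_measurable borel" using add by simp_all
  have "(\<integral>\<^sup>+y. (v y + u y) * indicator P y \<partial>lborel) = (\<integral>\<^sup>+y. v y * indicator P y \<partial>lborel) + (\<integral>\<^sup>+y. u y * indicator P y \<partial>lborel)"
    by (simp add: distrib_right nn_integral_add)
  also have "\<dots> \<le> (\<Sum>a\<in>F. \<integral>\<^sup>+x. v (g a x) * ennreal (D a x) * indicator (S a) x \<partial>lborel)
      + (\<Sum>a\<in>F. \<integral>\<^sup>+x. u (g a x) * ennreal (D a x) * indicator (S a) x \<partial>lborel)"
    using add by (intro add_mono)
  also have "\<dots> = (\<Sum>a\<in>F. \<integral>\<^sup>+x. (v (g a x) + u (g a x)) * ennreal (D a x) * indicator (S a) x \<partial>lborel)"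
    unfolding sum.distrib[symmetric] by (intro sum.cong refl) (simp add: distrib_right nn_integral_add)
  finally show ?case .
next
  case (seq U)
  have [measurable]: "U i \<in> borel_measurable borel" for i using seq by simp
  have "(\<integral>\<^sup>+y. (SUP i. U i) y * indicator P y \<partial>lborel) = (\<integral>\<^sup>+y. (SUP i. U i y * indicator P y) \<partial>lborel)"
    by (intro nn_integral_cong) (simp add: SUP_mult_right_ennreal image_comp)
  also have "\<dots> = (SUP i. \<integral>\<^sup>+y. U i y * indicator P y \<partial>lborel)"
    using seq by (intro nn_integral_monotone_convergence_SUP) (auto simp: incseq_def le_fun_def intro!: mult_right_mono)
  also have "\<dots> \<le> (\<Sum>a\<in>F. \<integral>\<^sup>+x. (SUP i. U i) (g a x) * ennreal (D a x) * indicator (S a) x \<partial>lborel)"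
  proof (rule SUP_least)
    fix i
    have "(\<integral>\<^sup>+y. U i y * indicator P y \<partial>lborel) \<le> (\<Sum>a\<in>F. \<integral>\<^sup>+x. U i (g a x) * ennreal (D a x) * indicator (S a) x \<partial>lborel)"
      using seq by simp
    also have "\<dots> \<le> (\<Sum>a\<in>F. \<integral>\<^sup>+x. (SUP i. U i) (g a x) * ennreal (D a x) * indicator (S a) x \<partial>lborel)"
      by (intro sum_mono nn_integral_mono mult_right_mono le_funD[OF SUP_upper]) auto
    finally show "(\<integral>\<^sup>+y. U i y * indicator P y \<partial>lborel) \<le> (\<Sum>a\<in>F. \<integral>\<^sup>+x. (SUP i. U i) (g a x) * ennreal (D a x) * indicator (S a) x \<partial>lborel)" .
  qed
  finally show ?case by (simp add: image_comp)
qed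

section \<open>Integration over positive-definite matrices in spectral coordinates\<close>

text \<open>Closed at the walls \<open>d $ i = d $ j\<close>, so that every positive-definite matrix
  has coordinates in it. The Vandermonde product vanishes on the walls, hence weighted bounds have
  to be checked only for distinct eigenvalues.\<close>

definition chamber :: "(real^'k::{finite,linorder}) set" where
  "chamber = {d. (\<forall>i j. i < j \<longrightarrow> d $ j \<le> d $ i) \<and> (\<forall>i. 0 < d $ i)}"

definition vandermonde :: "real^'k::{finite,linorder} \<Rightarrow> real" where
  "vandermonde d = (\<Prod>(i, j)\<in>{(i, j). i < j}. d $ i - d $ j)"

lemma chamber_pos: "d \<in> chamber \<Longrightarrow> 0 < d $ i"
  by (simp add: chamber_def)

lemma chamber_mono: "d \<in> chamber \<Longrightarrow> i \<le> j \<Longrightarrow> d $ j \<le> d $ i"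
  by (cases "i = j") (auto simp: chamber_def)

lemma vandermonde_nonneg: "d \<in> chamber \<Longrightarrow> 0 \<le> vandermonde d"
  unfolding vandermonde_def by (intro prod_nonneg) (auto simp: chamber_def)

lemma measurable_vandermonde [measurable]: "vandermonde \<in> borel_measurable borel"
  unfolding vandermonde_def by (intro borel_measurable_prod) (auto simp: case_prod_beta)

lemma chamber_sets [measurable]: "chamber \<in> sets borel"
  unfolding chamber_def by measurable

text \<open>The Cayley chart at the identity, translated to \<open>H0\<close>.\<close>

definition chart :: "real^'k::{finite,linorder}^'k::_ \<Rightarrow> real^('k sidx) \<Rightarrow> real^'k::_^'k::_" where
  "chart H0 z = cayley (skew z) ** H0"

definition sym_chart :: "real^'k::{finite,linorder}^'k::_ \<Rightarrow> real^('k sidx) \<Rightarrow> real^('k sidx)" where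
  "sym_chart H0 z = upper (transpose (chart H0 z) ** diag (dg z) ** chart H0 z)"

lemma orthogonal_chart: "orthogonal_matrix H0 \<Longrightarrow> orthogonal_matrix (chart H0 z)"
  unfolding chart_def by (intro orthogonal_matrix_mul orthogonal_cayley) simp_all

lemma symm_sym_chart: "symm (sym_chart H0 z) = transpose (chart H0 z) ** diag (dg z) ** chart H0 z"
  unfolding sym_chart_def by (rule symm_upper) (rule transpose_conjugate_diag)

abbreviation res :: "real^('k::{finite,linorder} sidx) \<Rightarrow> real^'k::_^'k::_" where
  "res z \<equiv> resolvent (skew z)"

lemma norm_matrix_le:
  fixes A :: "real^'n^'m" and B :: real
  assumes "\<And>i j. \<bar>A $ i $ j\<bar> \<le> B"
  shows "norm A \<le> CARD('m) * (CARD('n) * B)"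
proof -
  have "norm A \<le> (\<Sum>i\<in>UNIV. norm (A $ i))"
    by (simp add: norm_vec_def[of A] L2_set_le_sum)
  also have "\<dots> \<le> (\<Sum>i\<in>(UNIV :: 'm set). \<Sum>j\<in>(UNIV :: 'n set). B)"
    using assms by (intro sum_mono order_trans[OF norm_le_l1_cart])
  finally show ?thesis by simp
qed

text \<open>The resolvent identity applied twice writes the error exactly as a product that contains
  the increment twice. Resolvents of skew matrices are uniformly bounded, so this product is
  quadratic in the increment.\<close>

lemma resolvent_has_derivative:
  "(res has_derivative (\<lambda>w. - (res z ** skew w ** res z))) (at (z :: real^('k::{finite,linorder} sidx)))"
proof -
  interpret M: bounded_bilinear "\<lambda>(A::real^'k::_^'k::_) (B::real^'k::_^'k::_). A ** B"
    by (rule bounded_bilinear_matrix_mult)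
  obtain M where M: "0 < M" "\<And>(A::real^'k::_^'k::_) (B::real^'k::_^'k::_). norm (A ** B) \<le> norm A * norm B * M"
    using M.pos_bounded by blast
  obtain L where L: "0 < L" "\<And>w. norm (skew w :: real^'k::_^'k::_) \<le> norm w * L"
    using bounded_linear.pos_bounded[OF bounded_linear_skew] by blast
  define R where "R = real CARD('k) * real CARD('k)"
  have R: "norm (res y) \<le> R" for y :: "real^('k sidx)"
    using norm_matrix_le[of "res y" 1, OF resolvent_entry_le[OF transpose_skew]] by (simp add: R_def)
  have R0: "0 \<le> R" by (simp add: R_def)
  define c where "c = R * (L * (R * (L * R * M) * M) * M) * M"
  have diff: "res y - res z + res z ** skew (y - z) ** res z = res y ** (skew (y - z) ** (res z ** (skew (y - z) ** res z)))"
    (is "_ = ?r y") for y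
  proof -
    have s: "skew (y - z) = (mat 1 + skew y) - (mat 1 + skew z)"
      by (simp add: linear_diff[OF linear_skew])
    have e: "res y - res z = - (res y ** (skew (y - z) ** res z))"
      unfolding s matrix_mult_diff_left resolvent_inverse[OF transpose_skew] matrix_mult_diff_right
      by (simp add: matrix_mul_assoc resolvent_inverse[OF transpose_skew])
    have "res y - res z + res z ** skew (y - z) ** res z
        = - (res y ** (skew (y - z) ** res z)) + res z ** (skew (y - z) ** res z)"
      unfolding e by (simp add: matrix_mul_assoc)
    also have "\<dots> = - ((res y - res z) ** (skew (y - z) ** res z))"
      by (simp add: matrix_mult_diff_left)
    also have "\<dots> = ?r y"
      unfolding e by (simp add: matrix_mult_minus_left matrix_mul_assoc)
    finally show ?thesis .
  qed
  have bound: "norm (?r y) \<le> c * (norm (y - z))\<^sup>2" for y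
  proof -
    let ?n = "norm (y - z)"
    note b = order_trans[OF M(2) mult_right_mono[OF mult_mono]]
    have 1: "norm (skew (y - z) ** res z) \<le> (?n * L) * R * M"
      by (rule b) (use L R R0 M(1) in auto)
    have 2: "norm (res z ** (skew (y - z) ** res z)) \<le> R * ((?n * L) * R * M) * M"
      by (rule b) (use L(1) R R0 M(1) 1 in auto)
    have 3: "norm (skew (y - z) ** (res z ** (skew (y - z) ** res z))) \<le> (?n * L) * (R * ((?n * L) * R * M) * M) * M"
      by (rule b) (use L R R0 M(1) 2 in auto)
    have "norm (?r y) \<le> R * ((?n * L) * (R * ((?n * L) * R * M) * M) * M) * M"
      by (rule b) (use L(1) R R0 M(1) 3 in auto)
    then show ?thesis by (simp add: c_def power2_eq_square mult_ac)
  qed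
  have lin: "bounded_linear (\<lambda>w. - (res z ** skew w ** res z))"
    by (intro bounded_linear_minus bounded_linear_compose[OF M.bounded_linear_left]
        bounded_linear_compose[OF M.bounded_linear_right] bounded_linear_skew)
  have lim: "((\<lambda>y. c * norm (y - z)) \<longlongrightarrow> 0) (at z)"
    by (rule tendsto_eq_intros | simp)+
  show ?thesis
  proof (rule has_derivativeI_sandwich[OF zero_less_one lin _ lim])
    fix y assume "y \<noteq> z"
    have "res y - res z - - (res z ** skew (y - z) ** res z) = ?r y"
      using diff[of y] by simp
    then show "norm (res y - res z - - (res z ** skew (y - z) ** res z)) / norm (y - z) \<le> c * norm (y - z)"
      using bound[of y] \<open>y \<noteq> z\<close> by (simp add: divide_le_eq power2_eq_square mult.assoc)
  qed
qed

text \<open>The value 1 belongs to the diagonal positions, along which the eigenvalues themselves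
  move; the product over all positions is therefore the Vandermonde product.\<close>

definition gap :: "real^'k::{finite,linorder} \<Rightarrow> 'k sidx \<Rightarrow> real" where
  "gap d p = (if lo p < hi p then d $ lo p - d $ hi p else 1)"

text \<open>The logarithmic derivative \<open>dC C\<^sup>t\<close> of the Cayley transform \<open>C\<close> in the direction \<open>w\<close>.\<close>

definition log_deriv :: "real^('k::{finite,linorder} sidx) \<Rightarrow> real^('k sidx) \<Rightarrow> real^'k::_^'k::_" where
  "log_deriv z w = - (res z ** skew w ** transpose (res z) + res z ** skew w ** transpose (res z))"

text \<open>The direction \<open>w\<close> seen in the moving frame: its skew part through
  \<open>log_deriv\<close>, its eigenvalue part unchanged. In the factorisation of the derivative as
  \<open>conjugation\<close>, \<open>stretch\<close>, \<open>tangent\<close> only the diagonal map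
  \<open>stretch\<close> depends on the eigenvalues.\<close>

definition tangent :: "real^('k::{finite,linorder} sidx) \<Rightarrow> real^('k sidx) \<Rightarrow> real^('k sidx)" where
  "tangent z w = (\<chi> p. if lo p < hi p then log_deriv z w $ lo p $ hi p else w $ p)"

definition stretch :: "real^'k::{finite,linorder} \<Rightarrow> real^('k sidx) \<Rightarrow> real^('k sidx)" where
  "stretch d w = (\<chi> p. gap d p * w $ p)"

definition conjugation :: "real^'k::{finite,linorder}^'k::_ \<Rightarrow> real^('k sidx) \<Rightarrow> real^('k sidx)" where
  "conjugation H w = upper (transpose H ** symm w ** H)"

lemma transpose_log_deriv: "transpose (log_deriv z w) = - log_deriv z w"
  unfolding log_deriv_def transpose_minus transpose_add matrix_transpose_mul transpose_transpose transpose_skew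
    matrix_mul_assoc matrix_mult_minus_left matrix_mult_minus_right by simp

text \<open>A commutator with a diagonal matrix multiplies the entry at \<open>(i, j)\<close> by the
  difference of the two eigenvalues. This is the origin of the Vandermonde factor.\<close>

lemma commutator_eq: "diag (dg z) ** log_deriv z w - log_deriv z w ** diag (dg z) + diag (dg w)
    = symm (stretch (dg z) (tangent z w))"
proof -
  have skew: "log_deriv z w $ i $ j = - log_deriv z w $ j $ i" for i j
  proof -
    have "transpose (log_deriv z w) $ j $ i = (- log_deriv z w) $ j $ i" by (simp only: transpose_log_deriv)
    then show ?thesis by (simp add: transpose_def)
  qed
  then have zero: "log_deriv z w $ i $ i = 0" for i
    by (metis add.right_inverse double_zero)
  have left: "(diag d ** A) $ i $ j = d $ i * A $ i $ j" and right: "(A ** diag d) $ i $ j = A $ i $ j * d $ j"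
    for A :: "real^'a::_^'a::_" and d i j
    by (simp_all add: matrix_matrix_mult_def diag_def if_distrib[of "\<lambda>x. x * _"] if_distrib[of "\<lambda>x. _ * x"] cong: if_cong)
  show ?thesis
  proof (simp add: vec_eq_iff left right, intro allI)
    fix i j
    have "symm (stretch (dg z) (tangent z w)) $ i $ j = (dg z $ i - dg z $ j) * log_deriv z w $ i $ j + diag (dg w) $ i $ j"
      using skew[of i j] zero
      by (cases i j rule: linorder_cases)
        (auto simp: symm_def stretch_def tangent_def gap_def diag_def dg_def min_def max_def algebra_simps)
    then show "dg z $ i * log_deriv z w $ i $ j - log_deriv z w $ i $ j * dg z $ j + diag (dg w) $ i $ j
        = symm (stretch (dg z) (tangent z w)) $ i $ j"
      by (simp add: algebra_simps)
  qed
qed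

text \<open>With \<open>dC = L C\<close> and \<open>L\<close> skew, the product rule for
  \<open>C^t D C\<close> gives \<open>C^t (D L - L D + dD) C\<close>; the constant factor
  \<open>H0\<close> only conjugates the result.\<close>

lemma sym_chart_has_derivative:
  assumes H0: "orthogonal_matrix (H0 :: real^'k::{finite,linorder}^'k::_)"
  shows "(sym_chart H0 has_derivative (conjugation (chart H0 z) \<circ> stretch (dg z) \<circ> tangent z)) (at z)"
proof -
  interpret M: bounded_bilinear "\<lambda>(A::real^'k::_^'k::_) (B::real^'k::_^'k::_). A ** B"
    by (rule bounded_bilinear_matrix_mult)
  let ?C = "\<lambda>z. cayley (skew z) :: real^'k::_^'k::_" and ?M = "\<lambda>z. diag (dg z) :: real^'k::_^'k::_"
  define dC where "dC w = - (res z ** skew w ** res z) + - (res z ** skew w ** res z)" for w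
  have C: "(?C has_derivative dC) (at z)"
    unfolding cayley_def[abs_def] dC_def
    using has_derivative_diff[OF has_derivative_add[OF resolvent_has_derivative[of z] resolvent_has_derivative[of z]] has_derivative_const]
    by simp
  have Ct: "((\<lambda>z. transpose (?C z)) has_derivative (\<lambda>w. transpose (dC w))) (at z)"
    by (rule bounded_linear.has_derivative[OF bounded_linear_transpose C])
  have Mz: "(?M has_derivative ?M) (at z)"
    using bounded_linear_compose[OF bounded_linear_diag bounded_linear_dg] by (rule bounded_linear_imp_has_derivative)
  have V: "((\<lambda>z. transpose (?C z) ** ?M z ** ?C z) has_derivative
      (\<lambda>w. (transpose (?C z) ** ?M z) ** dC w + (transpose (?C z) ** ?M w + transpose (dC w) ** ?M z) ** ?C z)) (at z)"
    by (rule M.FDERIV[OF M.FDERIV[OF Ct Mz] C])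
  have lin: "bounded_linear (\<lambda>A. upper (transpose H0 ** A ** H0))"
    by (intro bounded_linear_compose[OF bounded_linear_upper] bounded_linear_compose[OF M.bounded_linear_left]
        M.bounded_linear_right)
  have eq: "sym_chart H0 = (\<lambda>z. upper (transpose H0 ** (transpose (?C z) ** ?M z ** ?C z) ** H0))"
    by (simp add: fun_eq_iff sym_chart_def chart_def matrix_transpose_mul matrix_mul_assoc)
  have o: "transpose (?C z) ** ?C z = mat 1" "?C z ** transpose (?C z) = mat 1"
    using orthogonal_cayley[OF transpose_skew[of z]] by (simp_all add: orthogonal_matrix_inverse)
  have log: "dC w ** transpose (?C z) = log_deriv z w" for w
    unfolding dC_def log_deriv_def matrix_mult_add_left matrix_mult_minus_left matrix_mul_assoc[symmetric]
      resolvent_transpose_cayley[OF transpose_skew] by simp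
  have dC: "dC w = log_deriv z w ** ?C z" for w
    unfolding log[symmetric] matrix_mul_assoc[symmetric] o by simp
  have dCt: "transpose (dC w) = transpose (?C z) ** - log_deriv z w" for w
    unfolding dC by (simp add: matrix_transpose_mul transpose_log_deriv)
  have inner: "(transpose (?C z) ** ?M z) ** dC w + (transpose (?C z) ** ?M w + transpose (dC w) ** ?M z) ** ?C z
      = transpose (?C z) ** symm (stretch (dg z) (tangent z w)) ** ?C z" for w
    unfolding commutator_eq[symmetric] dCt unfolding dC
    by (simp add: matrix_mult_algebra matrix_mul_assoc)
  show ?thesis
    using bounded_linear.has_derivative[OF lin V]
    unfolding eq inner
    by (simp add: conjugation_def[abs_def] chart_def o_def matrix_transpose_mul matrix_mul_assoc)
qed

lemma triple_product_entry_le: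
  fixes A B C :: "real^'n^'n"
  assumes "\<And>i j. \<bar>A $ i $ j\<bar> \<le> 1" "\<And>i j. \<bar>B $ i $ j\<bar> \<le> 1" "\<And>i j. \<bar>C $ i $ j\<bar> \<le> 1"
  shows "\<bar>(A ** B ** C) $ i $ j\<bar> \<le> (real CARD('n))\<^sup>2"
proof -
  have "(A ** B ** C) $ i $ j = (\<Sum>l\<in>UNIV. (\<Sum>m\<in>UNIV. A $ i $ m * B $ m $ l) * C $ l $ j)"
    by (simp add: matrix_matrix_mult_def)
  also have "\<bar>\<dots>\<bar> \<le> (\<Sum>l\<in>(UNIV::'n set). real CARD('n))"
  proof (intro order_trans[OF sum_abs] sum_mono)
    fix l
    have "\<bar>\<Sum>m\<in>UNIV. A $ i $ m * B $ m $ l\<bar> \<le> (\<Sum>m\<in>(UNIV::'n set). 1)"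
      using assms by (intro order_trans[OF sum_abs] sum_mono) (auto simp: abs_mult intro!: mult_le_one)
    then have "\<bar>\<Sum>m\<in>UNIV. A $ i $ m * B $ m $ l\<bar> * \<bar>C $ l $ j\<bar> \<le> real CARD('n) * 1"
      using assms(3) by (intro mult_mono) auto
    then show "\<bar>(\<Sum>m\<in>UNIV. A $ i $ m * B $ m $ l) * C $ l $ j\<bar> \<le> real CARD('n)"
      by (simp add: abs_mult)
  qed
  finally show ?thesis by (simp add: power2_eq_square)
qed

lemma prod_gap: "(\<Prod>p\<in>UNIV. gap d p) = vandermonde d"
proof -
  have "(\<Prod>p\<in>UNIV. gap d p) = (\<Prod>p\<in>{p. lo p < hi p}. d $ lo p - d $ hi p)"
    by (rule prod.mono_neutral_cong_right) (auto simp: gap_def)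
  also have "\<dots> = (\<Prod>(i, j)\<in>{(i, j). i < j}. d $ i - d $ j)"
    by (rule prod.reindex_bij_witness[of _ "\<lambda>(i, j). idx i j" "\<lambda>p. (lo p, hi p)"]) (auto simp: min_def max_def)
  finally show ?thesis by (simp add: vandermonde_def)
qed

text \<open>The determinant splits along the factorisation. The two outer maps have entries at most
  \<open>2 k^2\<close>, being built from products of three matrices with entries at most 1, two such
  products in \<open>log_deriv\<close>; \<open>stretch\<close> contributes the Vandermonde product
  exactly.\<close>

lemma det_sym_chart_le:
  fixes H :: "real^'k::{finite,linorder}^'k::_"
  assumes H: "orthogonal_matrix H"
  shows "\<bar>det (matrix (conjugation H \<circ> stretch d \<circ> tangent z))\<bar>
    \<le> (fact CARD('k sidx) * (2 * (real CARD('k))\<^sup>2) ^ CARD('k sidx))\<^sup>2 * \<bar>vandermonde d\<bar>"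
proof -
  have entry_axis: "\<bar>axis q (1::real) $ p\<bar> \<le> 1" for p q :: "'k sidx"
    by (simp add: axis_def)
  have k1: "1 \<le> (real CARD('k))\<^sup>2"
    by (rule one_le_power) (simp add: Suc_leI)
  have lc: "linear (conjugation H)"
    unfolding conjugation_def[abs_def]
    by (auto intro!: linearI simp: linear_add[OF linear_symm] linear_scale[OF linear_symm] linear_add[OF linear_upper]
        linear_scale[OF linear_upper] matrix_mult_algebra)
  have ls: "linear (stretch d)"
    by (auto intro!: linearI simp: stretch_def vec_eq_iff algebra_simps)
  have lt: "linear (tangent z)"
    by (auto intro!: linearI simp: tangent_def log_deriv_def vec_eq_iff linear_add[OF linear_skew] linear_scale[OF linear_skew]
        matrix_mult_algebra algebra_simps)
  have c: "\<bar>matrix (conjugation H) $ p $ q\<bar> \<le> 2 * (real CARD('k))\<^sup>2" for p q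
  proof -
    have "\<bar>(transpose H ** symm (axis q 1) ** H) $ lo p $ hi p\<bar> \<le> (real CARD('k))\<^sup>2"
      using orthogonal_matrix_entry_le[OF H] by (intro triple_product_entry_le) (auto simp: transpose_def symm_def entry_axis)
    then show ?thesis using k1 by (simp add: matrix_def conjugation_def upper_def)
  qed
  have t: "\<bar>matrix (tangent z) $ p $ q\<bar> \<le> 2 * (real CARD('k))\<^sup>2" for p q
  proof -
    have "\<bar>(res z ** skew (axis q 1) ** transpose (res z)) $ lo p $ hi p\<bar> \<le> (real CARD('k))\<^sup>2"
      using resolvent_entry_le[OF transpose_skew] by (intro triple_product_entry_le) (auto simp: transpose_def skew_def entry_axis)
    moreover have "\<bar>axis q (1::real) $ p\<bar> \<le> 2 * (real CARD('k))\<^sup>2"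
      using k1 entry_axis[of q p] by linarith
    ultimately show ?thesis by (auto simp: matrix_def tangent_def log_deriv_def)
  qed
  have "matrix (stretch d) = (\<chi> p q. if p = q then gap d p else 0)"
    by (auto simp: matrix_def stretch_def axis_def vec_eq_iff)
  then have s: "det (matrix (stretch d)) = vandermonde d"
    using prod_gap[of d] by (subst det_diagonal) auto
  have "matrix (conjugation H \<circ> stretch d \<circ> tangent z) = matrix (conjugation H) ** matrix (stretch d) ** matrix (tangent z)"
    using lc ls lt by (simp add: matrix_compose linear_compose)
  then have "\<bar>det (matrix (conjugation H \<circ> stretch d \<circ> tangent z))\<bar>
      = \<bar>det (matrix (conjugation H))\<bar> * \<bar>det (matrix (tangent z))\<bar> * \<bar>vandermonde d\<bar>"
    by (simp add: det_mul s abs_mult)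
  also have "\<dots> \<le> (fact CARD('k sidx) * (2 * (real CARD('k))\<^sup>2) ^ CARD('k sidx)) *
      (fact CARD('k sidx) * (2 * (real CARD('k))\<^sup>2) ^ CARD('k sidx)) * \<bar>vandermonde d\<bar>"
    using abs_det_le[OF c] abs_det_le[OF t] by (intro mult_right_mono mult_mono) auto
  finally show ?thesis by (simp add: power2_eq_square)
qed

text \<open>The off-diagonal coordinates of a chart range over a cube of side 6. Integrating them
  out of a function of the eigenvalues leaves a constant times Lebesgue measure.\<close>

lemma dg_pushforward:
  assumes F: "F \<in> borel_measurable borel"
  shows "(\<integral>\<^sup>+z. F (dg z) * indicator {z. \<forall>p. lo p < hi p \<longrightarrow> \<bar>z $ p\<bar> \<le> 3} z \<partial>lborel)
    = ennreal (6 ^ card {p :: 'k sidx. lo p < hi p}) * (\<integral>\<^sup>+d. F d \<partial>(lborel :: (real^'k::{finite,linorder}) measure))"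
proof -
  let ?O = "{z :: real^('k sidx). \<forall>p. lo p < hi p \<longrightarrow> \<bar>z $ p\<bar> \<le> 3}"
  let ?m = "card {p :: 'k sidx. lo p < hi p}"
  have [measurable]: "?O \<in> sets borel" by measurable
  have eq: "lborel = density (distr (density lborel (indicator ?O)) borel dg) (\<lambda>_. ennreal (1 / 6 ^ ?m))" (is "_ = ?M")
  proof (rule lborel_eqI)
    fix l u :: "real^'k::_" assume le: "\<And>b. b \<in> Basis \<Longrightarrow> l \<bullet> b \<le> u \<bullet> b"
    have lei: "l $ i \<le> u $ i" for i
      using le[of "axis i 1"] by (simp add: cart_eq_inner_axis)
    let ?h = "\<lambda>p t. if lo p < hi p then indicator {-3..3} t else indicator {l $ lo p<..<u $ lo p} t :: ennreal"
    have pt: "indicator ?O z * indicator (box l u) (dg z) = (\<Prod>p\<in>UNIV. ?h p (z $ p))" for z :: "real^('k sidx)"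
    proof (cases "z \<in> ?O \<and> dg z \<in> box l u")
      case True
      then have "?h p (z $ p) = 1" for p
        using lo_le_hi[of p] by (auto simp: mem_box_cart dg_def abs_le_iff indicator_def) (metis idx_lo_hi order.order_iff_strict)+
      then show ?thesis using True by simp
    next
      case False
      then have l0: "indicator ?O z * indicator (box l u) (dg z) = (0 :: ennreal)"
        by (auto simp: indicator_def)
      from False obtain p where hp: "?h p (z $ p) = 0"
      proof (cases "z \<in> ?O")
        case True
        with False obtain i where i: "dg z $ i \<notin> {l $ i<..<u $ i}" by (auto simp: mem_box_cart)
        show ?thesis using i by (intro that[of "idx i i"]) (simp add: dg_def)
      next
        case False
        then obtain p where "lo p < hi p" "\<not> \<bar>z $ p\<bar> \<le> 3" by auto
        then show ?thesis by (intro that[of p]) (auto simp: abs_le_iff)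
      qed
      have "(\<Prod>p\<in>UNIV. ?h p (z $ p)) = 0"
        by (rule prod_zero, simp, rule bexI[of _ p], rule hp, simp)
      then show ?thesis unfolding l0 by simp
    qed
    have "emeasure ?M (box l u) = ennreal (1 / 6 ^ ?m) * emeasure (distr (density lborel (indicator ?O)) borel dg) (box l u)"
      by (subst emeasure_density) (auto simp: nn_integral_cmult)
    also have "emeasure (distr (density lborel (indicator ?O)) borel dg) (box l u)
        = (\<integral>\<^sup>+z. indicator ?O z * indicator (box l u) (dg z) \<partial>lborel)"
      by (subst emeasure_distr) (auto simp: emeasure_density measurable_sets_borel[OF measurable_dg] indicator_vimage
          intro!: nn_integral_cong split: split_indicator)
    also have "\<dots> = (\<Prod>p\<in>UNIV. \<integral>\<^sup>+t. ?h p t \<partial>lborel)"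
      unfolding pt by (rule nn_integral_lborel_vec_prod) auto
    also have "\<dots> = (\<Prod>p\<in>(UNIV :: 'k sidx set). ennreal (if lo p < hi p then 6 else u $ lo p - l $ lo p))"
      using lei by (intro prod.cong) auto
    also have "\<dots> = ennreal (\<Prod>p\<in>(UNIV :: 'k sidx set). if lo p < hi p then 6 else u $ lo p - l $ lo p)"
      using lei by (intro prod_ennreal) auto
    also have "(\<Prod>p\<in>(UNIV :: 'k sidx set). if lo p < hi p then 6 else u $ lo p - l $ lo p)
        = 6 ^ ?m * (\<Prod>p | lo p = hi p. u $ lo p - l $ lo p)"
    proof -
      have "{p :: 'k sidx. \<not> lo p < hi p} = {p. lo p = hi p}" using lo_le_hi by (auto simp: order.order_iff_strict)
      then show ?thesis by (simp add: prod.If_cases Compl_eq)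
    qed
    also have "(\<Prod>p :: 'k sidx | lo p = hi p. u $ lo p - l $ lo p) = (\<Prod>i\<in>UNIV. u $ i - l $ i)"
      by (rule prod.reindex_bij_witness[of _ "\<lambda>i. idx i i" lo]) (auto simp: sidx_eq_iff)
    also have "\<dots> = (\<Prod>b\<in>Basis. (u - l) \<bullet> b)"
      by (simp add: prod_Basis_vec inner_axis)
    finally show "emeasure ?M (box l u) = ennreal (\<Prod>b\<in>Basis. (u - l) \<bullet> b)"
      using lei by (simp flip: ennreal_mult add: prod_Basis_vec inner_axis prod_nonneg)
  qed simp
  have "ennreal (6 ^ ?m) * (\<integral>\<^sup>+d. F d \<partial>lborel) = ennreal (6 ^ ?m) * (ennreal (1 / 6 ^ ?m) * (\<integral>\<^sup>+z. F (dg z) * indicator ?O z \<partial>lborel))"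
  proof -
    have [measurable]: "F \<in> borel_measurable borel" by fact
    have "(\<integral>\<^sup>+d. F d \<partial>lborel) = (\<integral>\<^sup>+d. F d \<partial>?M)" by (subst eq) (rule refl)
    also have "\<dots> = ennreal (1 / 6 ^ ?m) * (\<integral>\<^sup>+d. F d \<partial>distr (density lborel (indicator ?O)) borel dg)"
      by (subst nn_integral_density) (auto simp: nn_integral_cmult)
    also have "(\<integral>\<^sup>+d. F d \<partial>distr (density lborel (indicator ?O)) borel dg) = (\<integral>\<^sup>+z. F (dg z) * indicator ?O z \<partial>lborel)"
      by (subst nn_integral_distr) (auto simp: nn_integral_density mult.commute)
    finally show ?thesis by simp
  qed
  also have "\<dots> = (\<integral>\<^sup>+z. F (dg z) * indicator ?O z \<partial>lborel)"
    by (simp flip: mult.assoc ennreal_mult)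
  finally show ?thesis by simp
qed

text \<open>Compactness of the unit sphere. The constant is a natural number so that
  positive-definiteness becomes a countable union of closed conditions.\<close>

lemma pos_def_lower_bound:
  assumes V: "pos_def (V :: real^'n^'n)"
  obtains n :: nat where "\<And>x. (norm x)\<^sup>2 \<le> real n * (x \<bullet> (V *v x))"
proof -
  have "compact (sphere (0::real^'n) 1)" by simp
  moreover have "sphere (0::real^'n) 1 \<noteq> {}"
    using norm_axis_1 by (metis mem_sphere_0 empty_iff)
  moreover have "continuous_on (sphere (0::real^'n) 1) (\<lambda>x. x \<bullet> (V *v x))"
    by (intro continuous_intros linear_continuous_on matrix_vector_mul_bounded_linear)
  ultimately have "\<exists>x0\<in>sphere 0 1. \<forall>x\<in>sphere 0 1. x0 \<bullet> (V *v x0) \<le> x \<bullet> (V *v x)"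
    by (rule continuous_attains_inf)
  then obtain x0 where x0: "x0 \<in> sphere 0 1" "\<And>x. x \<in> sphere 0 1 \<Longrightarrow> x0 \<bullet> (V *v x0) \<le> x \<bullet> (V *v x)"
    by blast
  have "x0 \<noteq> 0" using x0(1) by auto
  then have p: "0 < x0 \<bullet> (V *v x0)" using V by (simp add: pos_def_def)
  obtain n :: nat where n: "1 / (x0 \<bullet> (V *v x0)) \<le> real n" using real_arch_simple by blast
  have "(norm x)\<^sup>2 \<le> real n * (x \<bullet> (V *v x))" for x
  proof (cases "x = 0")
    case False
    have "x0 \<bullet> (V *v x0) \<le> (x /\<^sub>R norm x) \<bullet> (V *v (x /\<^sub>R norm x))"
      using False by (intro x0(2)) simp
    also have "\<dots> = (x \<bullet> (V *v x)) / (norm x)\<^sup>2"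
      by (simp add: matrix_vector_mult_scaleR power2_eq_square divide_simps)
    finally have 1: "(norm x)\<^sup>2 * (x0 \<bullet> (V *v x0)) \<le> x \<bullet> (V *v x)"
      using False by (simp add: field_simps)
    have "1 \<le> real n * (x0 \<bullet> (V *v x0))"
      using n p by (simp add: field_simps)
    then have "(norm x)\<^sup>2 * 1 \<le> (norm x)\<^sup>2 * (real n * (x0 \<bullet> (V *v x0)))"
      by (intro mult_left_mono) auto
    also have "\<dots> = real n * ((norm x)\<^sup>2 * (x0 \<bullet> (V *v x0)))" by (simp add: mult_ac)
    also have "\<dots> \<le> real n * (x \<bullet> (V *v x))" using 1 by (intro mult_left_mono) auto
    finally show ?thesis by simp
  qed simp
  then show ?thesis using that by blast
qed

lemma pos_def_sets [measurable]: "{V :: real^'n^'n. pos_def V} \<in> sets borel"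
proof -
  let ?A = "\<lambda>n::nat. {V :: real^'n^'n. transpose V = V \<and> (\<forall>x. (norm x)\<^sup>2 \<le> real n * (x \<bullet> (V *v x)))}"
  have c: "continuous_on UNIV (\<lambda>V :: real^'n^'n. V *v x)" for x
    by (intro linear_continuous_on linear_conv_bounded_linear[THEN iffD1] linearI)
      (simp_all add: matrix_vector_mult_add_rdistrib scaleR_matrix_vector_assoc)
  have "closed (?A n)" for n
    unfolding Collect_conj_eq Collect_all_eq
    by (intro closed_Int closed_INT ballI closed_Collect_eq closed_Collect_le continuous_intros c
        linear_continuous_on bounded_linear_transpose)
  then have "(\<Union>n. ?A n) \<in> sets borel"
    by (intro sets.countable_UN) (auto intro: borel_closed)
  moreover have "{V :: real^'n^'n. pos_def V} = (\<Union>n. ?A n)"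
  proof safe
    fix V :: "real^'n^'n" assume V: "pos_def V"
    then obtain n :: nat where "\<And>x. (norm x)\<^sup>2 \<le> real n * (x \<bullet> (V *v x))"
      using pos_def_lower_bound by blast
    then show "V \<in> (\<Union>n. ?A n)" using V by (auto simp: pos_def_def)
  next
    fix V :: "real^'n^'n" and n :: nat
    assume "transpose V = V" and b: "\<forall>x. (norm x)\<^sup>2 \<le> real n * (x \<bullet> (V *v x))"
    moreover have "0 < x \<bullet> (V *v x)" if "x \<noteq> 0" for x
    proof -
      have "0 < (norm x)\<^sup>2" using that by simp
      then have "0 < real n * (x \<bullet> (V *v x))" using b by (meson less_le_trans)
      then show ?thesis by (simp add: zero_less_mult_iff)
    qed
    ultimately show "pos_def V" by (simp add: pos_def_def)
  qed
  ultimately show ?thesis by simp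
qed

text \<open>Finitely many balls of radius 1/2 cover the orthogonal group. If \<open>H\<close> lies
  within 1/2 of a centre \<open>H0\<close>, then \<open>H H0^t\<close> lies within 1/2 of the
  identity in operator norm and has a Cayley preimage with entries at most 3.\<close>

lemma chart_cover:
  obtains F where "finite F" "\<And>H0. H0 \<in> F \<Longrightarrow> orthogonal_matrix H0"
    "\<And>V :: real^'k::{finite,linorder}^'k::_. pos_def V \<Longrightarrow>
      \<exists>H0\<in>F. \<exists>z. dg z \<in> chamber \<and> (\<forall>p. lo p < hi p \<longrightarrow> \<bar>z $ p\<bar> \<le> 3) \<and> upper V = sym_chart H0 z"
proof -
  let ?O = "{H :: real^'k::_^'k::_. orthogonal_matrix H}"
  obtain F where F: "F \<subseteq> ?O" "finite F" "?O \<subseteq> (\<Union>H\<in>F. ball H (1/2))"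
    using compactE_image[OF compact_orthogonal_matrices, of ?O "\<lambda>H. ball H (1/2)"]
    by (metis (no_types, lifting) UN_I centre_in_ball half_gt_zero_iff open_ball subsetI zero_less_one)
  have "\<exists>H0\<in>F. \<exists>z. dg z \<in> chamber \<and> (\<forall>p. lo p < hi p \<longrightarrow> \<bar>z $ p\<bar> \<le> 3) \<and> upper V = sym_chart H0 z"
    if V: "pos_def V" for V :: "real^'k::_^'k::_"
  proof -
    obtain H d where H: "orthogonal_matrix H" and Veq: "V = transpose H ** diag d ** H"
      and d: "\<And>i j. i < j \<Longrightarrow> d $ j \<le> d $ i" "\<And>i. 0 < d $ i"
      using pos_def_spectral[OF V] by blast
    obtain H0 where H0: "H0 \<in> F" "dist H0 H < 1/2" using F(3) H by auto
    have o: "orthogonal_matrix H0" using F(1) H0(1) by auto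
    let ?G = "H ** transpose H0"
    have "?G - mat 1 = (H - H0) ** transpose H0"
      by (simp add: matrix_mult_diff_left orthogonal_matrix_inverse[OF o])
    then have "norm ((?G - mat 1) *v x) = norm ((H - H0) *v (transpose H0 *v x))" for x
      by (simp only: matrix_vector_mul_assoc)
    also have "norm ((H - H0) *v (transpose H0 *v x)) \<le> norm (H - H0) * norm (transpose H0 *v x)" for x
      by (rule norm_matrix_vector_mult_le)
    also have "norm (H - H0) * norm (transpose H0 *v x) \<le> 1/2 * norm x" for x
      using H0(2) o norm_orthogonal_mult[of "transpose H0" x]
      by (intro mult_mono) (auto simp: dist_norm norm_minus_commute)
    finally have near: "norm ((?G - mat 1) *v x) \<le> norm x / 2" for x by simp
    have "orthogonal_matrix ?G" using H o by (intro orthogonal_matrix_mul) auto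
    then obtain S where S: "transpose S = - S" "cayley S = ?G" "\<And>i j. \<bar>S $ i $ j\<bar> \<le> 3"
      using cayley_onto near by metis
    define z where "z = (\<chi> p. if lo p < hi p then S $ lo p $ hi p else d $ lo p)"
    have Sij: "S $ i $ j = - S $ j $ i" for i j
    proof -
      have "transpose S $ j $ i = (- S) $ j $ i" by (simp only: S(1))
      then show ?thesis by (simp add: transpose_def)
    qed
    then have S0: "S $ i $ i = 0" for i
      by (metis add.right_inverse double_zero)
    have "skew z $ i $ j = S $ i $ j" for i j
      using Sij[of i j] S0[of i]
      by (cases i j rule: linorder_cases) (auto simp: skew_def z_def min_absorb1 min_absorb2 max_absorb1 max_absorb2 less_imp_le)
    then have "skew z = S"
      by (simp add: vec_eq_iff)
    moreover have "dg z = d" by (simp add: dg_def z_def vec_eq_iff)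
    moreover have "?G ** H0 = H"
      by (simp add: orthogonal_matrix_inverse[OF o] flip: matrix_mul_assoc)
    ultimately have "upper V = sym_chart H0 z"
      by (simp add: sym_chart_def chart_def S(2) Veq)
    moreover have "dg z \<in> chamber" using d \<open>dg z = d\<close> by (auto simp: chamber_def)
    moreover have "\<forall>p. lo p < hi p \<longrightarrow> \<bar>z $ p\<bar> \<le> 3" using S(3) by (simp add: z_def)
    ultimately show ?thesis using H0(1) by blast
  qed
  then show ?thesis using that F by blast
qed

text \<open>A one-sided Weyl integration formula. Since \<open>\<psi>\<close> bounds the integrand
  uniformly in \<open>H\<close>, the orthogonal coordinates contribute only a constant, and
  \<open>K\<close> is fixed before \<open>f\<close> and \<open>\<psi>\<close>.\<close>

theorem nn_integral_pos_def_le: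
  obtains K where "0 \<le> K"
    "\<And>f \<psi>. f \<in> borel_measurable borel \<Longrightarrow> \<psi> \<in> borel_measurable borel \<Longrightarrow>
      (\<And>H d. orthogonal_matrix H \<Longrightarrow> d \<in> chamber \<Longrightarrow>
        f (transpose H ** diag d ** H) * ennreal (vandermonde d) \<le> \<psi> d) \<Longrightarrow>
      (\<integral>\<^sup>+V. f V * indicator {V. pos_def V} V \<partial>sym_lborel)
        \<le> ennreal K * (\<integral>\<^sup>+d. \<psi> d * indicator chamber d \<partial>(lborel :: (real^'k::{finite,linorder}) measure))"
proof -
  obtain F where F: "finite F" "\<And>H0. H0 \<in> F \<Longrightarrow> orthogonal_matrix H0"
    "\<And>V :: real^'k::_^'k::_. pos_def V \<Longrightarrow>
      \<exists>H0\<in>F. \<exists>z. dg z \<in> chamber \<and> (\<forall>p. lo p < hi p \<longrightarrow> \<bar>z $ p\<bar> \<le> 3) \<and> upper V = sym_chart H0 z"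
    using chart_cover by blast
  let ?O = "{z :: real^('k sidx). \<forall>p. lo p < hi p \<longrightarrow> \<bar>z $ p\<bar> \<le> 3}"
  define S where "S = {z :: real^('k sidx). dg z \<in> chamber} \<inter> ?O"
  define L where "L = (fact CARD('k sidx) * (2 * (real CARD('k))\<^sup>2) ^ CARD('k sidx))\<^sup>2"
  have L: "0 \<le> L" by (simp add: L_def)
  have [measurable]: "S \<in> sets borel" unfolding S_def by measurable
  have cont: "continuous_on UNIV (sym_chart H0)" if "H0 \<in> F" for H0
    using sym_chart_has_derivative[OF F(2)[OF that]]
    by (intro continuous_at_imp_continuous_on ballI) (rule has_derivative_continuous)
  define K where "K = real (card F) * (L * 6 ^ card {p :: 'k sidx. lo p < hi p})"
  have "(\<integral>\<^sup>+V. f V * indicator {V. pos_def V} V \<partial>sym_lborel) \<le> ennreal K * (\<integral>\<^sup>+d. \<psi> d * indicator chamber d \<partial>lborel)"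
    if [measurable]: "f \<in> borel_measurable borel" and \<psi> [measurable]: "\<psi> \<in> borel_measurable borel"
      and f: "\<And>H d. orthogonal_matrix H \<Longrightarrow> d \<in> chamber \<Longrightarrow> f (transpose H ** diag d ** H) * ennreal (vandermonde d) \<le> \<psi> d"
    for f and \<psi> :: "real^'k::_ \<Rightarrow> ennreal"
  proof -
    let ?P = "{z :: real^('k sidx). pos_def (symm z)}"
    have P: "?P \<in> sets borel"
      using measurable_sets[OF measurable_symm pos_def_sets] by (simp add: vimage_def)
    have "(\<integral>\<^sup>+V. f V * indicator {V. pos_def V} V \<partial>sym_lborel) = (\<integral>\<^sup>+z. f (symm z) * indicator ?P z \<partial>lborel)"
      unfolding sym_lborel_eq by (subst nn_integral_distr) (auto intro!: nn_integral_cong split: split_indicator)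
    also have "\<dots> \<le> (\<Sum>H0\<in>F. \<integral>\<^sup>+z. f (symm (sym_chart H0 z)) * ennreal (L * vandermonde (dg z)) * indicator S z \<partial>lborel)"
    proof (rule nn_integral_image_le[where g'="\<lambda>H0 z. conjugation (chart H0 z) \<circ> stretch (dg z) \<circ> tangent z"])
      show "finite F" "?P \<in> sets borel" by fact+
      show "(sym_chart H0 has_derivative conjugation (chart H0 z) \<circ> stretch (dg z) \<circ> tangent z) (at z)" if "H0 \<in> F" for H0 z
        using F(2)[OF that] by (rule sym_chart_has_derivative)
      show "sym_chart H0 \<in> borel_measurable borel" if "H0 \<in> F" for H0
        using cont[OF that] by (rule borel_measurable_continuous_onI)
      show "\<bar>det (matrix (conjugation (chart H0 z) \<circ> stretch (dg z) \<circ> tangent z))\<bar> \<le> L * vandermonde (dg z)"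
        if "H0 \<in> F" "z \<in> S" for H0 z
        using det_sym_chart_le[OF orthogonal_chart[OF F(2)[OF that(1)]], of z "dg z" z] vandermonde_nonneg[of "dg z"] that(2)
        by (simp add: L_def S_def)
      show "?P \<subseteq> (\<Union>H0\<in>F. sym_chart H0 ` S)"
      proof
        fix z assume "z \<in> ?P"
        then show "z \<in> (\<Union>H0\<in>F. sym_chart H0 ` S)"
          using F(3)[of "symm z"] by (fastforce simp: S_def)
      qed
    qed measurable
    also have "\<dots> \<le> (\<Sum>H0\<in>F. \<integral>\<^sup>+z. ennreal L * (\<psi> (dg z) * indicator chamber (dg z) * indicator ?O z) \<partial>lborel)"
    proof (intro sum_mono nn_integral_mono)
      fix H0 z assume "H0 \<in> F"
      show "f (symm (sym_chart H0 z)) * ennreal (L * vandermonde (dg z)) * indicator S z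
        \<le> ennreal L * (\<psi> (dg z) * indicator chamber (dg z) * indicator ?O z)"
      proof (cases "z \<in> S")
        case True
        then have "f (symm (sym_chart H0 z)) * ennreal (vandermonde (dg z)) \<le> \<psi> (dg z)"
          unfolding symm_sym_chart using F(2)[OF \<open>H0 \<in> F\<close>] by (intro f orthogonal_chart) (auto simp: S_def)
        then have "ennreal L * (f (symm (sym_chart H0 z)) * ennreal (vandermonde (dg z))) \<le> ennreal L * \<psi> (dg z)"
          by (rule mult_left_mono) simp
        then show ?thesis
          using True L vandermonde_nonneg[of "dg z"] by (simp add: S_def ennreal_mult mult_ac)
      qed simp
    qed
    also have "\<dots> = (\<Sum>H0\<in>F. ennreal L * (ennreal (6 ^ card {p :: 'k sidx. lo p < hi p}) * (\<integral>\<^sup>+d. \<psi> d * indicator chamber d \<partial>lborel)))"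
      using dg_pushforward[of "\<lambda>d. \<psi> d * indicator chamber d"] by (simp add: nn_integral_cmult)
    also have "\<dots> = ennreal K * (\<integral>\<^sup>+d. \<psi> d * indicator chamber d \<partial>lborel)"
      using L by (simp add: K_def ennreal_mult mult.assoc flip: ennreal_of_nat_eq_real_of_nat)
    finally show ?thesis .
  qed
  moreover have "0 \<le> K" using L by (simp add: K_def)
  ultimately show ?thesis using that by blast
qed

section \<open>Gaussian averages\<close>

text \<open>Uniqueness of Haar measure: both measures are translation invariant and agree on the unit ball.\<close>

lemma lborel_orthogonal:
  fixes L :: "'a::euclidean_space \<Rightarrow> 'a"
  assumes "orthogonal_transformation L"
  shows "distr lborel borel L = lborel"
proof -
  have L: "linear L" and nL: "norm (L x) = norm x" for x
    using assms by (auto simp: orthogonal_transformation)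
  have [measurable]: "L \<in> borel_measurable borel"
    using L by (intro borel_measurable_continuous_onI linear_continuous_on) (simp add: linear_conv_bounded_linear)
  obtain L' where L': "\<And>x. L (L' x) = x"
    using orthogonal_transformation_surj[OF assms] by (metis surj_f_inv_f)
  let ?N = "distr lborel borel L"
  have trans: "(\<integral>\<^sup>+y. f (y + c) \<partial>?N) = (\<integral>\<^sup>+y. f y \<partial>?N)" if [measurable]: "f \<in> borel_measurable borel" for f :: "'a \<Rightarrow> ennreal" and c
  proof -
    have "(\<integral>\<^sup>+y. f (y + c) \<partial>?N) = (\<integral>\<^sup>+x. f (L (L' c + x)) \<partial>lborel)"
      by (subst nn_integral_distr) (auto simp: linear_add[OF L] L' add.commute)
    also have "\<dots> = (\<integral>\<^sup>+x. f (L x) \<partial>distr lborel borel ((+) (L' c)))"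
      by (subst nn_integral_distr) auto
    also have "\<dots> = (\<integral>\<^sup>+y. f y \<partial>?N)"
      by (simp add: lborel_distr_plus nn_integral_distr)
    finally show ?thesis .
  qed
  have trans': "(\<integral>\<^sup>+y. f (c + y) \<partial>lborel) = (\<integral>\<^sup>+y. f y \<partial>lborel)" if [measurable]: "f \<in> borel_measurable borel" for f :: "'a \<Rightarrow> ennreal" and c
  proof -
    have "(\<integral>\<^sup>+y. f (c + y) \<partial>lborel) = (\<integral>\<^sup>+y. f y \<partial>distr lborel borel ((+) c))"
      by (subst nn_integral_distr) auto
    then show ?thesis by (simp add: lborel_distr_plus)
  qed
  have emb: "emeasure ?N S = emeasure lborel (L -` S)" if "S \<in> sets borel" for S
    using that by (simp add: emeasure_distr)
  let ?U = "ball (0::'a) 1"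
  have ball: "emeasure ?N ?U = emeasure lborel ?U"
    by (subst emb) (auto simp: nL intro!: arg_cong[where f="emeasure lborel"])
  have sf: "sigma_finite_measure ?N"
  proof
    let ?A = "\<lambda>n::nat. ball (0::'a) (real n)"
    have "emeasure ?N (?A n) \<noteq> \<infinity>" for n
    proof -
      have "L -` ?A n = ?A n" by (auto simp: nL)
      then show ?thesis
        using emeasure_bounded_finite[of "?A n"] by (simp add: emb)
    qed
    moreover have "(\<Union>n. ?A n) = UNIV" using reals_Archimedean2 by fastforce
    ultimately show "\<exists>A::'a set set. countable A \<and> A \<subseteq> sets ?N \<and> \<Union> A = space ?N \<and> (\<forall>a\<in>A. emeasure ?N a \<noteq> \<infinity>)"
      by (intro exI[of _ "range ?A"]) auto
  qed
  interpret N: sigma_finite_measure ?N by (rule sf)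
  interpret P: pair_sigma_finite "lborel :: 'a measure" ?N
    by (simp add: pair_sigma_finite.intro sf lborel.sigma_finite_measure_axioms)
  have pos: "0 < emeasure lborel ?U" and fin: "emeasure lborel ?U < \<infinity>"
    by (auto simp: emeasure_ball)
  show ?thesis
  proof (rule measure_eqI)
    fix B assume "B \<in> sets ?N"
    then have [measurable]: "B \<in> sets borel" by simp
    define u :: "'a \<Rightarrow> ennreal" where "u = indicator ?U"
    define b :: "'a \<Rightarrow> ennreal" where "b = indicator B"
    have [measurable]: "u \<in> borel_measurable borel" "b \<in> borel_measurable borel"
      by (auto simp: u_def b_def intro!: borel_measurable_indicator)
    have iu: "(\<integral>\<^sup>+x. u x \<partial>lborel) = emeasure lborel ?U" "(\<integral>\<^sup>+x. u x \<partial>?N) = emeasure lborel ?U"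
      and ib: "(\<integral>\<^sup>+x. b x \<partial>lborel) = emeasure lborel B" "(\<integral>\<^sup>+x. b x \<partial>?N) = emeasure ?N B"
      by (simp_all add: u_def b_def ball[symmetric])
    have um: "u (- y) = u y" for y by (simp add: u_def indicator_def)
    \<comment> \<open>The double integral of \<open>u x * b (y + x)\<close> is evaluated in both
      orders. Symmetry of the ball under negation makes the integral of \<open>u (x - y)\<close>
      over \<open>y\<close> equal to the mass of the ball.\<close>
    have "emeasure lborel ?U * emeasure ?N B = (\<integral>\<^sup>+x. u x * (\<integral>\<^sup>+y. b (y + x) \<partial>?N) \<partial>lborel)"
      by (simp add: trans[of b] ib iu nn_integral_multc)
    also have "\<dots> = (\<integral>\<^sup>+x. (\<integral>\<^sup>+y. u x * b (y + x) \<partial>?N) \<partial>lborel)"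
      by (intro nn_integral_cong nn_integral_cmult[symmetric]) measurable
    also have "\<dots> = (\<integral>\<^sup>+y. (\<integral>\<^sup>+x. u x * b (y + x) \<partial>lborel) \<partial>?N)"
      by (rule P.Fubini'[symmetric]) measurable
    also have "\<dots> = (\<integral>\<^sup>+y. (\<integral>\<^sup>+x. u (x - y) * b x \<partial>lborel) \<partial>?N)"
    proof (rule nn_integral_cong)
      fix y
      have "(\<integral>\<^sup>+x. u (y + x - y) * b (y + x) \<partial>lborel) = (\<integral>\<^sup>+x. u (x - y) * b x \<partial>lborel)"
        by (rule trans') measurable
      then show "(\<integral>\<^sup>+x. u x * b (y + x) \<partial>lborel) = (\<integral>\<^sup>+x. u (x - y) * b x \<partial>lborel)"
        by simp
    qed
    also have "\<dots> = (\<integral>\<^sup>+x. (\<integral>\<^sup>+y. u (x - y) * b x \<partial>?N) \<partial>lborel)"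
      by (rule P.Fubini') measurable
    also have "\<dots> = (\<integral>\<^sup>+x. emeasure lborel ?U * b x \<partial>lborel)"
    proof (rule nn_integral_cong)
      fix x
      have "(\<integral>\<^sup>+y. u (x - y) * b x \<partial>?N) = (\<integral>\<^sup>+y. u (x - y) \<partial>?N) * b x"
        by (rule nn_integral_multc) measurable
      also have "(\<integral>\<^sup>+y. u (x - y) \<partial>?N) = (\<integral>\<^sup>+y. u (x - (y + x)) \<partial>?N)"
        by (rule trans[symmetric]) measurable
      also have "\<dots> = emeasure lborel ?U"
        by (simp add: um iu)
      finally show "(\<integral>\<^sup>+y. u (x - y) * b x \<partial>?N) = emeasure lborel ?U * b x" .
    qed
    also have "\<dots> = emeasure lborel ?U * emeasure lborel B"
      by (simp add: nn_integral_cmult ib)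
    finally show "emeasure ?N B = emeasure lborel B"
      using pos fin by (auto simp: ennreal_mult_cancel_left)
  qed simp
qed

lemma nn_integral_orthogonal:
  fixes H :: "real^'n^'n"
  assumes "orthogonal_matrix H" and [measurable]: "f \<in> borel_measurable borel"
  shows "(\<integral>\<^sup>+y. f (H *v y) \<partial>lborel) = (\<integral>\<^sup>+y. f y \<partial>lborel)"
proof -
  have "orthogonal_transformation ((*v) H)"
    using assms by (simp add: orthogonal_transformation_matrix)
  from lborel_orthogonal[OF this] have "(\<integral>\<^sup>+y. f y \<partial>lborel) = (\<integral>\<^sup>+y. f y \<partial>distr lborel borel ((*v) H))" by simp
  also have "\<dots> = (\<integral>\<^sup>+y. f (H *v y) \<partial>lborel)"
    by (subst nn_integral_distr) (auto intro!: borel_measurable_continuous_onI linear_continuous_on)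
  finally show ?thesis by simp
qed

section \<open>Normal densities in spectral coordinates\<close>

lemma matrix_inv_eqI:
  assumes "A ** B = mat 1" "B ** A = mat (1::real)"
  shows "matrix_inv A = (B :: real^'n^'n)"
proof -
  have "A ** matrix_inv A = mat 1"
    using someI[of "\<lambda>A'. A ** A' = mat 1 \<and> A' ** A = mat 1" B] assms by (simp add: matrix_inv_def)
  then show ?thesis
    by (metis assms(2) matrix_mul_assoc matrix_mul_lid matrix_mul_rid)
qed

lemma det_diag: "det (diag d) = (\<Prod>i\<in>UNIV. d $ i)"
  by (subst det_diagonal) (auto simp: diag_def)

lemma det_conjugate_diag:
  assumes "orthogonal_matrix (H :: real^'n^'n)"
  shows "det (transpose H ** diag d ** H) = (\<Prod>i\<in>UNIV. d $ i)"
proof -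
  have "det H * det H = 1"
    using det_orthogonal_matrix[OF assms] by auto
  then show ?thesis by (simp add: det_mul det_diag mult_ac)
qed

lemma matrix_inv_conjugate_diag:
  assumes H: "orthogonal_matrix (H :: real^'n^'n)" and d: "\<And>i. d $ i \<noteq> 0"
  shows "matrix_inv (transpose H ** diag d ** H) = transpose H ** diag (\<chi> i. inverse (d $ i)) ** H"
proof -
  have dd: "diag a ** diag c = diag (\<chi> i. a $ i * c $ i)" for a c :: "real^'n"
    by (simp add: matrix_matrix_mult_def diag_def vec_eq_iff if_distrib[of "\<lambda>x. x * _"] if_distrib[of "\<lambda>x. _ * x"] cong: if_cong)
  have id: "diag (\<chi> i. 1) = (mat 1 :: real^'n^'n)"
    by (simp add: diag_def mat_def vec_eq_iff)
  have e: "(transpose H ** A ** H) ** (transpose H ** B ** H) = transpose H ** (A ** B) ** H" for A B :: "real^'n^'n"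
  proof -
    have "(transpose H ** A ** H) ** (transpose H ** B ** H) = transpose H ** A ** (H ** transpose H) ** B ** H"
      by (simp add: matrix_mul_assoc)
    then show ?thesis by (simp add: orthogonal_matrix_inverse[OF H] matrix_mul_assoc)
  qed
  show ?thesis
    by (rule matrix_inv_eqI) (simp_all add: e dd d id orthogonal_matrix_inverse[OF H])
qed

lemma mvn_density_conjugate_diag:
  fixes H :: "real^'n^'n"
  assumes H: "orthogonal_matrix H" and d: "\<And>i. 0 < d $ i"
  shows "mvn_density \<mu> (transpose H ** diag d ** H) y
    = (\<Prod>i\<in>UNIV. normal_density ((H *v \<mu>) $ i) (sqrt (d $ i)) ((H *v y) $ i))"
proof -
  have d': "d $ i \<noteq> 0" for i using d[of i] by simp
  define r where "r i = (H *v (y - \<mu>)) $ i" for i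
  have quad: "(y - \<mu>) \<bullet> (matrix_inv (transpose H ** diag d ** H) *v (y - \<mu>)) = (\<Sum>i\<in>UNIV. (r i)\<^sup>2 / d $ i)"
    unfolding matrix_inv_conjugate_diag[OF H d'] inner_conjugate_diag
    by (simp add: r_def divide_inverse mult.commute)
  have sq: "sqrt (prod f A) = (\<Prod>i\<in>A. sqrt (f i))" for f :: "'n \<Rightarrow> real" and A
    by (induction A rule: infinite_finite_induct) (auto simp: real_sqrt_mult)
  have "normal_density ((H *v \<mu>) $ i) (sqrt (d $ i)) ((H *v y) $ i) = exp (- ((r i)\<^sup>2 / d $ i) / 2) / sqrt (2 * pi * d $ i)" for i
    using d[of i] by (simp add: normal_density_def r_def matrix_vector_mult_diff_distrib less_imp_le mult.commute)
  then have "(\<Prod>i\<in>UNIV. normal_density ((H *v \<mu>) $ i) (sqrt (d $ i)) ((H *v y) $ i))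
      = exp (\<Sum>i\<in>UNIV. - ((r i)\<^sup>2 / d $ i) / 2) / sqrt (\<Prod>i\<in>UNIV. 2 * pi * d $ i)"
    by (simp add: prod_dividef exp_sum sq)
  also have "(\<Sum>i\<in>UNIV. - ((r i)\<^sup>2 / d $ i) / 2) = - (\<Sum>i\<in>UNIV. (r i)\<^sup>2 / d $ i) / 2"
    by (simp only: sum_negf sum_divide_distrib[symmetric])
  also have "(\<Prod>i\<in>UNIV. 2 * pi * d $ i) = (2 * pi) ^ CARD('n) * (\<Prod>i\<in>UNIV. d $ i)"
    by (simp add: prod.distrib)
  finally show ?thesis
    unfolding mvn_density_def quad det_conjugate_diag[OF H] by simp
qed

lemma mvn_density_shift: "mvn_density (\<mu> + e) S (y + e) = mvn_density \<mu> S y"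
  by (simp add: mvn_density_def)

lemma mvn_density_nonneg:
  assumes "pos_def (S :: real^'n::{finite,linorder}^'n::_)"
  shows "0 \<le> mvn_density \<mu> S y"
proof -
  obtain H d where "orthogonal_matrix H" "S = transpose H ** diag d ** H" "\<And>i. 0 < d $ i"
    using pos_def_spectral[OF assms] by metis
  then show ?thesis
    by (simp add: mvn_density_conjugate_diag prod_nonneg)
qed

lemma nn_integral_mvn_prod:
  fixes H :: "real^'n^'n"
  assumes H: "orthogonal_matrix H" and d: "\<And>i. 0 < d $ i" and f [measurable]: "\<And>i. f i \<in> borel_measurable borel"
  shows "(\<integral>\<^sup>+y. ennreal (mvn_density \<mu> (transpose H ** diag d ** H) y) * (\<Prod>i\<in>UNIV. f i ((H *v y) $ i)) \<partial>lborel)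
    = (\<Prod>i\<in>UNIV. \<integral>\<^sup>+t. ennreal (normal_density ((H *v \<mu>) $ i) (sqrt (d $ i)) t) * f i t \<partial>lborel)"
proof -
  let ?g = "\<lambda>i t. ennreal (normal_density ((H *v \<mu>) $ i) (sqrt (d $ i)) t) * f i t"
  have "(\<integral>\<^sup>+y. ennreal (mvn_density \<mu> (transpose H ** diag d ** H) y) * (\<Prod>i\<in>UNIV. f i ((H *v y) $ i)) \<partial>lborel)
      = (\<integral>\<^sup>+y. (\<Prod>i\<in>UNIV. ?g i ((H *v y) $ i)) \<partial>lborel)"
    by (simp add: mvn_density_conjugate_diag[OF H d] prod.distrib prod_ennreal[symmetric])
  also have "\<dots> = (\<integral>\<^sup>+y. (\<Prod>i\<in>UNIV. ?g i (y $ i)) \<partial>lborel)"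
    using H by (rule nn_integral_orthogonal) measurable
  also have "\<dots> = (\<Prod>i\<in>UNIV. \<integral>\<^sup>+t. ?g i t \<partial>lborel)"
    by (rule nn_integral_lborel_vec_prod) measurable
  finally show ?thesis .
qed

lemma nn_integral_normal_density: "0 < \<sigma> \<Longrightarrow> (\<integral>\<^sup>+t. ennreal (normal_density \<mu> \<sigma> t) \<partial>lborel) = 1"
  by (subst nn_integral_eq_integral) auto

lemma nn_integral_mvn_density:
  assumes "pos_def (S :: real^'n::{finite,linorder}^'n::_)"
  shows "(\<integral>\<^sup>+y. ennreal (mvn_density \<mu> S y) \<partial>lborel) = 1"
proof -
  obtain H d where Hd: "orthogonal_matrix H" "S = transpose H ** diag d ** H" "\<And>i. 0 < d $ i"
    using pos_def_spectral[OF assms] by metis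
  show ?thesis
    using nn_integral_mvn_prod[OF Hd(1,3), of "\<lambda>_ _. 1" \<mu>] Hd by (simp add: nn_integral_normal_density)
qed

section \<open>Decay of negative moments under normal averaging\<close>

lemma nn_integral_abs_powr:
  assumes a: "a > -1" and c: "0 \<le> c"
  shows "(\<integral>\<^sup>+x. ennreal (\<bar>x\<bar> powr a) * indicator {-c..c} x \<partial>lborel) \<le> ennreal (2 * (c powr (a + 1) / (a + 1)))"
proof -
  let ?f = "\<lambda>x::real. ennreal (\<bar>x\<bar> powr a) * indicator {0..c} x"
  have I: "(\<integral>\<^sup>+x. ?f x \<partial>lborel) = ennreal (c powr (a + 1) / (a + 1))"
  proof -
    have "((\<lambda>x. \<bar>x\<bar> powr a) has_integral (c powr (a + 1) / (a + 1))) {0..c}"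
      using has_integral_powr_from_0[OF a c] by (rule has_integral_eq[rotated]) auto
    then have "(\<integral>\<^sup>+x. ennreal (indicator {0..c} x * \<bar>x\<bar> powr a) \<partial>lborel) = ennreal (c powr (a + 1) / (a + 1))"
    proof (intro nn_integral_has_integral_lborel)
      assume "((\<lambda>x. \<bar>x\<bar> powr a) has_integral (c powr (a + 1) / (a + 1))) {0..c}"
      moreover have "(\<lambda>x. indicator {0..c} x * \<bar>x\<bar> powr a) = (\<lambda>x. if x \<in> {0..c} then \<bar>x\<bar> powr a else 0)"
        by (auto simp: indicator_def)
      ultimately show "((\<lambda>x. indicator {0..c} x * \<bar>x\<bar> powr a) has_integral (c powr (a + 1) / (a + 1))) UNIV"
        by (simp only: has_integral_restrict_UNIV)
    qed auto
    then show ?thesis by (simp add: ennreal_mult' ennreal_indicator mult.commute)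
  qed
  have "(\<integral>\<^sup>+x. ennreal (\<bar>x\<bar> powr a) * indicator {-c..c} x \<partial>lborel) \<le> (\<integral>\<^sup>+x. ?f x + ?f (0 + (-1) * x) \<partial>lborel)"
    by (intro nn_integral_mono) (auto simp: indicator_def)
  also have "\<dots> = (\<integral>\<^sup>+x. ?f x \<partial>lborel) + (\<integral>\<^sup>+x. ?f (0 + (-1) * x) \<partial>lborel)"
    by (rule nn_integral_add) measurable
  also have "(\<integral>\<^sup>+x. ?f (0 + (-1) * x) \<partial>lborel) = (\<integral>\<^sup>+x. ?f x \<partial>lborel)"
    using nn_integral_real_affine[of ?f "-1" 0] by simp
  also have "(\<integral>\<^sup>+x. ?f x \<partial>lborel) + (\<integral>\<^sup>+x. ?f x \<partial>lborel) = ennreal (2 * (c powr (a + 1) / (a + 1)))"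
    using a unfolding I by (subst ennreal_plus[symmetric]) auto
  finally show ?thesis .
qed

lemma one_plus_powr_le:
  fixes d \<alpha> :: real
  assumes "1 \<le> d" "0 \<le> \<alpha>" "\<alpha> \<le> 1"
  shows "d powr (- \<alpha>) \<le> 2 * (1 + d) powr (- \<alpha>)"
proof -
  have "(1 + d) powr \<alpha> \<le> (2 * d) powr \<alpha>" using assms by (intro powr_mono2) auto
  also have "\<dots> = 2 powr \<alpha> * d powr \<alpha>" using assms by (simp add: powr_mult)
  also have "2 powr \<alpha> \<le> 2 powr 1" using assms by (intro powr_mono) auto
  finally have "(1 + d) powr \<alpha> \<le> 2 * d powr \<alpha>" using assms by (simp add: mult_right_mono)
  then show ?thesis using assms by (simp add: powr_minus field_simps)
qed

text \<open>For \<open>d \<ge> 1\<close> the line is split at \<open>sqrt d\<close>. Inside, the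
  density is at most \<open>d powr (-1/2)\<close> whatever the mean, and
  \<open>\<bar>x\<bar> powr (-2 \<alpha>)\<close> integrates to order
  \<open>d powr (1/2 - \<alpha>)\<close>, which needs \<open>\<alpha> < 1/2\<close>. Outside, the
  weight is at most \<open>d powr (-\<alpha>)\<close>. For \<open>d < 1\<close> the right-hand side
  exceeds 1.\<close>

lemma normal_density_shrink:
  assumes \<alpha>: "0 \<le> \<alpha>" "\<alpha> < 1/2" and d: "0 < d"
  shows "(\<integral>\<^sup>+x. ennreal (normal_density \<mu> (sqrt d) x) * ennreal ((1 + x\<^sup>2) powr (- \<alpha>)) \<partial>lborel)
    \<le> ennreal (2 * (1 + 2 / (1 - 2 * \<alpha>)) * (1 + d) powr (- \<alpha>))"
proof (cases "1 \<le> d")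
  case False
  have "(1 + x\<^sup>2) powr (- \<alpha>) \<le> 1" for x :: real
    using \<alpha> by (auto simp: powr_minus inverse_le_1_iff intro: ge_one_powr_ge_zero)
  then have "ennreal (normal_density \<mu> (sqrt d) x) * ennreal ((1 + x\<^sup>2) powr (- \<alpha>)) \<le> ennreal (normal_density \<mu> (sqrt d) x)" for x
    by (simp flip: ennreal_mult add: mult_left_le ennreal_leI)
  then have "(\<integral>\<^sup>+x. ennreal (normal_density \<mu> (sqrt d) x) * ennreal ((1 + x\<^sup>2) powr (- \<alpha>)) \<partial>lborel)
      \<le> (\<integral>\<^sup>+x. ennreal (normal_density \<mu> (sqrt d) x) \<partial>lborel)"
    by (rule nn_integral_mono)
  also have "\<dots> = 1" using d by (simp add: nn_integral_normal_density)
  also have "\<dots> \<le> ennreal (2 * (1 + 2 / (1 - 2 * \<alpha>)) * (1 + d) powr (- \<alpha>))"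
  proof -
    have "(2::real) powr (- 1) \<le> 2 powr (- \<alpha>)" using \<alpha> by (intro powr_mono) auto
    also have "\<dots> \<le> (1 + d) powr (- \<alpha>)" using \<alpha> d False by (intro powr_mono2') auto
    finally have "1 \<le> 2 * (1 + d) powr (- \<alpha>)" by (simp add: powr_minus)
    also have "\<dots> \<le> 2 * (1 + 2 / (1 - 2 * \<alpha>)) * (1 + d) powr (- \<alpha>)"
      using \<alpha> by (intro mult_right_mono) auto
    finally show ?thesis by simp
  qed
  finally show ?thesis .
next
  case True
  let ?n = "normal_density \<mu> (sqrt d)"
  \<comment> \<open>The point 0 is left out because \<open>powr\<close> takes the default value 0
    there, for which the bound can fail; it is a null set.\<close>
  have pt: "ennreal (?n x) * ennreal ((1 + x\<^sup>2) powr (- \<alpha>))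
      \<le> ennreal (d powr (- 1/2)) * (ennreal (\<bar>x\<bar> powr (- (2 * \<alpha>))) * indicator {- sqrt d..sqrt d} x) + ennreal (d powr (- \<alpha>)) * ennreal (?n x)"
    if "x \<noteq> 0" for x
  proof (cases "\<bar>x\<bar> \<le> sqrt d")
    case le: True
    have "?n x \<le> d powr (- 1/2)"
    proof -
      have "?n x \<le> 1 / sqrt (2 * pi * (sqrt d)\<^sup>2) * 1"
        unfolding normal_density_def by (intro mult_left_mono) auto
      also have "\<dots> \<le> 1 / sqrt d"
        using d pi_gt3 by (auto intro!: divide_left_mono real_sqrt_le_mono)
      also have "\<dots> = d powr (- 1/2)"
        using d by (simp add: powr_half_sqrt powr_minus_divide)
      finally show ?thesis .
    qed
    moreover have "(1 + x\<^sup>2) powr (- \<alpha>) \<le> \<bar>x\<bar> powr (- (2 * \<alpha>))"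
    proof -
      have "(1 + x\<^sup>2) powr (- \<alpha>) \<le> (\<bar>x\<bar>\<^sup>2) powr (- \<alpha>)"
        using \<alpha> \<open>x \<noteq> 0\<close> by (intro powr_mono2') auto
      also have "\<bar>x\<bar>\<^sup>2 = \<bar>x\<bar> powr 2" using \<open>x \<noteq> 0\<close> powr_realpow[of "\<bar>x\<bar>" 2] by simp
      finally show ?thesis unfolding powr_powr by simp
    qed
    ultimately have "?n x * (1 + x\<^sup>2) powr (- \<alpha>) \<le> d powr (- 1/2) * \<bar>x\<bar> powr (- (2 * \<alpha>))"
      by (intro mult_mono) auto
    then have "ennreal (?n x) * ennreal ((1 + x\<^sup>2) powr (- \<alpha>)) \<le> ennreal (d powr (- 1/2)) * ennreal (\<bar>x\<bar> powr (- (2 * \<alpha>)))"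
      by (simp flip: ennreal_mult add: ennreal_leI)
    moreover have "indicator {- sqrt d..sqrt d} x = (1 :: ennreal)" using le by (auto simp: abs_le_iff)
    ultimately show ?thesis by (simp add: add_increasing2)
  next
    case False
    have "d \<le> x\<^sup>2" using False d by (metis abs_ge_zero linear power2_abs real_sqrt_abs real_sqrt_le_iff)
    then have "(1 + x\<^sup>2) powr (- \<alpha>) \<le> d powr (- \<alpha>)" using \<alpha> d by (intro powr_mono2') auto
    then have "?n x * (1 + x\<^sup>2) powr (- \<alpha>) \<le> ?n x * d powr (- \<alpha>)"
      by (intro mult_left_mono) auto
    then have "ennreal (?n x) * ennreal ((1 + x\<^sup>2) powr (- \<alpha>)) \<le> ennreal (d powr (- \<alpha>)) * ennreal (?n x)"
      by (subst mult.commute[of "ennreal (d powr (- \<alpha>))"]) (simp flip: ennreal_mult add: ennreal_leI)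
    then show ?thesis by (rule order_trans) simp
  qed
  have "(\<integral>\<^sup>+x. ennreal (?n x) * ennreal ((1 + x\<^sup>2) powr (- \<alpha>)) \<partial>lborel)
      \<le> (\<integral>\<^sup>+x. ennreal (d powr (- 1/2)) * (ennreal (\<bar>x\<bar> powr (- (2 * \<alpha>))) * indicator {- sqrt d..sqrt d} x) + ennreal (d powr (- \<alpha>)) * ennreal (?n x) \<partial>lborel)"
    by (rule nn_integral_mono_AE, rule AE_mp[OF AE_lborel_singleton[of 0]]) (use pt in auto)
  also have "\<dots> = ennreal (d powr (- 1/2)) * (\<integral>\<^sup>+x. ennreal (\<bar>x\<bar> powr (- (2 * \<alpha>))) * indicator {- sqrt d..sqrt d} x \<partial>lborel)
      + ennreal (d powr (- \<alpha>)) * (\<integral>\<^sup>+x. ennreal (?n x) \<partial>lborel)"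
    by (subst nn_integral_add) (auto simp: nn_integral_cmult)
  also have "\<dots> \<le> ennreal (d powr (- 1/2)) * ennreal (2 * (sqrt d powr (- (2 * \<alpha>) + 1) / (- (2 * \<alpha>) + 1))) + ennreal (d powr (- \<alpha>)) * 1"
    using \<alpha> d by (intro add_mono mult_left_mono nn_integral_abs_powr) (auto simp: nn_integral_normal_density)
  also have "\<dots> = ennreal (d powr (- 1/2) * (2 * (sqrt d powr (- (2 * \<alpha>) + 1) / (- (2 * \<alpha>) + 1))) + d powr (- \<alpha>))"
    using \<alpha> by (subst ennreal_plus) (auto simp flip: ennreal_mult)
  also have "d powr (- 1/2) * (2 * (sqrt d powr (- (2 * \<alpha>) + 1) / (- (2 * \<alpha>) + 1))) + d powr (- \<alpha>)
      = (1 + 2 / (1 - 2 * \<alpha>)) * d powr (- \<alpha>)"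
  proof -
    have "d powr (- 1/2) * sqrt d powr (- (2 * \<alpha>) + 1) = d powr (- \<alpha>)"
      using d by (simp add: powr_half_sqrt[symmetric] powr_powr flip: powr_add) (simp add: field_simps)
    then have "d powr (- 1/2) * (2 * (sqrt d powr (- (2 * \<alpha>) + 1) / (- (2 * \<alpha>) + 1))) = 2 / (1 - 2 * \<alpha>) * d powr (- \<alpha>)"
      by (simp add: mult_ac)
    then show ?thesis by (simp add: distrib_right)
  qed
  also have "ennreal ((1 + 2 / (1 - 2 * \<alpha>)) * d powr (- \<alpha>)) \<le> ennreal ((1 + 2 / (1 - 2 * \<alpha>)) * (2 * (1 + d) powr (- \<alpha>)))"
    using \<alpha> True by (intro ennreal_leI mult_left_mono one_plus_powr_le) auto
  finally show ?thesis by (simp only: mult_ac)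
qed

lemma prod_mono_ennreal: "(\<And>i. i \<in> A \<Longrightarrow> f i \<le> g i) \<Longrightarrow> prod f A \<le> prod g A" for f g :: "'i \<Rightarrow> ennreal"
  by (induction A rule: infinite_finite_induct) (auto intro: mult_mono)

text \<open>One application of the one-dimensional bound per spectral coordinate. Staying below a
  fixed \<open>a < 1/2\<close> makes the constant uniform in the exponents; mean, rotation and
  variances do not affect it.\<close>

lemma mvn_shrink:
  assumes a: "a < 1/2"
  obtains c where "0 \<le> c"
    "\<And>(H :: real^'n::finite^'n) d \<mu> \<alpha>. orthogonal_matrix H \<Longrightarrow> (\<And>i. 0 < d $ i) \<Longrightarrow> (\<And>i. 0 \<le> \<alpha> i) \<Longrightarrow> (\<And>i. \<alpha> i \<le> a) \<Longrightarrow>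
      (\<integral>\<^sup>+y. ennreal (mvn_density \<mu> (transpose H ** diag d ** H) y) * ennreal (\<Prod>i\<in>UNIV. (1 + ((H *v y) $ i)\<^sup>2) powr (- \<alpha> i)) \<partial>lborel)
      \<le> ennreal (c * (\<Prod>i\<in>UNIV. (1 + d $ i) powr (- \<alpha> i)))"
proof -
  define c where "c = 2 * (1 + 2 / (1 - 2 * a))"
  have c0: "0 \<le> c" using a by (simp add: c_def)
  have "(\<integral>\<^sup>+y. ennreal (mvn_density \<mu> (transpose H ** diag d ** H) y) * ennreal (\<Prod>i\<in>UNIV. (1 + ((H *v y) $ i)\<^sup>2) powr (- \<alpha> i)) \<partial>lborel)
      \<le> ennreal (c ^ CARD('n) * (\<Prod>i\<in>UNIV. (1 + d $ i) powr (- \<alpha> i)))"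
    if H: "orthogonal_matrix H" and d: "\<And>i. 0 < d $ i" and \<alpha>: "\<And>i. 0 \<le> \<alpha> i" "\<And>i. \<alpha> i \<le> a"
    for H :: "real^'n^'n" and d \<mu> \<alpha>
  proof -
    have "(\<integral>\<^sup>+y. ennreal (mvn_density \<mu> (transpose H ** diag d ** H) y) * ennreal (\<Prod>i\<in>UNIV. (1 + ((H *v y) $ i)\<^sup>2) powr (- \<alpha> i)) \<partial>lborel)
        = (\<Prod>i\<in>UNIV. \<integral>\<^sup>+t. ennreal (normal_density ((H *v \<mu>) $ i) (sqrt (d $ i)) t) * ennreal ((1 + t\<^sup>2) powr (- \<alpha> i)) \<partial>lborel)"
      using nn_integral_mvn_prod[OF H d, of "\<lambda>i t. ennreal ((1 + t\<^sup>2) powr (- \<alpha> i))" \<mu>] by (simp add: prod_ennreal)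
    also have "\<dots> \<le> (\<Prod>i\<in>UNIV. ennreal (c * (1 + d $ i) powr (- \<alpha> i)))"
    proof (rule prod_mono_ennreal)
      fix i
      have "2 / (1 - 2 * \<alpha> i) \<le> 2 / (1 - 2 * a)"
        using \<alpha>[of i] a by (intro divide_left_mono mult_pos_pos) auto
      then have "2 * (1 + 2 / (1 - 2 * \<alpha> i)) * (1 + d $ i) powr (- \<alpha> i) \<le> c * (1 + d $ i) powr (- \<alpha> i)"
        unfolding c_def by (intro mult_right_mono) auto
      moreover have "\<alpha> i < 1/2" using \<alpha>(2)[of i] a by linarith
      ultimately show "(\<integral>\<^sup>+t. ennreal (normal_density ((H *v \<mu>) $ i) (sqrt (d $ i)) t) * ennreal ((1 + t\<^sup>2) powr (- \<alpha> i)) \<partial>lborel)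
          \<le> ennreal (c * (1 + d $ i) powr (- \<alpha> i))"
        using \<alpha>(1) d by (intro order_trans[OF normal_density_shrink ennreal_leI])
    qed
    also have "\<dots> = ennreal (c ^ CARD('n) * (\<Prod>i\<in>UNIV. (1 + d $ i) powr (- \<alpha> i)))"
      using c0 by (subst prod_ennreal) (auto simp: prod.distrib)
    finally show ?thesis .
  qed
  moreover have "0 \<le> c ^ CARD('n)" using c0 by simp
  ultimately show ?thesis using that by blast
qed

section \<open>Joint measurability of the normal density\<close>

lemma borel_measurable_vec_nth [measurable (raw)]:
  fixes f :: "'b \<Rightarrow> 'a::euclidean_space^'n"
  assumes "f \<in> borel_measurable M"
  shows "(\<lambda>x. f x $ i) \<in> borel_measurable M"
  by (rule measurable_compose[OF assms]) (auto intro!: borel_measurable_continuous_onI continuous_intros)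

lemma borel_measurable_vec_lambda [measurable (raw)]:
  fixes f :: "'b \<Rightarrow> 'n::finite \<Rightarrow> 'a::euclidean_space"
  assumes [measurable]: "\<And>i. (\<lambda>x. f x i) \<in> borel_measurable M"
  shows "(\<lambda>x. \<chi> i. f x i) \<in> borel_measurable M"
proof -
  have "(\<lambda>x. f x) \<in> M \<rightarrow>\<^sub>M (\<Pi>\<^sub>M p\<in>UNIV. (borel :: 'a measure))"
    by (rule measurable_PiM_single') (auto simp: PiE_def)
  then show ?thesis
    by (rule measurable_compose[OF _ measurable_vec_lambda_component]) simp
qed

lemma borel_measurable_det [measurable (raw)]:
  fixes A :: "'b \<Rightarrow> real^'n^'n"
  assumes [measurable]: "A \<in> borel_measurable M"
  shows "(\<lambda>x. det (A x)) \<in> borel_measurable M"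
  unfolding det_def by measurable

text \<open>Cramer's rule makes the normal density jointly measurable in its mean and covariance.\<close>

definition cramer_solve :: "real^'n^'n \<Rightarrow> real^'n \<Rightarrow> real^'n" where
  "cramer_solve A b = (\<chi> k. det (\<chi> i j. if j = k then b $ i else A $ i $ j) / det A)"

lemma borel_measurable_cramer_solve [measurable (raw)]:
  assumes [measurable]: "A \<in> borel_measurable M" "b \<in> borel_measurable M"
  shows "(\<lambda>x. cramer_solve (A x) (b x)) \<in> borel_measurable M"
proof -
  have [measurable]: "(\<lambda>x. if j = k then b x $ i else A x $ i $ j) \<in> borel_measurable M" for i j k
    by (cases "j = k") simp_all
  show ?thesis unfolding cramer_solve_def by measurable
qed

lemma pos_def_det_pos:
  assumes "pos_def (S :: real^'n::{finite,linorder}^'n::_)"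
  shows "0 < det S"
proof -
  obtain H d where "orthogonal_matrix H" "S = transpose H ** diag d ** H" "\<And>i. 0 < d $ i"
    using pos_def_spectral[OF assms] by metis
  then show ?thesis by (simp add: det_conjugate_diag prod_pos)
qed

lemma matrix_inv_mult_eq_cramer_solve:
  assumes "det (A :: real^'n^'n) \<noteq> 0"
  shows "matrix_inv A *v b = cramer_solve A b"
proof -
  have "invertible A" using assms by (simp add: invertible_det_nz)
  then obtain B where "A ** B = mat 1" "B ** A = mat 1" by (auto simp: invertible_def)
  then have "A *v (matrix_inv A *v b) = b"
    by (simp add: matrix_inv_eqI matrix_vector_mul_assoc)
  then show ?thesis
    using cramer[OF assms, of "matrix_inv A *v b" b] by (simp add: cramer_solve_def)
qed

definition mvn_cramer :: "real^'n \<Rightarrow> real^'n^'n \<Rightarrow> real^'n \<Rightarrow> real" where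
  "mvn_cramer \<mu> S x = exp (- ((x - \<mu>) \<bullet> cramer_solve S (x - \<mu>)) / 2) / sqrt ((2 * pi) ^ CARD('n) * det S)"

lemma mvn_density_eq_cramer: "pos_def S \<Longrightarrow> mvn_density \<mu> (S :: real^'n::{finite,linorder}^'n::_) x = mvn_cramer \<mu> S x"
  using pos_def_det_pos[of S] by (simp add: mvn_density_def mvn_cramer_def matrix_inv_mult_eq_cramer_solve)

lemma borel_measurable_mvn_cramer [measurable (raw)]:
  assumes [measurable]: "\<mu> \<in> borel_measurable M" "S \<in> borel_measurable M" "f \<in> borel_measurable M"
  shows "(\<lambda>x. mvn_cramer (\<mu> x) (S x) (f x)) \<in> borel_measurable M"
  unfolding mvn_cramer_def by measurable

section \<open>Averages of negative powers over the blocks\<close>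

lemma pos_def_scaleR: "0 < c \<Longrightarrow> pos_def A \<Longrightarrow> pos_def (c *\<^sub>R A)"
  by (auto simp: pos_def_def transpose_scaleR scaleR_matrix_vector_assoc[symmetric])

lemma scaleR_conjugate_diag: "c *\<^sub>R (transpose H ** diag d ** H) = transpose H ** diag (c *\<^sub>R d) ** (H :: real^'n^'n)"
proof -
  have "diag (c *\<^sub>R d) = c *\<^sub>R diag d" by (simp add: diag_def vec_eq_iff)
  then show ?thesis by (simp add: matrix_mult_scaleR_left matrix_mult_scaleR_right)
qed

lemma qq_vec_nth_le: "qq (\<theta> $ l) \<le> qq (\<theta> :: 'a::euclidean_space^'m)"
  using Finite_Cartesian_Product.norm_nth_le[of \<theta> l] by (simp add: qq_def power_mono)

text \<open>Every spectral coordinate is dominated by the whole vector, so the exponent may be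
  distributed over the directions in any proportion. This freedom is what lets the largest
  eigenvalue receive more than the others.\<close>

lemma qq_powr_le_prod:
  fixes H :: "real^'n^'n"
  assumes H: "orthogonal_matrix H" and \<alpha>: "\<And>i. 0 \<le> \<alpha> i" and q: "qq y \<le> q"
  shows "q powr (- (\<Sum>i\<in>UNIV. \<alpha> i)) \<le> (\<Prod>i\<in>UNIV. (1 + ((H *v y) $ i)\<^sup>2) powr (- \<alpha> i))"
proof -
  have q0: "0 < q" using q qq_pos[of y] by linarith
  have le: "1 + ((H *v y) $ i)\<^sup>2 \<le> q" for i
  proof -
    have "\<bar>(H *v y) $ i\<bar> \<le> norm y"
      using component_le_norm_cart[of "H *v y" i] by (simp add: norm_orthogonal_mult[OF H])
    then have "((H *v y) $ i)\<^sup>2 \<le> (norm y)\<^sup>2"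
      by (metis abs_ge_zero power2_abs power_mono)
    then show ?thesis using q by (simp add: qq_def)
  qed
  have "q powr (- (\<Sum>i\<in>UNIV. \<alpha> i)) = (\<Prod>i\<in>UNIV. q powr (- \<alpha> i))"
    using q0 by (simp add: powr_sum sum_negf[symmetric])
  also have "\<dots> \<le> (\<Prod>i\<in>UNIV. (1 + ((H *v y) $ i)\<^sup>2) powr (- \<alpha> i))"
    using le \<alpha> by (intro prod_mono conjI powr_mono2') (auto simp: add_pos_nonneg)
  finally show ?thesis .
qed

lemma nn_integral_theta_density:
  fixes F :: "'m::finite \<Rightarrow> real^'k::{finite,linorder} \<Rightarrow> ennreal"
  assumes V: "pos_def V" and [measurable]: "\<And>l. F l \<in> borel_measurable borel"
  shows "(\<integral>\<^sup>+\<theta>. ennreal (theta_density \<beta> V \<theta>) * (\<Prod>l\<in>UNIV. F l (\<theta> $ l)) \<partial>lborel)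
    = (\<Prod>l\<in>UNIV. \<integral>\<^sup>+y. ennreal (mvn_density \<beta> V y) * F l y \<partial>lborel)"
proof -
  have [measurable]: "mvn_density \<beta> V \<in> borel_measurable borel"
    using mvn_density_eq_cramer[OF V, abs_def] by (subst fun_eq_iff[THEN iffD2, of _ "mvn_cramer \<beta> V"]) auto
  have "(\<integral>\<^sup>+\<theta>. ennreal (theta_density \<beta> V \<theta>) * (\<Prod>l\<in>UNIV. F l (\<theta> $ l)) \<partial>lborel)
      = (\<integral>\<^sup>+\<theta>. (\<Prod>l\<in>UNIV. ennreal (mvn_density \<beta> V (\<theta> $ l)) * F l (\<theta> $ l)) \<partial>lborel)"
    using mvn_density_nonneg[OF V] by (simp add: theta_density_def prod.distrib prod_ennreal)
  also have "\<dots> = (\<Prod>l\<in>UNIV. \<integral>\<^sup>+y. ennreal (mvn_density \<beta> V y) * F l y \<partial>lborel)"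
    by (rule nn_integral_lborel_vec_prod) measurable
  finally show ?thesis .
qed

text \<open>Two blocks, independent given \<open>\<beta>\<close> and \<open>V\<close>, each carry
  half of the exponent, which raises the limit per direction from 1/2 to 1. The bound is uniform in
  \<open>\<beta>\<close>, so a finite prior of \<open>\<beta>\<close> integrates out
  afterwards.\<close>

lemma theta_shrink_unconditional:
  fixes m1 m2 :: "'m::finite"
  assumes m: "m1 \<noteq> m2" and a: "a < 1/2"
  obtains c where "0 \<le> c"
    "\<And>(H :: real^'k::{finite,linorder}^'k::_) d \<beta> \<alpha>. orthogonal_matrix H \<Longrightarrow> (\<And>i. 0 < d $ i) \<Longrightarrow> (\<And>i. 0 \<le> \<alpha> i) \<Longrightarrow> (\<And>i. \<alpha> i \<le> a) \<Longrightarrow>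
      (\<integral>\<^sup>+\<theta>. ennreal (theta_density \<beta> (transpose H ** diag d ** H) (\<theta> :: real^'k::_^'m)) * ennreal (qq \<theta> powr (- (2 * (\<Sum>i\<in>UNIV. \<alpha> i)))) \<partial>lborel)
      \<le> ennreal (c * (\<Prod>i\<in>UNIV. (1 + d $ i) powr (- (2 * \<alpha> i))))"
proof -
  obtain c where c: "0 \<le> c" and shrink:
    "\<And>(H :: real^'k::_^'k::_) d \<mu> \<alpha>. orthogonal_matrix H \<Longrightarrow> (\<And>i. 0 < d $ i) \<Longrightarrow> (\<And>i. 0 \<le> \<alpha> i) \<Longrightarrow> (\<And>i. \<alpha> i \<le> a) \<Longrightarrow>
      (\<integral>\<^sup>+y. ennreal (mvn_density \<mu> (transpose H ** diag d ** H) y) * ennreal (\<Prod>i\<in>UNIV. (1 + ((H *v y) $ i)\<^sup>2) powr (- \<alpha> i)) \<partial>lborel)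
      \<le> ennreal (c * (\<Prod>i\<in>UNIV. (1 + d $ i) powr (- \<alpha> i)))"
    using mvn_shrink[OF a] by blast
  have "(\<integral>\<^sup>+\<theta>. ennreal (theta_density \<beta> (transpose H ** diag d ** H) (\<theta> :: real^'k::_^'m)) * ennreal (qq \<theta> powr (- (2 * (\<Sum>i\<in>UNIV. \<alpha> i)))) \<partial>lborel)
      \<le> ennreal (c\<^sup>2 * (\<Prod>i\<in>UNIV. (1 + d $ i) powr (- (2 * \<alpha> i))))"
    if H: "orthogonal_matrix H" and d: "\<And>i. 0 < d $ i" and \<alpha>: "\<And>i. 0 \<le> \<alpha> i" "\<And>i. \<alpha> i \<le> a"
    for H :: "real^'k::_^'k::_" and d \<beta> \<alpha>
  proof -
    let ?V = "transpose H ** diag d ** H"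
    have V: "pos_def ?V" using H d by (simp add: pos_def_conjugate_diag_iff)
    let ?P = "\<lambda>y. \<Prod>i\<in>UNIV. (1 + ((H *v y) $ i)\<^sup>2) powr (- \<alpha> i)"
    have [measurable]: "(\<lambda>y. H *v y) \<in> borel_measurable borel"
      by (intro borel_measurable_continuous_onI linear_continuous_on matrix_vector_mul_bounded_linear)
    have Pnn: "0 \<le> ?P y" for y by (intro prod_nonneg) auto
    \<comment> \<open>Weights sit on two blocks only; the density of every other block integrates to
      1.\<close>
    define F where "F l y = (if l = m1 \<or> l = m2 then ennreal (?P y) else 1)" for l y
    have [measurable]: "F l \<in> borel_measurable borel" for l
      unfolding F_def by (cases "l = m1 \<or> l = m2") auto
    have split: "(\<Prod>l\<in>UNIV. g l) = g m1 * g m2 * (\<Prod>l\<in>UNIV - {m1, m2}. g l)" for g :: "'m \<Rightarrow> ennreal"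
      using m by (subst prod.subset_diff[of "{m1, m2}"]) (auto simp: mult.commute)
    have pF: "(\<Prod>l\<in>UNIV. F l (\<theta> $ l)) = ennreal (?P (\<theta> $ m1)) * ennreal (?P (\<theta> $ m2))" for \<theta> :: "real^'k::_^'m"
      by (subst split) (simp add: F_def)
    have q: "ennreal (qq \<theta> powr (- (2 * (\<Sum>i\<in>UNIV. \<alpha> i)))) \<le> (\<Prod>l\<in>UNIV. F l (\<theta> $ l))" for \<theta> :: "real^'k::_^'m"
    proof -
      have "qq \<theta> powr (- (2 * (\<Sum>i\<in>UNIV. \<alpha> i))) = qq \<theta> powr (- (\<Sum>i\<in>UNIV. \<alpha> i)) * qq \<theta> powr (- (\<Sum>i\<in>UNIV. \<alpha> i))"
        by (simp flip: powr_add)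
      also have "\<dots> \<le> ?P (\<theta> $ m1) * ?P (\<theta> $ m2)"
        using Pnn by (intro mult_mono qq_powr_le_prod[OF H \<alpha>(1)] qq_vec_nth_le) auto
      finally show ?thesis
        unfolding pF using Pnn by (simp flip: ennreal_mult add: ennreal_leI)
    qed
    have "(\<integral>\<^sup>+\<theta>. ennreal (theta_density \<beta> ?V (\<theta> :: real^'k::_^'m)) * ennreal (qq \<theta> powr (- (2 * (\<Sum>i\<in>UNIV. \<alpha> i)))) \<partial>lborel)
        \<le> (\<integral>\<^sup>+\<theta>. ennreal (theta_density \<beta> ?V \<theta>) * (\<Prod>l\<in>UNIV. F l (\<theta> $ l)) \<partial>lborel)"
      by (intro nn_integral_mono mult_left_mono q) simp
    also have "\<dots> = (\<Prod>l\<in>UNIV. \<integral>\<^sup>+y. ennreal (mvn_density \<beta> ?V y) * F l y \<partial>lborel)"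
      using V by (rule nn_integral_theta_density) measurable
    also have "\<dots> = (\<integral>\<^sup>+y. ennreal (mvn_density \<beta> ?V y) * ennreal (?P y) \<partial>lborel) * (\<integral>\<^sup>+y. ennreal (mvn_density \<beta> ?V y) * ennreal (?P y) \<partial>lborel)"
      by (subst split) (simp add: F_def nn_integral_mvn_density[OF V])
    also have "\<dots> \<le> ennreal (c * (\<Prod>i\<in>UNIV. (1 + d $ i) powr (- \<alpha> i))) * ennreal (c * (\<Prod>i\<in>UNIV. (1 + d $ i) powr (- \<alpha> i)))"
      using shrink[OF H d \<alpha>] by (intro mult_mono) auto
    also have "\<dots> = ennreal ((c * (\<Prod>i\<in>UNIV. (1 + d $ i) powr (- \<alpha> i))) * (c * (\<Prod>i\<in>UNIV. (1 + d $ i) powr (- \<alpha> i))))"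
      using c by (intro ennreal_mult[symmetric] mult_nonneg_nonneg prod_nonneg) auto
    also have "(c * (\<Prod>i\<in>UNIV. (1 + d $ i) powr (- \<alpha> i))) * (c * (\<Prod>i\<in>UNIV. (1 + d $ i) powr (- \<alpha> i)))
        = c\<^sup>2 * (\<Prod>i\<in>UNIV. (1 + d $ i) powr (- \<alpha> i) * (1 + d $ i) powr (- \<alpha> i))"
      by (simp add: power2_eq_square prod.distrib mult_ac)
    also have "(\<Prod>i\<in>UNIV. (1 + d $ i) powr (- \<alpha> i) * (1 + d $ i) powr (- \<alpha> i)) = (\<Prod>i\<in>UNIV. (1 + d $ i) powr (- (2 * \<alpha> i)))"
      by (simp flip: powr_add)
    finally show ?thesis .
  qed
  then show ?thesis using that[of "c\<^sup>2"] by simp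
qed

text \<open>
  One block \<open>\<theta>\<^sub>m\<^sub>1\<close> is averaged over \<open>\<beta>\<close> and yields the power of \<open>1 + \<lambda>\<close>; another block, conditionally
  independent of it, yields the power of \<open>det (1 + V)\<close> uniformly in \<open>\<beta>\<close>.
\<close>

lemma theta_shrink_two_stage:
  fixes m1 m2 :: "'m::finite" and A :: "real^'k::{finite,linorder}^'k::_"
  assumes m: "m1 \<noteq> m2" and a: "a < 1/2" and A: "pos_def A"
  obtains c where "0 \<le> c"
    "\<And>(H :: real^'k::_^'k::_) d l \<kappa> b. orthogonal_matrix H \<Longrightarrow> (\<And>i. 0 < d $ i) \<Longrightarrow> 0 < l \<Longrightarrow>
      0 \<le> \<kappa> \<Longrightarrow> \<kappa> / CARD('k) \<le> a \<Longrightarrow> 0 \<le> b \<Longrightarrow> b / CARD('k) \<le> a \<Longrightarrow> \<kappa> \<le> 2 \<Longrightarrow>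
      (\<integral>\<^sup>+\<beta>. ennreal (mvn_density \<beta>0 (l *\<^sub>R A) \<beta>) *
        (\<integral>\<^sup>+\<theta>. ennreal (theta_density \<beta> (transpose H ** diag d ** H) (\<theta> :: real^'k::_^'m)) * ennreal (qq \<theta> powr (- (\<kappa> + b))) \<partial>lborel) \<partial>lborel)
      \<le> ennreal (c * (1 + l) powr (- \<kappa>) * (\<Prod>i\<in>UNIV. (1 + d $ i) powr (- (b / CARD('k)))))"
proof -
  let ?k = "real CARD('k)"
  have k0: "0 < ?k" by simp
  obtain c where c: "0 \<le> c" and shrink:
    "\<And>(H :: real^'k::_^'k::_) d \<mu> \<alpha>. orthogonal_matrix H \<Longrightarrow> (\<And>i. 0 < d $ i) \<Longrightarrow> (\<And>i. 0 \<le> \<alpha> i) \<Longrightarrow> (\<And>i. \<alpha> i \<le> a) \<Longrightarrow>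
      (\<integral>\<^sup>+y. ennreal (mvn_density \<mu> (transpose H ** diag d ** H) y) * ennreal (\<Prod>i\<in>UNIV. (1 + ((H *v y) $ i)\<^sup>2) powr (- \<alpha> i)) \<partial>lborel)
      \<le> ennreal (c * (\<Prod>i\<in>UNIV. (1 + d $ i) powr (- \<alpha> i)))"
    using mvn_shrink[OF a] by blast
  have shrink1: "(\<integral>\<^sup>+y. ennreal (mvn_density \<mu> (transpose H ** diag d ** H) y) * ennreal (qq y powr (- e)) \<partial>lborel)
      \<le> ennreal (c * (\<Prod>i\<in>UNIV. (1 + d $ i) powr (- (e / ?k))))"
    if H: "orthogonal_matrix H" and d: "\<And>i. 0 < d $ i" and e: "0 \<le> e" "e / ?k \<le> a" for H :: "real^'k::_^'k::_" and d \<mu> e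
  proof -
    have "qq y powr (- e) \<le> (\<Prod>i\<in>UNIV. (1 + ((H *v y) $ i)\<^sup>2) powr (- (e / ?k)))" for y
      using qq_powr_le_prod[OF H, of "\<lambda>_. e / ?k" y "qq y"] e k0 by simp
    then have "(\<integral>\<^sup>+y. ennreal (mvn_density \<mu> (transpose H ** diag d ** H) y) * ennreal (qq y powr (- e)) \<partial>lborel)
        \<le> (\<integral>\<^sup>+y. ennreal (mvn_density \<mu> (transpose H ** diag d ** H) y) * ennreal (\<Prod>i\<in>UNIV. (1 + ((H *v y) $ i)\<^sup>2) powr (- (e / ?k))) \<partial>lborel)"
      by (intro nn_integral_mono mult_left_mono ennreal_leI) auto
    also have "\<dots> \<le> ennreal (c * (\<Prod>i\<in>UNIV. (1 + d $ i) powr (- (e / ?k))))"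
      using H d e k0 by (intro shrink) auto
    finally show ?thesis .
  qed
  obtain HA dA where HA: "orthogonal_matrix HA" "A = transpose HA ** diag dA ** HA" "\<And>i. 0 < dA $ i"
    using pos_def_spectral[OF A] by metis
  \<comment> \<open>The smallest eigenvalue of \<open>A\<close>, capped at 1, so that
    \<open>1 + l * dA $ i \<ge> a0 * (1 + l)\<close>.\<close>
  define a0 where "a0 = Min (insert 1 (range (\<lambda>i. dA $ i)))"
  have a0: "0 < a0" "a0 \<le> 1"
    unfolding a0_def using HA(3) by auto
  have a0_le: "a0 \<le> dA $ i" for i
    unfolding a0_def by (rule Min_le) auto
  \<comment> \<open>For \<open>a0 \<le> 1\<close> and \<open>\<kappa> \<le> 2\<close> the factor
    \<open>a0 powr (-2)\<close> dominates \<open>a0 powr (-\<kappa>)\<close>, which frees the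
    constant from \<open>\<kappa>\<close>.\<close>
  define c1 where "c1 = c * a0 powr (- 2)"
  have c1: "0 \<le> c1" using c by (simp add: c1_def)
  have shrinkA: "(\<integral>\<^sup>+y. ennreal (mvn_density \<mu> (l *\<^sub>R A) y) * ennreal (qq y powr (- \<kappa>)) \<partial>lborel) \<le> ennreal (c1 * (1 + l) powr (- \<kappa>))"
    if l: "0 < l" and \<kappa>: "0 \<le> \<kappa>" "\<kappa> / ?k \<le> a" "\<kappa> \<le> 2" for l \<kappa> \<mu>
  proof -
    have eq: "l *\<^sub>R A = transpose HA ** diag (l *\<^sub>R dA) ** HA"
      unfolding HA(2) by (rule scaleR_conjugate_diag)
    have "(\<integral>\<^sup>+y. ennreal (mvn_density \<mu> (l *\<^sub>R A) y) * ennreal (qq y powr (- \<kappa>)) \<partial>lborel)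
        \<le> ennreal (c * (\<Prod>i\<in>UNIV. (1 + (l *\<^sub>R dA) $ i) powr (- (\<kappa> / ?k))))"
      unfolding eq using l HA \<kappa> by (intro shrink1) auto
    also have "\<dots> \<le> ennreal (c * (\<Prod>i\<in>(UNIV::'k set). (a0 * (1 + l)) powr (- (\<kappa> / ?k))))"
    proof (intro ennreal_leI mult_left_mono prod_mono conjI c powr_mono2')
      fix i
      have "l * a0 \<le> l * dA $ i" using a0_le l by (intro mult_left_mono) auto
      then show "a0 * (1 + l) \<le> 1 + (l *\<^sub>R dA) $ i" using a0(2) by (simp add: algebra_simps)
    qed (use a0 l \<kappa> k0 in auto)
    also have "(\<Prod>i\<in>(UNIV::'k set). (a0 * (1 + l)) powr (- (\<kappa> / ?k))) = (a0 * (1 + l)) powr (- \<kappa>)"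
      using a0 l k0 by (simp add: powr_realpow[symmetric] powr_powr)
    also have "(a0 * (1 + l)) powr (- \<kappa>) = a0 powr (- \<kappa>) * (1 + l) powr (- \<kappa>)"
      using a0 l by (simp add: powr_mult)
    also have "ennreal (c * (a0 powr (- \<kappa>) * (1 + l) powr (- \<kappa>))) \<le> ennreal (c * (a0 powr (- 2) * (1 + l) powr (- \<kappa>)))"
      using c a0 \<kappa> by (intro ennreal_leI mult_left_mono mult_right_mono powr_mono') auto
    finally show ?thesis by (simp add: c1_def mult_ac)
  qed
  have "(\<integral>\<^sup>+\<beta>. ennreal (mvn_density \<beta>0 (l *\<^sub>R A) \<beta>) *
        (\<integral>\<^sup>+\<theta>. ennreal (theta_density \<beta> (transpose H ** diag d ** H) (\<theta> :: real^'k::_^'m)) * ennreal (qq \<theta> powr (- (\<kappa> + b))) \<partial>lborel) \<partial>lborel)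
      \<le> ennreal (c1 * c * (1 + l) powr (- \<kappa>) * (\<Prod>i\<in>UNIV. (1 + d $ i) powr (- (b / ?k))))"
    if H: "orthogonal_matrix H" and d: "\<And>i. 0 < d $ i" and l: "0 < l"
      and \<kappa>: "0 \<le> \<kappa>" "\<kappa> / ?k \<le> a" "\<kappa> \<le> 2" and b: "0 \<le> b" "b / ?k \<le> a" for H :: "real^'k::_^'k::_" and d l \<kappa> b
  proof -
    let ?V = "transpose H ** diag d ** H"
    have V: "pos_def ?V" using H d by (simp add: pos_def_conjugate_diag_iff)
    have lA: "pos_def (l *\<^sub>R A)" using l A by (rule pos_def_scaleR)
    define B where "B = c * (\<Prod>i\<in>UNIV. (1 + d $ i) powr (- (b / ?k)))"
    have B: "0 \<le> B" unfolding B_def using c by (intro mult_nonneg_nonneg prod_nonneg) auto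
    define F :: "'m \<Rightarrow> real^'k::_ \<Rightarrow> ennreal"
      where "F j y = (if j = m1 then ennreal (qq y powr (- \<kappa>)) else if j = m2 then ennreal (qq y powr (- b)) else 1)" for j y
    have [measurable]: "F j \<in> borel_measurable borel" for j
      unfolding F_def by (cases "j = m1"; cases "j = m2") auto
    have split: "(\<Prod>j\<in>UNIV. g j) = g m1 * g m2 * (\<Prod>j\<in>UNIV - {m1, m2}. g j)" for g :: "'m \<Rightarrow> ennreal"
      using m by (subst prod.subset_diff[of "{m1, m2}"]) (auto simp: mult.commute)
    have pF: "(\<Prod>j\<in>UNIV. F j (\<theta> $ j)) = ennreal (qq (\<theta> $ m1) powr (- \<kappa>)) * ennreal (qq (\<theta> $ m2) powr (- b))" for \<theta> :: "real^'k::_^'m"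
      using m by (subst split) (simp add: F_def)
    have q: "ennreal (qq \<theta> powr (- (\<kappa> + b))) \<le> (\<Prod>j\<in>UNIV. F j (\<theta> $ j))" for \<theta> :: "real^'k::_^'m"
    proof -
      have "qq \<theta> powr (- (\<kappa> + b)) = qq \<theta> powr (- \<kappa>) * qq \<theta> powr (- b)"
        by (simp flip: powr_add)
      also have "\<dots> \<le> qq (\<theta> $ m1) powr (- \<kappa>) * qq (\<theta> $ m2) powr (- b)"
        using \<kappa> b by (intro mult_mono powr_mono2' qq_vec_nth_le) (auto simp: qq_pos)
      finally show ?thesis
        unfolding pF by (simp flip: ennreal_mult add: ennreal_leI)
    qed
    \<comment> \<open>The law of the noise \<open>e = \<theta> $ m1 - \<beta>\<close> does not
      involve \<open>\<beta>\<close>. With \<open>e\<close> fixed after the exchange of integrals,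
      \<open>e + \<beta>\<close> is normal with covariance \<open>l *\<^sub>R A\<close> and a
      shifted mean, and \<open>shrinkA\<close> is uniform in the mean.\<close>
    let ?n = "\<lambda>y. ennreal (mvn_cramer 0 ?V y)"
    have [measurable]: "mvn_density \<beta> ?V \<in> borel_measurable borel" for \<beta>
      using mvn_density_eq_cramer[OF V, abs_def] by (subst fun_eq_iff[THEN iffD2, of _ "mvn_cramer \<beta> ?V"]) auto
    have inner: "(\<integral>\<^sup>+\<theta>. ennreal (theta_density \<beta> ?V (\<theta> :: real^'k::_^'m)) * ennreal (qq \<theta> powr (- (\<kappa> + b))) \<partial>lborel)
        \<le> (\<integral>\<^sup>+e. ?n e * ennreal (qq (e + \<beta>) powr (- \<kappa>)) \<partial>lborel) * ennreal B" for \<beta>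
    proof -
      have "(\<integral>\<^sup>+\<theta>. ennreal (theta_density \<beta> ?V (\<theta> :: real^'k::_^'m)) * ennreal (qq \<theta> powr (- (\<kappa> + b))) \<partial>lborel)
          \<le> (\<integral>\<^sup>+\<theta>. ennreal (theta_density \<beta> ?V \<theta>) * (\<Prod>j\<in>UNIV. F j (\<theta> $ j)) \<partial>lborel)"
        by (intro nn_integral_mono mult_left_mono q) simp
      also have "\<dots> = (\<Prod>j\<in>UNIV. \<integral>\<^sup>+y. ennreal (mvn_density \<beta> ?V y) * F j y \<partial>lborel)"
        using V by (rule nn_integral_theta_density) measurable
      also have "\<dots> = (\<integral>\<^sup>+y. ennreal (mvn_density \<beta> ?V y) * ennreal (qq y powr (- \<kappa>)) \<partial>lborel)
          * (\<integral>\<^sup>+y. ennreal (mvn_density \<beta> ?V y) * ennreal (qq y powr (- b)) \<partial>lborel)"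
        using m by (subst split) (simp add: F_def nn_integral_mvn_density[OF V])
      also have "(\<integral>\<^sup>+y. ennreal (mvn_density \<beta> ?V y) * ennreal (qq y powr (- \<kappa>)) \<partial>lborel)
          = (\<integral>\<^sup>+y. ennreal (mvn_density \<beta> ?V y) * ennreal (qq y powr (- \<kappa>)) \<partial>distr lborel borel ((+) \<beta>))"
        by (simp add: lborel_distr_plus)
      also have "\<dots> = (\<integral>\<^sup>+e. ?n e * ennreal (qq (e + \<beta>) powr (- \<kappa>)) \<partial>lborel)"
        using mvn_density_shift[of 0 \<beta> ?V]
        by (subst nn_integral_distr) (auto simp: add.commute[of \<beta>] mvn_density_eq_cramer[OF V, symmetric])
      finally show ?thesis
        unfolding B_def using H d b by (elim order_trans) (intro mult_left_mono shrink1, auto)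
    qed
    have "(\<integral>\<^sup>+\<beta>. ennreal (mvn_density \<beta>0 (l *\<^sub>R A) \<beta>) *
        (\<integral>\<^sup>+\<theta>. ennreal (theta_density \<beta> ?V (\<theta> :: real^'k::_^'m)) * ennreal (qq \<theta> powr (- (\<kappa> + b))) \<partial>lborel) \<partial>lborel)
      \<le> (\<integral>\<^sup>+\<beta>. ennreal (mvn_cramer \<beta>0 (l *\<^sub>R A) \<beta>) * ((\<integral>\<^sup>+e. ?n e * ennreal (qq (e + \<beta>) powr (- \<kappa>)) \<partial>lborel) * ennreal B) \<partial>lborel)"
      unfolding mvn_density_eq_cramer[OF lA] by (intro nn_integral_mono mult_left_mono inner) simp
    also have "\<dots> = ennreal B * (\<integral>\<^sup>+\<beta>. (\<integral>\<^sup>+e. ennreal (mvn_cramer \<beta>0 (l *\<^sub>R A) \<beta>) * (?n e * ennreal (qq (e + \<beta>) powr (- \<kappa>))) \<partial>lborel) \<partial>lborel)"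
      by (subst nn_integral_cmult[symmetric]) (auto simp: nn_integral_cmult mult_ac)
    also have "(\<integral>\<^sup>+\<beta>. (\<integral>\<^sup>+e. ennreal (mvn_cramer \<beta>0 (l *\<^sub>R A) \<beta>) * (?n e * ennreal (qq (e + \<beta>) powr (- \<kappa>))) \<partial>lborel) \<partial>lborel)
        = (\<integral>\<^sup>+e. (\<integral>\<^sup>+\<beta>. ennreal (mvn_cramer \<beta>0 (l *\<^sub>R A) \<beta>) * (?n e * ennreal (qq (e + \<beta>) powr (- \<kappa>))) \<partial>lborel) \<partial>lborel)"
      by (rule lborel_pair.Fubini') measurable
    also have "\<dots> = (\<integral>\<^sup>+e. ?n e * (\<integral>\<^sup>+\<beta>. ennreal (mvn_cramer \<beta>0 (l *\<^sub>R A) \<beta>) * ennreal (qq (e + \<beta>) powr (- \<kappa>)) \<partial>lborel) \<partial>lborel)"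
      by (intro nn_integral_cong) (subst nn_integral_cmult[symmetric], auto simp: mult_ac)
    also have "\<dots> \<le> (\<integral>\<^sup>+e. ?n e * ennreal (c1 * (1 + l) powr (- \<kappa>)) \<partial>lborel)"
    proof (intro nn_integral_mono mult_left_mono)
      fix e
      have "(\<integral>\<^sup>+\<beta>. ennreal (mvn_cramer \<beta>0 (l *\<^sub>R A) \<beta>) * ennreal (qq (e + \<beta>) powr (- \<kappa>)) \<partial>lborel)
          = (\<integral>\<^sup>+\<beta>. ennreal (mvn_cramer (\<beta>0 + e) (l *\<^sub>R A) (e + \<beta>)) * ennreal (qq (e + \<beta>) powr (- \<kappa>)) \<partial>lborel)"
        using mvn_density_shift[of \<beta>0 e "l *\<^sub>R A"] by (simp add: mvn_density_eq_cramer[OF lA] add.commute[of e])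
      also have "\<dots> = (\<integral>\<^sup>+\<beta>. ennreal (mvn_cramer (\<beta>0 + e) (l *\<^sub>R A) \<beta>) * ennreal (qq \<beta> powr (- \<kappa>)) \<partial>distr lborel borel ((+) e))"
        by (subst nn_integral_distr) auto
      also have "\<dots> \<le> ennreal (c1 * (1 + l) powr (- \<kappa>))"
        using shrinkA[OF l \<kappa>, of "\<beta>0 + e"] by (simp add: lborel_distr_plus mvn_density_eq_cramer[OF lA])
      finally show "(\<integral>\<^sup>+\<beta>. ennreal (mvn_cramer \<beta>0 (l *\<^sub>R A) \<beta>) * ennreal (qq (e + \<beta>) powr (- \<kappa>)) \<partial>lborel) \<le> ennreal (c1 * (1 + l) powr (- \<kappa>))" .
    qed simp
    also have "\<dots> = ennreal (c1 * (1 + l) powr (- \<kappa>))"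
      using nn_integral_mvn_density[OF V, of 0] by (simp add: nn_integral_multc mvn_density_eq_cramer[OF V])
    finally have "(\<integral>\<^sup>+\<beta>. ennreal (mvn_density \<beta>0 (l *\<^sub>R A) \<beta>) *
        (\<integral>\<^sup>+\<theta>. ennreal (theta_density \<beta> ?V (\<theta> :: real^'k::_^'m)) * ennreal (qq \<theta> powr (- (\<kappa> + b))) \<partial>lborel) \<partial>lborel)
      \<le> ennreal B * ennreal (c1 * (1 + l) powr (- \<kappa>))"
      by (simp add: mult_left_mono)
    then show ?thesis
      using B c1 by (simp add: B_def mult_ac flip: ennreal_mult)
  qed
  then show ?thesis using that[of "c1 * c"] c c1 by (simp add: mult_ac)
qed

section \<open>Integrals over the eigenvalues and over the mixing parameter\<close>

text \<open>The share of one eigenvalue in the bound on the prior: like \<open>x powr (-a)\<close>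
  at 0 and like \<open>x powr (-p)\<close> at infinity. Averaging over \<theta> acts on it by
  raising \<open>p\<close>.\<close>

definition eig_weight :: "real \<Rightarrow> real \<Rightarrow> real \<Rightarrow> real" where
  "eig_weight a p x = (1 + x) powr (a - p) * x powr (- a)"

lemma eig_weight_nonneg [simp]: "0 \<le> eig_weight a p x"
  by (simp add: eig_weight_def)

lemma eig_weight_measurable [measurable]: "eig_weight a p \<in> borel_measurable borel"
  unfolding eig_weight_def[abs_def] by measurable

lemma one_plus_powr_bound:
  assumes "1 \<le> y" "y \<le> u" "u \<le> 2 * y"
  shows "u powr e \<le> 2 powr \<bar>e\<bar> * y powr (e :: real)"
proof (cases "0 \<le> e")
  case True
  have "u powr e \<le> (2 * y) powr e" using assms True by (intro powr_mono2) auto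
  then show ?thesis using assms True by (simp add: powr_mult)
next
  case False
  have "u powr e \<le> y powr e" using assms False by (intro powr_mono2') auto
  also have "\<dots> \<le> 2 powr \<bar>e\<bar> * y powr e"
    using mult_right_mono[of 1 "2 powr \<bar>e\<bar>" "y powr e"] ge_one_powr_ge_zero[of 2 "\<bar>e\<bar>"] by simp
  finally show ?thesis .
qed

lemma eig_weight_le_near: "0 < x \<Longrightarrow> x \<le> 1 \<Longrightarrow> eig_weight a p x \<le> 2 powr \<bar>a - p\<bar> * x powr (- a)"
  using one_plus_powr_bound[of 1 "1 + x" "a - p"] by (simp add: eig_weight_def mult_right_mono)

lemma eig_weight_le_far:
  assumes "1 \<le> x"
  shows "eig_weight a p x \<le> 2 powr \<bar>a - p\<bar> * x powr (- p)"
proof -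
  have "eig_weight a p x \<le> 2 powr \<bar>a - p\<bar> * x powr (a - p) * x powr (- a)"
    using one_plus_powr_bound[of x "1 + x" "a - p"] assms by (simp add: eig_weight_def mult_right_mono)
  also have "\<dots> = 2 powr \<bar>a - p\<bar> * x powr (- p)"
    by (simp add: mult.assoc flip: powr_add)
  finally show ?thesis .
qed

lemma nn_integral_powr_tail:
  assumes "a < - 1" "0 < (c :: real)"
  shows "(\<integral>\<^sup>+x. ennreal (x powr a) * indicator {c..} x \<partial>lborel) = ennreal (c powr (a + 1) / (- a - 1))"
proof -
  have "((\<lambda>x. x powr a) has_integral (- (c powr (a + 1)) / (a + 1))) {c..}"
    using assms by (rule has_integral_powr_to_inf)
  moreover have "(\<lambda>x. x powr a * indicator {c..} x) = (\<lambda>x. if x \<in> {c..} then x powr a else 0)"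
    by (auto simp: indicator_def)
  ultimately have "((\<lambda>x. x powr a * indicator {c..} x) has_integral (- (c powr (a + 1)) / (a + 1))) UNIV"
    by (simp only: has_integral_restrict_UNIV)
  then have "(\<integral>\<^sup>+x. ennreal (x powr a * indicator {c..} x) \<partial>lborel) = ennreal (- (c powr (a + 1)) / (a + 1))"
    by (intro nn_integral_has_integral_lborel) auto
  moreover have "- (c powr (a + 1)) / (a + 1) = c powr (a + 1) / (- a - 1)"
    using assms by (simp add: field_simps)
  ultimately show ?thesis by (simp add: ennreal_mult' ennreal_indicator)
qed

lemma eig_weight_near_integral:
  assumes "a < 1"
  shows "(\<integral>\<^sup>+x. ennreal (eig_weight a p x) * indicator {0<..1} x \<partial>lborel) \<le> ennreal (2 powr \<bar>a - p\<bar> * (2 / (1 - a)))"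
proof -
  have "(\<integral>\<^sup>+x. ennreal (eig_weight a p x) * indicator {0<..1} x \<partial>lborel)
      \<le> (\<integral>\<^sup>+x. ennreal (2 powr \<bar>a - p\<bar>) * (ennreal (\<bar>x\<bar> powr (- a)) * indicator {-1..1} x) \<partial>lborel)"
  proof (rule nn_integral_mono)
    fix x :: real
    show "ennreal (eig_weight a p x) * indicator {0<..1} x \<le> ennreal (2 powr \<bar>a - p\<bar>) * (ennreal (\<bar>x\<bar> powr (- a)) * indicator {-1..1} x)"
      using eig_weight_le_near[of x a p] by (auto simp: indicator_def ennreal_leI simp flip: ennreal_mult)
  qed
  also have "\<dots> = ennreal (2 powr \<bar>a - p\<bar>) * (\<integral>\<^sup>+x. ennreal (\<bar>x\<bar> powr (- a)) * indicator {-1..1} x \<partial>lborel)"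
    by (rule nn_integral_cmult) measurable
  also have "\<dots> \<le> ennreal (2 powr \<bar>a - p\<bar>) * ennreal (2 * (1 powr (- a + 1) / (- a + 1)))"
    using assms by (intro mult_left_mono nn_integral_abs_powr) auto
  also have "\<dots> = ennreal (2 powr \<bar>a - p\<bar> * (2 / (1 - a)))"
    using assms by (simp flip: ennreal_mult)
  finally show ?thesis .
qed

lemma eig_weight_integral_finite:
  assumes "a < 1" "1 < p"
  shows "(\<integral>\<^sup>+x. ennreal (eig_weight a p x) * indicator {0<..} x \<partial>lborel) < \<infinity>"
proof -
  have "(\<integral>\<^sup>+x. ennreal (eig_weight a p x) * indicator {0<..} x \<partial>lborel)
      \<le> (\<integral>\<^sup>+x. ennreal (eig_weight a p x) * indicator {0<..1} x + ennreal (2 powr \<bar>a - p\<bar>) * (ennreal (x powr (- p)) * indicator {1..} x) \<partial>lborel)"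
  proof (rule nn_integral_mono)
    fix x :: real
    show "ennreal (eig_weight a p x) * indicator {0<..} x
      \<le> ennreal (eig_weight a p x) * indicator {0<..1} x + ennreal (2 powr \<bar>a - p\<bar>) * (ennreal (x powr (- p)) * indicator {1..} x)"
      using eig_weight_le_far[of x a p] by (cases "x \<le> 1") (auto simp: indicator_def ennreal_leI simp flip: ennreal_mult)
  qed
  also have "\<dots> = (\<integral>\<^sup>+x. ennreal (eig_weight a p x) * indicator {0<..1} x \<partial>lborel)
      + ennreal (2 powr \<bar>a - p\<bar>) * (\<integral>\<^sup>+x. ennreal (x powr (- p)) * indicator {1..} x \<partial>lborel)"
    by (subst nn_integral_add) (auto simp: nn_integral_cmult)
  also have "\<dots> \<le> ennreal (2 powr \<bar>a - p\<bar> * (2 / (1 - a))) + ennreal (2 powr \<bar>a - p\<bar>) * ennreal (1 powr (- p + 1) / (- (- p) - 1))"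
    using assms by (intro add_mono eig_weight_near_integral mult_left_mono) (auto simp: nn_integral_powr_tail)
  also have "\<dots> < \<infinity>" by (simp add: ennreal_mult_less_top)
  finally show ?thesis .
qed

text \<open>For \<open>p < 1\<close> the far end dominates and gives the order
  \<open>T powr (1 - p)\<close>; the finite part near 0 is absorbed because
  \<open>T \<ge> 1\<close>.\<close>

lemma eig_weight_integral_growth:
  assumes "a < 1" "p < 1"
  obtains c where "0 \<le> c" "\<And>T. 1 \<le> T \<Longrightarrow>
    (\<integral>\<^sup>+x. ennreal (eig_weight a p x) * indicator {0<..T} x \<partial>lborel) \<le> ennreal (c * T powr (1 - p))"
proof -
  define c where "c = 2 powr \<bar>a - p\<bar> * (2 / (1 - a) + 2 / (1 - p))"
  have "(\<integral>\<^sup>+x. ennreal (eig_weight a p x) * indicator {0<..T} x \<partial>lborel) \<le> ennreal (c * T powr (1 - p))" if T: "1 \<le> T" for T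
  proof -
    have "(\<integral>\<^sup>+x. ennreal (eig_weight a p x) * indicator {0<..T} x \<partial>lborel)
        \<le> (\<integral>\<^sup>+x. ennreal (eig_weight a p x) * indicator {0<..1} x + ennreal (2 powr \<bar>a - p\<bar>) * (ennreal (\<bar>x\<bar> powr (- p)) * indicator {-T..T} x) \<partial>lborel)"
    proof (rule nn_integral_mono)
      fix x :: real
      show "ennreal (eig_weight a p x) * indicator {0<..T} x
        \<le> ennreal (eig_weight a p x) * indicator {0<..1} x + ennreal (2 powr \<bar>a - p\<bar>) * (ennreal (\<bar>x\<bar> powr (- p)) * indicator {-T..T} x)"
        using eig_weight_le_far[of x a p] by (cases "x \<le> 1") (auto simp: indicator_def ennreal_leI simp flip: ennreal_mult)
    qed
    also have "\<dots> = (\<integral>\<^sup>+x. ennreal (eig_weight a p x) * indicator {0<..1} x \<partial>lborel)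
        + ennreal (2 powr \<bar>a - p\<bar>) * (\<integral>\<^sup>+x. ennreal (\<bar>x\<bar> powr (- p)) * indicator {-T..T} x \<partial>lborel)"
      by (subst nn_integral_add) (auto simp: nn_integral_cmult)
    also have "\<dots> \<le> ennreal (2 powr \<bar>a - p\<bar> * (2 / (1 - a))) + ennreal (2 powr \<bar>a - p\<bar>) * ennreal (2 * (T powr (- p + 1) / (- p + 1)))"
      using assms T by (intro add_mono eig_weight_near_integral mult_left_mono nn_integral_abs_powr) auto
    also have "\<dots> = ennreal (2 powr \<bar>a - p\<bar> * (2 / (1 - a)) + 2 powr \<bar>a - p\<bar> * (2 * (T powr (- p + 1) / (- p + 1))))"
      using assms by (subst ennreal_plus) (auto simp flip: ennreal_mult)
    also have "\<dots> \<le> ennreal (c * T powr (1 - p))"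
    proof (rule ennreal_leI)
      have "1 \<le> T powr (1 - p)" using T assms by (intro ge_one_powr_ge_zero) auto
      then have "2 / (1 - a) * 1 \<le> 2 / (1 - a) * T powr (1 - p)" using assms by (intro mult_left_mono) auto
      then have "2 powr \<bar>a - p\<bar> * (2 / (1 - a) + 2 * (T powr (- p + 1) / (- p + 1)))
          \<le> 2 powr \<bar>a - p\<bar> * (2 / (1 - a) * T powr (1 - p) + 2 / (1 - p) * T powr (1 - p))"
        by (intro mult_left_mono add_mono) (auto simp: add.commute)
      then show "2 powr \<bar>a - p\<bar> * (2 / (1 - a)) + 2 powr \<bar>a - p\<bar> * (2 * (T powr (- p + 1) / (- p + 1))) \<le> c * T powr (1 - p)"
        unfolding c_def distrib_left distrib_right by (simp only: mult.assoc)
    qed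
    finally show ?thesis .
  qed
  moreover have "0 \<le> c" using assms by (simp add: c_def)
  ultimately show ?thesis using that by blast
qed

lemma chamber_integral_finite:
  assumes "a < 1" "1 < p"
  shows "(\<integral>\<^sup>+d. ennreal (\<Prod>i\<in>UNIV. eig_weight a p (d $ i)) * indicator chamber d \<partial>(lborel :: (real^'k::{finite,linorder}) measure)) < \<infinity>"
proof -
  have "(\<integral>\<^sup>+d. ennreal (\<Prod>i\<in>UNIV. eig_weight a p (d $ i)) * indicator chamber d \<partial>(lborel :: (real^'k::_) measure))
      \<le> (\<integral>\<^sup>+d. (\<Prod>i\<in>UNIV. ennreal (eig_weight a p (d $ i)) * indicator {0<..} (d $ i)) \<partial>(lborel :: (real^'k::_) measure))"
  proof (rule nn_integral_mono)
    fix d :: "real^'k::_"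
    show "ennreal (\<Prod>i\<in>UNIV. eig_weight a p (d $ i)) * indicator chamber d \<le> (\<Prod>i\<in>UNIV. ennreal (eig_weight a p (d $ i)) * indicator {0<..} (d $ i))"
      using chamber_pos[of d] by (cases "d \<in> chamber") (auto simp: prod_ennreal)
  qed
  also have "\<dots> = (\<Prod>i\<in>(UNIV :: 'k set). \<integral>\<^sup>+x. ennreal (eig_weight a p x) * indicator {0<..} x \<partial>lborel)"
    by (rule nn_integral_lborel_vec_prod) measurable
  also have "\<dots> < \<infinity>"
    using eig_weight_integral_finite[OF assms] by (simp add: power_less_top_ennreal)
  finally show ?thesis .
qed

text \<open>
  At the critical exponent the integral diverges only along the overall scale.  Writing
  \<open>(1 + d\<^sub>1) powr -\<gamma>\<close> as an integral over the scales \<open>T \<ge> 1 + d\<^sub>1\<close> reduces it to a product for each \<open>T\<close>.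
\<close>

lemma chamber_integral_critical:
  fixes i0 :: "'k::{finite,linorder}"
  assumes a: "a < 1" and i0: "\<And>j. i0 \<le> j"
  obtains c where "0 \<le> c" "\<And>s. 0 < s \<Longrightarrow> s \<le> 1/2 \<Longrightarrow>
    (\<integral>\<^sup>+d. ennreal ((1 + d $ i0) powr (- (1/2 + s)) * (\<Prod>i\<in>UNIV. eig_weight a (1 - 1 / (2 * real CARD('k))) (d $ i))) * indicator chamber d
      \<partial>(lborel :: (real^'k::_) measure)) \<le> ennreal (c / s)"
proof -
  let ?k = "real CARD('k)"
  \<comment> \<open>Chosen so that \<open>1 - ?p = 1 / (2 k)\<close>: the product of the
    \<open>k\<close> truncated masses grows like \<open>T powr (1/2)\<close>, which cancels the 1/2
    in the exponent of the largest eigenvalue and leaves \<open>T powr (-1 - s)\<close>.\<close>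
  let ?p = "1 - 1 / (2 * ?k)"
  have k0: "0 < ?k" by simp
  obtain c where c: "0 \<le> c" and growth: "\<And>T. 1 \<le> T \<Longrightarrow>
    (\<integral>\<^sup>+x. ennreal (eig_weight a ?p x) * indicator {0<..T} x \<partial>lborel) \<le> ennreal (c * T powr (1 - ?p))"
    using eig_weight_integral_growth[of a ?p] a by (auto simp: k0)
  have "(\<integral>\<^sup>+d. ennreal ((1 + d $ i0) powr (- (1/2 + s)) * (\<Prod>i\<in>UNIV. eig_weight a ?p (d $ i))) * indicator chamber d
      \<partial>(lborel :: (real^'k::_) measure)) \<le> ennreal (c ^ CARD('k) / s)" if s: "0 < s" "s \<le> 1/2" for s
  proof -
    let ?g = "1/2 + s"
    let ?w = "\<lambda>T::real. ennreal (?g * T powr (- ?g - 1)) * indicator {1..} T"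
    have "(\<integral>\<^sup>+d. ennreal ((1 + d $ i0) powr (- ?g) * (\<Prod>i\<in>UNIV. eig_weight a ?p (d $ i))) * indicator chamber d \<partial>(lborel :: (real^'k::_) measure))
        \<le> (\<integral>\<^sup>+d. (\<integral>\<^sup>+T. ?w T * (\<Prod>i\<in>UNIV. ennreal (eig_weight a ?p (d $ i)) * indicator {0<..} (d $ i) * indicator {x. x \<le> T} (d $ i)) \<partial>lborel) \<partial>(lborel :: (real^'k::_) measure))"
    proof (rule nn_integral_mono)
      fix d :: "real^'k::_"
      show "ennreal ((1 + d $ i0) powr (- ?g) * (\<Prod>i\<in>UNIV. eig_weight a ?p (d $ i))) * indicator chamber d
        \<le> (\<integral>\<^sup>+T. ?w T * (\<Prod>i\<in>UNIV. ennreal (eig_weight a ?p (d $ i)) * indicator {0<..} (d $ i) * indicator {x. x \<le> T} (d $ i)) \<partial>lborel)"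
      proof (cases "d \<in> chamber")
        case True
        let ?P = "\<Prod>i\<in>UNIV. eig_weight a ?p (d $ i)"
        have P0: "0 \<le> ?P" by (intro prod_nonneg) auto
        have d0: "0 < d $ i0" using chamber_pos[OF True] .
        have "(\<integral>\<^sup>+T. ennreal (T powr (- ?g - 1)) * indicator {1 + d $ i0..} T \<partial>lborel) = ennreal ((1 + d $ i0) powr (- ?g) / ?g)"
          using nn_integral_powr_tail[of "- ?g - 1" "1 + d $ i0"] s d0 by simp
        then have "ennreal ((1 + d $ i0) powr (- ?g) * ?P)
            = ennreal (?g * ?P) * (\<integral>\<^sup>+T. ennreal (T powr (- ?g - 1)) * indicator {1 + d $ i0..} T \<partial>lborel)"
          using s P0 by (simp flip: ennreal_mult)
        also have "\<dots> = (\<integral>\<^sup>+T. ennreal (?g * ?P) * (ennreal (T powr (- ?g - 1)) * indicator {1 + d $ i0..} T) \<partial>lborel)"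
          by (rule nn_integral_cmult[symmetric]) measurable
        also have "\<dots> \<le> (\<integral>\<^sup>+T. ?w T * (\<Prod>i\<in>UNIV. ennreal (eig_weight a ?p (d $ i)) * indicator {0<..} (d $ i) * indicator {x. x \<le> T} (d $ i)) \<partial>lborel)"
        proof (rule nn_integral_mono)
          fix T :: real
          show "ennreal (?g * ?P) * (ennreal (T powr (- ?g - 1)) * indicator {1 + d $ i0..} T)
            \<le> ?w T * (\<Prod>i\<in>UNIV. ennreal (eig_weight a ?p (d $ i)) * indicator {0<..} (d $ i) * indicator {x. x \<le> T} (d $ i))"
          proof (cases "1 + d $ i0 \<le> T")
            case le: True
            \<comment> \<open>\<open>i0\<close> is the least index and hence belongs to the largest
              eigenvalue, so a scale above it bounds all of them.\<close>
            have "d $ i \<le> T" "0 < d $ i" for i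
              using chamber_mono[OF True i0, of i] chamber_pos[OF True, of i] le by auto
            then have "(\<Prod>i\<in>UNIV. ennreal (eig_weight a ?p (d $ i)) * indicator {0<..} (d $ i) * indicator {x. x \<le> T} (d $ i)) = ennreal ?P"
              by (simp add: prod_ennreal)
            then show ?thesis using le d0 s P0 by (simp add: mult_ac flip: ennreal_mult)
          qed simp
        qed
        finally show ?thesis using True by simp
      qed simp
    qed
    also have "\<dots> = (\<integral>\<^sup>+T. (\<integral>\<^sup>+d. ?w T * (\<Prod>i\<in>UNIV. ennreal (eig_weight a ?p (d $ i)) * indicator {0<..} (d $ i) * indicator {x. x \<le> T} (d $ i)) \<partial>(lborel :: (real^'k::_) measure)) \<partial>lborel)"
      by (rule lborel_pair.Fubini') measurable
    also have "\<dots> \<le> (\<integral>\<^sup>+T. ennreal (c ^ CARD('k)) * (ennreal (T powr (- 1 - s)) * indicator {1..} T) \<partial>lborel)"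
    proof (rule nn_integral_mono)
      fix T :: real
      have "(\<integral>\<^sup>+d. ?w T * (\<Prod>i\<in>UNIV. ennreal (eig_weight a ?p (d $ i)) * indicator {0<..} (d $ i) * indicator {x. x \<le> T} (d $ i)) \<partial>(lborel :: (real^'k::_) measure))
          = ?w T * (\<Prod>i\<in>(UNIV :: 'k set). \<integral>\<^sup>+x. ennreal (eig_weight a ?p x) * indicator {0<..} x * indicator {x. x \<le> T} x \<partial>lborel)"
        by (subst nn_integral_cmult) (simp_all add: nn_integral_lborel_vec_prod[where f="\<lambda>_ x. ennreal (eig_weight a ?p x) * indicator {0<..} x * indicator {x. x \<le> T} x"])
      also have "\<dots> = ?w T * (\<integral>\<^sup>+x. ennreal (eig_weight a ?p x) * indicator {0<..T} x \<partial>lborel) ^ CARD('k)"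
      proof -
        have "(\<integral>\<^sup>+x. ennreal (eig_weight a ?p x) * indicator {0<..} x * indicator {x. x \<le> T} x \<partial>lborel)
            = (\<integral>\<^sup>+x. ennreal (eig_weight a ?p x) * indicator {0<..T} x \<partial>lborel)"
          by (intro nn_integral_cong) (auto simp: indicator_def)
        then show ?thesis by simp
      qed
      also have "\<dots> \<le> ennreal (c ^ CARD('k)) * (ennreal (T powr (- 1 - s)) * indicator {1..} T)"
      proof (cases "1 \<le> T")
        case T: True
        have "(\<integral>\<^sup>+x. ennreal (eig_weight a ?p x) * indicator {0<..T} x \<partial>lborel) ^ CARD('k) \<le> ennreal (c * T powr (1 - ?p)) ^ CARD('k)"
          using growth[OF T] by (intro power_mono) auto
        also have "\<dots> = ennreal (c ^ CARD('k) * T powr (1/2))"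
          using c T k0 by (simp add: ennreal_power power_mult_distrib powr_realpow[symmetric] powr_powr)
        finally have "?w T * (\<integral>\<^sup>+x. ennreal (eig_weight a ?p x) * indicator {0<..T} x \<partial>lborel) ^ CARD('k)
            \<le> ?w T * ennreal (c ^ CARD('k) * T powr (1/2))"
          by (rule mult_left_mono) simp
        also have "\<dots> = ennreal (?g * T powr (- ?g - 1) * (c ^ CARD('k) * T powr (1/2)))"
          using T s c by (simp flip: ennreal_mult)
        also have "?g * T powr (- ?g - 1) * (c ^ CARD('k) * T powr (1/2)) = ?g * (c ^ CARD('k) * (T powr (- ?g - 1) * T powr (1/2)))"
          by (simp only: mult_ac)
        also have "T powr (- ?g - 1) * T powr (1/2) = T powr (- 1 - s)"
          by (simp flip: powr_add)
        also have "ennreal (?g * (c ^ CARD('k) * T powr (- 1 - s))) \<le> ennreal (1 * (c ^ CARD('k) * T powr (- 1 - s)))"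
          using s c by (intro ennreal_leI mult_right_mono) auto
        finally show ?thesis using T c by (simp add: ennreal_mult)
      qed simp
      finally show "(\<integral>\<^sup>+d. ?w T * (\<Prod>i\<in>UNIV. ennreal (eig_weight a ?p (d $ i)) * indicator {0<..} (d $ i) * indicator {x. x \<le> T} (d $ i)) \<partial>(lborel :: (real^'k::_) measure))
          \<le> ennreal (c ^ CARD('k)) * (ennreal (T powr (- 1 - s)) * indicator {1..} T)" .
    qed
    also have "\<dots> = ennreal (c ^ CARD('k)) * ennreal (1 powr (- 1 - s + 1) / (- (- 1 - s) - 1))"
      using s by (subst nn_integral_cmult) (auto simp: nn_integral_powr_tail)
    also have "\<dots> = ennreal (c ^ CARD('k) / s)"
      using s c by (simp flip: ennreal_mult)
    finally show ?thesis .
  qed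
  then show ?thesis using that[of "c ^ CARD('k)"] c by simp
qed

section \<open>The mixing density of the scale parameter\<close>

context
  fixes \<pi>L :: "real \<Rightarrow> real" and b C :: real
  assumes L_meas: "set_borel_measurable borel {0<..} \<pi>L"
    and L_nonneg: "\<And>l. l > 0 \<Longrightarrow> \<pi>L l \<ge> 0"
    and L_fin: "\<And>c. c > 0 \<Longrightarrow> (\<integral>\<^sup>+ l\<in>{0<..c}. ennreal (\<pi>L l) \<partial>lborel) < \<infinity>"
    and C_pos: "C > 0" and L_asymp: "\<pi>L \<sim>[at_top] (\<lambda>l. C * l powr (- b))"
begin

lemma mixing_tail:
  obtains L where "1 \<le> L" "\<And>l. L \<le> l \<Longrightarrow> \<pi>L l \<le> 2 * C * l powr (- b)"
proof -
  have "\<forall>\<^sub>F l in at_top. norm (\<pi>L l) \<le> 2 * norm (C * l powr (- b))"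
    using asymp_equiv_imp_eventually_le[OF L_asymp, of 2] by simp
  then obtain L0 where L0: "\<And>l. L0 \<le> l \<Longrightarrow> norm (\<pi>L l) \<le> 2 * norm (C * l powr (- b))"
    by (auto simp: eventually_at_top_linorder)
  show ?thesis
  proof (rule that[of "max 1 L0"])
    fix l assume "max 1 L0 \<le> l"
    then show "\<pi>L l \<le> 2 * C * l powr (- b)"
      using L0[of l] C_pos by (simp add: abs_mult)
  qed simp
qed

lemma mixing_measurable [measurable]: "(\<lambda>l. ennreal (\<pi>L l) * indicator {0<..} l) \<in> borel_measurable borel"
proof -
  have "(\<lambda>l. ennreal (indicator {0<..} l *\<^sub>R \<pi>L l)) \<in> borel_measurable borel"
    using L_meas unfolding set_borel_measurable_def by measurable
  moreover have "ennreal (indicator {0<..} l *\<^sub>R \<pi>L l) = ennreal (\<pi>L l) * indicator {0<..} l" for l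
    by (auto simp: indicator_def)
  ultimately show ?thesis by simp
qed

text \<open>Below \<open>L\<close> the weight is at most 1 and local integrability suffices. Above
  \<open>L\<close> the power tail integrates explicitly, and \<open>L \<ge> 1\<close> lets the
  remaining power of \<open>L\<close> be dropped.\<close>

lemma mixing_split:
  assumes L: "1 \<le> L" "\<And>l. L \<le> l \<Longrightarrow> \<pi>L l \<le> 2 * C * l powr (- b)" and \<kappa>: "0 \<le> \<kappa>" "1 < b + \<kappa>"
  shows "(\<integral>\<^sup>+l\<in>{0<..}. ennreal (\<pi>L l) * ennreal ((1 + l) powr (- \<kappa>)) \<partial>lborel)
    \<le> (\<integral>\<^sup>+ l\<in>{0<..L}. ennreal (\<pi>L l) \<partial>lborel) + ennreal (2 * C / (b + \<kappa> - 1))"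
proof -
  have m [measurable]: "(\<lambda>l. ennreal (\<pi>L l) * indicator {0<..L} l) \<in> borel_measurable borel"
  proof -
    have "ennreal (\<pi>L l) * indicator {0<..L} l = ennreal (\<pi>L l) * indicator {0<..} l * indicator {..L} l" for l
      by (auto simp: indicator_def)
    then show ?thesis by simp
  qed
  have "(\<integral>\<^sup>+l\<in>{0<..}. ennreal (\<pi>L l) * ennreal ((1 + l) powr (- \<kappa>)) \<partial>lborel)
      \<le> (\<integral>\<^sup>+l. ennreal (\<pi>L l) * indicator {0<..L} l + ennreal (2 * C) * (ennreal (l powr (- (b + \<kappa>))) * indicator {L..} l) \<partial>lborel)"
  proof (rule nn_integral_mono)
    fix l :: real
    show "ennreal (\<pi>L l) * ennreal ((1 + l) powr (- \<kappa>)) * indicator {0<..} l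
      \<le> ennreal (\<pi>L l) * indicator {0<..L} l + ennreal (2 * C) * (ennreal (l powr (- (b + \<kappa>))) * indicator {L..} l)"
    proof (cases "0 < l")
      case l: True
      have "(1 + l) powr (- \<kappa>) \<le> 1 powr (- \<kappa>)" using l \<kappa> by (intro powr_mono2') auto
      then have one: "ennreal (\<pi>L l) * ennreal ((1 + l) powr (- \<kappa>)) \<le> ennreal (\<pi>L l)"
        using L_nonneg[OF l] by (simp flip: ennreal_mult add: ennreal_leI mult_left_le)
      show ?thesis
      proof (cases "l \<le> L")
        case True
        then show ?thesis using one l by (simp add: add_increasing2)
      next
        case False
        have "(1 + l) powr (- \<kappa>) \<le> l powr (- \<kappa>)" using l \<kappa> by (intro powr_mono2') auto
        then have "\<pi>L l * (1 + l) powr (- \<kappa>) \<le> (2 * C * l powr (- b)) * l powr (- \<kappa>)"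
          using L(2)[of l] L_nonneg[OF l] False C_pos by (intro mult_mono) auto
        also have "\<dots> = 2 * C * l powr (- (b + \<kappa>))"
          by (simp add: mult.assoc flip: powr_add)
        finally show ?thesis
          using False l L_nonneg[OF l] C_pos by (simp flip: ennreal_mult add: ennreal_leI)
      qed
    qed simp
  qed
  also have "\<dots> = (\<integral>\<^sup>+ l\<in>{0<..L}. ennreal (\<pi>L l) \<partial>lborel) + ennreal (2 * C) * (\<integral>\<^sup>+l. ennreal (l powr (- (b + \<kappa>))) * indicator {L..} l \<partial>lborel)"
    by (subst nn_integral_add) (auto simp: nn_integral_cmult)
  also have "(\<integral>\<^sup>+l. ennreal (l powr (- (b + \<kappa>))) * indicator {L..} l \<partial>lborel) = ennreal (L powr (- (b + \<kappa>) + 1) / (- (- (b + \<kappa>)) - 1))"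
    using L \<kappa> by (intro nn_integral_powr_tail) auto
  also have "\<dots> \<le> ennreal (1 / (b + \<kappa> - 1))"
  proof (rule ennreal_leI)
    have "L powr (- (b + \<kappa>) + 1) \<le> 1 powr (- (b + \<kappa>) + 1)" using L \<kappa> by (intro powr_mono2') auto
    then have "L powr (- (b + \<kappa>) + 1) / (b + \<kappa> - 1) \<le> 1 / (b + \<kappa> - 1)"
      using \<kappa> L by (intro divide_right_mono) auto
    then show "L powr (- (b + \<kappa>) + 1) / (- (- (b + \<kappa>)) - 1) \<le> 1 / (b + \<kappa> - 1)"
      by (simp only: minus_minus)
  qed
  finally show ?thesis
    using C_pos \<kappa> by (simp add: mult_left_mono add_left_mono flip: ennreal_mult)
qed

lemma mixing_proper:
  assumes "1 < b"
  shows "(\<integral>\<^sup>+l\<in>{0<..}. ennreal (\<pi>L l) \<partial>lborel) < \<infinity>"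
proof -
  obtain L where L: "1 \<le> L" "\<And>l. L \<le> l \<Longrightarrow> \<pi>L l \<le> 2 * C * l powr (- b)" using mixing_tail by blast
  have eq: "(\<integral>\<^sup>+l\<in>{0<..}. ennreal (\<pi>L l) \<partial>lborel) = (\<integral>\<^sup>+l\<in>{0<..}. ennreal (\<pi>L l) * ennreal ((1 + l) powr (- 0)) \<partial>lborel)"
    by (intro nn_integral_cong) (auto simp: indicator_def)
  also have "\<dots> \<le> (\<integral>\<^sup>+ l\<in>{0<..L}. ennreal (\<pi>L l) \<partial>lborel) + ennreal (2 * C / (b + 0 - 1))"
    using assms by (intro mixing_split L) auto
  also have "\<dots> < \<infinity>" using L_fin[of L] L by simp
  finally show ?thesis .
qed

text \<open>The exponent \<open>1 - b + s\<close> completes the tail \<open>l powr (-b)\<close> to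
  \<open>l powr (-1 - s)\<close> whatever \<open>b\<close> is, and this integrates to order
  \<open>1 / s\<close>.\<close>

lemma mixing_shrink:
  obtains c where "0 \<le> c" "\<And>s. 0 < s \<Longrightarrow> s \<le> 1 \<Longrightarrow> 0 \<le> 1 - b + s \<Longrightarrow>
    (\<integral>\<^sup>+l\<in>{0<..}. ennreal (\<pi>L l) * ennreal ((1 + l) powr (- (1 - b + s))) \<partial>lborel) \<le> ennreal (c / s)"
proof -
  obtain L where L: "1 \<le> L" "\<And>l. L \<le> l \<Longrightarrow> \<pi>L l \<le> 2 * C * l powr (- b)" using mixing_tail by blast
  define M where "M = enn2real (\<integral>\<^sup>+ l\<in>{0<..L}. ennreal (\<pi>L l) \<partial>lborel)"
  have M: "(\<integral>\<^sup>+ l\<in>{0<..L}. ennreal (\<pi>L l) \<partial>lborel) = ennreal M" and M0: "0 \<le> M"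
    using L_fin[of L] L(1) by (auto simp: M_def)
  show ?thesis
  proof (rule that[of "M + 2 * C"])
    fix s assume s: "0 < s" "s \<le> 1" "0 \<le> 1 - b + s"
    have "(\<integral>\<^sup>+l\<in>{0<..}. ennreal (\<pi>L l) * ennreal ((1 + l) powr (- (1 - b + s))) \<partial>lborel)
        \<le> ennreal M + ennreal (2 * C / (b + (1 - b + s) - 1))"
      unfolding M[symmetric] using s by (intro mixing_split L) auto
    also have "\<dots> = ennreal (M + 2 * C / s)" using M0 C_pos s by simp
    also have "\<dots> \<le> ennreal ((M + 2 * C) / s)"
    proof (rule ennreal_leI)
      have "M * s \<le> M * 1" using M0 s by (intro mult_left_mono) auto
      then have "M \<le> M / s" using s by (simp add: field_simps)
      then show "M + 2 * C / s \<le> (M + 2 * C) / s" by (simp add: add_divide_distrib)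
    qed
    finally show "(\<integral>\<^sup>+l\<in>{0<..}. ennreal (\<pi>L l) * ennreal ((1 + l) powr (- (1 - b + s))) \<partial>lborel) \<le> ennreal ((M + 2 * C) / s)" .
  qed (use M0 C_pos in auto)
qed

text \<open>Needed to exclude that the prior of \<open>\<beta>\<close> is the zero measure.\<close>

lemma mixing_eventually_pos: obtains L where "0 < L" "\<And>l. L \<le> l \<Longrightarrow> 0 < \<pi>L l"
proof -
  have "\<forall>\<^sub>F l in at_top. 0 < C * l powr (- b)"
    using eventually_gt_at_top[of "0::real"] by eventually_elim (simp add: C_pos)
  then have "\<forall>\<^sub>F l in at_top. 0 < \<pi>L l"
    using asymp_equiv_eventually_pos_iff[OF L_asymp] by eventually_elim simp
  then obtain L0 where "\<And>l. L0 \<le> l \<Longrightarrow> 0 < \<pi>L l" by (auto simp: eventually_at_top_linorder)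
  then show ?thesis using that[of "max 1 L0"] by simp
qed

end

section \<open>The two-stage prior\<close>

definition gauss_kernel :: "real^'k^'m \<Rightarrow> real" where
  "gauss_kernel z = exp (- (norm z)\<^sup>2 / 2) / sqrt ((2 * pi) ^ CARD('k)) ^ CARD('m)"

lemma likelihood_eq: "likelihood x \<theta> = gauss_kernel (x - \<theta>)"
proof -
  have inv: "matrix_inv (mat 1) = (mat 1 :: real^'a^'a)" by (rule matrix_inv_eqI) simp_all
  have "likelihood x \<theta> = (\<Prod>i\<in>UNIV. exp (- (norm ((x - \<theta>) $ i))\<^sup>2 / 2) / sqrt ((2 * pi) ^ CARD('a)))"
    by (simp add: likelihood_def mvn_density_def inv power2_norm_eq_inner)
  also have "\<dots> = exp (\<Sum>i\<in>UNIV. - (norm ((x - \<theta>) $ i))\<^sup>2 / 2) / sqrt ((2 * pi) ^ CARD('a)) ^ CARD('b)"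
    by (simp only: prod_dividef exp_sum finite prod_constant)
  also have "(\<Sum>i\<in>UNIV. - (norm ((x - \<theta>) $ i))\<^sup>2 / 2) = - (norm (x - \<theta>))\<^sup>2 / 2"
    by (simp add: norm_vec_def[of "x - \<theta>"] L2_set_def sum_nonneg sum_negf sum_divide_distrib)
  finally show ?thesis by (simp add: gauss_kernel_def)
qed

lemma gauss_kernel_pos: "0 < gauss_kernel z"
  by (simp add: gauss_kernel_def)

lemma gauss_kernel_measurable [measurable]: "gauss_kernel \<in> borel_measurable borel"
  unfolding gauss_kernel_def[abs_def] by measurable

text \<open>The inequality \<open>x \<le> exp x\<close> at \<open>x = y / (4 j)\<close>, raised to
  the power \<open>j\<close>.\<close>

lemma power_exp_bounded:
  fixes y :: real
  assumes "0 \<le> y"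
  shows "y ^ j * exp (- y / 4) \<le> (4 * real j) ^ j"
proof (cases "j = 0")
  case False
  have "y / (4 * real j) \<le> exp (y / (4 * real j))"
    using exp_ge_add_one_self[of "y / (4 * real j)"] by linarith
  then have "(y / (4 * real j)) ^ j \<le> exp (y / (4 * real j)) ^ j"
    using assms by (intro power_mono) auto
  also have "\<dots> = exp (y / 4)"
    using False by (simp flip: exp_of_nat_mult)
  finally have "y ^ j \<le> (4 * real j) ^ j * exp (y / 4)"
    using False by (simp add: power_divide field_simps)
  then show ?thesis by (simp add: exp_minus field_simps)
qed (use assms in simp)

text \<open>Half of the Gaussian exponent pays for the power of \<open>qq\<close>; the other half
  remains as an integrable bound.\<close>

lemma gauss_kernel_moment_le:
  "\<exists>C\<ge>0. \<forall>z :: real^'k^'m. qq z ^ j * gauss_kernel z \<le> C * exp (- (norm z)\<^sup>2 / 4)"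
proof -
  let ?c = "sqrt ((2 * pi) ^ CARD('k)) ^ CARD('m)"
  have "qq z ^ j * gauss_kernel z \<le> (4 * real j) ^ j * exp (1/4) / ?c * exp (- (norm z)\<^sup>2 / 4)" for z :: "real^'k^'m"
  proof -
    have "exp (- (norm z)\<^sup>2 / 2) = exp (- qq z / 4) * (exp (1/4) * exp (- (norm z)\<^sup>2 / 4))"
      by (simp add: qq_def field_simps flip: exp_add)
    then have "qq z ^ j * gauss_kernel z = (qq z ^ j * exp (- qq z / 4)) * (exp (1/4) * exp (- (norm z)\<^sup>2 / 4) / ?c)"
      by (simp add: gauss_kernel_def)
    also have "\<dots> \<le> (4 * real j) ^ j * (exp (1/4) * exp (- (norm z)\<^sup>2 / 4) / ?c)"
      by (intro mult_right_mono power_exp_bounded qq_nonneg) auto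
    finally show ?thesis by (simp add: mult_ac)
  qed
  then show ?thesis by (intro exI[of _ "(4 * real j) ^ j * exp (1/4) / ?c"]) auto
qed

lemma nn_integral_exp_norm_sq_finite: "(\<integral>\<^sup>+z. ennreal (exp (- (norm (z :: 'a::euclidean_space))\<^sup>2 / 4)) \<partial>lborel) < \<infinity>"
proof -
  have one: "(\<integral>\<^sup>+t. ennreal (exp (- (t::real)\<^sup>2 / 4)) \<partial>lborel) < \<infinity>"
  proof -
    have "ennreal (exp (- t\<^sup>2 / 4)) = ennreal (sqrt (4 * pi)) * ennreal (normal_density 0 (sqrt 2) t)" for t
      by (simp add: normal_density_def flip: ennreal_mult)
    then have "(\<integral>\<^sup>+t. ennreal (exp (- (t::real)\<^sup>2 / 4)) \<partial>lborel) = (\<integral>\<^sup>+t. ennreal (sqrt (4 * pi)) * ennreal (normal_density 0 (sqrt 2) t) \<partial>lborel)"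
      by simp
    also have "\<dots> = ennreal (sqrt (4 * pi))"
      by (subst nn_integral_cmult) (auto simp: nn_integral_normal_density)
    finally show ?thesis by simp
  qed
  have "exp (- (norm z)\<^sup>2 / 4) = (\<Prod>b\<in>Basis. exp (- (z \<bullet> b)\<^sup>2 / 4))" for z :: 'a
  proof -
    have "(norm z)\<^sup>2 = (\<Sum>b\<in>Basis. (z \<bullet> b)\<^sup>2)"
      using euclidean_inner[of z z] by (simp only: power2_norm_eq_inner power2_eq_square[of "_ \<bullet> _"])
    then show ?thesis by (simp add: exp_sum[symmetric] sum_negf sum_divide_distrib)
  qed
  then have "(\<integral>\<^sup>+z. ennreal (exp (- (norm (z :: 'a))\<^sup>2 / 4)) \<partial>lborel) = (\<integral>\<^sup>+z. (\<Prod>b\<in>Basis. ennreal (exp (- ((z :: 'a) \<bullet> b)\<^sup>2 / 4))) \<partial>lborel)"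
    by (simp add: prod_ennreal)
  also have "\<dots> = (\<Prod>b\<in>(Basis :: 'a set). \<integral>\<^sup>+t. ennreal (exp (- t\<^sup>2 / 4)) \<partial>lborel)"
    by (rule nn_integral_lborel_prod) auto
  also have "\<dots> < \<infinity>" using one by (simp add: power_less_top_ennreal)
  finally show ?thesis .
qed

lemma gauss_kernel_bounded: "\<exists>C. \<forall>z :: real^'k^'m. qq z ^ j * gauss_kernel z \<le> C"
proof -
  obtain C where C: "0 \<le> C" "\<And>z :: real^'k^'m. qq z ^ j * gauss_kernel z \<le> C * exp (- (norm z)\<^sup>2 / 4)"
    using gauss_kernel_moment_le by blast
  have "C * exp (- (norm z)\<^sup>2 / 4) \<le> C" for z :: "real^'k^'m"
    using C(1) by (intro mult_left_le) auto
  then show ?thesis using C(2) order_trans by blast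
qed

lemma gauss_kernel_moment_finite: "(\<integral>\<^sup>+z. ennreal (qq z ^ j * gauss_kernel (z :: real^'k^'m)) \<partial>lborel) < \<infinity>"
proof -
  obtain C where C: "0 \<le> C" "\<And>z :: real^'k^'m. qq z ^ j * gauss_kernel z \<le> C * exp (- (norm z)\<^sup>2 / 4)"
    using gauss_kernel_moment_le by blast
  have "(\<integral>\<^sup>+z. ennreal (qq z ^ j * gauss_kernel (z :: real^'k^'m)) \<partial>lborel)
      \<le> (\<integral>\<^sup>+z. ennreal C * ennreal (exp (- (norm (z :: real^'k^'m))\<^sup>2 / 4)) \<partial>lborel)"
    using C by (intro nn_integral_mono) (simp flip: ennreal_mult add: ennreal_leI)
  also have "\<dots> = ennreal C * (\<integral>\<^sup>+z. ennreal (exp (- (norm (z :: real^'k^'m))\<^sup>2 / 4)) \<partial>lborel)"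
    by (rule nn_integral_cmult) measurable
  also have "\<dots> < \<infinity>"
    using nn_integral_exp_norm_sq_finite[where 'a="real^'k^'m"] by (simp add: ennreal_mult_less_top)
  finally show ?thesis .
qed

lemma norm_stack: "norm (stack \<theta>) = norm \<theta>"
proof -
  have "(norm (stack \<theta>))\<^sup>2 = (\<Sum>p\<in>UNIV. (\<theta> $ fst p $ snd p)\<^sup>2)"
    by (simp add: norm_vec_def L2_set_def sum_nonneg stack_def)
  also have "\<dots> = (\<Sum>i\<in>UNIV. \<Sum>j\<in>UNIV. (\<theta> $ i $ j)\<^sup>2)"
    by (simp add: sum.cartesian_product case_prod_beta)
  also have "\<dots> = (norm \<theta>)\<^sup>2"
    by (simp add: norm_vec_def[of \<theta>] norm_vec_def[of "\<theta> $ _"] L2_set_def sum_nonneg)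
  finally show ?thesis by (simp add: power2_eq_iff_nonneg)
qed

lemma bounded_linear_stack: "bounded_linear stack"
  by (intro linear_conv_bounded_linear[THEN iffD1] linearI) (simp_all add: stack_def vec_eq_iff)

section \<open>The measure on the parameter space\<close>

lemma sets_param_measure [measurable_cong]:
  "sets (param_measure :: ((real^'k::{finite,linorder}^'m) \<times> (real^'k::_) \<times> (real^'k::_^'k::_)) measure)
    = sets (borel \<Otimes>\<^sub>M (borel \<Otimes>\<^sub>M borel))"
  unfolding param_measure_def by (intro sets_pair_measure_cong) simp_all

lemma sigma_finite_hyper: "sigma_finite_measure (lborel \<Otimes>\<^sub>M (sym_lborel :: (real^'k::{finite,linorder}^'k::_) measure) :: ((real^'k::_) \<times> _) measure)"
proof -
  interpret pair_sigma_finite "lborel :: (real^'k::_) measure" "sym_lborel :: (real^'k::_^'k::_) measure"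
    by (intro pair_sigma_finite.intro sigma_finite_sym_lborel lborel.sigma_finite_measure_axioms)
  show ?thesis by unfold_locales
qed

text \<open>Tonelli with \<open>V\<close> outermost, the order in which the averages are estimated:
  the blocks given \<open>(\<beta>, V)\<close>, then \<open>\<beta>\<close>, then
  \<open>V\<close>.\<close>

lemma nn_integral_param_measure:
  fixes f :: "(real^'k::{finite,linorder}^'m) \<times> (real^'k::_) \<times> (real^'k::_^'k::_) \<Rightarrow> ennreal"
  assumes [measurable]: "f \<in> borel_measurable (borel \<Otimes>\<^sub>M (borel \<Otimes>\<^sub>M borel))"
  shows "(\<integral>\<^sup>+w. f w \<partial>param_measure) = (\<integral>\<^sup>+V. (\<integral>\<^sup>+\<beta>. (\<integral>\<^sup>+\<theta>. f (\<theta>, \<beta>, V) \<partial>lborel) \<partial>lborel) \<partial>sym_lborel)"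
proof -
  interpret Y: sigma_finite_measure "sym_lborel :: (real^'k::_^'k::_) measure" by (rule sigma_finite_sym_lborel)
  interpret I: pair_sigma_finite "lborel :: (real^'k::_) measure" "sym_lborel :: (real^'k::_^'k::_) measure"
    by (intro pair_sigma_finite.intro sigma_finite_sym_lborel lborel.sigma_finite_measure_axioms)
  interpret O: pair_sigma_finite "lborel :: (real^'k::_^'m) measure" "lborel \<Otimes>\<^sub>M sym_lborel :: ((real^'k::_) \<times> (real^'k::_^'k::_)) measure"
    by (intro pair_sigma_finite.intro sigma_finite_hyper lborel.sigma_finite_measure_axioms)
  have "(\<integral>\<^sup>+w. f w \<partial>param_measure) = (\<integral>\<^sup>+p. (\<integral>\<^sup>+\<theta>. f (\<theta>, p) \<partial>lborel) \<partial>(lborel \<Otimes>\<^sub>M sym_lborel))"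
    unfolding param_measure_def by (rule O.nn_integral_snd[symmetric]) simp
  also have "\<dots> = (\<integral>\<^sup>+V. (\<integral>\<^sup>+\<beta>. (\<integral>\<^sup>+\<theta>. f (\<theta>, \<beta>, V) \<partial>lborel) \<partial>lborel) \<partial>sym_lborel)"
    by (rule I.nn_integral_snd[symmetric]) measurable
  finally show ?thesis .
qed

text \<open>In upper-triangular coordinates a ball around the identity consists of positive-definite
  matrices. This is one half of the proof that the prior of \<open>V\<close> is not zero.\<close>

lemma emeasure_pos_def_pos: "0 < emeasure sym_lborel {V :: real^'k::{finite,linorder}^'k::_. pos_def V}"
proof -
  obtain L where L: "0 < L" "\<And>w. norm (symm w :: real^'k::_^'k::_) \<le> norm w * L"
    using bounded_linear.pos_bounded[OF bounded_linear_symm] by blast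
  define z1 where "z1 = upper (mat 1 :: real^'k::_^'k::_)"
  have z1: "symm z1 = mat 1" by (simp add: z1_def symm_upper)
  have pd: "pos_def (symm z)" if "z \<in> ball z1 (1 / L)" for z
  proof -
    have "norm (symm z - mat 1) = norm (symm (z - z1))"
      by (simp add: z1 linear_diff[OF linear_symm])
    also have "\<dots> \<le> norm (z - z1) * L" by (rule L)
    also have "\<dots> < 1" using that L(1) by (simp add: dist_norm norm_minus_commute field_simps)
    finally have n: "norm (symm z - mat 1) < 1" .
    have "0 < x \<bullet> (symm z *v x)" if "x \<noteq> 0" for x
    proof -
      have "\<bar>x \<bullet> ((symm z - mat 1) *v x)\<bar> \<le> norm x * norm ((symm z - mat 1) *v x)"
        by (rule Cauchy_Schwarz_ineq2)
      also have "\<dots> \<le> norm x * (norm (symm z - mat 1) * norm x)"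
        by (intro mult_left_mono norm_matrix_vector_mult_le) auto
      also have "\<dots> < norm x * (1 * norm x)"
        using n that by (intro mult_strict_left_mono mult_strict_right_mono) auto
      finally have "- (x \<bullet> x) < x \<bullet> ((symm z - mat 1) *v x)"
        by (simp add: dot_square_norm power2_eq_square abs_less_iff)
      then show ?thesis by (simp add: matrix_vector_mult_diff_rdistrib inner_diff_right)
    qed
    then show ?thesis by (simp add: pos_def_def)
  qed
  have "0 < emeasure lborel (ball z1 (1 / L))"
    using L(1) by (simp add: emeasure_ball)
  also have "\<dots> \<le> emeasure lborel (symm -` {V :: real^'k::_^'k::_. pos_def V})"
  proof (rule emeasure_mono)
    show "ball z1 (1 / L) \<subseteq> symm -` {V :: real^'k::_^'k::_. pos_def V}" using pd by blast
    show "symm -` {V :: real^'k::_^'k::_. pos_def V} \<in> sets lborel"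
      using measurable_sets_borel[OF measurable_symm pos_def_sets] by simp
  qed
  also have "\<dots> = emeasure sym_lborel {V :: real^'k::_^'k::_. pos_def V}"
    by (simp add: sym_lborel_eq emeasure_distr)
  finally show ?thesis .
qed

lemma vandermonde_pos_iff: "d \<in> chamber \<Longrightarrow> vandermonde d \<noteq> 0 \<longleftrightarrow> (\<forall>i j. i < j \<longrightarrow> d $ j < d $ i)"
  unfolding vandermonde_def chamber_def by (auto simp: less_le) metis+

text \<open>\<open>TM\<close> carries the type of the block index, which none of the other
  parameters mentions.\<close>

locale two_stage_model =
  fixes a1 a2 b C C1 C2 :: real
    and \<beta>0 :: "real^'k::{finite,linorder}"
    and A :: "real^'k::_^'k::_"
    and \<pi>L :: "real \<Rightarrow> real"
    and \<pi>V :: "real^'k::_^'k::_ \<Rightarrow> real"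
    and TM :: "'m::finite itself"
  assumes k2: "CARD('k) \<ge> 2" and m2: "CARD('m) \<ge> 2"
    and a1: "a1 < 1" and b0: "b \<ge> 0"
    and A: "pos_def A"
    and L_meas: "set_borel_measurable borel {0<..} \<pi>L"
    and L_nonneg: "\<And>l. l > 0 \<Longrightarrow> \<pi>L l \<ge> 0"
    and L_fin: "\<And>c. c > 0 \<Longrightarrow> (\<integral>\<^sup>+ l\<in>{0<..c}. ennreal (\<pi>L l) \<partial>lborel) < \<infinity>"
    and C: "C > 0" and L_asymp: "\<pi>L \<sim>[at_top] (\<lambda>l. C * l powr (- b))"
    and V_meas: "set_borel_measurable borel {V. pos_def V} \<pi>V"
    and V_nonneg: "\<And>V. pos_def V \<Longrightarrow> \<pi>V V \<ge> 0"
    and C1: "C1 > 0" and C2: "C2 > 0"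
    and V_bounds: "\<And>H d. orthogonal_matrix H \<Longrightarrow> (\<forall>i j. i < j \<longrightarrow> d $ i > d $ j) \<Longrightarrow> (\<forall>i. d $ i > 0) \<Longrightarrow>
           C1 / (det (mat 1 + diag d) powr (a2 - a1) * det (diag d) powr a1) \<le> prior_HD \<pi>V H d \<and>
           prior_HD \<pi>V H d \<le> C2 / (det (mat 1 + diag d) powr (a2 - a1) * det (diag d) powr a1)"
    and regime: "(CARD('k) \<ge> 2 \<and> a2 \<ge> 1 - 1 / real CARD('k) \<and> b > 1)
       \<or> (CARD('k) \<ge> 3 \<and> a2 > 1 - b / real CARD('k) \<and> 0 \<le> b \<and> b < 1)
       \<or> (CARD('k) = 2 \<and> a2 > 1 - b / 2 \<and> 0 < b \<and> b < 1)"
begin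

text \<open>\<open>mix\<close> and \<open>hyper\<close> cut the prior densities off to the sets on
  which they are specified. Measurability is assumed only there, and these total versions inherit
  it.\<close>

definition mix :: "real \<Rightarrow> ennreal" where
  "mix l = ennreal (\<pi>L l) * indicator {0<..} l"

definition hyper :: "real^'k::_^'k::_ \<Rightarrow> ennreal" where
  "hyper V = ennreal (\<pi>V V) * indicator {V. pos_def V} V"

definition prior_beta :: "real^'k::_ \<Rightarrow> ennreal" where
  "prior_beta = two_stage_prior \<beta>0 A \<pi>L"

lemma mix_measurable [measurable]: "mix \<in> borel_measurable borel"
  using mixing_measurable[OF L_meas L_nonneg L_fin C L_asymp] by (simp add: mix_def[abs_def])

lemma hyper_measurable [measurable]: "hyper \<in> borel_measurable borel"
proof -
  have "(\<lambda>V. ennreal (indicator {V. pos_def V} V *\<^sub>R \<pi>V V)) \<in> borel_measurable borel"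
    using V_meas unfolding set_borel_measurable_def by measurable
  moreover have "ennreal (indicator {V. pos_def V} V *\<^sub>R \<pi>V V) = hyper V" for V
    by (auto simp: indicator_def hyper_def)
  ultimately show ?thesis by simp
qed

lemma prior_beta_eq: "prior_beta \<beta> = (\<integral>\<^sup>+l. ennreal (mvn_cramer \<beta>0 (l *\<^sub>R A) \<beta>) * mix l \<partial>lborel)"
  unfolding prior_beta_def two_stage_prior_def
proof (intro nn_integral_cong)
  fix l :: real
  show "ennreal (mvn_density \<beta>0 (l *\<^sub>R A) \<beta> * \<pi>L l) * indicator {0<..} l = ennreal (mvn_cramer \<beta>0 (l *\<^sub>R A) \<beta>) * mix l"
  proof (cases "0 < l")
    case True
    then have pd: "pos_def (l *\<^sub>R A)" using A by (rule pos_def_scaleR)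
    show ?thesis
      using True L_nonneg[OF True] mvn_density_nonneg[OF pd, of \<beta>0 \<beta>]
      by (simp add: mix_def ennreal_mult mvn_density_eq_cramer[OF pd])
  qed (simp add: mix_def)
qed

lemma prior_beta_measurable [measurable]: "prior_beta \<in> borel_measurable borel"
  unfolding prior_beta_eq[abs_def] by measurable

lemma nn_integral_prior_beta:
  assumes [measurable]: "f \<in> borel_measurable borel"
  shows "(\<integral>\<^sup>+\<beta>. prior_beta \<beta> * f \<beta> \<partial>lborel) = (\<integral>\<^sup>+l. mix l * (\<integral>\<^sup>+\<beta>. ennreal (mvn_density \<beta>0 (l *\<^sub>R A) \<beta>) * f \<beta> \<partial>lborel) \<partial>lborel)"
proof -
  have "(\<integral>\<^sup>+\<beta>. prior_beta \<beta> * f \<beta> \<partial>lborel) = (\<integral>\<^sup>+\<beta>. (\<integral>\<^sup>+l. ennreal (mvn_cramer \<beta>0 (l *\<^sub>R A) \<beta>) * mix l * f \<beta> \<partial>lborel) \<partial>lborel)"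
    unfolding prior_beta_eq by (intro nn_integral_cong nn_integral_multc[symmetric]) measurable
  also have "\<dots> = (\<integral>\<^sup>+l. (\<integral>\<^sup>+\<beta>. ennreal (mvn_cramer \<beta>0 (l *\<^sub>R A) \<beta>) * mix l * f \<beta> \<partial>lborel) \<partial>lborel)"
    by (rule lborel_pair.Fubini') measurable
  also have "\<dots> = (\<integral>\<^sup>+l. mix l * (\<integral>\<^sup>+\<beta>. ennreal (mvn_density \<beta>0 (l *\<^sub>R A) \<beta>) * f \<beta> \<partial>lborel) \<partial>lborel)"
  proof (rule nn_integral_cong)
    fix l :: real
    show "(\<integral>\<^sup>+\<beta>. ennreal (mvn_cramer \<beta>0 (l *\<^sub>R A) \<beta>) * mix l * f \<beta> \<partial>lborel) = mix l * (\<integral>\<^sup>+\<beta>. ennreal (mvn_density \<beta>0 (l *\<^sub>R A) \<beta>) * f \<beta> \<partial>lborel)"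
    proof (cases "0 < l")
      case True
      then have pd: "pos_def (l *\<^sub>R A)" using A by (rule pos_def_scaleR)
      show ?thesis
        unfolding mvn_density_eq_cramer[OF pd] by (subst nn_integral_cmult[symmetric]) (auto simp: mult_ac)
    qed (simp add: mix_def)
  qed
  finally show ?thesis .
qed

lemma nn_integral_prior_beta_total: "(\<integral>\<^sup>+\<beta>. prior_beta \<beta> \<partial>lborel) = (\<integral>\<^sup>+l. mix l \<partial>lborel)"
proof -
  have "(\<integral>\<^sup>+\<beta>. prior_beta \<beta> \<partial>lborel) = (\<integral>\<^sup>+l. mix l * (\<integral>\<^sup>+\<beta>. ennreal (mvn_density \<beta>0 (l *\<^sub>R A) \<beta>) \<partial>lborel) \<partial>lborel)"
    using nn_integral_prior_beta[of "\<lambda>_. 1"] by simp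
  also have "\<dots> = (\<integral>\<^sup>+l. mix l \<partial>lborel)"
  proof (rule nn_integral_cong)
    fix l :: real
    show "mix l * (\<integral>\<^sup>+\<beta>. ennreal (mvn_density \<beta>0 (l *\<^sub>R A) \<beta>) \<partial>lborel) = mix l"
      using nn_integral_mvn_density[OF pos_def_scaleR[OF _ A, of l], of \<beta>0] by (cases "0 < l") (auto simp: mix_def)
  qed
  finally show ?thesis .
qed

text \<open>On the walls of the chamber the left side is 0. Off them the assumed bound applies, and
  its determinants factor over the eigenvalues into the product of
  \<open>eig_weight\<close>.\<close>

lemma prior_HD_upper:
  assumes H: "orthogonal_matrix H" and d: "d \<in> chamber"
  shows "hyper (transpose H ** diag d ** H) * ennreal (vandermonde d) \<le> ennreal (C2 * (\<Prod>i\<in>UNIV. eig_weight a1 a2 (d $ i)))"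
proof (cases "vandermonde d = 0")
  case False
  then have st: "\<forall>i j. i < j \<longrightarrow> d $ i > d $ j" using vandermonde_pos_iff[OF d] by simp
  have pos: "\<forall>i. d $ i > 0" using chamber_pos[OF d] by simp
  have pd: "pos_def (transpose H ** diag d ** H)" using pos_def_conjugate_diag_iff[OF H] pos by simp
  have id: "mat 1 + diag d = diag (\<chi> i. 1 + d $ i)" by (simp add: mat_def diag_def vec_eq_iff)
  have p1: "(\<Prod>i\<in>UNIV. 1 + d $ i) powr e = (\<Prod>i\<in>UNIV. (1 + d $ i) powr e)" "(\<Prod>i\<in>UNIV. d $ i) powr e = (\<Prod>i\<in>UNIV. (d $ i) powr e)" for e
    using pos by (auto intro!: prod_powr_distrib simp: less_imp_le add_nonneg_nonneg)
  have "C2 / (det (mat 1 + diag d) powr (a2 - a1) * det (diag d) powr a1) = C2 * (\<Prod>i\<in>UNIV. eig_weight a1 a2 (d $ i))"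
  proof -
    have "1 / (x powr (a2 - a1) * y powr a1) = x powr (a1 - a2) * y powr (- a1)" for x y :: real
      using powr_minus_divide[of x "a2 - a1"] powr_minus_divide[of y a1] by simp
    then have "C2 / (det (mat 1 + diag d) powr (a2 - a1) * det (diag d) powr a1) = C2 * (det (mat 1 + diag d) powr (a1 - a2) * det (diag d) powr (- a1))"
      by (metis mult.right_neutral times_divide_eq_right)
    also have "\<dots> = C2 * (\<Prod>i\<in>UNIV. eig_weight a1 a2 (d $ i))"
      unfolding id det_diag by (simp add: p1 eig_weight_def prod.distrib)
    finally show ?thesis .
  qed
  then have "\<pi>V (transpose H ** diag d ** H) * vandermonde d \<le> C2 * (\<Prod>i\<in>UNIV. eig_weight a1 a2 (d $ i))"
    using V_bounds[OF H st pos] by (simp add: prior_HD_def vandermonde_def)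
  then show ?thesis
    using pd V_nonneg[OF pd] vandermonde_nonneg[OF d] by (simp add: hyper_def ennreal_leI flip: ennreal_mult)
qed simp

text \<open>The lower bound with \<open>C1\<close> enters here: the prior of \<open>V\<close> does
  not vanish where the eigenvalues are distinct.\<close>

lemma hyper_pos:
  assumes H: "orthogonal_matrix H" and d: "d \<in> chamber" and v: "vandermonde d \<noteq> 0"
  shows "0 < \<pi>V (transpose H ** diag d ** H)"
proof -
  have st: "\<forall>i j. i < j \<longrightarrow> d $ i > d $ j" using vandermonde_pos_iff[OF d] v by simp
  have pos: "\<forall>i. d $ i > 0" using chamber_pos[OF d] by simp
  have id: "mat 1 + diag d = diag (\<chi> i. 1 + d $ i)" by (simp add: mat_def diag_def vec_eq_iff)
  have "0 < det (mat 1 + diag d)" "0 < det (diag d)"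
    unfolding id det_diag using pos by (auto intro!: prod_pos simp: add_pos_pos)
  then have "0 < C1 / (det (mat 1 + diag d) powr (a2 - a1) * det (diag d) powr a1)"
    using C1 by simp
  also have "\<dots> \<le> \<pi>V (transpose H ** diag d ** H) * vandermonde d"
    using V_bounds[OF H st pos] by (simp add: prior_HD_def vandermonde_def)
  finally show ?thesis
    using vandermonde_nonneg[OF d] by (simp add: zero_less_mult_iff)
qed

definition joint :: "(real^'k::_^'m) \<times> (real^'k::_) \<times> (real^'k::_^'k::_) \<Rightarrow> ennreal" where
  "joint = (\<lambda>(\<theta>, \<beta>, V). ennreal (theta_density \<beta> V \<theta>) * prior_beta \<beta> * hyper V)"

text \<open>The Cramer form, which is jointly measurable, may replace the density because
  \<open>hyper\<close> vanishes off the positive-definite matrices.\<close>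

lemma joint_eq: "joint (\<theta>, \<beta>, V) = ennreal (\<Prod>i\<in>UNIV. mvn_cramer \<beta> V (\<theta> $ i)) * prior_beta \<beta> * hyper V"
  by (cases "pos_def V") (auto simp: joint_def theta_density_def mvn_density_eq_cramer hyper_def)

lemma joint_measurable [measurable]: "joint \<in> borel_measurable (borel \<Otimes>\<^sub>M (borel \<Otimes>\<^sub>M borel))"
proof -
  have "joint = (\<lambda>w. ennreal (\<Prod>i\<in>UNIV. mvn_cramer (fst (snd w)) (snd (snd w)) (fst w $ i)) * prior_beta (fst (snd w)) * hyper (snd (snd w)))"
    by (auto simp: fun_eq_iff joint_eq)
  moreover have "\<dots> \<in> borel_measurable (borel \<Otimes>\<^sub>M (borel \<Otimes>\<^sub>M borel))"
    by measurable
  ultimately show ?thesis by simp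
qed

lemma joint_density_eq: "joint_density (two_stage_prior \<beta>0 A \<pi>L) \<pi>V x w = ennreal (gauss_kernel (x - fst w)) * joint w"
  by (cases w) (simp add: joint_density_def joint_def prior_beta_def hyper_def likelihood_eq mult_ac)

text \<open>The marginal prior of the means, possibly of infinite mass. Through it the hierarchical
  model becomes a translation family with kernel \<open>gauss_kernel\<close>.\<close>

definition \<nu> :: "(real^'k::_^'m) measure" where
  "\<nu> = distr (density param_measure joint) borel fst"

lemma sets_nu [measurable_cong, simp]: "sets \<nu> = sets borel"
  by (simp add: \<nu>_def)

lemma nn_integral_nu:
  assumes [measurable]: "f \<in> borel_measurable borel"
  shows "(\<integral>\<^sup>+\<theta>. f \<theta> \<partial>\<nu>) = (\<integral>\<^sup>+w. joint w * f (fst w) \<partial>param_measure)"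
  unfolding \<nu>_def by (subst nn_integral_distr) (auto simp: nn_integral_density)

text \<open>The moment given \<open>V\<close>, again in Cramer form so that it is measurable in
  \<open>V\<close>, as the bound in spectral coordinates requires.\<close>

definition cond_moment :: "real \<Rightarrow> real^'k::_^'k::_ \<Rightarrow> ennreal" where
  "cond_moment s V = (\<integral>\<^sup>+\<beta>. prior_beta \<beta> * (\<integral>\<^sup>+\<theta>. ennreal (\<Prod>i\<in>UNIV. mvn_cramer \<beta> V ((\<theta> :: real^'k::_^'m) $ i)) * ennreal (qq \<theta> powr (-1 - s)) \<partial>lborel) \<partial>lborel)"

lemma cond_moment_measurable [measurable]: "cond_moment s \<in> borel_measurable borel"
  unfolding cond_moment_def[abs_def] by measurable

lemma cond_moment_eq:
  assumes "pos_def V"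
  shows "cond_moment s V = (\<integral>\<^sup>+\<beta>. prior_beta \<beta> * (\<integral>\<^sup>+\<theta>. ennreal (theta_density \<beta> V (\<theta> :: real^'k::_^'m)) * ennreal (qq \<theta> powr (-1 - s)) \<partial>lborel) \<partial>lborel)"
  unfolding cond_moment_def theta_density_def mvn_density_eq_cramer[OF assms] ..

lemma nu_moment_eq: "(\<integral>\<^sup>+\<theta>. ennreal (qq \<theta> powr (-1 - s)) \<partial>\<nu>)
    = (\<integral>\<^sup>+V. hyper V * cond_moment s V * indicator {V. pos_def V} V \<partial>sym_lborel)"
proof -
  have "(\<integral>\<^sup>+\<theta>. ennreal (qq \<theta> powr (-1 - s)) \<partial>\<nu>) = (\<integral>\<^sup>+w. joint w * ennreal (qq (fst w) powr (-1 - s)) \<partial>param_measure)"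
    by (rule nn_integral_nu) measurable
  also have "\<dots> = (\<integral>\<^sup>+V. (\<integral>\<^sup>+\<beta>. (\<integral>\<^sup>+\<theta>. joint (\<theta>, \<beta>, V) * ennreal (qq \<theta> powr (-1 - s)) \<partial>lborel) \<partial>lborel) \<partial>sym_lborel)"
    by (subst nn_integral_param_measure) auto
  also have "\<dots> = (\<integral>\<^sup>+V. hyper V * cond_moment s V * indicator {V. pos_def V} V \<partial>sym_lborel)"
  proof (rule nn_integral_cong)
    fix V
    have "(\<integral>\<^sup>+\<beta>. (\<integral>\<^sup>+\<theta>. joint (\<theta>, \<beta>, V) * ennreal (qq \<theta> powr (-1 - s)) \<partial>lborel) \<partial>lborel)
        = (\<integral>\<^sup>+\<beta>. (\<integral>\<^sup>+\<theta>. hyper V * (prior_beta \<beta> * (ennreal (\<Prod>i\<in>UNIV. mvn_cramer \<beta> V ((\<theta> :: real^'k::_^'m) $ i)) * ennreal (qq \<theta> powr (-1 - s)))) \<partial>lborel) \<partial>lborel)"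
      by (intro nn_integral_cong) (simp add: joint_eq mult_ac)
    also have "\<dots> = hyper V * cond_moment s V"
      unfolding cond_moment_def by (simp add: nn_integral_cmult)
    also have "\<dots> = hyper V * cond_moment s V * indicator {V. pos_def V} V"
      by (auto simp: hyper_def indicator_def)
    finally show "(\<integral>\<^sup>+\<beta>. (\<integral>\<^sup>+\<theta>. joint (\<theta>, \<beta>, V) * ennreal (qq \<theta> powr (-1 - s)) \<partial>lborel) \<partial>lborel)
        = hyper V * cond_moment s V * indicator {V. pos_def V} V" .
  qed
  finally show ?thesis .
qed

section \<open>Moment bounds for the marginal prior of the means\<close>

lemma two_blocks: obtains m1 m2' :: 'm where "m1 \<noteq> m2'"
proof -
  have "\<not> (\<forall>x y :: 'm. x = y)"
  proof
    assume "\<forall>x y :: 'm. x = y"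
    then have "(UNIV :: 'm set) = {undefined}" by auto
    then have "CARD('m) = 1" by (metis card_1_singleton_iff One_nat_def)
    then show False using m2 by simp
  qed
  then show ?thesis using that by blast
qed

text \<open>Averaging over \<theta> improves the decay of the weight at infinity only; its behaviour
  at 0 is unchanged.\<close>

lemma eig_weight_mult: "0 < x \<Longrightarrow> eig_weight a p x * (1 + x) powr (- e) = eig_weight a (p + e) x"
  unfolding eig_weight_def by (simp add: algebra_simps flip: powr_add)

lemma eig_weight_antimono: "0 < x \<Longrightarrow> p \<le> p' \<Longrightarrow> eig_weight a p' x \<le> eig_weight a p x"
  unfolding eig_weight_def by (intro mult_right_mono powr_mono) auto

text \<open>The prior of \<open>\<beta>\<close> is finite here, so the whole exponent
  \<open>1 + s\<close> is spent on \<open>V\<close>, and the factor \<open>1 / s\<close> comes from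
  the scale of the eigenvalues.\<close>

lemma nu_moment_bound_proper:
  assumes b: "1 < b" and a2: "a2 \<ge> 1 - 1 / real CARD('k)"
  obtains K s0 where "0 < s0" "s0 \<le> 1" "0 \<le> K"
    "\<And>s. 0 < s \<Longrightarrow> s \<le> s0 \<Longrightarrow> (\<integral>\<^sup>+\<theta>. ennreal (qq \<theta> powr (-1 - s)) \<partial>\<nu>) \<le> ennreal (K / s)"
proof -
  let ?k = "real CARD('k)"
  have k: "2 \<le> ?k" using k2 by simp
  define i0 :: 'k where "i0 = Min UNIV"
  have i0: "i0 \<le> j" for j by (simp add: i0_def)
  obtain m1 m2' :: 'm where m: "m1 \<noteq> m2'" by (rule two_blocks)
  obtain c where c: "0 \<le> c" and shrink:
    "\<And>(H :: real^'k::_^'k::_) d \<beta> \<alpha>. orthogonal_matrix H \<Longrightarrow> (\<And>i. 0 < d $ i) \<Longrightarrow> (\<And>i. 0 \<le> \<alpha> i) \<Longrightarrow> (\<And>i. \<alpha> i \<le> 7/16) \<Longrightarrow>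
      (\<integral>\<^sup>+\<theta>. ennreal (theta_density \<beta> (transpose H ** diag d ** H) (\<theta> :: real^'k::_^'m)) * ennreal (qq \<theta> powr (- (2 * (\<Sum>i\<in>UNIV. \<alpha> i)))) \<partial>lborel)
      \<le> ennreal (c * (\<Prod>i\<in>UNIV. (1 + d $ i) powr (- (2 * \<alpha> i))))"
    by (rule theta_shrink_unconditional[OF m, of "7/16"]) auto
  obtain c' where c': "0 \<le> c'" and chamber: "\<And>s. 0 < s \<Longrightarrow> s \<le> 1/2 \<Longrightarrow>
    (\<integral>\<^sup>+d. ennreal ((1 + d $ i0) powr (- (1/2 + s)) * (\<Prod>i\<in>UNIV. eig_weight a1 (1 - 1 / (2 * ?k)) (d $ i))) * indicator chamber d
      \<partial>(lborel :: (real^'k::_) measure)) \<le> ennreal (c' / s)"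
    using chamber_integral_critical[OF a1 i0] by blast
  obtain K where K: "0 \<le> K" and weyl: "\<And>f \<psi>. f \<in> borel_measurable borel \<Longrightarrow> \<psi> \<in> borel_measurable borel \<Longrightarrow>
      (\<And>H d. orthogonal_matrix H \<Longrightarrow> d \<in> chamber \<Longrightarrow>
        f (transpose H ** diag d ** H) * ennreal (vandermonde d) \<le> \<psi> d) \<Longrightarrow>
      (\<integral>\<^sup>+V. f V * indicator {V. pos_def V} V \<partial>sym_lborel)
        \<le> ennreal K * (\<integral>\<^sup>+d. \<psi> d * indicator chamber d \<partial>(lborel :: (real^'k::_) measure))"
    using nn_integral_pos_def_le[where 'k='k] by blast
  define \<Lambda> where "\<Lambda> = enn2real (\<integral>\<^sup>+l. mix l \<partial>lborel)"
  have \<Lambda>: "(\<integral>\<^sup>+\<beta>. prior_beta \<beta> \<partial>lborel) = ennreal \<Lambda>" and \<Lambda>0: "0 \<le> \<Lambda>"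
    using mixing_proper[OF L_meas L_nonneg L_fin C L_asymp b]
    by (auto simp: \<Lambda>_def nn_integral_prior_beta_total mix_def)
  have "(\<integral>\<^sup>+\<theta>. ennreal (qq \<theta> powr (-1 - s)) \<partial>\<nu>) \<le> ennreal (K * (C2 * \<Lambda> * c * c') / s)" if s: "0 < s" "s \<le> 1/8" for s
  proof -
    \<comment> \<open>Since \<alpha> is doubled in \<open>shrink\<close>, every eigenvalue receives
      \<open>2 * q = 1 / (2 k)\<close> and the largest an extra \<open>1/2 + s\<close>, in total
      \<open>1 + s\<close>. With \<open>q \<le> 1/8\<close> and \<open>s \<le> 1/8\<close> the
      largest entry of \<alpha> is at most \<open>1/8 + 5/16 = 7/16\<close>, still below
      1/2.\<close>
    define q where "q = 1 / (4 * ?k)"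
    have q: "0 \<le> q" "q \<le> 1 / 8" "?k * q = 1 / 4" "1 / (2 * ?k) = 2 * q" "1 / ?k = 4 * q"
      using k by (simp_all add: q_def field_simps)
    define \<alpha> where "\<alpha> i = q + (if i = i0 then (1/2 + s) / 2 else 0)" for i
    have \<alpha>: "0 \<le> \<alpha> i" "\<alpha> i \<le> 7/16" for i
      using s q(1,2) by (auto simp: \<alpha>_def add_divide_distrib)
    have sum\<alpha>: "- (2 * (\<Sum>i\<in>UNIV. \<alpha> i)) = -1 - s"
      using q(3) by (simp add: \<alpha>_def sum.distrib add_divide_distrib)
    let ?\<psi> = "\<lambda>d::real^'k::_. ennreal (C2 * \<Lambda> * c) * ennreal ((1 + d $ i0) powr (- (1/2 + s)) * (\<Prod>i\<in>UNIV. eig_weight a1 (1 - 1 / (2 * ?k)) (d $ i)))"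
    have "(\<integral>\<^sup>+\<theta>. ennreal (qq \<theta> powr (-1 - s)) \<partial>\<nu>) \<le> ennreal K * (\<integral>\<^sup>+d. ?\<psi> d * indicator chamber d \<partial>lborel)"
      unfolding nu_moment_eq
    proof (rule weyl)
      fix H :: "real^'k::_^'k::_" and d :: "real^'k::_" assume H: "orthogonal_matrix H" and d: "d \<in> chamber"
      let ?V = "transpose H ** diag d ** H"
      have dp: "0 < d $ i" for i using chamber_pos[OF d] .
      have pd: "pos_def ?V" using pos_def_conjugate_diag_iff[OF H] dp by simp
      let ?P = "\<Prod>i\<in>UNIV. (1 + d $ i) powr (- (2 * \<alpha> i))"
      have P0: "0 \<le> ?P" by (intro prod_nonneg) auto
      have E0: "0 \<le> (\<Prod>i\<in>UNIV. eig_weight a1 a2 (d $ i))" by (intro prod_nonneg) auto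
      have "cond_moment s ?V \<le> (\<integral>\<^sup>+\<beta>. prior_beta \<beta> * ennreal (c * ?P) \<partial>lborel)"
        unfolding cond_moment_eq[OF pd] sum\<alpha>[symmetric] using H dp \<alpha> by (intro nn_integral_mono mult_left_mono shrink) auto
      also have "\<dots> = ennreal \<Lambda> * ennreal (c * ?P)"
        by (simp add: nn_integral_multc \<Lambda>)
      finally have "hyper ?V * ennreal (vandermonde d) * cond_moment s ?V
          \<le> ennreal (C2 * (\<Prod>i\<in>UNIV. eig_weight a1 a2 (d $ i))) * (ennreal \<Lambda> * ennreal (c * ?P))"
        by (intro mult_mono prior_HD_upper H d) auto
      also have "\<dots> = ennreal (C2 * \<Lambda> * c) * ennreal ((\<Prod>i\<in>UNIV. eig_weight a1 a2 (d $ i)) * ?P)"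
        using C2 \<Lambda>0 c P0 E0 by (simp add: mult_ac flip: ennreal_mult)
      also have "\<dots> \<le> ?\<psi> d"
      proof (intro mult_left_mono ennreal_leI)
        have "(\<Prod>i\<in>UNIV. eig_weight a1 a2 (d $ i)) * ?P
            = (\<Prod>i\<in>UNIV. (if i = i0 then (1 + d $ i0) powr (- (1/2 + s)) else 1) * (eig_weight a1 a2 (d $ i) * (1 + d $ i) powr (- (1 / (2 * ?k)))))"
          unfolding prod.distrib[symmetric]
        proof (rule prod.cong)
          fix i
          have "- (2 * \<alpha> i) = (if i = i0 then - (1/2 + s) else 0) + - (1 / (2 * ?k))"
            unfolding \<alpha>_def q(4) by (simp add: field_simps)
          then have "(1 + d $ i) powr (- (2 * \<alpha> i)) = (if i = i0 then (1 + d $ i0) powr (- (1/2 + s)) else 1) * (1 + d $ i) powr (- (1 / (2 * ?k)))"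
            using dp[of i] by (simp only: powr_add) auto
          then show "eig_weight a1 a2 (d $ i) * (1 + d $ i) powr (- (2 * \<alpha> i))
              = (if i = i0 then (1 + d $ i0) powr (- (1/2 + s)) else 1) * (eig_weight a1 a2 (d $ i) * (1 + d $ i) powr (- (1 / (2 * ?k))))"
            by (simp only: mult_ac)
        qed simp
        also have "\<dots> = (1 + d $ i0) powr (- (1/2 + s)) * (\<Prod>i\<in>UNIV. eig_weight a1 (a2 + 1 / (2 * ?k)) (d $ i))"
          unfolding prod.distrib eig_weight_mult[OF dp] by simp
        also have "\<dots> \<le> (1 + d $ i0) powr (- (1/2 + s)) * (\<Prod>i\<in>UNIV. eig_weight a1 (1 - 1 / (2 * ?k)) (d $ i))"
        proof (intro mult_left_mono prod_mono conjI eig_weight_antimono dp)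
          show "1 - 1 / (2 * ?k) \<le> a2 + 1 / (2 * ?k)" using a2 unfolding q by linarith
        qed auto
        finally show "(\<Prod>i\<in>UNIV. eig_weight a1 a2 (d $ i)) * ?P \<le> (1 + d $ i0) powr (- (1/2 + s)) * (\<Prod>i\<in>UNIV. eig_weight a1 (1 - 1 / (2 * ?k)) (d $ i))" .
      qed simp
      finally show "hyper ?V * cond_moment s ?V * ennreal (vandermonde d) \<le> ?\<psi> d"
        by (simp add: mult_ac)
    qed measurable
    also have "(\<integral>\<^sup>+d. ?\<psi> d * indicator chamber d \<partial>lborel) = ennreal (C2 * \<Lambda> * c) *
        (\<integral>\<^sup>+d. ennreal ((1 + d $ i0) powr (- (1/2 + s)) * (\<Prod>i\<in>UNIV. eig_weight a1 (1 - 1 / (2 * ?k)) (d $ i))) * indicator chamber d \<partial>(lborel :: (real^'k::_) measure))"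
      by (simp add: mult.assoc nn_integral_cmult)
    also have "ennreal K * \<dots> \<le> ennreal K * (ennreal (C2 * \<Lambda> * c) * ennreal (c' / s))"
      using s by (intro mult_left_mono chamber) auto
    also have "\<dots> = ennreal (K * (C2 * \<Lambda> * c * c') / s)"
      using K C2 \<Lambda>0 c c' s by (simp flip: ennreal_mult add: mult_ac)
    finally show ?thesis .
  qed
  then show ?thesis
    using that[of "1/8" "K * (C2 * \<Lambda> * c * c')"] K C2 \<Lambda>0 c c' by simp
qed

text \<open>\<lambda> receives \<open>1 - b + s\<close> and \<open>V\<close> receives
  \<open>b\<close>, that is \<open>b / k\<close> per eigenvalue. As \<open>a2 + b / k > 1\<close>,
  the eigenvalue integral converges outright, and the factor \<open>1 / s\<close> comes from
  \<lambda> alone.\<close>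

lemma nu_moment_bound_improper:
  assumes b: "b < 1" "0 < b \<or> CARD('k) \<ge> 3" and a2: "a2 > 1 - b / real CARD('k)"
  obtains K s0 where "0 < s0" "s0 \<le> 1" "0 \<le> K"
    "\<And>s. 0 < s \<Longrightarrow> s \<le> s0 \<Longrightarrow> (\<integral>\<^sup>+\<theta>. ennreal (qq \<theta> powr (-1 - s)) \<partial>\<nu>) \<le> ennreal (K / s)"
proof -
  let ?k = "real CARD('k)"
  have k: "2 \<le> ?k" using k2 by simp
  \<comment> \<open>Keeps \<open>(1 - b + s) / k\<close> below 1/2 for \<open>s \<le> s0\<close>:
    for \<open>k \<ge> 3\<close> it is at most \<open>(1 + 1/8) / 3\<close>, and for
    \<open>k = 2\<close> at most \<open>(1 - b/2) / 2\<close>.\<close>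
  define s0 where "s0 = (if CARD('k) \<ge> 3 then 1/8 else b/2)"
  have s0: "0 < s0" "s0 \<le> 1" using b by (auto simp: s0_def)
  define a where "a = max ((1 - b + s0) / ?k) (b / ?k)"
  have "a < 1/2"
  proof -
    have "b / ?k < 1/2" using b b0 k by (simp add: field_simps)
    moreover have "(1 - b + s0) / ?k < 1/2"
    proof (cases "CARD('k) \<ge> 3")
      case True
      then have "3 \<le> ?k" by simp
      then show ?thesis using b0 True by (simp add: s0_def field_simps)
    next
      case False
      then have "0 < b" using b by simp
      then show ?thesis using False k by (simp add: s0_def field_simps)
    qed
    ultimately show ?thesis unfolding a_def max_less_iff_conj by blast
  qed
  obtain m1 m2' :: 'm where m: "m1 \<noteq> m2'" by (rule two_blocks)
  obtain c where c: "0 \<le> c" and shrink: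
    "\<And>(H :: real^'k::_^'k::_) d l \<kappa> b. orthogonal_matrix H \<Longrightarrow> (\<And>i. 0 < d $ i) \<Longrightarrow> 0 < l \<Longrightarrow>
      0 \<le> \<kappa> \<Longrightarrow> \<kappa> / ?k \<le> a \<Longrightarrow> 0 \<le> b \<Longrightarrow> b / ?k \<le> a \<Longrightarrow> \<kappa> \<le> 2 \<Longrightarrow>
      (\<integral>\<^sup>+\<beta>. ennreal (mvn_density \<beta>0 (l *\<^sub>R A) \<beta>) *
        (\<integral>\<^sup>+\<theta>. ennreal (theta_density \<beta> (transpose H ** diag d ** H) (\<theta> :: real^'k::_^'m)) * ennreal (qq \<theta> powr (- (\<kappa> + b))) \<partial>lborel) \<partial>lborel)
      \<le> ennreal (c * (1 + l) powr (- \<kappa>) * (\<Prod>i\<in>UNIV. (1 + d $ i) powr (- (b / ?k))))"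
    using theta_shrink_two_stage[OF m \<open>a < 1/2\<close> A, of \<beta>0] by blast
  obtain c' where c': "0 \<le> c'" and mixs: "\<And>s. 0 < s \<Longrightarrow> s \<le> 1 \<Longrightarrow> 0 \<le> 1 - b + s \<Longrightarrow>
    (\<integral>\<^sup>+l\<in>{0<..}. ennreal (\<pi>L l) * ennreal ((1 + l) powr (- (1 - b + s))) \<partial>lborel) \<le> ennreal (c' / s)"
    using mixing_shrink[OF L_meas L_nonneg L_fin C L_asymp] by blast
  obtain K where K: "0 \<le> K" and weyl: "\<And>f \<psi>. f \<in> borel_measurable borel \<Longrightarrow> \<psi> \<in> borel_measurable borel \<Longrightarrow>
      (\<And>H d. orthogonal_matrix H \<Longrightarrow> d \<in> chamber \<Longrightarrow>
        f (transpose H ** diag d ** H) * ennreal (vandermonde d) \<le> \<psi> d) \<Longrightarrow>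
      (\<integral>\<^sup>+V. f V * indicator {V. pos_def V} V \<partial>sym_lborel)
        \<le> ennreal K * (\<integral>\<^sup>+d. \<psi> d * indicator chamber d \<partial>(lborel :: (real^'k::_) measure))"
    using nn_integral_pos_def_le[where 'k='k] by blast
  define J where "J = enn2real (\<integral>\<^sup>+d. ennreal (\<Prod>i\<in>UNIV. eig_weight a1 (a2 + b / ?k) (d $ i)) * indicator chamber d \<partial>(lborel :: (real^'k::_) measure))"
  have J: "(\<integral>\<^sup>+d. ennreal (\<Prod>i\<in>UNIV. eig_weight a1 (a2 + b / ?k) (d $ i)) * indicator chamber d \<partial>(lborel :: (real^'k::_) measure)) = ennreal J"
    and J0: "0 \<le> J"
    using chamber_integral_finite[OF a1, of "a2 + b / ?k", where 'k='k] a2 by (auto simp: J_def)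
  have "(\<integral>\<^sup>+\<theta>. ennreal (qq \<theta> powr (-1 - s)) \<partial>\<nu>) \<le> ennreal (K * (C2 * c * c' * J) / s)" if s: "0 < s" "s \<le> s0" for s
  proof -
    let ?kap = "1 - b + s"
    have e: "-1 - s = - (?kap + b)" by simp
    let ?\<psi> = "\<lambda>d::real^'k::_. ennreal (C2 * c * (c' / s)) * ennreal (\<Prod>i\<in>UNIV. eig_weight a1 (a2 + b / ?k) (d $ i))"
    have "(\<integral>\<^sup>+\<theta>. ennreal (qq \<theta> powr (-1 - s)) \<partial>\<nu>) \<le> ennreal K * (\<integral>\<^sup>+d. ?\<psi> d * indicator chamber d \<partial>lborel)"
      unfolding nu_moment_eq
    proof (rule weyl)
      fix H :: "real^'k::_^'k::_" and d :: "real^'k::_" assume H: "orthogonal_matrix H" and d: "d \<in> chamber"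
      let ?V = "transpose H ** diag d ** H"
      have dp: "0 < d $ i" for i using chamber_pos[OF d] .
      have pd: "pos_def ?V" using pos_def_conjugate_diag_iff[OF H] dp by simp
      let ?P = "\<Prod>i\<in>UNIV. (1 + d $ i) powr (- (b / ?k))"
      have P0: "0 \<le> ?P" by (intro prod_nonneg) auto
      have E0: "0 \<le> (\<Prod>i\<in>UNIV. eig_weight a1 a2 (d $ i))" by (intro prod_nonneg) auto
      have [measurable]: "(\<lambda>\<beta>. \<integral>\<^sup>+\<theta>. ennreal (theta_density \<beta> ?V (\<theta> :: real^'k::_^'m)) * ennreal (qq \<theta> powr (-1 - s)) \<partial>lborel) \<in> borel_measurable borel"
        unfolding theta_density_def mvn_density_eq_cramer[OF pd] by measurable
      have "cond_moment s ?V = (\<integral>\<^sup>+l. mix l * (\<integral>\<^sup>+\<beta>. ennreal (mvn_density \<beta>0 (l *\<^sub>R A) \<beta>) *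
          (\<integral>\<^sup>+\<theta>. ennreal (theta_density \<beta> ?V (\<theta> :: real^'k::_^'m)) * ennreal (qq \<theta> powr (-1 - s)) \<partial>lborel) \<partial>lborel) \<partial>lborel)"
        unfolding cond_moment_eq[OF pd] by (rule nn_integral_prior_beta) measurable
      also have "\<dots> \<le> (\<integral>\<^sup>+l. (ennreal (\<pi>L l) * ennreal ((1 + l) powr (- ?kap)) * indicator {0<..} l) * ennreal (c * ?P) \<partial>lborel)"
      proof (rule nn_integral_mono)
        fix l :: real
        show "mix l * (\<integral>\<^sup>+\<beta>. ennreal (mvn_density \<beta>0 (l *\<^sub>R A) \<beta>) *
          (\<integral>\<^sup>+\<theta>. ennreal (theta_density \<beta> ?V (\<theta> :: real^'k::_^'m)) * ennreal (qq \<theta> powr (-1 - s)) \<partial>lborel) \<partial>lborel)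
          \<le> (ennreal (\<pi>L l) * ennreal ((1 + l) powr (- ?kap)) * indicator {0<..} l) * ennreal (c * ?P)"
        proof (cases "0 < l")
          case l: True
          have "?kap / ?k \<le> (1 - b + s0) / ?k" using s k by (intro divide_right_mono) auto
          then have "?kap / ?k \<le> a" by (simp add: a_def)
          then have "(\<integral>\<^sup>+\<beta>. ennreal (mvn_density \<beta>0 (l *\<^sub>R A) \<beta>) *
            (\<integral>\<^sup>+\<theta>. ennreal (theta_density \<beta> ?V (\<theta> :: real^'k::_^'m)) * ennreal (qq \<theta> powr (-1 - s)) \<partial>lborel) \<partial>lborel)
            \<le> ennreal (c * (1 + l) powr (- ?kap) * ?P)"
            unfolding e using H dp l s b b0 s0 by (intro shrink) (auto simp: a_def)
          also have "\<dots> = ennreal ((1 + l) powr (- ?kap)) * ennreal (c * ?P)"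
            using c P0 by (simp flip: ennreal_mult add: mult_ac)
          finally show ?thesis using l by (simp add: mix_def mult.assoc mult_left_mono)
        qed (simp add: mix_def)
      qed
      also have "\<dots> = (\<integral>\<^sup>+l\<in>{0<..}. ennreal (\<pi>L l) * ennreal ((1 + l) powr (- ?kap)) \<partial>lborel) * ennreal (c * ?P)"
      proof (rule nn_integral_multc)
        have "(\<lambda>l. ennreal (\<pi>L l) * ennreal ((1 + l) powr (- ?kap)) * indicator {0<..} l) = (\<lambda>l. mix l * ennreal ((1 + l) powr (- ?kap)))"
          by (auto simp: mix_def mult_ac)
        then show "(\<lambda>l. ennreal (\<pi>L l) * ennreal ((1 + l) powr (- ?kap)) * indicator {0<..} l) \<in> borel_measurable lborel"
          by simp
      qed
      also have "\<dots> \<le> ennreal (c' / s) * ennreal (c * ?P)"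
        using s s0 b by (intro mult_right_mono mixs) auto
      finally have "hyper ?V * ennreal (vandermonde d) * cond_moment s ?V
          \<le> ennreal (C2 * (\<Prod>i\<in>UNIV. eig_weight a1 a2 (d $ i))) * (ennreal (c' / s) * ennreal (c * ?P))"
        by (intro mult_mono prior_HD_upper H d) auto
      also have "\<dots> = ennreal (C2 * c * (c' / s)) * ennreal ((\<Prod>i\<in>UNIV. eig_weight a1 a2 (d $ i)) * ?P)"
        using C2 c' s c P0 E0 by (simp add: mult_ac flip: ennreal_mult)
      also have "(\<Prod>i\<in>UNIV. eig_weight a1 a2 (d $ i)) * ?P = (\<Prod>i\<in>UNIV. eig_weight a1 (a2 + b / ?k) (d $ i))"
        unfolding prod.distrib[symmetric] eig_weight_mult[OF dp] ..
      finally show "hyper ?V * cond_moment s ?V * ennreal (vandermonde d) \<le> ?\<psi> d"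
        by (simp add: mult_ac)
    qed measurable
    also have "(\<integral>\<^sup>+d. ?\<psi> d * indicator chamber d \<partial>lborel) = ennreal (C2 * c * (c' / s)) * ennreal J"
      by (simp add: mult.assoc nn_integral_cmult J)
    also have "ennreal K * \<dots> = ennreal (K * (C2 * c * c' * J) / s)"
      using K C2 c c' s J0 by (simp flip: ennreal_mult add: mult_ac)
    finally show ?thesis .
  qed
  then show ?thesis
    using that[of s0 "K * (C2 * c * c' * J)"] s0 K C2 c c' J0 by simp
qed

lemma nu_moment_bound:
  obtains K s0 where "0 < s0" "s0 \<le> 1" "0 \<le> K"
    "\<And>s. 0 < s \<Longrightarrow> s \<le> s0 \<Longrightarrow> (\<integral>\<^sup>+\<theta>. ennreal (qq \<theta> powr (-1 - s)) \<partial>\<nu>) \<le> ennreal (K / s)"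
proof (cases "1 < b")
  case True
  then show ?thesis using regime nu_moment_bound_proper that by auto
next
  case False
  then have "b < 1" "0 < b \<or> CARD('k) \<ge> 3" "a2 > 1 - b / real CARD('k)" using regime by auto
  then show ?thesis by (rule nu_moment_bound_improper) (use that in blast)
qed

text \<open>The normal densities integrate to 1, so the total mass is the product of the masses of
  the mixing density and of the prior of \<open>V\<close>. The first is positive because of its
  tail, the second because its density vanishes only on a null set of positive-definite
  matrices.\<close>

lemma nu_nonzero: "emeasure \<nu> UNIV \<noteq> 0"
proof
  assume "emeasure \<nu> UNIV = 0"
  obtain K where weyl: "\<And>f \<psi>. f \<in> borel_measurable borel \<Longrightarrow> \<psi> \<in> borel_measurable borel \<Longrightarrow>
      (\<And>H d. orthogonal_matrix H \<Longrightarrow> d \<in> chamber \<Longrightarrow>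
        f (transpose H ** diag d ** H) * ennreal (vandermonde d) \<le> \<psi> d) \<Longrightarrow>
      (\<integral>\<^sup>+V. f V * indicator {V. pos_def V} V \<partial>sym_lborel)
        \<le> ennreal K * (\<integral>\<^sup>+d. \<psi> d * indicator chamber d \<partial>(lborel :: (real^'k::_) measure))"
    using nn_integral_pos_def_le[where 'k='k] by blast
  let ?B = "\<integral>\<^sup>+\<beta>. prior_beta \<beta> \<partial>lborel"
  have "emeasure \<nu> UNIV = (\<integral>\<^sup>+\<theta>. 1 \<partial>\<nu>)" by (simp add: \<nu>_def)
  also have "\<dots> = (\<integral>\<^sup>+w. joint w \<partial>param_measure)" by (subst nn_integral_nu) simp_all
  also have "\<dots> = (\<integral>\<^sup>+V. (\<integral>\<^sup>+\<beta>. (\<integral>\<^sup>+\<theta>. joint (\<theta>, \<beta>, V) \<partial>lborel) \<partial>lborel) \<partial>sym_lborel)"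
    by (rule nn_integral_param_measure) measurable
  also have "\<dots> = (\<integral>\<^sup>+V. ?B * hyper V \<partial>sym_lborel)"
  proof (rule nn_integral_cong)
    fix V
    show "(\<integral>\<^sup>+\<beta>. (\<integral>\<^sup>+\<theta>. joint (\<theta>, \<beta>, V) \<partial>lborel) \<partial>lborel) = ?B * hyper V"
    proof (cases "pos_def V")
      case True
      have "(\<integral>\<^sup>+\<theta>. joint (\<theta>, \<beta>, V) \<partial>lborel) = prior_beta \<beta> * hyper V" for \<beta>
      proof -
        have "(\<integral>\<^sup>+\<theta>. joint (\<theta>, \<beta>, V) \<partial>lborel) = (\<integral>\<^sup>+\<theta>. ennreal (\<Prod>i\<in>UNIV. mvn_cramer \<beta> V ((\<theta> :: real^'k::_^'m) $ i)) * (prior_beta \<beta> * hyper V) \<partial>lborel)"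
          by (simp add: joint_eq mult.assoc)
        also have "\<dots> = (\<integral>\<^sup>+\<theta>. ennreal (\<Prod>i\<in>UNIV. mvn_cramer \<beta> V ((\<theta> :: real^'k::_^'m) $ i)) \<partial>lborel) * (prior_beta \<beta> * hyper V)"
          by (rule nn_integral_multc) measurable
        also have "(\<integral>\<^sup>+\<theta>. ennreal (\<Prod>i\<in>UNIV. mvn_cramer \<beta> V ((\<theta> :: real^'k::_^'m) $ i)) \<partial>lborel) = 1"
          using nn_integral_theta_density[OF True, of "\<lambda>(_::'m) _. 1" \<beta>]
          by (simp add: nn_integral_mvn_density[OF True]) (simp add: theta_density_def mvn_density_eq_cramer[OF True])
        finally show ?thesis by simp
      qed
      then show ?thesis by (simp add: nn_integral_multc)
    qed (simp add: joint_eq hyper_def)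
  qed
  also have "\<dots> = ?B * (\<integral>\<^sup>+V. hyper V \<partial>sym_lborel)"
    by (rule nn_integral_cmult) simp
  finally have "?B = 0 \<or> (\<integral>\<^sup>+V. hyper V \<partial>sym_lborel) = 0"
    using \<open>emeasure \<nu> UNIV = 0\<close> by simp
  moreover have "?B \<noteq> 0"
  proof
    assume "?B = 0"
    then have AE0: "AE l in lborel. mix l = 0"
      by (simp add: nn_integral_prior_beta_total nn_integral_0_iff_AE)
    obtain L where L: "0 < L" "\<And>l. L \<le> l \<Longrightarrow> 0 < \<pi>L l"
      using mixing_eventually_pos[OF L_meas L_nonneg L_fin C L_asymp] by blast
    have "AE l in lborel. l \<notin> {L..L + 1}"
      using AE0
    proof eventually_elim
      case (elim l)
      then show ?case using L(1) L(2)[of l] by (auto simp: mix_def indicator_def ennreal_eq_0_iff split: if_splits)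
    qed
    then have "{L..L + 1} \<in> null_sets lborel"
      by (subst AE_iff_null_sets) auto
    then show False by (simp add: null_sets_def)
  qed
  moreover have "(\<integral>\<^sup>+V. hyper V \<partial>sym_lborel) \<noteq> 0"
  proof
    assume "(\<integral>\<^sup>+V. hyper V \<partial>sym_lborel) = 0"
    then have "AE V in sym_lborel. hyper V = 0"
      by (subst (asm) nn_integral_0_iff_AE) auto
    \<comment> \<open>A positive-definite matrix at which \<open>hyper\<close> vanishes has
      coinciding eigenvalues, where the Vandermonde product is 0. The bound in spectral coordinates
      therefore applies with \<open>\<psi> = 0\<close>.\<close>
    moreover have "AE V in sym_lborel. indicator {V. hyper V = 0} V * indicator {V. pos_def V} V = (0 :: ennreal)"
    proof -
      have "(\<integral>\<^sup>+V. indicator {V. hyper V = 0} V * indicator {V. pos_def V} V \<partial>sym_lborel)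
          \<le> ennreal K * (\<integral>\<^sup>+d. 0 * indicator chamber d \<partial>(lborel :: (real^'k::_) measure))"
      proof (rule weyl)
        fix H :: "real^'k::_^'k::_" and d :: "real^'k::_" assume H: "orthogonal_matrix H" and d: "d \<in> chamber"
        have "pos_def (transpose H ** diag d ** H)"
          using pos_def_conjugate_diag_iff[OF H] chamber_pos[OF d] by simp
        then have "hyper (transpose H ** diag d ** H) \<noteq> 0" if "vandermonde d \<noteq> 0"
          using hyper_pos[OF H d that] by (simp add: hyper_def ennreal_eq_0_iff)
        then show "indicator {V. hyper V = 0} (transpose H ** diag d ** H) * ennreal (vandermonde d) \<le> 0"
          by (cases "vandermonde d = 0") auto
      qed measurable
      then show ?thesis by (subst nn_integral_0_iff_AE[symmetric]) auto
    qed
    ultimately have "AE V in sym_lborel. V \<notin> {V :: real^'k::_^'k::_. pos_def V}"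
      by eventually_elim (auto simp: indicator_def split: if_splits)
    then have "{V :: real^'k::_^'k::_. pos_def V} \<in> null_sets sym_lborel"
      by (subst AE_iff_null_sets) auto
    then show False using emeasure_pos_def_pos[where 'k='k] by (simp add: null_sets_def)
  qed
  ultimately show False by simp
qed

text \<open>Since \<open>qq\<close> is at least 1, exponents beyond \<open>s0\<close> only decrease
  the integrand.\<close>

lemma nu_growth:
  assumes "0 < s"
  shows "(\<integral>\<^sup>+\<theta>. ennreal (qq \<theta> powr (-1 - s)) \<partial>\<nu>) < \<infinity>"
proof -
  obtain K s0 where K: "0 < s0" "\<And>s. 0 < s \<Longrightarrow> s \<le> s0 \<Longrightarrow> (\<integral>\<^sup>+\<theta>. ennreal (qq \<theta> powr (-1 - s)) \<partial>\<nu>) \<le> ennreal (K / s)"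
    using nu_moment_bound by metis
  have "(\<integral>\<^sup>+\<theta>. ennreal (qq \<theta> powr (-1 - s)) \<partial>\<nu>) \<le> (\<integral>\<^sup>+\<theta>. ennreal (qq \<theta> powr (-1 - min s s0)) \<partial>\<nu>)"
    by (intro nn_integral_mono ennreal_leI powr_mono) (auto simp: qq_ge_1)
  also have "\<dots> \<le> ennreal (K / min s s0)" using assms K by (intro K(2)) auto
  also have "\<dots> < \<infinity>" by simp
  finally show ?thesis .
qed

section \<open>The posterior mean as a Bayes rule of a translation family\<close>

sublocale translation_bayes gauss_kernel \<nu>
  by standard (use gauss_kernel_pos gauss_kernel_bounded gauss_kernel_moment_finite nu_growth nu_nonzero in auto)

lemma marginal_eq: "marginal (two_stage_prior \<beta>0 A \<pi>L) \<pi>V x = ennreal (dens x)"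
proof -
  have "marginal (two_stage_prior \<beta>0 A \<pi>L) \<pi>V x = (\<integral>\<^sup>+w. joint w * ennreal (gauss_kernel (x - fst w)) \<partial>param_measure)"
    unfolding marginal_def joint_density_eq by (simp add: mult.commute)
  also have "\<dots> = (\<integral>\<^sup>+\<theta>. ennreal (gauss_kernel (x - \<theta>)) \<partial>\<nu>)"
    by (rule nn_integral_nu[symmetric]) measurable
  also have "\<dots> = ennreal (dens x)"
    unfolding dens_def using integrable_K by (intro nn_integral_eq_integral) (auto simp: K_nonneg)
  finally show ?thesis .
qed

text \<open>The posterior law of the means depends on the hyperparameters only through
  \<open>\<nu>\<close>. Since the marginal is \<open>ennreal (dens x)\<close> with
  \<open>dens x\<close> positive, the division in \<open>ennreal\<close> is an ordinary one.\<close>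

lemma distr_posterior: "distr (posterior (two_stage_prior \<beta>0 A \<pi>L) \<pi>V (x :: real^'k::_^'m)) borel fst = density \<nu> (\<lambda>\<theta>. ennreal (gauss_kernel (x - \<theta>) / dens x))"
proof -
  have eq: "joint_density (two_stage_prior \<beta>0 A \<pi>L) \<pi>V x w / marginal (two_stage_prior \<beta>0 A \<pi>L) \<pi>V x = joint w * ennreal (gauss_kernel (x - fst w) / dens x)" for w
    unfolding joint_density_eq marginal_eq using dens_pos[of x] K_nonneg
    by (simp add: divide_ennreal[symmetric] ennreal_times_divide mult.commute)
  have "posterior (two_stage_prior \<beta>0 A \<pi>L) \<pi>V x = density (density param_measure joint) (\<lambda>w. ennreal (gauss_kernel (x - fst w) / dens x))"
    unfolding posterior_def eq by (rule density_density_eq[symmetric]) measurable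
  then show ?thesis
    unfolding \<nu>_def by (subst density_distr) auto
qed

lemma integrable_density_nu: "integrable (density \<nu> (\<lambda>\<theta>. ennreal (gauss_kernel (x - \<theta>) / dens x))) (\<lambda>\<theta>. \<theta>)"
proof (subst integrable_density)
  have "integrable \<nu> (\<lambda>\<theta>. (1 / dens x) *\<^sub>R (gauss_kernel (x - \<theta>) *\<^sub>R \<theta>))"
    by (intro integrable_scaleR_right integrable_K_scaleR)
  then show "integrable \<nu> (\<lambda>\<theta>. (gauss_kernel (x - \<theta>) / dens x) *\<^sub>R \<theta>)" by simp
qed (use dens_pos[of x] K_nonneg in auto)

lemma fst_measurable_posterior: "fst \<in> posterior (two_stage_prior \<beta>0 A \<pi>L) \<pi>V (x :: real^'k::_^'m) \<rightarrow>\<^sub>M (borel :: (real^'k::_^'m) measure)"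
  unfolding posterior_def by (simp cong: measurable_cong_sets)

lemma posterior_mean_exists_all: "posterior_mean_exists (two_stage_prior \<beta>0 A \<pi>L) \<pi>V (x :: real^'k::_^'m)"
  unfolding posterior_mean_exists_def marginal_eq
proof (intro conjI)
  show "0 < ennreal (dens x)" "ennreal (dens x) < \<infinity>" using dens_pos[of x] by auto
  show "integrable (posterior (two_stage_prior \<beta>0 A \<pi>L) \<pi>V x) fst"
    using integrable_density_nu[of x] unfolding distr_posterior[symmetric]
    by (rule integrable_distr[OF fst_measurable_posterior])
qed

lemma posterior_mean_eq: "posterior_mean (two_stage_prior \<beta>0 A \<pi>L) \<pi>V = bayes"
proof
  fix x :: "real^'k::_^'m"
  have "posterior_mean (two_stage_prior \<beta>0 A \<pi>L) \<pi>V x = (\<integral>\<theta>. \<theta> \<partial>distr (posterior (two_stage_prior \<beta>0 A \<pi>L) \<pi>V x) borel fst)"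
    unfolding posterior_mean_def by (rule integral_distr[OF fst_measurable_posterior, symmetric]) simp
  also have "\<dots> = (\<integral>\<theta>. (gauss_kernel (x - \<theta>) / dens x) *\<^sub>R \<theta> \<partial>\<nu>)"
    unfolding distr_posterior using dens_pos[of x] K_nonneg by (subst integral_density) auto
  also have "\<dots> = (\<integral>\<theta>. (1 / dens x) *\<^sub>R (gauss_kernel (x - \<theta>) *\<^sub>R \<theta>) \<partial>\<nu>)" by simp
  also have "\<dots> = bayes x"
    unfolding bayes_def by (subst integral_scaleR_right) (auto simp: divide_inverse)
  finally show "posterior_mean (two_stage_prior \<beta>0 A \<pi>L) \<pi>V x = bayes x" .
qed

text \<open>A rule whose risk is nowhere larger equals the posterior mean almost everywhere with
  respect to Lebesgue measure. The sampling laws have densities, so the two risk functions coincide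
  and no strict improvement is possible.\<close>

lemma posterior_mean_admissible:
  fixes Q :: "real^('m \<times> 'k::_)^('m \<times> 'k::_)"
  assumes Q: "pos_def Q"
  shows "admissible Q (posterior_mean (two_stage_prior \<beta>0 A \<pi>L) \<pi>V)"
  unfolding admissible_def posterior_mean_eq
proof (intro conjI notI)
  show "bayes \<in> borel_measurable borel" by (rule bayes_measurable)
  define B where "B v w = stack v \<bullet> (Q *v stack w)" for v w :: "real^'k::_^'m"
  have bl: "bounded_bilinear B"
  proof -
    have "bilinear (\<lambda>x y. x \<bullet> (Q *v y))"
      by (auto simp: bilinear_def linear_iff inner_add_left inner_add_right matrix_vector_right_distrib matrix_vector_mult_scaleR)
    then have "bounded_bilinear (\<lambda>x y. x \<bullet> (Q *v y))"
      by (simp add: bilinear_conv_bounded_bilinear)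
    from bounded_bilinear.comp[OF this bounded_linear_stack bounded_linear_stack] show ?thesis
      by (simp add: B_def[abs_def])
  qed
  have sym: "B v w = B w v" for v w
  proof -
    have "B v w = (transpose Q *v stack v) \<bullet> stack w"
      unfolding B_def by (metis dot_lmul_matrix transpose_matrix_vector vector_transpose_matrix)
    also have "transpose Q = Q" using Q by (simp add: pos_def_def)
    finally show ?thesis unfolding B_def by (simp add: inner_commute)
  qed
  obtain n :: nat where n: "\<And>x. (norm x)\<^sup>2 \<le> real n * (x \<bullet> (Q *v x))"
    using pos_def_lower_bound[OF Q] by blast
  have lower: "1 / (real n + 1) * (norm v)\<^sup>2 \<le> B v v" for v
  proof -
    have "0 \<le> B v v" using Q by (cases "stack v = 0") (auto simp: B_def pos_def_def less_imp_le)
    then have "(norm v)\<^sup>2 \<le> (real n + 1) * B v v"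
      using n[of "stack v"] by (simp add: norm_stack B_def distrib_right)
    then show ?thesis by (simp add: field_simps)
  qed
  have risk: "risk Q \<theta> \<delta> = (\<integral>\<^sup>+x. ennreal (B (\<theta> - \<delta> x) (\<theta> - \<delta> x) * gauss_kernel (x - \<theta>)) \<partial>lborel)"
    if [measurable]: "\<delta> \<in> borel_measurable borel" for \<theta> \<delta>
  proof -
    have [measurable]: "(stack :: real^'k::_^'m \<Rightarrow> _) \<in> borel_measurable borel" "(\<lambda>y. Q *v y) \<in> borel_measurable borel"
      by (auto intro!: borel_measurable_continuous_onI linear_continuous_on bounded_linear_stack)
    have "0 \<le> B v v" for v
      using lower[of v] by (rule order_trans[rotated]) simp
    then show ?thesis
      unfolding risk_def quad_loss_def
      by (subst nn_integral_density) (auto simp: likelihood_eq B_def K_nonneg ennreal_mult[symmetric] mult.commute)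
  qed
  assume "inadmissible Q bayes"
  then obtain \<delta> where \<delta> [measurable]: "\<delta> \<in> borel_measurable borel"
    and le: "\<And>\<theta>. risk Q \<theta> \<delta> \<le> risk Q \<theta> bayes" and less: "\<exists>\<theta>. risk Q \<theta> \<delta> < risk Q \<theta> bayes"
    unfolding inadmissible_def by blast
  obtain K s0 where K: "0 < s0" "s0 \<le> 1" "0 \<le> K"
    "\<And>s. 0 < s \<Longrightarrow> s \<le> s0 \<Longrightarrow> (\<integral>\<^sup>+\<theta>. ennreal (qq \<theta> powr (-1 - s)) \<partial>\<nu>) \<le> ennreal (K / s)"
    using nu_moment_bound by metis
  have "AE x in lborel. \<delta> x = bayes x"
  proof (rule bayes_unique[OF bl sym lower])
    show "(\<integral>\<^sup>+x. ennreal (B (\<theta> - \<delta> x) (\<theta> - \<delta> x) * gauss_kernel (x - \<theta>)) \<partial>lborel)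
        \<le> (\<integral>\<^sup>+x. ennreal (B (\<theta> - bayes x) (\<theta> - bayes x) * gauss_kernel (x - \<theta>)) \<partial>lborel)" for \<theta>
      using le[of \<theta>] by (simp add: risk)
    show "\<exists>t. 0 < t \<and> t \<le> 1 \<and> ennreal (t\<^sup>2) * (\<integral>\<^sup>+\<theta>. ennreal (qq \<theta> powr (-1 - t)) \<partial>\<nu>) \<le> ennreal e" if "0 < e" for e
    proof (intro exI conjI)
      \<comment> \<open>The quantity to be bounded is at most \<open>t^2 * (K / t) = t * K\<close>;
        the denominator \<open>K + 1\<close> also covers \<open>K = 0\<close>.\<close>
      let ?t = "min s0 (e / (K + 1))"
      show t: "0 < ?t" "?t \<le> 1" using K that by auto
      have "ennreal (?t\<^sup>2) * (\<integral>\<^sup>+\<theta>. ennreal (qq \<theta> powr (-1 - ?t)) \<partial>\<nu>) \<le> ennreal (?t\<^sup>2) * ennreal (K / ?t)"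
        using t by (intro mult_left_mono K(4)) auto
      also have "\<dots> = ennreal (?t * K)"
        using t K(3) by (simp flip: ennreal_mult add: power2_eq_square)
      also have "\<dots> \<le> ennreal e"
      proof (rule ennreal_leI)
        have "?t * K \<le> e / (K + 1) * K" using K by (intro mult_right_mono) auto
        also have "\<dots> \<le> e" using K that by (simp add: field_simps)
        finally show "?t * K \<le> e" .
      qed
      finally show "ennreal (?t\<^sup>2) * (\<integral>\<^sup>+\<theta>. ennreal (qq \<theta> powr (-1 - ?t)) \<partial>\<nu>) \<le> ennreal e" .
    qed
  qed auto
  then have "risk Q \<theta> \<delta> = risk Q \<theta> bayes" for \<theta>
    unfolding risk[OF \<delta>] risk[OF bayes_measurable]
    by (intro nn_integral_cong_AE) (auto elim!: eventually_mono)
  then show False using less by simp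
qed

end

theorem theorem3p14:
  fixes a1 a2 b C C1 C2 :: real
    and \<beta>0 :: "real^'k::{finite,linorder}"
    and A :: "real^'k::_^'k::_"
    and \<pi>L :: "real \<Rightarrow> real"
    and \<pi>V :: "real^'k::_^'k::_ \<Rightarrow> real"
    and Q :: "real^('m::finite \<times> 'k::_)^('m \<times> 'k::_)"
  assumes "CARD('k) \<ge> 2" and "CARD('m) \<ge> 2"
    and "a1 < 1" and "b \<ge> 0"
    and "pos_def A"
    and "set_borel_measurable borel {0<..} \<pi>L"
    and "\<And>l. l > 0 \<Longrightarrow> \<pi>L l \<ge> 0"
    and "\<And>c. c > 0 \<Longrightarrow> (\<integral>\<^sup>+ l\<in>{0<..c}. ennreal (\<pi>L l) \<partial>lborel) < \<infinity>"
    and "C > 0" and "\<pi>L \<sim>[at_top] (\<lambda>l. C * l powr (- b))"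
    and "set_borel_measurable borel {V. pos_def V} \<pi>V"
    and "\<And>V. pos_def V \<Longrightarrow> \<pi>V V \<ge> 0"
    and "C1 > 0" and "C2 > 0"
    and "\<And>H d. orthogonal_matrix H \<Longrightarrow> (\<forall>i j. i < j \<longrightarrow> d $ i > d $ j) \<Longrightarrow> (\<forall>i. d $ i > 0) \<Longrightarrow>
           C1 / (det (mat 1 + diag d) powr (a2 - a1) * det (diag d) powr a1) \<le> prior_HD \<pi>V H d \<and>
           prior_HD \<pi>V H d \<le> C2 / (det (mat 1 + diag d) powr (a2 - a1) * det (diag d) powr a1)"
    and "pos_def Q"
    and "(CARD('k) \<ge> 2 \<and> a2 \<ge> 1 - 1 / real CARD('k) \<and> b > 1)
       \<or> (CARD('k) \<ge> 3 \<and> a2 > 1 - b / real CARD('k) \<and> 0 \<le> b \<and> b < 1)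
       \<or> (CARD('k) = 2 \<and> a2 > 1 - b / 2 \<and> 0 < b \<and> b < 1)"
  shows "(\<forall>x :: real^'k::_^'m. posterior_mean_exists (two_stage_prior \<beta>0 A \<pi>L) \<pi>V x)
       \<and> admissible Q (posterior_mean (two_stage_prior \<beta>0 A \<pi>L) \<pi>V)"
proof -
  interpret two_stage_model a1 a2 b C C1 C2 \<beta>0 A \<pi>L \<pi>V "TYPE('m)"
    by (rule two_stage_model.intro) (fact assms)+
  show ?thesis
    using posterior_mean_exists_all posterior_mean_admissible[OF \<open>pos_def Q\<close>] by blast
qed

end
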